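(* Let $F$ and $F'$ be two genus $0$ fatgraphs with the same underlying graph $G$, and let $P$ denote the Poincaré polynomial of the chromatic homology. Then $P(H(\mathcal C(F)))=P(H(\mathcal C(F')))$; that is, the Poincaré polynomial is independent of the planar embedding of $G$.
   Context: A fatgraph is a finite graph (loops and multiple edges allowed) with a cyclic order of half-edges at each vertex; it determines a compact orientable surface with boundary; genus $0$ means every component of this surface is planar (equivalently, the fatgraph comes from an embedding of $G$ in the sphere). For a fatgraph $H$: $v(H),e(H)$ numbers of vertices and edges, $p(H)$ boundary components, $g(H)$ genus. A state is a spanning fatsubgraph $H=(V(F),W)$, $W\subseteq E(F)$, of height $h(H)=e(F)-e(H)$. For a graded $\mathbb Z$-module $M$, $\operatorname{qdim}M=\sum_iq^i\operatorname{rk}M_i$, $M\{l\}_m=M_{m-l}$; for homology $H=(H^i)$ of a cochain complex of graded modules, $P(H)=\sum_it^i\operatorname{qdim}H^i$. Chromatic complex: $V$ free on $v_\pm$ in degrees $\pm1$; $R$ free on $x_{-2},x_0$ in degrees $-2,0$. Maps: $\widetilde m':V\otimes V\to V$, $v_+\otimes v_+\mapsto v_+$, $v_\pm\otimes v_\mp\mapsto v_-$, $v_-\otimes v_-\mapsto0$; $\widetilde\Delta':V\to V\otimes V$, $v_+\mapsto v_+\otimes v_-+v_-\otimes v_+$, $v_-\mapsto v_-\otimes v_-$; $\widehat m_g:V^{\otimes2g}\to V^{\otimes2(g-1)}$ sends a basis tensor to the sum of all basis tensors of the same degree; $\overline\Delta_h:R^{\otimes h}\to R^{\otimes(h+1)}$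 is $1\mapsto x_0$ for $h=0$ and for $h\ge1$ acts on the last factor by $x_0\mapsto x_0\otimes x_0$, $x_{-2}\mapsto x_{-2}\otimes x_0+x_0\otimes x_{-2}$. State $H$ gets $A(H)=V^{\otimes v(H)}\otimes V^{\otimes p(H)}\otimes V^{\otimes2g(H)}\otimes R^{\otimes h(H)}\{h(H)\}$ (boundary factors indexed by boundary components). Number edges $1,\dots,n$, encode states by $\alpha\in\{0,1\}^n$ ($\alpha_i=0$ iff edge $i$ present). For edge $j$ in $H$, $H'=H-e_j$ merges two boundary components or splits one and $g(H')\in\{g(H),g(H)-1\}$; per-edge map $A(H)\to A(H')$ is $(-1)^{\sum_{i<j}\alpha_i}$ times the tensor of identity on $V^{\otimes v}$, $\widetilde m'$ (merge) or $\widetilde\Delta'$ (split) on affected boundary factors and identity elsewhere, identity or $\widehat m_g$ on $V^{\otimes2g}$, and $\overline\Delta_{h(H)}$ on $R^{\otimes h(H)}$. $\widetilde{\mathcal C}^h(F)=\bigoplus_{h(H)=h}A(H)$ with differential the sum of per-edge maps; $\mathcal C(F)=\widetilde{\mathcal C}(F)[-e(F)]$ with $(\mathcal C[s])^i=\mathcal C^{i-s}$. *)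

theory Defs
  imports
    "HOL-Algebra.Free_Abelian_Groups"
    "HOL-Combinatorics.Permutations"
    "HOL-Combinatorics.Orbits"
begin

section \<open>Graded cochain complexes and their Poincare polynomials\<close>

text \<open>The rank is the maximal size of a \<open>\<int>\<close>-linearly independent set. The supremum is
  meaningful whenever the rank is finite, in particular for finitely generated groups.\<close>

definition int_independent :: "('a, 'm) monoid_scheme \<Rightarrow> 'a set \<Rightarrow> bool" where
  "int_independent G S \<longleftrightarrow> finite S \<and> S \<subseteq> carrier G \<and>
     (\<forall>c :: 'a \<Rightarrow> int. finprod G (\<lambda>x. x [^]\<^bsub>G\<^esub> c x) S = \<one>\<^bsub>G\<^esub> \<longrightarrow> (\<forall>x\<in>S. c x = 0))"

definition group_rank :: "('a, 'm) monoid_scheme \<Rightarrow> nat" where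
  "group_rank G = Sup {card S | S. int_independent G S}"

text \<open>\<open>comp C i j\<close> is the part of \<open>q\<close>-degree \<open>j\<close> of the \<open>i\<close>-th cochain group, and
  \<open>diff C i\<close> is the differential leaving cohomological degree \<open>i\<close>, which preserves the
  \<open>q\<close>-degree.\<close>

record 'a cochain_complex =
  comp :: "int \<Rightarrow> int \<Rightarrow> 'a monoid"
  diff :: "int \<Rightarrow> 'a \<Rightarrow> 'a"

definition shift_complex :: "'a cochain_complex \<Rightarrow> int \<Rightarrow> 'a cochain_complex" where
  "shift_complex C s = \<lparr>comp = (\<lambda>i. comp C (i - s)), diff = (\<lambda>i. diff C (i - s))\<rparr>"

definition cohomology :: "'a cochain_complex \<Rightarrow> int \<Rightarrow> int \<Rightarrow> 'a set monoid" where
  "cohomology C i j =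
     subgroup_generated (comp C i j) (kernel (comp C i j) (comp C (i + 1) j) (diff C i))
       Mod (diff C (i - 1) ` carrier (comp C (i - 1) j))"

text \<open>Laurent polynomials in \<open>q\<close> over \<open>\<int>\<close> are rendered as \<^typ>\<open>int \<Rightarrow>\<^sub>0 int\<close>, the monomial
  \<open>q\<^sup>j\<close> being \<^term>\<open>Poly_Mapping.single j 1\<close>; Laurent polynomials in \<open>t\<close> over those are
  rendered as \<^typ>\<open>int \<Rightarrow>\<^sub>0 (int \<Rightarrow>\<^sub>0 int)\<close>. \<^const>\<open>Sum_any\<close> sums over all integers, and is only
  used where finitely many terms are nonzero: the complexes below have finite total rank.\<close>

definition qdim :: "(int \<Rightarrow> ('a, 'm) monoid_scheme) \<Rightarrow> (int \<Rightarrow>\<^sub>0 int)" where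
  "qdim M = Sum_any (\<lambda>j. Poly_Mapping.single j (int (group_rank (M j))))"

definition poincare :: "(int \<Rightarrow> int \<Rightarrow> ('a, 'm) monoid_scheme) \<Rightarrow> (int \<Rightarrow>\<^sub>0 (int \<Rightarrow>\<^sub>0 int))" where
  "poincare H = Sum_any (\<lambda>i. Poly_Mapping.single i (qdim (H i)))"


section \<open>Fatgraphs\<close>

text \<open>Every edge \<open>e\<close> has the two half-edges \<open>(e, False)\<close> and \<open>(e, True)\<close>; \<open>att\<close> sends a half-edge
  to its vertex and \<open>rot\<close> sends it to the next one in the cyclic order at that vertex.\<close>

record ('v, 'e) fatgraph =
  verts :: "'v set"
  edges :: "'e set"
  att :: "'e \<times> bool \<Rightarrow> 'v"
  rot :: "'e \<times> bool \<Rightarrow> 'e \<times> bool"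

definition half_edges :: "'e set \<Rightarrow> ('e \<times> bool) set" where
  "half_edges W = W \<times> UNIV"

definition half_edges_at :: "('v, 'e) fatgraph \<Rightarrow> 'e set \<Rightarrow> 'v \<Rightarrow> ('e \<times> bool) set" where
  "half_edges_at F W v = {d \<in> half_edges W. att F d = v}"

definition is_fatgraph :: "('v, 'e) fatgraph \<Rightarrow> bool" where
  "is_fatgraph F \<longleftrightarrow>
     finite (verts F) \<and> finite (edges F) \<and>
     att F ` half_edges (edges F) \<subseteq> verts F \<and>
     rot F permutes half_edges (edges F) \<and>
     (\<forall>v\<in>verts F. half_edges_at F (edges F) v \<noteq> {} \<longrightarrow>
        cyclic_on (rot F) (half_edges_at F (edges F) v))"

text \<open>Graphs with loops and multiple edges: \<open>gends\<close> gives the set of the one (for a loop) or two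
  end vertices of an edge.\<close>

record ('v, 'e) graph =
  gverts :: "'v set"
  gedges :: "'e set"
  gends :: "'e \<Rightarrow> 'v set"

definition underlying_graph :: "('v, 'e) fatgraph \<Rightarrow> ('v, 'e) graph" where
  "underlying_graph F =
     \<lparr>gverts = verts F, gedges = edges F,
      gends = (\<lambda>e\<in>edges F. {att F (e, False), att F (e, True)})\<rparr>"

text \<open>From here on a set \<open>W \<subseteq> edges F\<close> of edges stands for the spanning fatsubgraph
  \<open>(verts F, W)\<close>, whose cyclic orders are the induced ones.\<close>

definition rot_in :: "('v, 'e) fatgraph \<Rightarrow> 'e set \<Rightarrow> 'e \<times> bool \<Rightarrow> 'e \<times> bool" where
  "rot_in F W d = (rot F ^^ (LEAST n. 0 < n \<and> (rot F ^^ n) d \<in> half_edges W)) d"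

text \<open>Following the boundary of the surface along the half-edge \<open>d\<close> one arrives at the other half
  of the edge of \<open>d\<close>, and leaves along the half-edge that comes next there. So the boundary
  components meeting an edge are the orbits of \<open>boundary_step\<close>. An isolated vertex is a disc and
  contributes one further component.\<close>

definition boundary_step :: "('v, 'e) fatgraph \<Rightarrow> 'e set \<Rightarrow> 'e \<times> bool \<Rightarrow> 'e \<times> bool" where
  "boundary_step F W d = rot_in F W (fst d, \<not> snd d)"

definition boundaries :: "('v, 'e) fatgraph \<Rightarrow> 'e set \<Rightarrow> (('e \<times> bool) set + 'v) set" where
  "boundaries F W =
     Inl ` orbit (boundary_step F W) ` half_edges W \<union>
     Inr ` {v \<in> verts F. half_edges_at F W v = {}}"

text \<open>The boundary component of \<open>(verts F, W)\<close> that passes the vertex of \<open>d\<close> immediately after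
  the position of \<open>d\<close> in the cyclic order; \<open>d\<close> itself need not belong to an edge in \<open>W\<close>.\<close>

definition boundary_at ::
  "('v, 'e) fatgraph \<Rightarrow> 'e set \<Rightarrow> 'e \<times> bool \<Rightarrow> ('e \<times> bool) set + 'v" where
  "boundary_at F W d =
     (if half_edges_at F W (att F d) = {} then Inr (att F d)
      else Inl (orbit (boundary_step F W) (rot_in F W d)))"

definition adjacency :: "('v, 'e) fatgraph \<Rightarrow> 'e set \<Rightarrow> ('v \<times> 'v) set" where
  "adjacency F W = {(att F (e, b), att F (e, \<not> b)) | e b. e \<in> W}"

definition num_components :: "('v, 'e) fatgraph \<Rightarrow> 'e set \<Rightarrow> nat" where
  "num_components F W = card (verts F // ((adjacency F W)\<^sup>* \<inter> verts F \<times> verts F))"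

text \<open>The genus of a possibly disconnected surface is the sum of the genera of its components.
  Capping off all boundary circles gives a closed surface of Euler characteristic \<open>v - e + p\<close>,
  which equals \<open>2 k - 2 g\<close> for \<open>k\<close> components. All components are planar iff this total
  genus is 0.\<close>

definition genus :: "('v, 'e) fatgraph \<Rightarrow> 'e set \<Rightarrow> int" where
  "genus F W =
     (2 * int (num_components F W) - int (card (verts F)) + int (card W)
        - int (card (boundaries F W))) div 2"

definition height :: "('v, 'e) fatgraph \<Rightarrow> 'e set \<Rightarrow> nat" where
  "height F W = card (edges F) - card W"


section \<open>The chromatic complex\<close>

datatype vbasis = VPlus | VMinus
datatype rbasis = XMinus2 | X0

fun vdeg :: "vbasis \<Rightarrow> int" where
  "vdeg VPlus = 1"
| "vdeg VMinus = -1"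

fun rdeg :: "rbasis \<Rightarrow> int" where
  "rdeg XMinus2 = -2"
| "rdeg X0 = 0"

text \<open>The structure maps on basis tensors. Tensors in \<open>V\<^sup>\<otimes>\<^sup>2\<^sup>g\<close> and \<open>R\<^sup>\<otimes>\<^sup>h\<close> are indexed by lists
  of basis elements.\<close>

fun merge_map :: "vbasis \<times> vbasis \<Rightarrow> (vbasis \<Rightarrow>\<^sub>0 int)" where
  "merge_map (VPlus, VPlus) = frag_of VPlus"
| "merge_map (VPlus, VMinus) = frag_of VMinus"
| "merge_map (VMinus, VPlus) = frag_of VMinus"
| "merge_map (VMinus, VMinus) = 0"

fun split_map :: "vbasis \<Rightarrow> (vbasis \<times> vbasis \<Rightarrow>\<^sub>0 int)" where
  "split_map VPlus = frag_of (VPlus, VMinus) + frag_of (VMinus, VPlus)"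
| "split_map VMinus = frag_of (VMinus, VMinus)"

definition genus_map :: "vbasis list \<Rightarrow> (vbasis list \<Rightarrow>\<^sub>0 int)" where
  "genus_map u =
     (\<Sum>w\<in>{w. length w = length u - 2 \<and> sum_list (map vdeg w) = sum_list (map vdeg u)}. frag_of w)"

definition height_map :: "rbasis list \<Rightarrow> (rbasis list \<Rightarrow>\<^sub>0 int)" where
  "height_map r =
     (if r = [] then frag_of [X0]
      else case last r of
          X0 \<Rightarrow> frag_of (butlast r @ [X0, X0])
        | XMinus2 \<Rightarrow> frag_of (butlast r @ [XMinus2, X0]) + frag_of (butlast r @ [X0, XMinus2]))"

text \<open>A basis tensor of \<open>A(H)\<close>, together with the edge set of the state \<open>H\<close>.\<close>

datatype ('v, 'e) gen =
  Gen (state: "'e set")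
      (vlab: "'v \<Rightarrow> vbasis")
      (blab: "('e \<times> bool) set + 'v \<Rightarrow> vbasis")
      (glab: "vbasis list")
      (rlab: "rbasis list")

definition state_gens :: "('v, 'e) fatgraph \<Rightarrow> 'e set \<Rightarrow> ('v, 'e) gen set" where
  "state_gens F W =
     {x. state x = W \<and> vlab x \<in> verts F \<rightarrow>\<^sub>E UNIV \<and> blab x \<in> boundaries F W \<rightarrow>\<^sub>E UNIV \<and>
         length (glab x) = nat (2 * genus F W) \<and> length (rlab x) = height F W}"

definition gen_deg :: "('v, 'e) fatgraph \<Rightarrow> ('v, 'e) gen \<Rightarrow> int" where
  "gen_deg F x =
     (\<Sum>v\<in>verts F. vdeg (vlab x v)) + (\<Sum>c\<in>boundaries F (state x). vdeg (blab x c)) +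
     sum_list (map vdeg (glab x)) + sum_list (map rdeg (rlab x)) +
     int (height F (state x))"

text \<open>The remaining definitions give the matrix coefficient at \<open>x \<in> state_gens F W\<close> and
  \<open>y \<in> state_gens F (W - {e})\<close>, for \<open>e \<in> W\<close>, of each tensor factor of the map that belongs to
  deleting \<open>e\<close>. The boundary components along the two sides of \<open>e\<close> are
  \<open>boundary_at F W (e, b)\<close> for \<open>b = False, True\<close>. Deleting \<open>e\<close> replaces them by the
  components \<open>boundary_at F (W - {e}) (e, b)\<close>, and leaves all the others (as sets of
  half-edges, or as isolated vertices) unchanged: two distinct components merge, and a single one
  splits. By the symmetry of \<open>merge_map\<close> and \<open>split_map\<close> the order of the two is irrelevant.\<close>

definition boundary_coeff ::
  "('v, 'e) fatgraph \<Rightarrow> 'e \<Rightarrow> ('v, 'e) gen \<Rightarrow> ('v, 'e) gen \<Rightarrow> int" where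
  "boundary_coeff F e x y =
     (let W = state x; W' = W - {e};
          s = (\<lambda>b. boundary_at F W (e, b)); s' = (\<lambda>b. boundary_at F W' (e, b))
      in if \<forall>c\<in>boundaries F W \<inter> boundaries F W'. blab x c = blab y c
         then if s False \<noteq> s True
              then Poly_Mapping.lookup (merge_map (blab x (s False), blab x (s True)))
                     (blab y (s' False))
              else Poly_Mapping.lookup (split_map (blab x (s False)))
                     (blab y (s' False), blab y (s' True))
         else 0)"

definition genus_coeff ::
  "('v, 'e) fatgraph \<Rightarrow> 'e \<Rightarrow> ('v, 'e) gen \<Rightarrow> ('v, 'e) gen \<Rightarrow> int" where
  "genus_coeff F e x y =
     (if genus F (state x - {e}) = genus F (state x)
      then of_bool (glab y = glab x)
      else Poly_Mapping.lookup (genus_map (glab x)) (glab y))"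

definition edge_coeff ::
  "('v, 'e) fatgraph \<Rightarrow> 'e \<Rightarrow> ('v, 'e) gen \<Rightarrow> ('v, 'e) gen \<Rightarrow> int" where
  "edge_coeff F e x y =
     of_bool (vlab y = vlab x) * boundary_coeff F e x y * genus_coeff F e x y *
     Poly_Mapping.lookup (height_map (rlab x)) (rlab y)"

text \<open>The edges are numbered by their positions in the list \<open>es\<close>; the sign counts the edges before
  \<open>e\<close> that are absent from the state.\<close>

definition edge_sign :: "'e list \<Rightarrow> 'e set \<Rightarrow> 'e \<Rightarrow> int" where
  "edge_sign es W e = (-1) ^ length (filter (\<lambda>e'. e' \<notin> W) (takeWhile (\<lambda>e'. e' \<noteq> e) es))"

definition edge_map ::
  "('v, 'e) fatgraph \<Rightarrow> 'e list \<Rightarrow> 'e \<Rightarrow> ('v, 'e) gen \<Rightarrow> (('v, 'e) gen \<Rightarrow>\<^sub>0 int)" where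
  "edge_map F es e x =
     frag_cmul (edge_sign es (state x) e)
       (\<Sum>y\<in>state_gens F (state x - {e}). frag_cmul (edge_coeff F e x y) (frag_of y))"

definition unshifted_chromatic_complex ::
  "('v, 'e) fatgraph \<Rightarrow> 'e list \<Rightarrow> (('v, 'e) gen \<Rightarrow>\<^sub>0 int) cochain_complex" where
  "unshifted_chromatic_complex F es =
     \<lparr>comp = (\<lambda>i j. free_Abelian_group
        {x. \<exists>W\<subseteq>edges F. int (height F W) = i \<and> x \<in> state_gens F W \<and> gen_deg F x = j}),
      diff = (\<lambda>i. frag_extend (\<lambda>x. \<Sum>e\<in>state x. edge_map F es e x))\<rparr>"

definition chromatic_complex ::
  "('v, 'e) fatgraph \<Rightarrow> 'e list \<Rightarrow> (('v, 'e) gen \<Rightarrow>\<^sub>0 int) cochain_complex" where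
  "chromatic_complex F es =
     shift_complex (unshifted_chromatic_complex F es) (- int (card (edges F)))"

end

(* Resolving the edges of a planar fatgraph cuts its states into circles, and on circles the
   differential is that of Khovanov homology; the R-factor of the differential is injective, so the
   kernel ranks of the chromatic complex are sums of kernel ranks of this circle complex over
   passive labels. For a connected planar graph the circle complex is thin: its homology lies on
   two adjacent diagonals (deletion-contraction). The Lee deformation of the differential has a
   homology that is counted by colourings of the circles, that is, by pairs of an even edge set and
   a cut, which only depend on the graph; together with thinness this determines all ranks.
   Disconnected graphs are treated one component at a time: over the rationals, complexes with equal
   chain and kernel dimensions are isomorphic, and the isomorphism extends over the other
   components. *)
theory Submission
  imports Defs "HOL-Library.Function_Algebras" "HOL.Vector_Spaces"
begin


section \<open>Rational functions with finite support as vectors\<close>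

text \<open>Two embeddings of a connected planar graph offer no evident chain isomorphism, so only
  kernel dimensions \<open>kappa\<close> are compared. In height h homology can occur only in the
  degrees 2h - h0 + 1 and 2h - h0 - 1, where h0 is the height of a spanning tree. Exactness
  elsewhere computes \<open>kappa\<close> from numbers of generators, going up from negative heights
  above the diagonals and down from large heights below them; only the degree 2h - h0 + 1 escapes.
  The Lee differential respects degrees mod 4, and its kernel in the residue class of that degree
  has dimension the sum of \<open>kappa\<close> over the class, which supplies the missing number.
  The obstacle in the proof of thinness is a resolution that disconnects, for then the induction
  hypothesis fails for it. In that case a colouring S separates the two sides of the edge, and a
  sign twist along S makes the split map followed by the merge map a short exact sequence, so that
  the connected resolution alone decides.\<close>

definition rscale :: "rat \<Rightarrow> ('x \<Rightarrow> rat) \<Rightarrow> 'x \<Rightarrow> rat" where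
  "rscale c f = (\<lambda>x. c * f x)"

interpretation rv: vector_space "rscale :: rat \<Rightarrow> ('x \<Rightarrow> rat) \<Rightarrow> 'x \<Rightarrow> rat"
  by unfold_locales (auto simp: rscale_def fun_eq_iff algebra_simps)

interpretation rvp: vector_space_pair "rscale :: rat \<Rightarrow> ('x \<Rightarrow> rat) \<Rightarrow> 'x \<Rightarrow> rat"
  "rscale :: rat \<Rightarrow> ('y \<Rightarrow> rat) \<Rightarrow> 'y \<Rightarrow> rat"
  by unfold_locales

abbreviation rlin :: "(('x \<Rightarrow> rat) \<Rightarrow> 'y \<Rightarrow> rat) \<Rightarrow> bool" where
  "rlin \<equiv> Vector_Spaces.linear rscale rscale"

lemma rscale_apply: "rscale c f x = c * f x"
  by (simp add: rscale_def)

lemma rlin_iff: "rlin T \<longleftrightarrow> (\<forall>f g. T (f + g) = T f + T g) \<and> (\<forall>c f. T (rscale c f) = rscale c (T f))"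
  by (simp add: linear_iff rv.vector_space_axioms)

lemma rlinI:
  assumes "\<And>f g y. T (f + g) y = T f y + T g y" "\<And>c f y. T (rscale c f) y = c * T f y"
  shows "rlin T"
  unfolding rlin_iff by (auto simp: fun_eq_iff assms rscale_apply)

lemma rlin_add: "rlin T \<Longrightarrow> T (f + g) = T f + T g"
  and rlin_scale: "rlin T \<Longrightarrow> T (rscale c f) = rscale c (T f)"
  by (auto simp: rlin_iff)

lemma rlin_0: "rlin T \<Longrightarrow> T 0 = 0"
  using rlin_scale[of T 0 0] by (simp add: rscale_def zero_fun_def)

lemma rlin_uminus: "rlin T \<Longrightarrow> T (- f) = - T f"
  using rlin_scale[of T "-1" f] by (simp add: rscale_def fun_Compl_def)

lemma rlin_diff: "rlin T \<Longrightarrow> T (f - g) = T f - T g"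
  using rlin_add[of T f "- g"] rlin_uminus[of T g] by simp

lemma rlin_sum: "rlin T \<Longrightarrow> T (\<Sum>i\<in>I. f i) = (\<Sum>i\<in>I. T (f i))"
  by (rule rvp.linear_sum)

lemma rlin_compose: "rlin S \<Longrightarrow> rlin T \<Longrightarrow> rlin (\<lambda>f. S (T f))"
  by (auto simp: rlin_iff)

lemma sum_fun_apply: "(\<Sum>i\<in>I. f i) x = (\<Sum>i\<in>I. f i x)"
  by (induction I rule: infinite_finite_induct) auto

definition fsup :: "'x set \<Rightarrow> ('x \<Rightarrow> rat) set" where
  "fsup X = {f. \<forall>x. x \<notin> X \<longrightarrow> f x = 0}"

definition pt :: "'x \<Rightarrow> 'x \<Rightarrow> rat" where
  "pt x = (\<lambda>y. of_bool (y = x))"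

lemma fsup_subspace: "rv.subspace (fsup X)"
  unfolding rv.subspace_def by (auto simp: fsup_def rscale_apply)

lemma fsup_mono: "X \<subseteq> Y \<Longrightarrow> fsup X \<subseteq> fsup Y"
  by (auto simp: fsup_def)

lemma fsup_expand: "finite X \<Longrightarrow> f \<in> fsup X \<Longrightarrow> f = (\<Sum>x\<in>X. rscale (f x) (pt x))"
  by (rule ext) (auto simp: rscale_apply sum_fun_apply fsup_def pt_def if_distrib sum.If_cases of_bool_def
      cong: if_cong)

lemma inj_pt: "inj_on pt X"
proof (rule inj_onI)
  fix x y :: 'a assume "pt x = pt y"
  then have "pt x x = pt y x" by simp
  then show "x = y" by (simp add: pt_def split: if_splits)
qed

lemma span_pt: "finite X \<Longrightarrow> rv.span (pt ` X) = fsup X"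
proof (intro equalityI subsetI)
  fix f assume "finite X" "f \<in> fsup X"
  then have "f = (\<Sum>x\<in>X. rscale (f x) (pt x))" by (rule fsup_expand)
  moreover have "(\<Sum>x\<in>X. rscale (f x) (pt x)) \<in> rv.span (pt ` X)"
    by (intro rv.span_sum rv.span_scale rv.span_base) auto
  ultimately show "f \<in> rv.span (pt ` X)" by simp
next
  fix f assume "f \<in> rv.span (pt ` X)"
  moreover have "rv.span (pt ` X) \<subseteq> fsup X"
    by (rule rv.span_minimal[OF _ fsup_subspace]) (auto simp: fsup_def pt_def)
  ultimately show "f \<in> fsup X" by blast
qed

lemma independent_pt: "finite X \<Longrightarrow> rv.independent (pt ` X)"
proof (rule rv.independent_if_scalars_zero)
  fix f b assume X: "finite X" and s: "(\<Sum>b\<in>pt ` X. rscale (f b) b) = 0" and "b \<in> pt ` X"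
  then obtain x where x: "x \<in> X" "b = pt x" by auto
  have "0 = (\<Sum>b\<in>pt ` X. rscale (f b) b) x" using s by simp
  also have "\<dots> = (\<Sum>y\<in>X. f (pt y) * pt y x)"
    by (simp add: sum_fun_apply sum.reindex[OF inj_pt] rscale_apply)
  also have "\<dots> = f (pt x)"
    using x X by (simp add: pt_def of_bool_def if_distrib sum.If_cases cong: if_cong)
  finally show "f b = 0" using x by simp
qed auto

lemma dim_fsup: "finite X \<Longrightarrow> rv.dim (fsup X) = card X"
  by (metis card_image independent_pt inj_pt rv.dim_span_eq_card_independent span_pt)

lemma fsup_indep_finite:
  assumes "finite X" "rv.independent B" "B \<subseteq> fsup X"
  shows "finite B"
  using rv.independent_span_bound[of "pt ` X" B] assms span_pt[of X] by auto

lemma subspace_basis: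
  assumes "finite X" "rv.subspace U" "U \<subseteq> fsup X"
  obtains B where "finite B" "rv.independent B" "rv.span B = U" "B \<subseteq> U" "card B = rv.dim U"
proof -
  obtain B where B: "B \<subseteq> U" "rv.independent B" "U \<subseteq> rv.span B" "card B = rv.dim U"
    using rv.basis_exists by blast
  moreover have "rv.span B = U" using B assms(2) by (simp add: rv.span_minimal subset_antisym)
  moreover have "finite B" using fsup_indep_finite[OF assms(1) B(2)] B(1) assms(3) by blast
  ultimately show thesis using that by blast
qed

text \<open>The coordinates of \<open>u\<close> over \<open>B\<close> are supported in
  \<open>A\<close> and in \<open>B - A\<close> at once, so they all vanish.\<close>

lemma indep_disjoint_span:
  assumes B: "rv.independent B" "A \<subseteq> B" "u \<in> rv.span A" "u \<in> rv.span (B - A)"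
  shows "u = 0"
proof -
  have 1: "rv.representation B u = rv.representation A u"
    using rv.representation_extend[OF B(1) B(3) B(2)] .
  have 2: "rv.representation B u = rv.representation (B - A) u"
    using rv.representation_extend[OF B(1) B(4)] by blast
  have "rv.representation B u b = 0" for b
    using 1 2 rv.representation_ne_zero[of A u b] rv.representation_ne_zero[of "B - A" u b] by auto
  moreover have "u \<in> rv.span B" using B(2,3) rv.span_mono by blast
  ultimately show ?thesis
    using rv.sum_nonzero_representation_eq[OF B(1)] by force
qed

lemma kernel_subspace: "rlin T \<Longrightarrow> rv.subspace U \<Longrightarrow> rv.subspace {u\<in>U. T u = 0}"
  by (auto simp: rv.subspace_def rlin_add rlin_scale rlin_0)

lemma image_subspace: "rlin T \<Longrightarrow> rv.subspace U \<Longrightarrow> rv.subspace (T ` U)"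
  by (rule rvp.linear_subspace_image)

text \<open>A basis of the kernel is extended to one of \<open>U\<close>; the added vectors span a
  complement on which \<open>T\<close> is injective with the full image.\<close>

lemma kernel_complement:
  assumes T: "rlin T" and U: "rv.subspace U" "U \<subseteq> fsup X" and X: "finite X"
  obtains A C where "finite A" "finite C" "A \<inter> C = {}" "rv.independent (A \<union> C)"
    "rv.span A = {u\<in>U. T u = 0}" "rv.span (A \<union> C) = U" "inj_on T (rv.span C)"
    "rv.independent (T ` C)" "rv.span (T ` C) = T ` U"
proof -
  let ?K = "{u\<in>U. T u = 0}"
  have K: "rv.subspace ?K" using kernel_subspace[OF T U(1)] .
  have "?K \<subseteq> fsup X" using U(2) by blast
  then obtain A where A: "finite A" "rv.independent A" "rv.span A = ?K" "A \<subseteq> ?K" "card A = rv.dim ?K"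
    by (rule subspace_basis[OF X K])
  have "A \<subseteq> U" using A(4) by blast
  then obtain B where B: "A \<subseteq> B" "B \<subseteq> U" "rv.independent B" "U \<subseteq> rv.span B"
    by (rule rv.maximal_independent_subset_extend[OF _ A(2)])
  have BU: "rv.span B = U" using B U(1) by (simp add: rv.span_minimal subset_antisym)
  have fB: "finite B" using fsup_indep_finite[OF X B(3)] B(2) U(2) by blast
  let ?C = "B - A"
  have AC: "A \<union> ?C = B" using B by blast
  have inj: "inj_on T (rv.span ?C)"
  proof (rule inj_onI)
    fix u v assume uv: "u \<in> rv.span ?C" "v \<in> rv.span ?C" "T u = T v"
    then have w: "u - v \<in> rv.span ?C" by (simp add: rv.span_diff)
    moreover have "rv.span ?C \<subseteq> U" using BU rv.span_mono[of ?C B] by blast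
    ultimately have "u - v \<in> ?K" using uv by (auto simp: rlin_diff[OF T])
    then have "u - v \<in> rv.span A" using A by simp
    then have "u - v = 0" using indep_disjoint_span[OF B(3,1) _ w] by blast
    then show "u = v" by simp
  qed
  have ind: "rv.independent (T ` ?C)"
    using rvp.linear_independent_injective_image[OF T _ inj] rv.independent_mono[OF B(3)] by blast
  have "rv.span (T ` ?C) = T ` rv.span ?C" using rvp.linear_span_image[OF T] by simp
  also have "\<dots> = T ` U"
  proof (intro equalityI subsetI)
    fix y assume "y \<in> T ` rv.span ?C"
    then show "y \<in> T ` U" using BU rv.span_mono[of ?C B] by blast
  next
    fix y assume "y \<in> T ` U"
    then obtain u where u: "u \<in> rv.span B" "y = T u" using BU by blast
    then have "u \<in> rv.span (A \<union> ?C)" using AC by simp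
    then obtain a c where "a \<in> rv.span A" "c \<in> rv.span ?C" "u = a + c"
      unfolding rv.span_Un by auto
    then have "y = T c" using u A(3) by (auto simp: rlin_add[OF T])
    then show "y \<in> T ` rv.span ?C" using \<open>c \<in> _\<close> by blast
  qed
  finally show thesis using that[of A ?C] A fB AC B BU inj ind by auto
qed

lemma rank_nullity:
  assumes "rlin T" "rv.subspace U" "U \<subseteq> fsup X" "finite X"
  shows "rv.dim U = rv.dim {u\<in>U. T u = 0} + rv.dim (T ` U)"
proof -
  obtain A C where *: "finite A" "finite C" "A \<inter> C = {}" "rv.independent (A \<union> C)"
    "rv.span A = {u\<in>U. T u = 0}" "rv.span (A \<union> C) = U" "inj_on T (rv.span C)"
    "rv.independent (T ` C)" "rv.span (T ` C) = T ` U"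
    by (rule kernel_complement[OF assms])
  have "rv.dim U = card (A \<union> C)" using * rv.dim_span_eq_card_independent by metis
  also have "\<dots> = card A + card C" using * by (simp add: card_Un_disjoint)
  also have "card A = rv.dim {u\<in>U. T u = 0}"
    using * rv.dim_span_eq_card_independent[of A] rv.independent_mono[OF *(4), of A] by simp
  also have "card C = card (T ` C)"
    using * by (metis card_image inj_on_subset rv.span_superset)
  also have "\<dots> = rv.dim (T ` U)" using * rv.dim_span_eq_card_independent by metis
  finally show ?thesis .
qed

lemma dim_zero: "rv.dim {0} = 0"
  using rv.dim_span_eq_card_independent[OF rv.independent_empty] by simp

lemma dim_inj_image:
  assumes "rlin T" "rv.subspace U" "U \<subseteq> fsup X" "finite X"
    and "\<And>u. u \<in> U \<Longrightarrow> T u = 0 \<Longrightarrow> u = 0"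
  shows "rv.dim (T ` U) = rv.dim U"
proof -
  have "{u\<in>U. T u = 0} = {0}"
    using assms(5) rv.subspace_0[OF assms(2)] rlin_0[OF assms(1)] by auto
  then show ?thesis using rank_nullity[OF assms(1-4)] dim_zero by simp
qed

lemma dim_mono_fsup:
  assumes "rv.subspace V" "V \<subseteq> fsup X" "finite X" "U \<subseteq> V"
  shows "rv.dim U \<le> rv.dim V"
proof -
  obtain B where B: "finite B" "rv.independent B" "rv.span B = V" "B \<subseteq> V" "card B = rv.dim V"
    by (rule subspace_basis[OF assms(3,1,2)])
  have "U \<subseteq> rv.span B" using assms(4) by (simp only: B(3))
  then show ?thesis using rv.dim_le_card[OF _ B(1)] B(5) by metis
qed

definition row :: "'r \<Rightarrow> ('x \<times> 'r \<Rightarrow> rat) \<Rightarrow> 'x \<Rightarrow> rat" where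
  "row r f = (\<lambda>x. f (x, r))"

lemma rlin_row: "rlin (row r)"
  by (rule rlinI) (auto simp: row_def rscale_apply)

lemma row_add: "row r (f + g) = row r f + row r g"
  and row_scale: "row r (rscale c f) = rscale c (row r f)"
  and row_0: "row r 0 = 0"
  by (auto simp: row_def fun_eq_iff rscale_apply)

text \<open>The space is the direct sum of the \<open>U r\<close>; projecting to one row and
  applying rank-nullity removes that row. The rows will be the labels of vertices, isolated circles
  and R-factors.\<close>

lemma dim_rows:
  assumes "finite R" "\<And>r. r \<in> R \<Longrightarrow> rv.subspace (U r)" "\<And>r. r \<in> R \<Longrightarrow> U r \<subseteq> fsup X" "finite X"
  shows "rv.dim {f. (\<forall>r\<in>R. row r f \<in> U r) \<and> (\<forall>r. r \<notin> R \<longrightarrow> row r f = 0)} = (\<Sum>r\<in>R. rv.dim (U r))"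
  using assms(1-3)
proof (induction R)
  case empty
  have *: "{f. (\<forall>r\<in>{}. row r f \<in> U r) \<and> (\<forall>r. r \<notin> {} \<longrightarrow> row r f = 0)} = {0}"
    by (auto simp: row_def fun_eq_iff)
  show ?case unfolding * by (simp only: dim_zero sum.empty)
next
  case (insert q R)
  let ?V = "\<lambda>R. {f. (\<forall>r\<in>R. row r f \<in> U r) \<and> (\<forall>r. r \<notin> R \<longrightarrow> row r f = 0)}"
  have sub: "rv.subspace (?V (insert q R))"
    unfolding rv.subspace_def
    using insert.prems(1)[THEN rv.subspace_add] insert.prems(1)[THEN rv.subspace_scale]
      insert.prems(1)[THEN rv.subspace_0]
    by (simp add: row_add row_scale row_0)
  have "?V (insert q R) \<subseteq> fsup (X \<times> insert q R)"
  proof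
    fix f assume f: "f \<in> ?V (insert q R)"
    have "f (x, r) = 0" if "x \<notin> X" "r \<in> insert q R" for x r
      using f that insert.prems(2)[of r] by (auto simp: fsup_def row_def)
    moreover have "f (x, r) = 0" if "r \<notin> insert q R" for x r
      using f that by (auto simp: row_def fun_eq_iff)
    ultimately show "f \<in> fsup (X \<times> insert q R)" by (auto simp: fsup_def)
  qed
  then have "rv.dim (?V (insert q R)) = rv.dim {f \<in> ?V (insert q R). row q f = 0} +
      rv.dim (row q ` ?V (insert q R))"
    by (intro rank_nullity[OF rlin_row sub]) (auto simp: insert assms)
  also have "{f \<in> ?V (insert q R). row q f = 0} = ?V R"
  proof (intro equalityI subsetI)
    fix f assume f: "f \<in> ?V R"
    then have "row q f = 0" using insert.hyps by blast
    then show "f \<in> {f \<in> ?V (insert q R). row q f = 0}"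
      using f rv.subspace_0[OF insert.prems(1)[of q]] by simp
  next
    fix f assume "f \<in> {f \<in> ?V (insert q R). row q f = 0}"
    then have f: "\<forall>r\<in>R. row r f \<in> U r" "\<forall>r. r \<notin> insert q R \<longrightarrow> row r f = 0" "row q f = 0"
      by blast+
    then have "row r f = 0" if "r \<notin> R" for r using that by (cases "r = q") auto
    then show "f \<in> ?V R" using f by blast
  qed
  also have "row q ` ?V (insert q R) = U q"
  proof (intro equalityI subsetI)
    fix u assume "u \<in> U q"
    define f where "f = (\<lambda>(x, r). if r = q then u x else 0)"
    have "row r f = (if r = q then u else 0)" for r by (auto simp: f_def row_def fun_eq_iff)
    then have "f \<in> ?V (insert q R)" "u = row q f"
      using \<open>u \<in> U q\<close> insert.prems(1) by (auto simp: rv.subspace_0)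
    then show "u \<in> row q ` ?V (insert q R)" by blast
  qed auto
  finally show ?case using insert by simp
qed

section \<open>Circles of a state\<close>

lemma orbit_eq_of_mem:
  assumes "permutation f" "y \<in> orbit f x"
  shows "orbit f y = orbit f x"
  using assms orbit_swap[OF permutation_self_in_orbit] orbit_trans by (metis subsetI subset_antisym)

lemma orbit_least:
  assumes "f x \<in> A" "\<And>y. y \<in> A \<Longrightarrow> f y \<in> A"
  shows "orbit f x \<subseteq> A"
proof
  fix z assume "z \<in> orbit f x"
  then show "z \<in> A" by induct (use assms in auto)
qed

text \<open>If the \<open>g\<close>-cycle of \<open>x\<close> avoided \<open>y\<close>, then
  \<open>f\<close> and \<open>g\<close> would agree along it up to its last step, where
  \<open>g\<close> returns to \<open>x\<close> and \<open>f\<close> therefore goes to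
  \<open>y\<close>; but \<open>y\<close> is not on the \<open>f\<close>-cycle of
  \<open>x\<close>.\<close>

lemma orbit_transpose_join_aux:
  assumes f: "permutation f" and g: "permutation g" and gf: "g = transpose x y \<circ> f"
    and y: "y \<notin> orbit f x"
  shows "y \<in> orbit g x"
proof (rule ccontr)
  assume ny: "y \<notin> orbit g x"
  have fg: "f z = transpose x y (g z)" for z using gf by simp
  have "x \<in> orbit g x" using g by (rule permutation_self_in_orbit)
  then have ex: "\<exists>n. 0 < n \<and> (g ^^ n) x = x" by (auto simp: orbit_altdef)
  define n where "n = (LEAST n. 0 < n \<and> (g ^^ n) x = x)"
  have n: "0 < n" "(g ^^ n) x = x" using LeastI_ex[OF ex] by (auto simp: n_def)
  have least: "(g ^^ i) x \<noteq> x" if "0 < i" "i < n" for i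
    using that not_less_Least[of i] unfolding n_def by blast
  have gy: "(g ^^ i) x \<noteq> y" for i
    using ny \<open>x \<in> orbit g x\<close> by (metis funpow_in_orbit)
  have eq: "(f ^^ i) x = (g ^^ i) x" if "i < n" for i
    using that
  proof (induction i)
    case (Suc i)
    have "(f ^^ Suc i) x = f ((f ^^ i) x)" by simp
    also have "(f ^^ i) x = (g ^^ i) x" using Suc by simp
    also have "f ((g ^^ i) x) = transpose x y ((g ^^ Suc i) x)" by (simp only: fg funpow.simps o_apply)
    also have "\<dots> = (g ^^ Suc i) x" using least[of "Suc i"] gy[of "Suc i"] Suc.prems by simp
    finally show ?case .
  qed simp
  have "(f ^^ n) x = f ((f ^^ (n - 1)) x)" using n(1) by (cases n) auto
  also have "\<dots> = transpose x y (g ((g ^^ (n - 1)) x))" using eq[of "n - 1"] n(1) by (simp add: fg)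
  also have "g ((g ^^ (n - 1)) x) = x" using n by (cases n) auto
  finally have "(f ^^ n) x = y" by simp
  then show False using y n(1) by (auto simp: orbit_altdef)
qed

lemma orbit_transpose_other:
  assumes f: "permutation f" and gf: "g = transpose x y \<circ> f" and "x \<notin> orbit f z" "y \<notin> orbit f z"
  shows "orbit g z = orbit f z"
proof (rule orbit_cong)
  show "z \<in> orbit f z" using f by (rule permutation_self_in_orbit)
  fix w assume "w \<in> orbit f z"
  then have "f w \<in> orbit f z" by (rule orbit.step)
  then have "f w \<noteq> x" "f w \<noteq> y" using assms by auto
  then show "g w = f w" using gf by simp
qed

lemma orbit_transpose_join:
  assumes f: "permutation f" and g: "permutation g" and gf: "g = transpose x y \<circ> f"
    and y: "y \<notin> orbit f x"
  shows "orbit g x = orbit f x \<union> orbit f y" "orbit g y = orbit f x \<union> orbit f y"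
proof -
  have fg: "f = transpose x y \<circ> g" using gf by (simp add: fun_eq_iff)
  have xy: "y \<in> orbit g x" using orbit_transpose_join_aux[OF assms] .
  have eq: "orbit g y = orbit g x" using orbit_eq_of_mem[OF g xy] .
  have self: "x \<in> orbit f x" "y \<in> orbit f y" using f by (auto intro: permutation_self_in_orbit)
  have sub: "orbit g x \<subseteq> orbit f x \<union> orbit f y"
  proof (rule orbit_least)
    have "g w \<in> orbit f x \<union> orbit f y" if "f w \<in> orbit f x \<union> orbit f y" for w
      using that self gf by (cases "f w = x \<or> f w = y") (auto simp: transpose_def)
    then show "g x \<in> orbit f x \<union> orbit f y"
      "\<And>w. w \<in> orbit f x \<union> orbit f y \<Longrightarrow> g w \<in> orbit f x \<union> orbit f y"
      by (auto intro: orbit.intros)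
  qed
  have "z \<in> orbit g x" if "z \<in> orbit f x \<union> orbit f y" for z
  proof (rule ccontr)
    assume nz: "z \<notin> orbit g x"
    have "x \<notin> orbit g z" "y \<notin> orbit g z"
      using nz eq orbit_swap[OF permutation_self_in_orbit[OF g]] by blast+
    then have "orbit f z = orbit g z" using orbit_transpose_other[OF g fg] by blast
    moreover have "x \<in> orbit f z \<or> y \<in> orbit f z"
      using that orbit_swap[OF permutation_self_in_orbit[OF f]] by blast
    ultimately show False using \<open>x \<notin> orbit g z\<close> \<open>y \<notin> orbit g z\<close> by blast
  qed
  then show "orbit g x = orbit f x \<union> orbit f y" using sub by blast
  then show "orbit g y = orbit f x \<union> orbit f y" using eq by simp
qed

text \<open>The \<open>g\<close>-cycle of \<open>x\<close> stays inside the stretch of the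
  \<open>f\<close>-cycle from \<open>x\<close> up to the point before \<open>y\<close>, because the
  step into \<open>y\<close> is redirected to \<open>x\<close>.\<close>

lemma orbit_transpose_split:
  assumes f: "permutation f" and gf: "g = transpose x y \<circ> f" and "x \<noteq> y"
    and y: "y \<in> orbit f x"
  shows "y \<notin> orbit g x"
proof -
  have ex: "\<exists>n. 0 < n \<and> (f ^^ n) x = y" using y by (auto simp: orbit_altdef)
  define n where "n = (LEAST n. 0 < n \<and> (f ^^ n) x = y)"
  have n: "0 < n" "(f ^^ n) x = y" using LeastI_ex[OF ex] by (auto simp: n_def)
  have least: "(f ^^ i) x \<noteq> y" if "0 < i" "i < n" for i
    using that not_less_Least[of i] unfolding n_def by blast
  have nx: "(f ^^ i) x \<noteq> x" if "0 < i" "i < n" for i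
  proof
    assume "(f ^^ i) x = x"
    then have "(f ^^ (n - i)) x = y"
      using n that funpow_add[of "n - i" i f] by simp
    then show False using least[of "n - i"] that by simp
  qed
  let ?A = "(\<lambda>i. (f ^^ i) x) ` {..<n}"
  have step: "g ((f ^^ i) x) \<in> ?A" if "i < n" for i
  proof (cases "Suc i = n")
    case True
    then have "g ((f ^^ i) x) = x" using n(2) gf by (auto simp flip: True)
    then show ?thesis using n(1) by (intro image_eqI[of _ _ 0]) auto
  next
    case False
    then have "g ((f ^^ i) x) = (f ^^ Suc i) x"
      using least[of "Suc i"] nx[of "Suc i"] that gf by simp
    then show ?thesis using False that by (intro image_eqI[of _ _ "Suc i"]) auto
  qed
  have "orbit g x \<subseteq> ?A"
    by (rule orbit_least) (use step[of 0] step n(1) in auto)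
  moreover have "y \<notin> ?A" using least \<open>x \<noteq> y\<close> by (auto, metis funpow_0 gr0I)
  ultimately show ?thesis by blast
qed

section \<open>States, toggled edges, and circles as cycles of a permutation\<close>

definition tog :: "'e \<Rightarrow> 'e set \<Rightarrow> 'e set" where
  "tog e W = (if e \<in> W then W - {e} else insert e W)"

lemma tog_tog [simp]: "tog e (tog e W) = W"
  by (auto simp: tog_def)

lemma tog_commute: "tog e (tog e' W) = tog e' (tog e W)"
  by (auto simp: tog_def)

lemma tog_subset: "W \<subseteq> E \<Longrightarrow> e \<in> E \<Longrightarrow> tog e W \<subseteq> E"
  by (auto simp: tog_def)

lemma mem_tog: "x \<in> tog e W \<longleftrightarrow> (if x = e then e \<notin> W else x \<in> W)"
  by (auto simp: tog_def)

definition flip :: "'e set \<Rightarrow> 'e \<times> bool \<Rightarrow> 'e \<times> bool" where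
  "flip W d = (if fst d \<in> W then (fst d, \<not> snd d) else d)"

lemma flip_flip [simp]: "flip W (flip W d) = d"
  by (auto simp: flip_def)

lemma fst_flip [simp]: "fst (flip W d) = fst d"
  by (auto simp: flip_def)

lemma flip_permutes: "W \<subseteq> E \<Longrightarrow> flip W permutes (E \<times> UNIV)"
  by (rule bij_imp_permutes, rule bij_betwI[of _ _ _ "flip W"]) (auto simp: flip_def)

locale ribbon =
  fixes E :: "'e set" and \<sigma> :: "'e \<times> bool \<Rightarrow> 'e \<times> bool"
  assumes finE: "finite E" and perm: "\<sigma> permutes (E \<times> UNIV)"
begin

definition H :: "('e \<times> bool) set" where "H = E \<times> UNIV"

text \<open>The ends of absent edges stay in the ground set: \<open>flip\<close> fixes them, so the
  walk passes by without crossing. All states thus permute the same half-edges, and toggling an edge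
  becomes composition with one transposition (\<open>phi_tog\<close>).\<close>

definition phi :: "'e set \<Rightarrow> 'e \<times> bool \<Rightarrow> 'e \<times> bool" where "phi W = flip W \<circ> \<sigma>"

definition cyc :: "'e set \<Rightarrow> 'e \<times> bool \<Rightarrow> ('e \<times> bool) set" where "cyc W x = orbit (phi W) x"

definition P :: "'e set \<Rightarrow> ('e \<times> bool) set set" where "P W = cyc W ` H"

text \<open>\<open>ca\<close> and \<open>cb\<close> are the circles along the two sides of
  \<open>e\<close>, whether \<open>e\<close> is present or absent.\<close>

definition ca :: "'e set \<Rightarrow> 'e \<Rightarrow> ('e \<times> bool) set" where "ca W e = cyc W (e, False)"
definition cb :: "'e set \<Rightarrow> 'e \<Rightarrow> ('e \<times> bool) set" where "cb W e = cyc W (e, True)"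

lemma finH: "finite H" by (simp add: H_def finE)

lemma mem_H: "d \<in> H \<longleftrightarrow> fst d \<in> E" by (cases d) (auto simp: H_def)

lemma phi_permutes: "W \<subseteq> E \<Longrightarrow> phi W permutes H"
  unfolding phi_def H_def by (rule permutes_compose[OF perm flip_permutes])

lemma phi_permutation: "W \<subseteq> E \<Longrightarrow> permutation (phi W)"
  using phi_permutes finH permutation_permutes by blast

lemma phi_in_H: "W \<subseteq> E \<Longrightarrow> x \<in> H \<Longrightarrow> phi W x \<in> H"
  by (meson phi_permutes permutes_in_image)

lemma cyc_self: "W \<subseteq> E \<Longrightarrow> x \<in> cyc W x"
  unfolding cyc_def by (rule permutation_self_in_orbit[OF phi_permutation])

lemma cyc_eq: "W \<subseteq> E \<Longrightarrow> y \<in> cyc W x \<Longrightarrow> cyc W y = cyc W x"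
  unfolding cyc_def by (rule orbit_eq_of_mem[OF phi_permutation])

lemma cyc_eq_iff: "W \<subseteq> E \<Longrightarrow> cyc W y = cyc W x \<longleftrightarrow> y \<in> cyc W x"
  using cyc_eq cyc_self by blast

lemma cyc_subset_H: "W \<subseteq> E \<Longrightarrow> x \<in> H \<Longrightarrow> cyc W x \<subseteq> H"
  unfolding cyc_def by (rule permutes_orbit_subset[OF phi_permutes])

lemma cyc_phi: "W \<subseteq> E \<Longrightarrow> cyc W (phi W x) = cyc W x"
  unfolding cyc_def by (rule permutation_orbit_step[OF phi_permutation])

lemma finP [simp, intro]: "finite (P W)" by (simp add: P_def finH)

lemma P_cyc: "W \<subseteq> E \<Longrightarrow> c \<in> P W \<Longrightarrow> x \<in> c \<Longrightarrow> c = cyc W x"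
  unfolding P_def by (metis (no_types) imageE cyc_eq)

lemma P_disjoint: "W \<subseteq> E \<Longrightarrow> c \<in> P W \<Longrightarrow> c' \<in> P W \<Longrightarrow> x \<in> c \<Longrightarrow> x \<in> c' \<Longrightarrow> c = c'"
  by (metis P_cyc)

lemma P_nonempty: "c \<in> P W \<Longrightarrow> c \<noteq> {}"
  unfolding P_def cyc_def using orbit_nonempty by fastforce

lemma P_subset_H: "W \<subseteq> E \<Longrightarrow> c \<in> P W \<Longrightarrow> c \<subseteq> H"
  unfolding P_def using cyc_subset_H by blast

lemma Union_P: "W \<subseteq> E \<Longrightarrow> \<Union>(P W) = H"
  using P_subset_H cyc_self by (auto simp: P_def)

lemma cyc_in_P: "x \<in> H \<Longrightarrow> cyc W x \<in> P W" by (auto simp: P_def)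

lemma ca_in_P: "e \<in> E \<Longrightarrow> ca W e \<in> P W" and cb_in_P: "e \<in> E \<Longrightarrow> cb W e \<in> P W"
  by (auto simp: ca_def cb_def mem_H intro: cyc_in_P)

lemma phi_tog: "phi (tog e W) = transpose (e, False) (e, True) \<circ> phi W"
  by (auto simp: fun_eq_iff phi_def flip_def tog_def transpose_def prod_eq_iff)

lemma cyc_tog_other:
  assumes "W \<subseteq> E" "cyc W z \<noteq> ca W e" "cyc W z \<noteq> cb W e"
  shows "cyc (tog e W) z = cyc W z"
  using assms orbit_transpose_other[OF phi_permutation phi_tog] cyc_eq_iff
  unfolding ca_def cb_def by (metis cyc_def)

lemma tog_join:
  assumes "W \<subseteq> E" "e \<in> E" "ca W e \<noteq> cb W e"
  shows "ca (tog e W) e = ca W e \<union> cb W e" "cb (tog e W) e = ca W e \<union> cb W e"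
  using orbit_transpose_join[OF phi_permutation phi_permutation phi_tog, of W e] assms
    tog_subset[OF assms(1,2)] cyc_eq_iff[OF assms(1), of "(e, True)" "(e, False)"]
  unfolding ca_def cb_def cyc_def by auto

lemma tog_split:
  assumes "W \<subseteq> E" "e \<in> E" "ca W e = cb W e"
  shows "ca (tog e W) e \<noteq> cb (tog e W) e"
  using orbit_transpose_split[OF phi_permutation phi_tog, of W e] assms
    tog_subset[OF assms(1,2)] cyc_eq_iff[OF assms(1), of "(e, True)" "(e, False)"]
    cyc_eq_iff[OF tog_subset[OF assms(1,2)], of "(e, True)" "(e, False)"]
  unfolding ca_def cb_def cyc_def by auto

lemma same_tog:
  assumes "W \<subseteq> E" "e \<in> E"
  shows "ca (tog e W) e = cb (tog e W) e \<longleftrightarrow> ca W e \<noteq> cb W e"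
  using tog_join[OF assms] tog_split[OF assms] by auto

text \<open>The circles away from \<open>e\<close> are the same sets before and after the toggle
  (\<open>rest_tog\<close>), so their labels are compared across states without any
  transport.\<close>

definition rest :: "'e set \<Rightarrow> 'e \<Rightarrow> ('e \<times> bool) set set" where
  "rest W e = P W - {ca W e, cb W e}"

lemma P_rest: "e \<in> E \<Longrightarrow> P W = insert (ca W e) (insert (cb W e) (rest W e))"
  by (auto simp: rest_def ca_in_P cb_in_P)

lemma rest_notin [simp]: "ca W e \<notin> rest W e" "cb W e \<notin> rest W e"
  by (auto simp: rest_def)

lemma rest_finite [simp]: "finite (rest W e)" by (simp add: rest_def)

lemma rest_tog_subset:
  assumes "W \<subseteq> E" "e \<in> E" shows "rest W e \<subseteq> rest (tog e W) e"
proof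
  fix c assume "c \<in> rest W e"
  then obtain z where z: "z \<in> H" "c = cyc W z" "cyc W z \<noteq> ca W e" "cyc W z \<noteq> cb W e"
    by (auto simp: rest_def P_def)
  then have eq: "cyc (tog e W) z = c" using cyc_tog_other[OF assms(1)] by auto
  have "(e, False) \<notin> c" "(e, True) \<notin> c" using z cyc_eq[OF assms(1), of _ z]
    by (auto simp: ca_def cb_def)
  moreover have "(e, False) \<in> ca (tog e W) e" "(e, True) \<in> cb (tog e W) e"
    using cyc_self[OF tog_subset[OF assms]] by (auto simp: ca_def cb_def)
  ultimately have "c \<noteq> ca (tog e W) e" "c \<noteq> cb (tog e W) e" by auto
  then show "c \<in> rest (tog e W) e" using eq z(1) by (auto simp: rest_def P_def)
qed

lemma rest_tog: "W \<subseteq> E \<Longrightarrow> e \<in> E \<Longrightarrow> rest (tog e W) e = rest W e"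
  using rest_tog_subset[of W e] rest_tog_subset[of "tog e W" e] tog_subset[of W E e] by auto

lemma card_P: "W \<subseteq> E \<Longrightarrow> e \<in> E \<Longrightarrow>
  card (P W) = card (rest W e) + (if ca W e = cb W e then 1 else 2)"
  by (auto simp: P_rest[of e W])

lemma card_P_tog: "W \<subseteq> E \<Longrightarrow> e \<in> E \<Longrightarrow>
  int (card (P (tog e W))) = int (card (P W)) + (if ca W e = cb W e then 1 else -1)"
  using card_P[of W e] card_P[of "tog e W" e] tog_subset[of W E e] same_tog[of W e] rest_tog[of W e]
  by auto

text \<open>A two-colouring of the circles, stored as the set of half-edges of one colour. In this
  form one and the same \<open>B\<close> can be a colouring of several states.\<close>

definition col :: "'e set \<Rightarrow> ('e \<times> bool) set \<Rightarrow> bool" where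
  "col W B \<longleftrightarrow> B \<subseteq> H \<and> (\<forall>x\<in>H. phi W x \<in> B \<longleftrightarrow> x \<in> B)"

lemma col_cyc: "W \<subseteq> E \<Longrightarrow> col W B \<Longrightarrow> x \<in> H \<Longrightarrow> y \<in> cyc W x \<Longrightarrow> y \<in> B \<longleftrightarrow> x \<in> B"
proof -
  assume *: "W \<subseteq> E" "col W B" "x \<in> H" "y \<in> cyc W x"
  have "cyc W x \<subseteq> {y\<in>H. y \<in> B \<longleftrightarrow> x \<in> B}" unfolding cyc_def
    by (rule orbit_least) (use * phi_in_H in \<open>auto simp: col_def\<close>)
  then show ?thesis using * by blast
qed

lemma col_cyc_subset: "W \<subseteq> E \<Longrightarrow> col W B \<Longrightarrow> x \<in> H \<Longrightarrow> cyc W x \<subseteq> B \<longleftrightarrow> x \<in> B"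
  using col_cyc cyc_self by blast

lemma colI:
  assumes "W \<subseteq> E" "B \<subseteq> H" "\<And>x y. x \<in> H \<Longrightarrow> y \<in> cyc W x \<Longrightarrow> x \<in> B \<Longrightarrow> y \<in> B"
  shows "col W B"
  unfolding col_def
proof (intro conjI ballI)
  fix x assume x: "x \<in> H"
  have 1: "phi W x \<in> cyc W x" by (auto simp: cyc_def intro: orbit.base)
  then have "x \<in> cyc W (phi W x)" using cyc_phi cyc_self assms(1) by auto
  then show "phi W x \<in> B \<longleftrightarrow> x \<in> B" using assms(3) 1 x phi_in_H[OF assms(1) x] by blast
qed (use assms in auto)

text \<open>The toggle exchanges the two ends of \<open>e\<close> among the values of
  \<open>phi\<close>, which respects \<open>B\<close> exactly when both ends have the same colour.
  For \<open>e\<close> outside \<open>E\<close> nothing in \<open>H\<close> is exchanged.\<close>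

lemma col_tog:
  assumes "col W B"
  shows "col (tog e W) B \<longleftrightarrow> ((e, False) \<in> B \<longleftrightarrow> (e, True) \<in> B) \<or> e \<notin> E" (is "?L \<longleftrightarrow> ?R")
proof
  assume L: ?L
  show ?R
  proof (cases "e \<in> E")
    case True
    obtain x where "\<sigma> x = (e, False)" using permutes_surj[OF perm] by (metis surjD)
    moreover have "x \<in> H" using True calculation permutes_in_image[OF perm, of x]
      by (simp add: H_def)
    ultimately have "flip W (e, False) \<in> B \<longleftrightarrow> x \<in> B" "flip (tog e W) (e, False) \<in> B \<longleftrightarrow> x \<in> B"
      using assms L by (auto simp: col_def phi_def)
    then show ?thesis by (auto simp: flip_def mem_tog split: if_splits)
  qed simp
next
  assume R: ?R
  have "transpose (e, False) (e, True) z \<in> B \<longleftrightarrow> z \<in> B" if "z \<in> H" for z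
  proof (cases "e \<in> E")
    case True then show ?thesis using R by (auto simp: transpose_def)
  next
    case False then show ?thesis using that by (auto simp: transpose_def mem_H)
  qed
  moreover have "phi W x \<in> H" if "x \<in> H" for x
    using that permutes_in_image[OF perm, of x] mem_H unfolding H_def[symmetric]
    by (simp add: phi_def)
  ultimately show ?L using assms by (auto simp: col_def phi_tog)
qed

end

section \<open>Edge operators and the Fourier transform\<close>

lemma sum_Pow_insert:
  assumes "finite S" "a \<notin> S"
  shows "(\<Sum>A\<in>Pow (insert a S). g A) = (\<Sum>R\<in>Pow S. g R + g (insert a R))"
proof -
  have "Pow (insert a S) = Pow S \<union> insert a ` Pow S" by (rule Pow_insert)
  moreover have "Pow S \<inter> insert a ` Pow S = {}" using assms by auto
  moreover have "inj_on (insert a) (Pow S)" using assms(2) by (auto intro!: inj_onI)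
  ultimately show ?thesis using assms
    by (simp add: sum.union_disjoint sum.reindex sum.distrib)
qed

lemma sum_Pow_insert2:
  assumes "finite S" "a \<notin> S" "b \<notin> S" "a \<noteq> b"
  shows "(\<Sum>A\<in>Pow (insert a (insert b S)). g A) =
    (\<Sum>R\<in>Pow S. g R + g (insert a R) + g (insert b R) + g (insert a (insert b R)))"
  using assms by (simp add: sum_Pow_insert sum.distrib algebra_simps)

lemma sum_Pow_prod:
  fixes w :: "'c \<Rightarrow> rat"
  assumes "finite S"
  shows "(\<Sum>A\<in>Pow S. \<Prod>c\<in>A. w c) = (\<Prod>c\<in>S. w c + 1)"
  using prod_add[OF assms, of w "\<lambda>_. 1"] by simp

type_synonym 'e bgen = "'e set \<times> ('e \<times> bool) set set"

text \<open>Evaluation of X at a root of X^2 = s^2, where the colour of the circle chooses the root.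
  \<open>chi\<close> is then the value of a basis monomial at the point \<open>B\<close>.\<close>

definition val :: "rat \<Rightarrow> 'c set \<Rightarrow> 'c set \<Rightarrow> rat" where
  "val s B c = (if c \<subseteq> B then - s else s)"

definition chi :: "rat \<Rightarrow> 'c set set \<Rightarrow> 'c set \<Rightarrow> rat" where
  "chi s A B = (\<Prod>c\<in>A. val s B c)"

lemma chi_insert: "finite R \<Longrightarrow> c \<notin> R \<Longrightarrow> chi s (insert c R) B = val s B c * chi s R B"
  by (simp add: chi_def)

context ribbon
begin

text \<open>The operator from \<^term>\<open>tog e W\<close> to \<open>W\<close> over the ring with \<open>X\<^sup>2 = t\<close>, where a set \<open>A\<close> of
  circles stands for the tensor with \<open>X = v\<^sub>-\<close> on \<open>A\<close> and \<open>1 = v\<^sub>+\<close> elsewhere. Both directions of an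
  edge are covered: \<open>t = 0\<close> gives the maps of the chromatic complex, \<open>t = 1\<close> Lee's deformation.\<close>

definition T :: "rat \<Rightarrow> 'e \<Rightarrow> ('e bgen \<Rightarrow> rat) \<Rightarrow> 'e bgen \<Rightarrow> rat" where
  "T t e f = (\<lambda>(W, A). if W \<subseteq> E \<and> A \<subseteq> P W then
     (let V = tog e W; R = A - {ca W e, cb W e} in
      if ca W e = cb W e then
        (if ca W e \<in> A then f (V, insert (ca V e) R) + f (V, insert (cb V e) R)
         else f (V, R) + t * f (V, insert (ca V e) (insert (cb V e) R)))
      else if ca W e \<in> A then (if cb W e \<in> A then f (V, insert (ca V e) R) else f (V, R))
      else if cb W e \<in> A then f (V, R) else t * f (V, insert (ca V e) R)) else 0)"

lemma T_linear: "rlin (T t e)"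
  by (rule rlinI) (auto simp: T_def Let_def rscale_apply algebra_simps)

text \<open>Products of two operators are therefore quadratic in \<open>t\<close>, so that
  identities known for enough nonzero squares carry over to \<open>t = 0\<close>.\<close>

lemma T_affine: "T t e f = T 0 e f + rscale t (T 1 e f - T 0 e f)"
  by (rule ext) (auto simp: T_def Let_def rscale_apply algebra_simps)

lemma T_outside: "\<not> (W \<subseteq> E \<and> A \<subseteq> P W) \<Longrightarrow> T t e f (W, A) = 0"
  by (auto simp: T_def)

lemma T_same:
  assumes "W \<subseteq> E" "e \<in> E" "ca W e = cb W e" "R \<subseteq> rest W e"
  shows "T t e f (W, R) = f (tog e W, R) +
      t * f (tog e W, insert (ca (tog e W) e) (insert (cb (tog e W) e) R))"
    and "T t e f (W, insert (ca W e) R) =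
      f (tog e W, insert (ca (tog e W) e) R) + f (tog e W, insert (cb (tog e W) e) R)"
proof -
  have "R - {ca W e, cb W e} = R" "insert (ca W e) R - {ca W e, cb W e} = R" "ca W e \<notin> R"
    using assms by (auto simp: rest_def)
  moreover have "R \<subseteq> P W" "insert (ca W e) R \<subseteq> P W"
    using assms by (auto simp: P_rest)
  ultimately show "T t e f (W, R) = f (tog e W, R) +
      t * f (tog e W, insert (ca (tog e W) e) (insert (cb (tog e W) e) R))"
    "T t e f (W, insert (ca W e) R) =
      f (tog e W, insert (ca (tog e W) e) R) + f (tog e W, insert (cb (tog e W) e) R)"
    using assms(1,3) by (simp_all add: T_def Let_def)
qed

lemma T_diff:
  assumes "W \<subseteq> E" "e \<in> E" "ca W e \<noteq> cb W e" "R \<subseteq> rest W e"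
  shows "T t e f (W, R) = t * f (tog e W, insert (ca (tog e W) e) R)"
    and "T t e f (W, insert (ca W e) R) = f (tog e W, R)"
    and "T t e f (W, insert (cb W e) R) = f (tog e W, R)"
    and "T t e f (W, insert (ca W e) (insert (cb W e) R)) = f (tog e W, insert (ca (tog e W) e) R)"
proof -
  have "R - {ca W e, cb W e} = R" "ca W e \<notin> R" "cb W e \<notin> R"
    using assms by (auto simp: rest_def)
  moreover have "R \<subseteq> P W" "ca W e \<in> P W" "cb W e \<in> P W"
    using assms by (auto simp: P_rest)
  ultimately show "T t e f (W, R) = t * f (tog e W, insert (ca (tog e W) e) R)"
    "T t e f (W, insert (ca W e) R) = f (tog e W, R)"
    "T t e f (W, insert (cb W e) R) = f (tog e W, R)"
    "T t e f (W, insert (ca W e) (insert (cb W e) R)) = f (tog e W, insert (ca (tog e W) e) R)"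
    using assms(1,3) by (auto simp: T_def Let_def insert_Diff_if)
qed

text \<open>A chain at the state \<open>W\<close> is a multilinear polynomial in one variable per
  circle; this is its value at the point given by \<open>B\<close>, a Walsh-Fourier
  transform.\<close>

definition hat :: "rat \<Rightarrow> ('e bgen \<Rightarrow> rat) \<Rightarrow> 'e set \<Rightarrow> ('e \<times> bool) set \<Rightarrow> rat" where
  "hat s f W B = (\<Sum>A\<in>Pow (P W). f (W, A) * chi s A B)"

definition sg1 :: "rat \<Rightarrow> ('e \<times> bool) set \<Rightarrow> 'e \<Rightarrow> rat" where
  "sg1 s B e = (if (e, False) \<in> B then - s else s)"

text \<open>In the coordinates given by \<open>hat\<close> the edge operators preserve the
  colouring: merging restricts to equal roots with factor 1, splitting multiplies by X1 + X2, which
  is zero at opposite roots and twice the root at equal ones.\<close>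

definition cc :: "rat \<Rightarrow> 'e set \<Rightarrow> 'e \<Rightarrow> ('e \<times> bool) set \<Rightarrow> rat" where
  "cc s W e B = (if ((e, False) \<in> B) \<noteq> ((e, True) \<in> B) then 0
     else if ca W e = cb W e then 1 else 2 * sg1 s B e)"

lemma col_ca: "W \<subseteq> E \<Longrightarrow> e \<in> E \<Longrightarrow> col W B \<Longrightarrow> ca W e \<subseteq> B \<longleftrightarrow> (e, False) \<in> B"
  and col_cb: "W \<subseteq> E \<Longrightarrow> e \<in> E \<Longrightarrow> col W B \<Longrightarrow> cb W e \<subseteq> B \<longleftrightarrow> (e, True) \<in> B"
  unfolding ca_def cb_def by (rule col_cyc_subset; simp add: mem_H)+

lemma rest_sub_finite: "R \<subseteq> rest W e \<Longrightarrow> finite R"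
  by (rule finite_subset[OF _ rest_finite])

lemma hat_same:
  assumes "W \<subseteq> E" "e \<in> E" "ca W e = cb W e"
  shows "hat s f W B = (\<Sum>R\<in>Pow (rest W e). (f (W, R) + f (W, insert (ca W e) R) * val s B (ca W e)) * chi s R B)"
proof -
  have P: "P W = insert (ca W e) (rest W e)" using assms by (simp add: P_rest)
  have *: "ca W e \<notin> R" "finite R" if "R \<subseteq> rest W e" for R
    using that rest_sub_finite by auto
  show ?thesis unfolding hat_def P
    by (subst sum_Pow_insert; (intro sum.cong refl)?) (auto simp: chi_insert * algebra_simps)
qed

lemma hat_diff:
  assumes "W \<subseteq> E" "e \<in> E" "ca W e \<noteq> cb W e"
  shows "hat s f W B = (\<Sum>R\<in>Pow (rest W e). (f (W, R) + f (W, insert (ca W e) R) * val s B (ca W e)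
    + f (W, insert (cb W e) R) * val s B (cb W e)
    + f (W, insert (ca W e) (insert (cb W e) R)) * (val s B (ca W e) * val s B (cb W e))) * chi s R B)"
proof -
  have *: "ca W e \<notin> R" "cb W e \<notin> R" "finite R" if "R \<subseteq> rest W e" for R
    using that rest_sub_finite by auto
  show ?thesis unfolding hat_def P_rest[OF assms(2), of W]
    by (subst sum_Pow_insert2; (intro sum.cong refl)?)
      (auto simp: chi_insert * assms algebra_simps)
qed

text \<open>Both sides are compared term by term over the labels \<open>R\<close> of the untouched
  circles. When \<open>B\<close> separates the sides of \<open>e\<close> it is no colouring of
  \<open>tog e W\<close>; the factor \<open>cc\<close> is zero then, so the meaningless value of
  \<open>hat\<close> there does no harm.\<close>

lemma hat_T:
  assumes W: "W \<subseteq> E" and e: "e \<in> E" and B: "col W B"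
  shows "hat s (T (s\<^sup>2) e f) W B = cc s W e B * hat s f (tog e W) B"
proof -
  let ?V = "tog e W"
  have V: "?V \<subseteq> E" using tog_subset[OF W e] .
  have r: "rest ?V e = rest W e" using rest_tog[OF W e] .
  show ?thesis
  proof (cases "ca W e = cb W e")
    case True
    then have nV: "ca ?V e \<noteq> cb ?V e" using same_tog[OF W e] by blast
    have ab: "(e, False) \<in> B \<longleftrightarrow> (e, True) \<in> B"
      using col_ca[OF W e B] col_cb[OF W e B] True by simp
    then have BV: "col ?V B" using col_tog[OF B] by blast
    let ?v = "sg1 s B e"
    have v: "val s B (ca W e) = ?v" "val s B (ca ?V e) = ?v" "val s B (cb ?V e) = ?v"
      using col_ca[OF W e B] col_ca[OF V e BV] col_cb[OF V e BV] ab
      by (auto simp: val_def sg1_def)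
    have "?v * ?v = s\<^sup>2" by (simp add: sg1_def power2_eq_square)
    moreover have "cc s W e B = 1" using ab True by (simp add: cc_def)
    ultimately show ?thesis
      unfolding hat_same[OF W e True] hat_diff[OF V e nV] r v
      by (auto simp: T_same[OF W e True] algebra_simps intro!: sum.cong)
  next
    case False
    then have sV: "ca ?V e = cb ?V e" using same_tog[OF W e] by blast
    let ?a = "val s B (ca W e)" and ?b = "val s B (cb W e)"
    have "hat s (T (s\<^sup>2) e f) W B = (\<Sum>R\<in>Pow (rest W e). (s\<^sup>2 * f (?V, insert (ca ?V e) R) +
        f (?V, R) * ?a + f (?V, R) * ?b + f (?V, insert (ca ?V e) R) * (?a * ?b)) * chi s R B)"
      unfolding hat_diff[OF W e False] by (intro sum.cong) (auto simp: T_diff[OF W e False])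
    also have "\<dots> = cc s W e B * hat s f ?V B"
    proof (cases "((e, False) \<in> B) \<noteq> ((e, True) \<in> B)")
      case True
      then have "?a = s \<and> ?b = -s \<or> ?a = -s \<and> ?b = s"
        using col_ca[OF W e B] col_cb[OF W e B] by (auto simp: val_def)
      then have "s\<^sup>2 * y + x * ?a + x * ?b + y * (?a * ?b) = 0" for x y
        by (auto simp: power2_eq_square)
      then show ?thesis using True by (simp add: cc_def)
    next
      case ab: False
      then have BV: "col ?V B" using col_tog[OF B] by blast
      let ?v = "sg1 s B e"
      have v: "?a = ?v" "?b = ?v" "val s B (ca ?V e) = ?v"
        using col_ca[OF W e B] col_cb[OF W e B] col_ca[OF V e BV] ab
        by (auto simp: val_def sg1_def)
      have "?v * ?v = s\<^sup>2" by (simp add: sg1_def power2_eq_square)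
      then show ?thesis unfolding hat_same[OF V e sV] r v sum_distrib_left
        using ab False by (auto simp: cc_def algebra_simps intro!: sum.cong)
    qed
    finally show ?thesis .
  qed
qed

lemma chi_scale: "chi s A B = s ^ card A * chi 1 A B"
proof -
  have "chi s A B = (\<Prod>c\<in>A. s * val 1 B c)" unfolding chi_def
    by (intro prod.cong) (auto simp: val_def)
  then show ?thesis by (simp add: prod.distrib chi_def)
qed

lemma col_Union: "W \<subseteq> E \<Longrightarrow> C \<subseteq> P W \<Longrightarrow> col W (\<Union>C)"
proof (rule colI)
  assume W: "W \<subseteq> E" and C: "C \<subseteq> P W"
  then show "\<Union>C \<subseteq> H" using P_subset_H by blast
  fix x y assume "x \<in> H" "y \<in> cyc W x" "x \<in> \<Union>C"
  then show "y \<in> \<Union>C" using W C P_cyc by blast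
qed

lemma subset_Union_iff: "W \<subseteq> E \<Longrightarrow> C \<subseteq> P W \<Longrightarrow> c \<in> P W \<Longrightarrow> c \<subseteq> \<Union>C \<longleftrightarrow> c \<in> C"
  using P_disjoint[of W c] P_nonempty[of c W] by blast

lemma chi_Union: "W \<subseteq> E \<Longrightarrow> C \<subseteq> P W \<Longrightarrow> A \<subseteq> P W \<Longrightarrow>
  chi 1 A (\<Union>C) = (\<Prod>c\<in>C. if c \<in> A then -1 else 1)"
proof -
  assume W: "W \<subseteq> E" and C: "C \<subseteq> P W" and A: "A \<subseteq> P W"
  have f: "finite A" "finite C" using A C finite_subset finP by blast+
  have "chi 1 A (\<Union>C) = (\<Prod>c\<in>A. if c \<in> C then -1 else 1)"
    unfolding chi_def val_def using subset_Union_iff[OF W C] A by (intro prod.cong) auto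
  also have "\<dots> = (\<Prod>c\<in>A \<inter> C. -1)" by (rule prod.inter_restrict[OF f(1), symmetric])
  also have "\<dots> = (\<Prod>c\<in>C \<inter> A. -1)" by (simp add: Int_commute)
  also have "\<dots> = (\<Prod>c\<in>C. if c \<in> A then -1 else 1)" by (rule prod.inter_restrict[OF f(2)])
  finally show ?thesis .
qed

lemma prod_pm_eq:
  fixes w :: "'c \<Rightarrow> rat"
  assumes "finite S" "\<And>c. c \<in> S \<Longrightarrow> w c = 1 \<or> w c = -1"
  shows "(\<Prod>c\<in>S. w c + 1) = (if \<forall>c\<in>S. w c = 1 then 2 ^ card S else 0)"
proof (cases "\<forall>c\<in>S. w c = 1")
  case False
  then obtain c where "c \<in> S" "w c + 1 = 0" using assms(2) by force
  then show ?thesis using False assms(1) by (simp add: prod_zero_iff) auto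
qed simp

text \<open>The sum over \<open>C\<close> factors over the circles, and a circle in exactly one of
  \<open>A\<close> and \<open>A'\<close> contributes 1 + (-1).\<close>

lemma chi_orth:
  assumes W: "W \<subseteq> E" and A: "A \<subseteq> P W" and A': "A' \<subseteq> P W"
  shows "(\<Sum>C\<in>Pow (P W). chi 1 A (\<Union>C) * chi 1 A' (\<Union>C)) = (if A = A' then 2 ^ card (P W) else 0)"
proof -
  let ?w = "\<lambda>c. (if c \<in> A then -1 else 1) * (if c \<in> A' then -1 else (1::rat))"
  have "(\<Sum>C\<in>Pow (P W). chi 1 A (\<Union>C) * chi 1 A' (\<Union>C)) = (\<Sum>C\<in>Pow (P W). \<Prod>c\<in>C. ?w c)"
    by (intro sum.cong) (auto simp: chi_Union[OF W] A A' prod.distrib)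
  also have "\<dots> = (\<Prod>c\<in>P W. ?w c + 1)" by (rule sum_Pow_prod) simp
  also have "\<dots> = (if \<forall>c\<in>P W. ?w c = 1 then 2 ^ card (P W) else 0)"
    by (rule prod_pm_eq) auto
  also have "(\<forall>c\<in>P W. ?w c = 1) \<longleftrightarrow> A = A'" using A A' by (auto split: if_splits)
  finally show ?thesis .
qed

lemma hat_inverse:
  assumes W: "W \<subseteq> E" and A: "A \<subseteq> P W"
  shows "(\<Sum>C\<in>Pow (P W). hat 1 f W (\<Union>C) * chi 1 A (\<Union>C)) = 2 ^ card (P W) * f (W, A)"
proof -
  have "(\<Sum>C\<in>Pow (P W). hat 1 f W (\<Union>C) * chi 1 A (\<Union>C)) =
    (\<Sum>A'\<in>Pow (P W). f (W, A') * (\<Sum>C\<in>Pow (P W). chi 1 A' (\<Union>C) * chi 1 A (\<Union>C)))"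
    unfolding hat_def sum_distrib_right sum_distrib_left
    by (subst sum.swap) (simp add: mult.assoc)
  also have "\<dots> = (\<Sum>A'\<in>Pow (P W). if A' = A then 2 ^ card (P W) * f (W, A) else 0)"
    by (intro sum.cong) (auto simp: chi_orth[OF W _ A])
  also have "\<dots> = 2 ^ card (P W) * f (W, A)" using A by simp
  finally show ?thesis .
qed

text \<open>Rescaling the coefficients by powers of \<open>s\<close> reduces to
  \<open>s = 1\<close>, where orthogonality inverts the transform. For \<open>s = 0\<close> the two
  roots would coincide.\<close>

lemma hat_inj:
  assumes W: "W \<subseteq> E" and s: "s \<noteq> 0" and A: "A \<subseteq> P W"
    and 0: "\<And>B. col W B \<Longrightarrow> hat s f W B = 0"
  shows "f (W, A) = 0"
proof -
  let ?g = "\<lambda>(W, A). s ^ card A * f (W, A)"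
  have "hat s f W B = hat 1 ?g W B" for B
    unfolding hat_def by (intro sum.cong refl) (simp add: chi_scale[of s] mult_ac)
  then have "hat 1 ?g W (\<Union>C) = 0" if "C \<in> Pow (P W)" for C
    using 0 col_Union[OF W] that by simp
  then have "2 ^ card (P W) * ?g (W, A) = 0"
    using hat_inverse[OF W A, of ?g] by simp
  then show ?thesis using s by simp
qed

lemma hat_lin: "hat s (f - g) W B = hat s f W B - hat s g W B"
  by (simp add: hat_def sum_subtractf left_diff_distrib)

text \<open>Under these hypotheses toggling \<open>e\<close> changes whether the sides of
  \<open>e'\<close> share a circle. Only circles along \<open>e\<close> are affected by the toggle,
  so \<open>e'\<close> must run along one of them.\<close>

lemma same_link:
  assumes W: "W \<subseteq> E" and e: "e \<in> E" "e' \<in> E"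
    and eq: "(ca W e = cb W e) = (ca W e' = cb W e')"
    and ne: "(ca (tog e W) e' = cb (tog e W) e') \<noteq> (ca W e = cb W e)"
  shows "ca W e' = ca W e \<or> ca W e' = cb W e"
proof (rule ccontr)
  assume *: "\<not> ?thesis"
  then have u: "ca (tog e W) e' = ca W e'"
    using cyc_tog_other[OF W, of "(e', False)" e] by (auto simp: ca_def)
  have V: "tog e W \<subseteq> E" using tog_subset[OF W e(1)] .
  show False
  proof (cases "ca W e' = cb W e'")
    case True
    then have "cb (tog e W) e' = cb W e'"
      using * cyc_tog_other[OF W, of "(e', True)" e] by (auto simp: ca_def cb_def)
    then show False using u True eq ne by simp
  next
    case False
    then have "ca (tog e W) e' = cb (tog e W) e'" using eq ne by auto
    then have "(e', True) \<in> ca W e'" using u cyc_self[OF V, of "(e', True)"] by (simp add: cb_def)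
    then show False using False cyc_eq[OF W, of "(e', True)" "(e', False)"]
      by (simp add: ca_def cb_def)
  qed
qed

lemma cc_commute:
  assumes W: "W \<subseteq> E" and e: "e \<in> E" "e' \<in> E" and B: "col W B"
  shows "cc s W e B * cc s (tog e W) e' B = cc s W e' B * cc s (tog e' W) e B"
proof (cases "((e, False) \<in> B) \<noteq> ((e, True) \<in> B) \<or> ((e', False) \<in> B) \<noteq> ((e', True) \<in> B)")
  case True
  then show ?thesis by (auto simp: cc_def)
next
  case l: False
  have V: "tog e W \<subseteq> E" "tog e' W \<subseteq> E" using tog_subset[OF W] e by auto
  let ?S = "\<lambda>W e. ca W e = cb W e"
  \<comment> \<open>Both orders lead to the same state, so they contain equally many merges; it
    remains to see which edge contributes the factor \<open>2 * sg1\<close>.\<close>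
  have count: "(if ?S W e then 1 else -1 :: int) + (if ?S (tog e W) e' then 1 else -1) =
      (if ?S W e' then 1 else -1) + (if ?S (tog e' W) e then 1 else -1)"
    using card_P_tog[OF W e(1)] card_P_tog[OF W e(2)] card_P_tog[OF V(1) e(2)]
      card_P_tog[OF V(2) e(1)] arg_cong[OF tog_commute[of e e' W], of "\<lambda>W. int (card (P W))"]
    by linarith
  have l1: "((e, False) \<in> B) = ((e, True) \<in> B)" and l2: "((e', False) \<in> B) = ((e', True) \<in> B)"
    using l by blast+
  define p q p' q' where "p = ?S W e" "q = ?S (tog e W) e'" "p' = ?S W e'" "q' = ?S (tog e' W) e"
  have pq: "(if p then 1 else -1 :: int) + (if q then 1 else -1) =
      (if p' then 1 else -1) + (if q' then 1 else -1)"
    using count unfolding p_q_p'_q'_def .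
  have c: "cc s W e B = (if p then 1 else 2 * sg1 s B e)"
    "cc s (tog e W) e' B = (if q then 1 else 2 * sg1 s B e')"
    "cc s W e' B = (if p' then 1 else 2 * sg1 s B e')"
    "cc s (tog e' W) e B = (if q' then 1 else 2 * sg1 s B e)"
    using l1 l2 by (simp_all add: cc_def p_q_p'_q'_def)
  \<comment> \<open>In this case the two orders give the factor to different edges;
    \<open>same_link\<close> puts both edges on one circle, hence they have one colour.\<close>
  have "sg1 s B e = sg1 s B e'" if "p = p'" "q \<noteq> p"
  proof -
    have "ca W e' = ca W e \<or> ca W e' = cb W e"
      by (rule same_link[OF W e that[unfolded p_q_p'_q'_def]])
    then have "(e', False) \<in> B \<longleftrightarrow> (e, False) \<in> B"
      using col_ca[OF W e(1) B] col_cb[OF W e(1) B] col_ca[OF W e(2) B] l by auto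
    then show ?thesis by (simp add: sg1_def)
  qed
  then show ?thesis using pq unfolding c by (cases p; cases q; cases p'; cases q') auto
qed

lemma hat_T_T:
  assumes W: "W \<subseteq> E" and e: "e \<in> E" "e' \<in> E" and B: "col W B"
  shows "hat s (T (s\<^sup>2) e (T (s\<^sup>2) e' f)) W B =
    cc s W e B * cc s (tog e W) e' B * hat s f (tog e' (tog e W)) B"
proof (cases "((e, False) \<in> B) \<noteq> ((e, True) \<in> B)")
  case True
  then show ?thesis using hat_T[OF W e(1) B] by (simp add: cc_def)
next
  case False
  then have "col (tog e W) B" using col_tog[OF B] by blast
  then show ?thesis
    using hat_T[OF W e(1) B] hat_T[OF tog_subset[OF W e(1)] e(2)] by simp
qed

lemma T_commute_sq:
  assumes s: "s \<noteq> 0" and e: "e \<in> E" "e' \<in> E"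
  shows "T (s\<^sup>2) e (T (s\<^sup>2) e' f) = T (s\<^sup>2) e' (T (s\<^sup>2) e f)"
proof (rule ext, clarify)
  fix W A
  show "T (s\<^sup>2) e (T (s\<^sup>2) e' f) (W, A) = T (s\<^sup>2) e' (T (s\<^sup>2) e f) (W, A)"
  proof (cases "W \<subseteq> E \<and> A \<subseteq> P W")
    case True
    then have W: "W \<subseteq> E" and A: "A \<subseteq> P W" by auto
    let ?D = "T (s\<^sup>2) e (T (s\<^sup>2) e' f) - T (s\<^sup>2) e' (T (s\<^sup>2) e f)"
    have "hat s ?D W B = 0" if "col W B" for B
      using hat_T_T[OF W e that] hat_T_T[OF W e(2,1) that] cc_commute[OF W e that]
      by (simp add: hat_lin tog_commute[of e e' W])
    then have "?D (W, A) = 0" by (rule hat_inj[OF W s A])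
    then show ?thesis by simp
  qed (simp add: T_outside)
qed

text \<open>The commutator is a quadratic polynomial in \<open>t\<close> that vanishes at \<open>t = 1, 4, 9\<close>.\<close>

lemma T_commute:
  assumes e: "e \<in> E" "e' \<in> E"
  shows "T t e (T t e' f) = T t e' (T t e f)"
proof (rule ext)
  fix x
  define L where "L d g = T 1 d g - T 0 d g" for d g
  have ex: "T t d (T t d' f) x = T 0 d (T 0 d' f) x + t * (T 0 d (L d' f) x + L d (T 0 d' f) x)
      + t\<^sup>2 * L d (L d' f) x" for t d d'
    unfolding T_affine[of t d' f] rlin_add[OF T_linear] rlin_scale[OF T_linear] L_def[symmetric]
    by (subst (1 2) T_affine[of t d], unfold L_def[symmetric])
      (simp add: rscale_apply algebra_simps power2_eq_square)
  define c0 where "c0 = T 0 e (T 0 e' f) x - T 0 e' (T 0 e f) x"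
  define c1 where "c1 = T 0 e (L e' f) x + L e (T 0 e' f) x - (T 0 e' (L e f) x + L e' (T 0 e f) x)"
  define c2 where "c2 = L e (L e' f) x - L e' (L e f) x"
  have q: "T u e (T u e' f) x - T u e' (T u e f) x = c0 + u * c1 + u\<^sup>2 * c2" for u
    unfolding ex[of u e e'] ex[of u e' e] c0_def c1_def c2_def by (simp only: algebra_simps)
  have "c0 + 1 * c1 + 1 * c2 = 0" "c0 + 4 * c1 + 16 * c2 = 0" "c0 + 9 * c1 + 81 * c2 = 0"
    using q[of 1] q[of 4] q[of 9] T_commute_sq[OF _ e, of 1 f] T_commute_sq[OF _ e, of 2 f]
      T_commute_sq[OF _ e, of 3 f] by simp_all
  then have "c0 = 0" "c1 = 0" "c2 = 0" by linarith+
  then show "T t e (T t e' f) x = T t e' (T t e f) x" using q[of t] by simp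
qed

end

section \<open>The differential\<close>

definition mask :: "('w \<Rightarrow> rat) \<Rightarrow> ('w \<times> 'a \<Rightarrow> rat) \<Rightarrow> 'w \<times> 'a \<Rightarrow> rat" where
  "mask k f = (\<lambda>(W, A). k W * f (W, A))"

lemma mask_apply [simp]: "mask k f (W, A) = k W * f (W, A)"
  by (simp add: mask_def)

lemma mask_mask: "mask k (mask l f) = mask (\<lambda>W. k W * l W) f"
  by (auto simp: fun_eq_iff)

lemma mask_linear: "rlin (mask k)"
  by (rule rlinI) (auto simp: mask_def rscale_apply algebra_simps split: prod.splits)

locale ordered_ribbon = ribbon +
  fixes pos :: "'a \<Rightarrow> nat"
  assumes inj_pos: "inj_on pos E"
begin

lemma T_mask: "T t e (mask k f) = mask (\<lambda>W. k (tog e W)) (T t e f)"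
  by (rule ext) (auto simp: T_def Let_def algebra_simps)

definition sg :: "'a set \<Rightarrow> 'a \<Rightarrow> rat" where
  "sg W e = (-1) ^ card {a \<in> E. a \<notin> W \<and> pos a < pos e}"

definition eps :: "'a \<Rightarrow> 'a \<Rightarrow> rat" where
  "eps a e = (if pos a < pos e then -1 else 1)"

lemma sg_sq [simp]: "sg W e * sg W e = 1"
  by (simp add: sg_def flip: power_add)

lemma sg_nz [simp]: "sg W e \<noteq> 0"
  by (simp add: sg_def)

lemma sg_remove:
  assumes "a \<in> E" "a \<notin> W"
  shows "sg W e = eps a e * sg (insert a W) e"
proof -
  let ?X = "{b \<in> E. b \<notin> insert a W \<and> pos b < pos e}"
  have "{b \<in> E. b \<notin> W \<and> pos b < pos e} = (if pos a < pos e then insert a ?X else ?X)"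
    using assms by auto
  then show ?thesis using finE by (simp add: sg_def eps_def)
qed

lemma sg_tog: "a \<in> E \<Longrightarrow> sg (tog a W) e = eps a e * sg W e"
proof -
  assume a: "a \<in> E"
  have "eps a e * eps a e = 1" by (simp add: eps_def)
  then have ee: "eps a e * (eps a e * x) = x" for x by (metis mult.assoc mult_1)
  show ?thesis
  proof (cases "a \<in> W")
    case True
    then show ?thesis using sg_remove[OF a, of "W - {a}" e] by (simp add: tog_def insert_absorb)
  next
    case False
    then show ?thesis using sg_remove[OF a, of W e] ee[of "sg (insert a W) e"] by (simp add: tog_def)
  qed
qed

lemma eps_anti: "a \<in> E \<Longrightarrow> b \<in> E \<Longrightarrow> a \<noteq> b \<Longrightarrow> eps a b * eps b a = -1"
  using inj_pos by (auto simp: eps_def inj_on_def not_less le_less)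

text \<open>\<open>Rop\<close> removes \<open>e\<close>, read off at target states without
  \<open>e\<close>. \<open>Mop\<close> restores \<open>e\<close>, against the direction of the
  differential; it links the two resolutions of \<open>e\<close> in the proof of thinness.\<close>

definition Rop :: "rat \<Rightarrow> 'a \<Rightarrow> ('a bgen \<Rightarrow> rat) \<Rightarrow> 'a bgen \<Rightarrow> rat" where
  "Rop t e f = mask (\<lambda>W. of_bool (e \<notin> W) * sg W e) (T t e f)"

definition Mop :: "rat \<Rightarrow> 'a \<Rightarrow> ('a bgen \<Rightarrow> rat) \<Rightarrow> 'a bgen \<Rightarrow> rat" where
  "Mop t e f = mask (\<lambda>W. of_bool (e \<in> W) * sg W e) (T t e f)"

definition d :: "rat \<Rightarrow> 'a set \<Rightarrow> ('a bgen \<Rightarrow> rat) \<Rightarrow> 'a bgen \<Rightarrow> rat" where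
  "d t N f = (\<Sum>e\<in>N. Rop t e f)"

lemma R_linear: "rlin (Rop t e)"
  unfolding Rop_def by (rule rlin_compose[OF mask_linear T_linear])

lemma M_linear: "rlin (Mop t e)"
  unfolding Mop_def by (rule rlin_compose[OF mask_linear T_linear])

lemma d_linear: "rlin (d t N)"
  by (rule rlinI)
    (simp_all add: d_def sum_fun_apply rlin_add[OF R_linear] rlin_scale[OF R_linear]
      rscale_apply sum.distrib sum_distrib_left)

text \<open>The unsigned operators commute, so anticommutation is a matter of the sign functions
  alone.\<close>

lemma mask_anti:
  assumes e: "e \<in> E" "e' \<in> E" and kl: "\<And>W. k W * l (tog e W) = - (l W * k (tog e' W))"
  shows "mask k (T t e (mask l (T t e' f))) = - mask l (T t e' (mask k (T t e f)))"
proof (rule ext, clarify)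
  fix W A
  have "mask k (T t e (mask l (T t e' f))) (W, A) = (k W * l (tog e W)) * T t e (T t e' f) (W, A)"
    unfolding T_mask mask_mask by simp
  also have "\<dots> = - ((l W * k (tog e' W)) * T t e' (T t e f) (W, A))"
    by (simp only: kl T_commute[OF e] minus_mult_left)
  also have "\<dots> = (- mask l (T t e' (mask k (T t e f)))) (W, A)"
    unfolding T_mask mask_mask by simp
  finally show "mask k (T t e (mask l (T t e' f))) (W, A) =
    (- mask l (T t e' (mask k (T t e f)))) (W, A)" .
qed

text \<open>Exactly one of the two edges precedes the other, and only toggling the earlier one
  changes the sign of the later one.\<close>

lemma sg_square:
  assumes "e \<in> E" "e' \<in> E" "e \<noteq> e'"
  shows "sg W e * sg (tog e W) e' = - (sg W e' * sg (tog e' W) e)"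
proof -
  have "eps e e' = - eps e' e" using eps_anti[OF assms] by (auto simp: eps_def split: if_splits)
  then show ?thesis using assms by (simp add: sg_tog algebra_simps)
qed

lemma R_R:
  assumes "e \<in> E" "e' \<in> E" "e \<noteq> e'"
  shows "Rop t e (Rop t e' f) = - Rop t e' (Rop t e f)"
  unfolding Rop_def
proof (rule mask_anti[OF assms(1,2)])
  fix W
  show "of_bool (e \<notin> W) * sg W e * (of_bool (e' \<notin> tog e W) * sg (tog e W) e') =
      - (of_bool (e' \<notin> W) * sg W e' * (of_bool (e \<notin> tog e' W) * sg (tog e' W) e))"
    using sg_square[OF assms, of W] assms by (simp add: mem_tog)
qed

lemma M_R:
  assumes "e \<in> E" "e' \<in> E" "e \<noteq> e'"
  shows "Mop t e (Rop t e' f) = - Rop t e' (Mop t e f)"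
  unfolding Rop_def Mop_def
proof (rule mask_anti[OF assms(1,2)])
  fix W
  show "of_bool (e \<in> W) * sg W e * (of_bool (e' \<notin> tog e W) * sg (tog e W) e') =
      - (of_bool (e' \<notin> W) * sg W e' * (of_bool (e \<in> tog e' W) * sg (tog e' W) e))"
    using sg_square[OF assms, of W] assms by (simp add: mem_tog)
qed

lemma R_R_same: "Rop t e (Rop t e f) = 0"
  unfolding Rop_def T_mask mask_mask by (auto simp: fun_eq_iff mem_tog)

lemma R_d: "e \<in> E \<Longrightarrow> N \<subseteq> E \<Longrightarrow> e \<notin> N \<Longrightarrow> Rop t e (d t N f) = - d t N (Rop t e f)"
  unfolding d_def rlin_sum[OF R_linear] sum_negf[symmetric]
  by (intro sum.cong refl R_R) auto

lemma M_d: "e \<in> E \<Longrightarrow> N \<subseteq> E \<Longrightarrow> e \<notin> N \<Longrightarrow> Mop t e (d t N f) = - d t N (Mop t e f)"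
  unfolding d_def rlin_sum[OF M_linear] sum_negf[symmetric]
  by (intro sum.cong refl M_R) auto

lemma d_remove: "N \<subseteq> E \<Longrightarrow> e \<in> N \<Longrightarrow> d t N f = Rop t e f + d t (N - {e}) f"
  unfolding d_def using finite_subset[OF _ finE] by (subst sum.remove[of N e]) auto

lemma d_d: "N \<subseteq> E \<Longrightarrow> d t N (d t N f) = 0"
proof -
  assume N: "N \<subseteq> E"
  have "finite N" using finite_subset[OF N finE] .
  then show ?thesis using N
  proof (induction N)
    case empty
    then show ?case by (simp add: d_def)
  next
    case (insert e N)
    have N': "insert e N - {e} = N" using insert.hyps by blast
    have *: "d t (insert e N) f = Rop t e f + d t N f" for f
      using d_remove[OF insert.prems, of e t f] N' by simp
    show ?case
      unfolding * rlin_add[OF R_linear] rlin_add[OF d_linear] R_R_same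
      using R_d[of e N t f] insert by simp
  qed
qed

section \<open>Supports and degrees\<close>

definition dv :: "'a bgen \<Rightarrow> int" where
  "dv = (\<lambda>(W, A). int (card (P W)) - 2 * int (card A))"

definition ht :: "'a set \<Rightarrow> int" where "ht W = int (card (E - W))"

text \<open>The grading in which thinness is stated. For \<open>t = 0\<close> the differential
  preserves \<open>dv + ht\<close> and raises the height, so it lowers the slope by 2, while
  \<open>Mop\<close> keeps it.\<close>

definition slope :: "'a bgen \<Rightarrow> int" where "slope x = dv x - ht (fst x)"

lemma ht_tog: "W \<subseteq> E \<Longrightarrow> e \<in> E \<Longrightarrow> ht (tog e W) = ht W + (if e \<in> W then 1 else -1)"
proof -
  assume W: "W \<subseteq> E" and e: "e \<in> E"
  have "ht (insert e V) = ht V - 1" if "e \<notin> V" for V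
  proof -
    have "E - V = insert e (E - insert e V)" using that e by blast
    then have "card (E - V) = Suc (card (E - insert e V))" using finE
      by (metis DiffD2 card_insert_disjoint finite_Diff insertI1)
    then show ?thesis by (simp add: ht_def)
  qed
  from this[of W] this[of "W - {e}"] show ?thesis by (auto simp: tog_def insert_absorb)
qed

lemma P_same: "e \<in> E \<Longrightarrow> ca W e = cb W e \<Longrightarrow> P W = insert (ca W e) (rest W e)"
  using P_rest by fastforce

lemma same_cases:
  assumes "W \<subseteq> E" "e \<in> E" "ca W e = cb W e" "A \<subseteq> P W"
  obtains R where "R \<subseteq> rest W e" "A = R" | R where "R \<subseteq> rest W e" "A = insert (ca W e) R"
proof (cases "ca W e \<in> A")
  case True
  then have "A - {ca W e} \<subseteq> rest W e" "A = insert (ca W e) (A - {ca W e})"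
    using assms by (auto simp: P_same)
  then show ?thesis using that(2) by blast
next
  case False
  then have "A \<subseteq> rest W e" using assms by (auto simp: P_same)
  then show ?thesis using that(1) by blast
qed

lemma diff_cases:
  assumes "W \<subseteq> E" "e \<in> E" "A \<subseteq> P W"
  obtains R where "R \<subseteq> rest W e" "A = R" | R where "R \<subseteq> rest W e" "A = insert (ca W e) R"
  | R where "R \<subseteq> rest W e" "A = insert (cb W e) R"
  | R where "R \<subseteq> rest W e" "A = insert (ca W e) (insert (cb W e) R)"
proof -
  let ?R = "A - {ca W e, cb W e}"
  have R: "?R \<subseteq> rest W e" using assms by (auto simp: rest_def)
  have "A = ?R \<or> A = insert (ca W e) ?R \<or> A = insert (cb W e) ?R \<or>
      A = insert (ca W e) (insert (cb W e) ?R)"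
    by blast
  then show ?thesis using that R by metis
qed

lemma R_card:
  assumes "R \<subseteq> rest W e"
  shows "card (insert (ca W e) R) = Suc (card R)" "card (insert (cb W e) R) = Suc (card R)"
    "ca W e \<noteq> cb W e \<Longrightarrow> card (insert (ca W e) (insert (cb W e) R)) = Suc (Suc (card R))"
proof -
  have "ca W e \<notin> R" "cb W e \<notin> R" "finite R" using assms rest_sub_finite by auto
  then show "card (insert (ca W e) R) = Suc (card R)" "card (insert (cb W e) R) = Suc (card R)"
    "ca W e \<noteq> cb W e \<Longrightarrow> card (insert (ca W e) (insert (cb W e) R)) = Suc (Suc (card R))"
    by simp_all
qed

lemma R_sub_tog: "W \<subseteq> E \<Longrightarrow> e \<in> E \<Longrightarrow> R \<subseteq> rest W e \<Longrightarrow> R \<subseteq> rest (tog e W) e"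
  using rest_tog by blast

text \<open>The terms of \<open>T\<close> without the factor \<open>t\<close> lower
  \<open>dv\<close> by 1, those with it raise \<open>dv\<close> by 3. The statement goes backwards
  because an operator on coefficient functions is read at its target.\<close>

lemma T_supp:
  assumes W: "W \<subseteq> E" and e: "e \<in> E" and nz: "T t e f (W, A) \<noteq> 0"
  shows "\<exists>A'. f (tog e W, A') \<noteq> 0 \<and>
    (dv (tog e W, A') = dv (W, A) + 1 \<or> t \<noteq> 0 \<and> dv (tog e W, A') = dv (W, A) - 3)"
proof -
  let ?V = "tog e W"
  have A: "A \<subseteq> P W" using nz T_outside by blast
  have V: "?V \<subseteq> E" using tog_subset[OF W e] .
  have pV: "int (card (P ?V)) = int (card (P W)) + (if ca W e = cb W e then 1 else -1)"
    using card_P_tog[OF W e] .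
  show ?thesis
  proof (cases "ca W e = cb W e")
    case True
    then have nV: "ca ?V e \<noteq> cb ?V e" using same_tog[OF W e] by blast
    show ?thesis using same_cases[OF W e True A]
    proof cases
      case (1 R)
      note R = R_card[OF R_sub_tog[OF W e 1(1)]]
      have "f (?V, R) \<noteq> 0 \<or> t \<noteq> 0 \<and> f (?V, insert (ca ?V e) (insert (cb ?V e) R)) \<noteq> 0"
        using nz T_same(1)[OF W e True 1(1), of t f] 1(2) by auto
      then show ?thesis
      proof
        assume "f (?V, R) \<noteq> 0"
        then show ?thesis using pV True 1 by (intro exI[of _ R]) (simp add: dv_def)
      next
        assume "t \<noteq> 0 \<and> f (?V, insert (ca ?V e) (insert (cb ?V e) R)) \<noteq> 0"
        then show ?thesis using pV True 1 R(3)[OF nV]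
          by (intro exI[of _ "insert (ca ?V e) (insert (cb ?V e) R)"]) (simp add: dv_def)
      qed
    next
      case (2 R)
      note R = R_card[OF R_sub_tog[OF W e 2(1)]]
      have "f (?V, insert (ca ?V e) R) \<noteq> 0 \<or> f (?V, insert (cb ?V e) R) \<noteq> 0"
        using nz T_same(2)[OF W e True 2(1), of t f] 2(2) by auto
      then obtain c where c: "c \<in> {ca ?V e, cb ?V e}" "f (?V, insert c R) \<noteq> 0" by blast
      then have "card (insert c R) = Suc (card R)" using R by auto
      then show ?thesis using c pV True 2 R_card(1)[OF 2(1)]
        by (intro exI[of _ "insert c R"]) (simp add: dv_def)
    qed
  next
    case False
    then have sV: "ca ?V e = cb ?V e" using same_tog[OF W e] by blast
    show ?thesis using diff_cases[OF W e A]
    proof cases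
      case (1 R)
      have "t \<noteq> 0" "f (?V, insert (ca ?V e) R) \<noteq> 0"
        using nz T_diff(1)[OF W e False 1(1), of t f] 1(2) by auto
      then show ?thesis using pV False 1 R_card(1)[OF R_sub_tog[OF W e 1(1)]]
        by (intro exI[of _ "insert (ca ?V e) R"]) (simp add: dv_def)
    next
      case (2 R)
      have "f (?V, R) \<noteq> 0" using nz T_diff(2)[OF W e False 2(1), of t f] 2(2) by auto
      then show ?thesis using pV False 2 R_card[OF 2(1)] by (intro exI[of _ R]) (simp add: dv_def)
    next
      case (3 R)
      have "f (?V, R) \<noteq> 0" using nz T_diff(3)[OF W e False 3(1), of t f] 3(2) by auto
      then show ?thesis using pV False 3 R_card[OF 3(1)] by (intro exI[of _ R]) (simp add: dv_def)
    next
      case (4 R)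
      have "f (?V, insert (ca ?V e) R) \<noteq> 0"
        using nz T_diff(4)[OF W e False 4(1), of t f] 4(2) by auto
      then show ?thesis using pV False 4 R_card(1)[OF R_sub_tog[OF W e 4(1)]] R_card(3)[OF 4(1) False]
        by (intro exI[of _ "insert (ca ?V e) R"]) (simp add: dv_def)
    qed
  qed
qed

lemma R_supp:
  assumes e: "e \<in> E" and nz: "Rop t e f (W, A) \<noteq> 0"
  shows "W \<subseteq> E" "A \<subseteq> P W" "e \<notin> W" "\<exists>A'. f (insert e W, A') \<noteq> 0 \<and>
    (dv (insert e W, A') = dv (W, A) + 1 \<or> t \<noteq> 0 \<and> dv (insert e W, A') = dv (W, A) - 3)"
proof -
  have *: "e \<notin> W" "T t e f (W, A) \<noteq> 0" using nz by (auto simp: Rop_def)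
  then show W: "W \<subseteq> E" "A \<subseteq> P W" "e \<notin> W" using T_outside by blast+
  show "\<exists>A'. f (insert e W, A') \<noteq> 0 \<and>
    (dv (insert e W, A') = dv (W, A) + 1 \<or> t \<noteq> 0 \<and> dv (insert e W, A') = dv (W, A) - 3)"
    using T_supp[OF W(1) e *(2)] *(1) by (simp add: tog_def)
qed

lemma M_supp:
  assumes e: "e \<in> E" and nz: "Mop 0 e f (W, A) \<noteq> 0"
  shows "W \<subseteq> E" "A \<subseteq> P W" "e \<in> W" "\<exists>A'. f (W - {e}, A') \<noteq> 0 \<and> dv (W - {e}, A') = dv (W, A) + 1"
proof -
  have *: "e \<in> W" "T 0 e f (W, A) \<noteq> 0" using nz by (auto simp: Mop_def)
  then show W: "W \<subseteq> E" "A \<subseteq> P W" "e \<in> W" using T_outside by blast+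
  show "\<exists>A'. f (W - {e}, A') \<noteq> 0 \<and> dv (W - {e}, A') = dv (W, A) + 1"
    using T_supp[OF W(1) e *(2)] *(1) by (simp add: tog_def)
qed

lemma d_supp:
  assumes N: "N \<subseteq> E" and nz: "d t N f (W, A) \<noteq> 0"
  shows "W \<subseteq> E" "A \<subseteq> P W" "\<exists>e\<in>N. e \<notin> W \<and> (\<exists>A'. f (insert e W, A') \<noteq> 0 \<and>
    (dv (insert e W, A') = dv (W, A) + 1 \<or> t \<noteq> 0 \<and> dv (insert e W, A') = dv (W, A) - 3))"
proof -
  have "(\<Sum>e\<in>N. Rop t e f (W, A)) \<noteq> 0" using nz by (simp add: d_def sum_fun_apply)
  then obtain e where e: "e \<in> N" "Rop t e f (W, A) \<noteq> 0" by (meson sum.neutral)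
  note R_supp[OF _ e(2)]
  then show "W \<subseteq> E" "A \<subseteq> P W" "\<exists>e\<in>N. e \<notin> W \<and> (\<exists>A'. f (insert e W, A') \<noteq> 0 \<and>
    (dv (insert e W, A') = dv (W, A) + 1 \<or> t \<noteq> 0 \<and> dv (insert e W, A') = dv (W, A) - 3))"
    using e(1) N by blast+
qed

lemma ht_insert: "W \<subseteq> E \<Longrightarrow> e \<in> E \<Longrightarrow> e \<notin> W \<Longrightarrow> ht (insert e W) = ht W - 1"
  using ht_tog[of W e] by (simp add: tog_def)

lemma ht_remove: "W \<subseteq> E \<Longrightarrow> e \<in> W \<Longrightarrow> ht (W - {e}) = ht W + 1"
  using ht_tog[of W e] by (auto simp: tog_def)

end

section \<open>Thinness\<close>

context ordered_ribbon
begin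

definition nS :: "('a \<times> bool) set \<Rightarrow> ('a \<times> bool) set set \<Rightarrow> nat" where
  "nS S X = card {c\<in>X. c \<subseteq> S}"

text \<open>Only differences between neighbouring states matter. When \<open>S\<close> does not
  separate the sides of the toggled edge, the numerator changes by 0 or 2, so the rounding of
  \<open>div 2\<close> has no effect (\<open>kS_tog\<close>).\<close>

definition kS :: "('a \<times> bool) set \<Rightarrow> 'a set \<Rightarrow> nat" where
  "kS S W = (nS S (P W) + card {a\<in>E - W. (a, False) \<in> S}) div 2"

text \<open>If every circle lies either in \<open>S\<close> or in its complement, the part of the degree that comes
  from \<open>S\<close> is preserved by the differential. The twist is the sign given by half this degree; it
  turns multiplication by \<open>X\<^sub>1 + X\<^sub>2\<close>, for circles 1 and 2 on the two sides, into multiplication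
  by \<open>X\<^sub>1 - X\<^sub>2\<close>.\<close>

definition tau :: "('a \<times> bool) set \<Rightarrow> 'a bgen \<Rightarrow> rat" where
  "tau S = (\<lambda>(W, A). (-1) ^ kS S W * (-1) ^ nS S A)"

definition tw :: "('a \<times> bool) set \<Rightarrow> ('a bgen \<Rightarrow> rat) \<Rightarrow> 'a bgen \<Rightarrow> rat" where
  "tw S f = (\<lambda>x. tau S x * f x)"

lemma tau_sq: "tau S x * tau S x = 1"
  by (cases x) (simp add: tau_def mult_ac flip: power_add)

lemma tau_nz: "tau S x \<noteq> 0"
  by (cases x) (simp add: tau_def)

lemma tw_tw: "tw S (tw S f) = f"
  by (rule ext) (simp add: tw_def tau_sq flip: mult.assoc)

lemma tw_linear: "rlin (tw S)"
  by (rule rlinI) (auto simp: tw_def rscale_apply algebra_simps)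

lemma nS_insert: "finite X \<Longrightarrow> c \<notin> X \<Longrightarrow> nS S (insert c X) = nS S X + (if c \<subseteq> S then 1 else 0)"
proof -
  assume X: "finite X" "c \<notin> X"
  have "{c'\<in>insert c X. c' \<subseteq> S} = (if c \<subseteq> S then insert c {c'\<in>X. c' \<subseteq> S} else {c'\<in>X. c' \<subseteq> S})"
    by auto
  then show ?thesis using X by (simp add: nS_def)
qed

lemma nS_R:
  assumes "R \<subseteq> rest W e"
  shows "nS S (insert (ca W e) R) = nS S R + (if ca W e \<subseteq> S then 1 else 0)"
    "nS S (insert (cb W e) R) = nS S R + (if cb W e \<subseteq> S then 1 else 0)"
    "ca W e \<noteq> cb W e \<Longrightarrow> nS S (insert (ca W e) (insert (cb W e) R)) =
      nS S R + (if ca W e \<subseteq> S then 1 else 0) + (if cb W e \<subseteq> S then 1 else 0)"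
proof -
  have "ca W e \<notin> R" "cb W e \<notin> R" "finite R" using assms rest_sub_finite by auto
  then show "nS S (insert (ca W e) R) = nS S R + (if ca W e \<subseteq> S then 1 else 0)"
    "nS S (insert (cb W e) R) = nS S R + (if cb W e \<subseteq> S then 1 else 0)"
    "ca W e \<noteq> cb W e \<Longrightarrow> nS S (insert (ca W e) (insert (cb W e) R)) =
      nS S R + (if ca W e \<subseteq> S then 1 else 0) + (if cb W e \<subseteq> S then 1 else 0)"
    by (simp_all add: nS_insert)
qed

lemma nS_P:
  assumes "W \<subseteq> E" "e \<in> E" "col W S" "(e, False) \<in> S \<longleftrightarrow> (e, True) \<in> S"
  shows "nS S (P W) = nS S (rest W e) +
    (if (e, False) \<in> S then (if ca W e = cb W e then 1 else 2) else 0)"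
  using nS_R[of "rest W e" W e S, OF order_refl] assms col_ca[OF assms(1-3)] col_cb[OF assms(1-3)]
  by (cases "ca W e = cb W e") (simp_all add: P_rest P_same)

lemma kS_tog:
  assumes W: "W \<subseteq> E" "e \<in> E" "e \<notin> W" and S: "col W S" "(e, False) \<in> S \<longleftrightarrow> (e, True) \<in> S"
  shows "kS S W = kS S (tog e W) + (if (e, False) \<in> S \<and> ca W e \<noteq> cb W e then 1 else 0)"
proof -
  have V: "tog e W \<subseteq> E" "col (tog e W) S" using tog_subset[OF W(1,2)] col_tog[OF S(1)] S(2) by auto
  define Y where "Y = {a\<in>E - tog e W. (a, False) \<in> S}"
  have "{a\<in>E - W. (a, False) \<in> S} = (if (e, False) \<in> S then insert e Y else Y)"
    using W by (auto simp: tog_def Y_def)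
  moreover have "e \<notin> Y" "finite Y" using W finE by (auto simp: tog_def Y_def)
  ultimately have h: "card {a\<in>E - W. (a, False) \<in> S} =
      card {a\<in>E - tog e W. (a, False) \<in> S} + (if (e, False) \<in> S then 1 else 0)"
    unfolding Y_def[symmetric] by simp
  show ?thesis
    unfolding kS_def h nS_P[OF W(1,2) S] nS_P[OF V(1) W(2) V(2) S(2)] same_tog[OF W(1,2)]
      rest_tog[OF W(1,2)]
    by simp
qed

text \<open>A split inside \<open>S\<close> adds one label v_- there and raises \<open>kS\<close> by
  one, so the two signs cancel; a merge with nonzero result changes neither.\<close>

lemma tw_T:
  assumes W: "W \<subseteq> E" "e \<in> E" "e \<notin> W" and S: "col W S" "(e, False) \<in> S \<longleftrightarrow> (e, True) \<in> S"
  shows "T 0 e (tw S f) (W, A) = tau S (W, A) * T 0 e f (W, A)"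
proof (cases "A \<subseteq> P W")
  case False
  then show ?thesis by (simp add: T_outside)
next
  case A: True
  let ?V = "tog e W"
  have V: "?V \<subseteq> E" "col ?V S" using tog_subset[OF W(1,2)] col_tog[OF S(1)] S(2) by auto
  let ?z = "(e, False) \<in> S"
  have z: "ca W e \<subseteq> S \<longleftrightarrow> ?z" "cb W e \<subseteq> S \<longleftrightarrow> ?z" "ca ?V e \<subseteq> S \<longleftrightarrow> ?z" "cb ?V e \<subseteq> S \<longleftrightarrow> ?z"
    using col_ca[OF W(1,2) S(1)] col_cb[OF W(1,2) S(1)] col_ca[OF V(1) W(2) V(2)]
      col_cb[OF V(1) W(2) V(2)] S(2) by auto
  have k: "kS S W = kS S ?V + (if ?z \<and> ca W e \<noteq> cb W e then 1 else 0)" using kS_tog[OF W S] .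
  show ?thesis
  proof (cases "ca W e = cb W e")
    case True
    show ?thesis using same_cases[OF W(1,2) True A]
    proof cases
      case (1 R)
      show ?thesis using T_same(1)[OF W(1,2) True 1(1), of 0] 1(2) k True by (simp add: tw_def tau_def)
    next
      case (2 R)
      show ?thesis
        using T_same(2)[OF W(1,2) True 2(1), of 0] 2(2) k True z nS_R[OF 2(1), of S]
          nS_R[OF R_sub_tog[OF W(1,2) 2(1)], of S]
        by (simp add: tw_def tau_def algebra_simps)
    qed
  next
    case False
    show ?thesis using diff_cases[OF W(1,2) A]
    proof cases
      case (1 R)
      show ?thesis using T_diff(1)[OF W(1,2) False 1(1), of 0] 1(2) by simp
    next
      case (2 R)
      show ?thesis using T_diff(2)[OF W(1,2) False 2(1), of 0] 2(2) k False z nS_R[OF 2(1), of S]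
        by (simp add: tw_def tau_def)
    next
      case (3 R)
      show ?thesis using T_diff(3)[OF W(1,2) False 3(1), of 0] 3(2) k False z nS_R[OF 3(1), of S]
        by (simp add: tw_def tau_def)
    next
      case (4 R)
      show ?thesis using T_diff(4)[OF W(1,2) False 4(1), of 0] 4(2) k False z
          nS_R(3)[OF 4(1) False, of S] nS_R(1)[OF R_sub_tog[OF W(1,2) 4(1)], of S]
        by (simp add: tw_def tau_def)
    qed
  qed
qed

section \<open>An edge whose two sides are separated by a colouring\<close>

context
  fixes Q :: "'a set \<Rightarrow> bool" and S :: "('a \<times> bool) set" and e :: 'a
  assumes Q: "\<And>W. Q W \<Longrightarrow> W \<subseteq> E \<and> col W S" and e: "e \<in> E"
    and S: "(e, True) \<in> S" "(e, False) \<notin> S"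
begin

text \<open>Separated sides lie on different circles. Throughout this context \<open>W\<close> is
  the state with two circles at \<open>e\<close> and \<open>tog e W\<close> the one where they are
  joined.\<close>

lemma side_facts:
  assumes "Q W"
  shows "W \<subseteq> E" "tog e W \<subseteq> E" "\<not> ca W e \<subseteq> S" "cb W e \<subseteq> S" "ca W e \<noteq> cb W e"
    "ca (tog e W) e = cb (tog e W) e" "rest (tog e W) e = rest W e"
proof -
  show W: "W \<subseteq> E" "tog e W \<subseteq> E" using Q[OF assms] tog_subset[of W E e] e by auto
  show 1: "\<not> ca W e \<subseteq> S" "cb W e \<subseteq> S"
    using col_ca[OF W(1) e] col_cb[OF W(1) e] Q[OF assms] S by auto
  then show 2: "ca W e \<noteq> cb W e" by auto
  then show "ca (tog e W) e = cb (tog e W) e" using same_tog[OF W(1) e] by blast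
  show "rest (tog e W) e = rest W e" using rest_tog[OF W(1) e] .
qed

lemma side_T:
  assumes "Q W" "R \<subseteq> rest W e"
  shows "T 0 e g (W, R) = 0"
    "T 0 e g (W, insert (ca W e) R) = g (tog e W, R)"
    "T 0 e g (W, insert (cb W e) R) = g (tog e W, R)"
    "T 0 e g (W, insert (ca W e) (insert (cb W e) R)) = g (tog e W, insert (ca (tog e W) e) R)"
    "T 0 e f (tog e W, R) = f (W, R)"
    "T 0 e f (tog e W, insert (ca (tog e W) e) R) = f (W, insert (ca W e) R) + f (W, insert (cb W e) R)"
proof -
  note F = side_facts[OF assms(1)]
  show "T 0 e g (W, R) = 0"
    "T 0 e g (W, insert (ca W e) R) = g (tog e W, R)"
    "T 0 e g (W, insert (cb W e) R) = g (tog e W, R)"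
    "T 0 e g (W, insert (ca W e) (insert (cb W e) R)) = g (tog e W, insert (ca (tog e W) e) R)"
    using T_diff[OF F(1) e F(5) assms(2), of 0 g] by simp_all
  have "R \<subseteq> rest (tog e W) e" using assms(2) F(7) by simp
  then show "T 0 e f (tog e W, R) = f (W, R)"
    "T 0 e f (tog e W, insert (ca (tog e W) e) R) = f (W, insert (ca W e) R) + f (W, insert (cb W e) R)"
    using T_same[OF F(2) e F(6), of R 0 f] by simp_all
qed

lemma side_tau:
  assumes "Q W" "R \<subseteq> rest W e"
  shows "tau S (W, insert (ca W e) R) = tau S (W, R)"
    "tau S (W, insert (cb W e) R) = - tau S (W, R)"
  using nS_R[OF assms(2), of S] side_facts(3,4)[OF assms(1)] by (simp_all add: tau_def)

text \<open>With v_- on the \<open>ca\<close> circle, the other circle shows the label of the joined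
  circle.\<close>

lemma split_inj:
  assumes W: "Q W" and 0: "\<And>A. T 0 e g (W, A) = 0" and A: "A \<subseteq> P (tog e W)"
  shows "g (tog e W, A) = 0"
proof -
  note F = side_facts[OF W]
  show ?thesis using same_cases[OF F(2) e F(6) A] unfolding F(7)
  proof cases
    case (1 R)
    then show ?thesis using side_T(2)[OF W 1(1), of g] 0 by simp
  next
    case (2 R)
    then show ?thesis using side_T(4)[OF W 2(1), of g] 0 by simp
  qed
qed

text \<open>A split is multiplication by X1 + X2. The twist changes the sign on the circle inside
  \<open>S\<close>, which gives X1 - X2 up to sign, and merging sends this to zero. The factor
  \<open>k\<close> absorbs the signs of the differential.\<close>

lemma merge_twist_split:
  assumes W: "Q W" and f: "\<And>A. f (W, A) = k * T 0 e g (W, A)"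
  shows "T 0 e (tw S f) (tog e W, A) = 0"
proof (cases "A \<subseteq> P (tog e W)")
  case True
  note F = side_facts[OF W]
  show ?thesis using same_cases[OF F(2) e F(6) True] unfolding F(7)
  proof cases
    case (1 R)
    then show ?thesis using side_T[OF W 1(1)] f by (simp add: tw_def)
  next
    case (2 R)
    then show ?thesis using side_T[OF W 2(1)] f side_tau[OF W 2(1)] by (simp add: tw_def)
  qed
qed (simp add: T_outside)

text \<open>A right inverse of the merge: the \<open>cb\<close> circle gets v_+ and the
  \<open>ca\<close> circle the label of the joined circle. The factor \<open>sg\<close> turns it
  into a right inverse of the signed operators \<open>Rop\<close> and \<open>Mop\<close>.\<close>

lemma merge_section:
  "\<exists>f. (\<forall>W A. f (W, A) \<noteq> 0 \<longrightarrow> Q W \<and> A \<subseteq> P W \<and>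
      (\<exists>A'. g (tog e W, A') \<noteq> 0 \<and> dv (tog e W, A') = dv (W, A) - 1)) \<and>
    (\<forall>W A. Q W \<longrightarrow> A \<subseteq> P (tog e W) \<longrightarrow> T 0 e f (tog e W, A) = sg (tog e W) e * g (tog e W, A))"
proof -
  define f where "f = (\<lambda>(W, A). if Q W \<and> A \<subseteq> P W \<and> cb W e \<notin> A then sg (tog e W) e *
      g (tog e W, if ca W e \<in> A then insert (ca (tog e W) e) (A - {ca W e}) else A) else 0)"
  have f1: "f (W, R) = sg (tog e W) e * g (tog e W, R)"
    and f2: "f (W, insert (ca W e) R) = sg (tog e W) e * g (tog e W, insert (ca (tog e W) e) R)"
    and f3: "f (W, insert (cb W e) R) = 0"
    if W: "Q W" and R: "R \<subseteq> rest W e" for W R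
  proof -
    have "ca W e \<notin> R" "cb W e \<notin> R" "R \<subseteq> P W" "insert (ca W e) R \<subseteq> P W"
      using R P_rest[OF e, of W] by auto
    then show "f (W, R) = sg (tog e W) e * g (tog e W, R)"
      "f (W, insert (ca W e) R) = sg (tog e W) e * g (tog e W, insert (ca (tog e W) e) R)"
      "f (W, insert (cb W e) R) = 0"
      using W side_facts(5)[OF W] by (auto simp: f_def)
  qed
  have "Q W \<and> A \<subseteq> P W \<and> (\<exists>A'. g (tog e W, A') \<noteq> 0 \<and> dv (tog e W, A') = dv (W, A) - 1)"
    if nz: "f (W, A) \<noteq> 0" for W A
  proof -
    have W: "Q W" and A: "A \<subseteq> P W" and b: "cb W e \<notin> A"
      using nz by (auto simp: f_def split: if_splits)
    note F = side_facts[OF W]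
    have p: "int (card (P (tog e W))) = int (card (P W)) - 1"
      using card_P_tog[OF F(1) e] F(5) by simp
    have "\<exists>A'. g (tog e W, A') \<noteq> 0 \<and> dv (tog e W, A') = dv (W, A) - 1"
      using diff_cases[OF F(1) e A]
    proof cases
      case (1 R)
      then show ?thesis using nz f1[OF W 1(1)] p by (intro exI[of _ R]) (simp add: dv_def)
    next
      case (2 R)
      then show ?thesis using nz f2[OF W 2(1)] p R_card(1)[OF 2(1)]
          R_card(1)[OF R_sub_tog[OF F(1) e 2(1)]]
        by (intro exI[of _ "insert (ca (tog e W) e) R"]) (simp add: dv_def)
    qed (use b in auto)
    then show ?thesis using W A by blast
  qed
  moreover have "T 0 e f (tog e W, A) = sg (tog e W) e * g (tog e W, A)"
    if W: "Q W" and A: "A \<subseteq> P (tog e W)" for W A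
  proof -
    note F = side_facts[OF W]
    show ?thesis using same_cases[OF F(2) e F(6) A] unfolding F(7)
    proof cases
      case (1 R)
      then show ?thesis using side_T(5)[OF W 1(1), of f] f1[OF W 1(1)] by simp
    next
      case (2 R)
      then show ?thesis using side_T(6)[OF W 2(1), of f] f2[OF W 2(1)] f3[OF W 2(1)] by simp
    qed
  qed
  ultimately show ?thesis by blast
qed

text \<open>Exactness in the middle: what the twisted merge kills is a split. Vanishing forces equal
  coefficients at X1 and X2 and none at 1, so the preimage can be read off with v_- on the
  \<open>cb\<close> circle.\<close>

lemma split_lift:
  assumes 0: "\<And>W A. Q W \<Longrightarrow> T 0 e (tw S f) (tog e W, A) = 0"
  shows "\<exists>g. (\<forall>V A. g (V, A) \<noteq> 0 \<longrightarrow> Q (tog e V) \<and> A \<subseteq> P V \<and>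
      (\<exists>A'. f (tog e V, A') \<noteq> 0 \<and> dv (tog e V, A') = dv (V, A) - 1)) \<and>
    (\<forall>W A. Q W \<longrightarrow> A \<subseteq> P W \<longrightarrow> T 0 e g (W, A) = sg W e * f (W, A))"
proof -
  define g where "g = (\<lambda>(V, A). if Q (tog e V) \<and> A \<subseteq> P V then sg (tog e V) e *
      f (tog e V, if ca V e \<in> A
        then insert (ca (tog e V) e) (insert (cb (tog e V) e) (A - {ca V e}))
        else insert (cb (tog e V) e) A) else 0)"
  have g1: "g (tog e W, R) = sg W e * f (W, insert (cb W e) R)"
    and g2: "g (tog e W, insert (ca (tog e W) e) R) =
      sg W e * f (W, insert (ca W e) (insert (cb W e) R))"
    if W: "Q W" and R: "R \<subseteq> rest W e" for W R
  proof -
    have "R \<subseteq> rest (tog e W) e" using R side_facts(7)[OF W] by simp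
    then have "ca (tog e W) e \<notin> R" "R \<subseteq> P (tog e W)" "insert (ca (tog e W) e) R \<subseteq> P (tog e W)"
      using P_rest[OF e, of "tog e W"] by auto
    then show "g (tog e W, R) = sg W e * f (W, insert (cb W e) R)"
      "g (tog e W, insert (ca (tog e W) e) R) = sg W e * f (W, insert (ca W e) (insert (cb W e) R))"
      using W by (auto simp: g_def)
  qed
  have "Q (tog e V) \<and> A \<subseteq> P V \<and> (\<exists>A'. f (tog e V, A') \<noteq> 0 \<and> dv (tog e V, A') = dv (V, A) - 1)"
    if nz: "g (V, A) \<noteq> 0" for V A
  proof -
    define W where "W = tog e V"
    have V: "V = tog e W" by (simp add: W_def)
    have W: "Q W" and A: "A \<subseteq> P (tog e W)"
      using nz by (auto simp: g_def V split: if_splits)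
    note F = side_facts[OF W]
    have p: "int (card (P (tog e W))) = int (card (P W)) - 1"
      using card_P_tog[OF F(1) e] F(5) by simp
    have "\<exists>A'. f (W, A') \<noteq> 0 \<and> dv (W, A') = dv (tog e W, A) - 1"
      using same_cases[OF F(2) e F(6) A] unfolding F(7)
    proof cases
      case (1 R)
      then show ?thesis using nz g1[OF W 1(1)] p V R_card[OF 1(1)]
        by (intro exI[of _ "insert (cb W e) R"]) (simp add: dv_def)
    next
      case (2 R)
      then show ?thesis using nz g2[OF W 2(1)] p V R_card(3)[OF 2(1) F(5)]
          R_card(1)[OF R_sub_tog[OF F(1) e 2(1)]]
        by (intro exI[of _ "insert (ca W e) (insert (cb W e) R)"]) (simp add: dv_def)
    qed
    then show ?thesis using W A V by simp
  qed
  moreover have "T 0 e g (W, A) = sg W e * f (W, A)" if W: "Q W" and A: "A \<subseteq> P W" for W A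
  proof -
    note F = side_facts[OF W]
    have f0: "f (W, R) = 0" "f (W, insert (ca W e) R) = f (W, insert (cb W e) R)"
      if R: "R \<subseteq> rest W e" for R
    proof -
      have "tau S (W, R) * f (W, R) = 0"
        using side_T(5)[OF W R, of "tw S f"] 0[OF W] by (simp add: tw_def)
      then show "f (W, R) = 0" using tau_nz by simp
      have "tau S (W, R) * f (W, insert (ca W e) R) = tau S (W, R) * f (W, insert (cb W e) R)"
        using side_T(6)[OF W R, of "tw S f"] 0[OF W] side_tau[OF W R] by (simp add: tw_def)
      then show "f (W, insert (ca W e) R) = f (W, insert (cb W e) R)" using tau_nz by simp
    qed
    show ?thesis using diff_cases[OF F(1) e A]
    proof cases
      case (1 R)
      then show ?thesis using side_T(1)[OF W 1(1), of g] f0[OF 1(1)] by simp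
    next
      case (2 R)
      then show ?thesis using side_T(2)[OF W 2(1), of g] g1[OF W 2(1)] f0[OF 2(1)] by simp
    next
      case (3 R)
      then show ?thesis using side_T(3)[OF W 3(1), of g] g1[OF W 3(1)] by simp
    next
      case (4 R)
      then show ?thesis using side_T(4)[OF W 4(1), of g] g2[OF W 4(1)] by simp
    qed
  qed
  ultimately show ?thesis by blast
qed

end

end

context ordered_ribbon
begin

text \<open>The face of the cube of states in which the edges of \<open>N\<close> are still
  unresolved.\<close>

definition itv :: "'a set \<Rightarrow> 'a set \<Rightarrow> 'a set \<Rightarrow> bool" where
  "itv C N W \<longleftrightarrow> C \<subseteq> W \<and> W \<subseteq> C \<union> N"

definition Spt :: "'a set \<Rightarrow> 'a set \<Rightarrow> ('a bgen \<Rightarrow> rat) set" where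
  "Spt C N = {f. \<forall>W A. f (W, A) \<noteq> 0 \<longrightarrow> itv C N W \<and> W \<subseteq> E \<and> A \<subseteq> P W}"

text \<open>Connectedness of the diagram whose unresolved edges are \<open>N\<close>. It is phrased
  by colourings because a failure then hands over the set \<open>S\<close> along which chains are
  twisted.\<close>

definition conn :: "'a set \<Rightarrow> 'a set \<Rightarrow> bool" where
  "conn C N \<longleftrightarrow> (\<forall>S\<subseteq>H. (\<forall>W. itv C N W \<longrightarrow> col W S) \<longrightarrow> S = {} \<or> S = H)"

definition homog :: "int \<Rightarrow> ('a bgen \<Rightarrow> rat) \<Rightarrow> bool" where
  "homog \<delta> f \<longleftrightarrow> (\<forall>x. f x \<noteq> 0 \<longrightarrow> slope x = \<delta>)"

lemma SptD: "f \<in> Spt C N \<Longrightarrow> f (W, A) \<noteq> 0 \<Longrightarrow> itv C N W \<and> W \<subseteq> E \<and> A \<subseteq> P W"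
  by (simp add: Spt_def)

lemma Spt_combine:
  "(\<And>x. h x \<noteq> 0 \<Longrightarrow> f x \<noteq> 0 \<or> g x \<noteq> 0) \<Longrightarrow> f \<in> Spt C N \<Longrightarrow> g \<in> Spt C N \<Longrightarrow> h \<in> Spt C N"
  unfolding Spt_def by blast

lemma Spt_diff: "f \<in> Spt C N \<Longrightarrow> g \<in> Spt C N \<Longrightarrow> f - g \<in> Spt C N"
  and Spt_add: "f \<in> Spt C N \<Longrightarrow> g \<in> Spt C N \<Longrightarrow> f + g \<in> Spt C N"
  by (rule Spt_combine[of _ f g]; auto)+

lemma Spt_tw: "f \<in> Spt C N \<Longrightarrow> tw S f \<in> Spt C N"
  by (auto simp: Spt_def tw_def)

lemma homog_diff: "homog \<delta> f \<Longrightarrow> homog \<delta> g \<Longrightarrow> homog \<delta> (f - g)"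
  unfolding homog_def by (auto, metis diff_0_right)

lemma homog_tw: "homog \<delta> f \<Longrightarrow> homog \<delta> (tw S f)"
  by (auto simp: homog_def tw_def)

lemma Spt_mono: "f \<in> Spt C N \<Longrightarrow> (\<And>W. itv C N W \<Longrightarrow> itv C' N' W) \<Longrightarrow> f \<in> Spt C' N'"
  by (auto simp: Spt_def)

lemma Spt_d:
  assumes "C \<inter> N = {}" "N \<subseteq> E" "f \<in> Spt C N"
  shows "d t N f \<in> Spt C N"
  unfolding Spt_def
proof (intro CollectI allI impI)
  fix W A assume nz: "d t N f (W, A) \<noteq> 0"
  from d_supp(3)[OF assms(2) nz] obtain e A' where e: "e \<in> N" "e \<notin> W" "f (insert e W, A') \<noteq> 0" by blast
  show "itv C N W \<and> W \<subseteq> E \<and> A \<subseteq> P W"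
    using SptD[OF assms(3) e(3)] e assms(1) d_supp(1,2)[OF assms(2) nz] unfolding itv_def by blast
qed

lemma Spt_R:
  assumes "e \<in> E" "e \<notin> C" "e \<notin> N" "f \<in> Spt (insert e C) N"
  shows "Rop t e f \<in> Spt C N"
  unfolding Spt_def
proof (intro CollectI allI impI)
  fix W A assume nz: "Rop t e f (W, A) \<noteq> 0"
  from R_supp[OF assms(1) nz] obtain A' where e: "e \<notin> W" "f (insert e W, A') \<noteq> 0" by blast
  show "itv C N W \<and> W \<subseteq> E \<and> A \<subseteq> P W"
    using SptD[OF assms(4) e(2)] e assms R_supp(1,2)[OF assms(1) nz] unfolding itv_def by blast
qed

lemma Spt_M:
  assumes "e \<in> E" "e \<notin> C" "e \<notin> N" "f \<in> Spt C N"
  shows "Mop 0 e f \<in> Spt (insert e C) N"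
  unfolding Spt_def
proof (intro CollectI allI impI)
  fix W A assume nz: "Mop 0 e f (W, A) \<noteq> 0"
  from M_supp[OF assms(1) nz] obtain A' where e: "e \<in> W" "f (W - {e}, A') \<noteq> 0" by blast
  show "itv (insert e C) N W \<and> W \<subseteq> E \<and> A \<subseteq> P W"
    using SptD[OF assms(4) e(2)] e assms M_supp(1,2)[OF assms(1) nz] unfolding itv_def by blast
qed

lemma R_vanish:
  assumes "e \<in> E" "e \<notin> C" "e \<notin> N" "f \<in> Spt C N"
  shows "Rop t e f = 0"
proof (rule ext, clarify, rule ccontr)
  fix W A assume "Rop t e f (W, A) \<noteq> 0 (W, A)"
  then have nz: "Rop t e f (W, A) \<noteq> 0" by simp
  from R_supp(4)[OF assms(1) nz] obtain A' where "f (insert e W, A') \<noteq> 0" by blast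
  then show False using SptD[OF assms(4)] assms unfolding itv_def by blast
qed

lemma homog_d:
  assumes "N \<subseteq> E" "homog \<delta> f"
  shows "homog (\<delta> - 2) (d 0 N f)"
  unfolding homog_def
proof (intro allI impI, clarify)
  fix W A assume nz: "d 0 N f (W, A) \<noteq> 0"
  from d_supp[OF assms(1) nz] obtain e A' where e: "e \<in> N" "e \<notin> W" "f (insert e W, A') \<noteq> 0"
    "dv (insert e W, A') = dv (W, A) + 1" "W \<subseteq> E" by blast
  have "slope (insert e W, A') = \<delta>" using assms(2) e(3) unfolding homog_def by blast
  then show "slope (W, A) = \<delta> - 2"
    using e ht_insert[of W e] subsetD[OF assms(1), of e] by (simp add: slope_def)
qed

lemma homog_M:
  assumes "e \<in> E" "homog \<delta> f"
  shows "homog \<delta> (Mop 0 e f)"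
  unfolding homog_def
proof (intro allI impI, clarify)
  fix W A assume nz: "Mop 0 e f (W, A) \<noteq> 0"
  from M_supp[OF assms(1) nz] obtain A' where e: "e \<in> W" "f (W - {e}, A') \<noteq> 0"
    "dv (W - {e}, A') = dv (W, A) + 1" "W \<subseteq> E" by blast
  have "slope (W - {e}, A') = \<delta>" using assms(2) e(2) unfolding homog_def by blast
  then show "slope (W, A) = \<delta>"
    using e ht_remove[of W e] by (simp add: slope_def)
qed

text \<open>The differential shifts the slope by exactly 2, so all other slopes of a preimage can be
  cut off.\<close>

lemma homog_preimage:
  assumes N: "N \<subseteq> E" and g: "g \<in> Spt C N" "d 0 N g = f" and f: "homog \<delta> f"
  shows "\<exists>g\<in>Spt C N. homog (\<delta> + 2) g \<and> d 0 N g = f"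
proof -
  define g' where "g' = (\<lambda>x. if slope x = \<delta> + 2 then g x else 0)"
  have hg: "homog (\<delta> + 2) g'" by (auto simp: homog_def g'_def)
  have "d 0 N g' x = f x" for x
  proof (cases "slope x = \<delta>")
    case True
    have "d 0 N (g - g') x = 0"
    proof (rule ccontr)
      assume nz: "d 0 N (g - g') x \<noteq> 0"
      obtain W A where x: "x = (W, A)" by fastforce
      from d_supp[OF N nz[unfolded x]] obtain e A' where e: "e \<in> N" "e \<notin> W"
        "(g - g') (insert e W, A') \<noteq> 0" "dv (insert e W, A') = dv (W, A) + 1" "W \<subseteq> E" by blast
      then have "slope (insert e W, A') = \<delta> + 2"
        using True x ht_insert[of W e] subsetD[OF N, of e] by (auto simp: slope_def)
      then show False using e(3) by (simp add: g'_def)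
    qed
    then show ?thesis using g(2) by (simp add: rlin_diff[OF d_linear])
  next
    case False
    have "homog \<delta> (d 0 N g')" using homog_d[OF N hg] by simp
    then have "d 0 N g' x = 0" using False unfolding homog_def by blast
    moreover have "f x = 0" using False f unfolding homog_def by blast
    ultimately show ?thesis by simp
  qed
  moreover have "g' \<in> Spt C N" using g(1) by (auto simp: Spt_def g'_def)
  ultimately show ?thesis using hg by blast
qed

lemma col_compl: "W \<subseteq> E \<Longrightarrow> col W S \<Longrightarrow> col W (H - S)"
  using phi_in_H by (auto simp: col_def)

text \<open>A colouring that shows the disconnection must separate the sides of \<open>e\<close>;
  otherwise it would colour the other resolution as well and contradict \<open>conn C N\<close>.
  Passing to the complement decides which side lies in it.\<close>

lemma not_conn_side:
  assumes CN: "C \<union> N \<subseteq> E" "e \<in> N" "e \<notin> C" and c: "conn C N" and C0: "C0 = C \<or> C0 = insert e C"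
    and nc: "\<not> conn C0 (N - {e})"
  shows "\<exists>S. (\<forall>W. itv C0 (N - {e}) W \<longrightarrow> col W S) \<and> (e, True) \<in> S \<and> (e, False) \<notin> S"
proof -
  let ?N = "N - {e}"
  obtain S where S: "S \<subseteq> H" "\<And>W. itv C0 ?N W \<Longrightarrow> col W S" "S \<noteq> {}" "S \<noteq> H"
    using nc by (auto simp: conn_def)
  have "((e, False) \<in> S) \<noteq> ((e, True) \<in> S)"
  proof
    assume eq: "((e, False) \<in> S) = ((e, True) \<in> S)"
    have "col W S" if W: "itv C N W" for W
    proof -
      have "itv C0 ?N W \<or> itv C0 ?N (tog e W)"
        using W C0 CN by (auto simp: itv_def tog_def)
      then show ?thesis using S(2) col_tog[of _ S e] eq tog_tog by metis
    qed
    then show False using c S unfolding conn_def by blast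
  qed
  moreover have "(e, True) \<in> H" "(e, False) \<in> H" using CN by (auto simp: mem_H)
  moreover have "col W (H - S)" if W: "itv C0 ?N W" for W
  proof (rule col_compl[OF _ S(2)[OF W]])
    show "W \<subseteq> E" using W CN C0 by (auto simp: itv_def)
  qed
  ultimately show ?thesis using S(2)
    by (cases "(e, True) \<in> S") (rule exI[of _ S], simp, rule exI[of _ "H - S"], simp)
qed

text \<open>At most one resolution disconnects: since \<open>S\<close> separates the sides of
  \<open>e\<close> in one of them, they share a circle in the other, so every colouring of the
  latter extends to both.\<close>

lemma side_conn:
  assumes CN: "C \<union> N \<subseteq> E" "e \<in> N" "e \<notin> C" and c: "conn C N"
    and C01: "C0 = C \<and> C1 = insert e C \<or> C0 = insert e C \<and> C1 = C"
    and S: "\<And>W. itv C0 (N - {e}) W \<Longrightarrow> col W S" "(e, True) \<in> S" "(e, False) \<notin> S"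
  shows "conn C1 (N - {e})"
  unfolding conn_def
proof (intro allI impI)
  let ?N = "N - {e}"
  fix S' assume S': "S' \<subseteq> H" "\<forall>W. itv C1 ?N W \<longrightarrow> col W S'"
  have W0: "C0 \<subseteq> E" "e \<in> E" "itv C0 ?N C0" using CN C01 by (auto simp: itv_def)
  have "ca C0 e \<noteq> cb C0 e"
    using col_ca[OF W0(1,2) S(1)[OF W0(3)]] col_cb[OF W0(1,2) S(1)[OF W0(3)]] S(2,3) by auto
  then have V: "ca (tog e C0) e = cb (tog e C0) e" using same_tog[OF W0(1,2)] by blast
  have VE: "tog e C0 \<subseteq> E" "itv C1 ?N (tog e C0)"
    using CN C01 by (auto simp: itv_def tog_def)
  then have "col (tog e C0) S'" using S' by blast
  then have eq: "((e, False) \<in> S') = ((e, True) \<in> S')"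
    using col_ca[OF VE(1) W0(2)] col_cb[OF VE(1) W0(2)] V by simp
  have "col W S'" if W: "itv C N W" for W
  proof -
    have "itv C1 ?N W \<or> itv C1 ?N (tog e W)"
      using W C01 CN by (auto simp: itv_def tog_def)
    then show ?thesis using S' col_tog[of _ S' e] eq tog_tog by metis
  qed
  then show "S' = {} \<or> S' = H" using c S'(1) unfolding conn_def by blast
qed

text \<open>Terms with source outside the face vanish since chains are supported on it; inside,
  \<open>S\<close> colours both ends of every arrow and \<open>tw_T\<close> applies.\<close>

lemma tw_d:
  assumes N: "C \<union> N \<subseteq> E" "C \<inter> N = {}" and S: "\<And>W. itv C N W \<Longrightarrow> col W S" and f: "f \<in> Spt C N"
  shows "d 0 N (tw S f) = tw S (d 0 N f)"
proof (rule ext, clarify)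
  fix W A
  have "Rop 0 e (tw S f) (W, A) = tau S (W, A) * Rop 0 e f (W, A)" if e: "e \<in> N" for e
  proof (cases "e \<notin> W \<and> itv C N (insert e W)")
    case True
    then have W: "itv C N W" "W \<subseteq> E" using N e by (auto simp: itv_def)
    have eE: "e \<in> E" using N e by blast
    have "col W S" "col (tog e W) S" using S W(1) True by (auto simp: tog_def)
    then have "T 0 e (tw S f) (W, A) = tau S (W, A) * T 0 e f (W, A)"
      using tw_T[OF W(2) eE] True col_tog[of W S e] eE by blast
    then show ?thesis by (simp add: Rop_def)
  next
    case False
    have eE: "e \<in> E" using N e by blast
    have "Rop 0 e g (W, A) = 0" if "g \<in> Spt C N" for g
    proof (rule ccontr)
      assume nz: "Rop 0 e g (W, A) \<noteq> 0"
      from R_supp[OF eE nz] obtain A' where "e \<notin> W" "g (insert e W, A') \<noteq> 0" by blast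
      then show False using SptD[OF that] False by blast
    qed
    then show ?thesis using f Spt_tw[OF f] by simp
  qed
  then show "d 0 N (tw S f) (W, A) = tw S (d 0 N f) (W, A)"
    by (simp add: d_def tw_def sum_fun_apply sum_distrib_left)
qed

text \<open>Induction on the number of unresolved edges. With none left, a connected state is a
  single circle, whose labels v_+ and v_- have the slopes 1 - h0 and -1 - h0, so other slopes carry
  no chain. Otherwise one edge is resolved both ways.\<close>

lemma thin:
  assumes EH: "E \<noteq> {}" and h0: "\<And>W. W \<subseteq> E \<Longrightarrow> card (P W) = 1 \<Longrightarrow> ht W = h0"
    and \<delta>: "\<delta> \<noteq> 1 - h0" "\<delta> \<noteq> - 1 - h0"
  shows "C \<union> N \<subseteq> E \<Longrightarrow> C \<inter> N = {} \<Longrightarrow> conn C N \<Longrightarrow> f \<in> Spt C N \<Longrightarrow> homog \<delta> f \<Longrightarrow> d 0 N f = 0 \<Longrightarrow>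
    \<exists>g\<in>Spt C N. homog (\<delta> + 2) g \<and> d 0 N g = f"
proof (induction "card N" arbitrary: C N f)
  case 0
  have N: "N = {}" using 0 finite_subset[OF _ finE, of N] by simp
  have C: "C \<subseteq> E" using 0 by blast
  have "cyc C x = H" if x: "x \<in> H" for x
  proof -
    have "col C (cyc C x)"
      using cyc_subset_H[OF C x] cyc_eq[OF C] by (intro colI[OF C]) auto
    moreover have "itv C N W \<Longrightarrow> W = C" for W using N by (auto simp: itv_def)
    ultimately show ?thesis
      using 0(4) cyc_subset_H[OF C x] cyc_self[OF C, of x] unfolding conn_def by blast
  qed
  moreover have "H \<noteq> {}" using EH by (auto simp: H_def)
  ultimately have P: "P C = {H}" by (auto simp: P_def)
  then have h: "ht C = h0" using h0[OF C] by simp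
  have "f (W, A) = 0" for W A
  proof (rule ccontr)
    assume nz: "f (W, A) \<noteq> 0"
    then have "W = C" "A \<subseteq> {H}" using SptD[OF 0(5) nz] N P by (auto simp: itv_def)
    then have "slope (W, A) = 1 - h0 \<or> slope (W, A) = - 1 - h0"
      using P h by (cases "A = {}") (auto simp: slope_def dv_def subset_singleton_iff)
    moreover have "slope (W, A) = \<delta>" using 0(6) nz unfolding homog_def by blast
    ultimately show False using \<delta> by simp
  qed
  then have f0: "f = 0" by (auto simp: fun_eq_iff)
  have "d 0 N 0 = f" unfolding f0 by (rule rlin_0[OF d_linear])
  moreover have "homog (\<delta> + 2) 0" "0 \<in> Spt C N" by (auto simp: homog_def Spt_def)
  ultimately show ?case by blast
next
  case (Suc n)
  then obtain e where e: "e \<in> N" by fastforce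
  let ?N = "N - {e}"
  have fN: "finite N" using Suc.prems(1) finite_subset[OF _ finE] by blast
  have n: "n = card ?N" using Suc.hyps(2) e fN by simp
  have eE: "e \<in> E" and eC: "e \<notin> C" and eN: "e \<notin> ?N" and NE: "N \<subseteq> E" "?N \<subseteq> E"
    using e Suc.prems(1,2) by auto
  have CN: "C \<union> ?N \<subseteq> E" "C \<inter> ?N = {}" "insert e C \<union> ?N \<subseteq> E" "insert e C \<inter> ?N = {}"
    using Suc.prems(1,2) eE by auto
  have dN: "d 0 N g = Rop 0 e g + d 0 ?N g" for g using d_remove[OF NE(1) e] .
  note Rv = R_vanish[OF eE eC eN]
  have mono: "g \<in> Spt C N" if "g \<in> Spt C ?N \<or> g \<in> Spt (insert e C) ?N" for g
    using that
  proof
    assume "g \<in> Spt C ?N"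
    then show ?thesis by (rule Spt_mono) (auto simp: itv_def)
  next
    assume "g \<in> Spt (insert e C) ?N"
    then show ?thesis by (rule Spt_mono) (use e in \<open>auto simp: itv_def\<close>)
  qed
  have split0: "p = 0 \<and> q = 0" if "p \<in> Spt (insert e C) ?N" "q \<in> Spt C ?N" "p + q = 0" for p q
  proof -
    have "p (W, A) = 0 \<and> q (W, A) = 0" for W A
    proof (rule ccontr)
      assume *: "\<not> ?thesis"
      have "p (W, A) + q (W, A) = 0" using that(3) by (metis plus_fun_apply zero_fun_apply)
      then have "p (W, A) \<noteq> 0" "q (W, A) \<noteq> 0" using * by auto
      then have "itv (insert e C) ?N W" "itv C ?N W" using SptD that by blast+
      then show False using eC unfolding itv_def by blast
    qed
    then show ?thesis by (auto simp: fun_eq_iff)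
  qed
  \<comment> \<open>\<open>p\<close> carries the states with \<open>e\<close> present and
    \<open>q\<close> those with \<open>e\<close> absent; the complex is the cone of
    \<open>Rop 0 e\<close> between the two.\<close>
  define p where "p = (\<lambda>(W, A). if e \<in> W then f (W, A) else 0)"
  define q where "q = (\<lambda>(W, A). if e \<in> W then 0 else f (W, A))"
  have fpq: "f = p + q" by (auto simp: fun_eq_iff p_def q_def)
  have pD: "e \<in> W \<and> f (W, A) \<noteq> 0" if "p (W, A) \<noteq> 0" for W A
    using that by (auto simp: p_def split: if_splits)
  have qD: "e \<notin> W \<and> f (W, A) \<noteq> 0" if "q (W, A) \<noteq> 0" for W A
    using that by (auto simp: q_def split: if_splits)
  have p: "p \<in> Spt (insert e C) ?N"
    unfolding Spt_def
  proof (intro CollectI allI impI)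
    fix W A assume "p (W, A) \<noteq> 0"
    then have "e \<in> W" "f (W, A) \<noteq> 0" using pD by blast+
    then show "itv (insert e C) ?N W \<and> W \<subseteq> E \<and> A \<subseteq> P W"
      using SptD[OF Suc.prems(4), of W A] unfolding itv_def by blast
  qed
  have q: "q \<in> Spt C ?N"
    unfolding Spt_def
  proof (intro CollectI allI impI)
    fix W A assume "q (W, A) \<noteq> 0"
    then have "e \<notin> W" "f (W, A) \<noteq> 0" using qD by blast+
    then show "itv C ?N W \<and> W \<subseteq> E \<and> A \<subseteq> P W"
      using SptD[OF Suc.prems(4), of W A] unfolding itv_def by blast
  qed
  have hp: "homog \<delta> p" and hq: "homog \<delta> q"
    using Suc.prems(5) pD qD unfolding homog_def by (metis surj_pair)+
  note Sd = Spt_d[OF CN(2) NE(2)] and Sd' = Spt_d[OF CN(4) NE(2)]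
  note SR = Spt_R[OF eE eC eN] and SM = Spt_M[OF eE eC eN]
  have "d 0 ?N p + (Rop 0 e p + d 0 ?N q) = 0"
    using Suc.prems(6) unfolding fpq dN rlin_add[OF d_linear] rlin_add[OF R_linear] Rv[OF q]
    by (simp add: algebra_simps)
  from split0[OF Sd'[OF p] Spt_add[OF SR[OF p] Sd[OF q]] this]
  have dp: "d 0 ?N p = 0" and dq: "Rop 0 e p + d 0 ?N q = 0" by blast+
  have Rd: "Rop 0 e (d 0 ?N g) = - d 0 ?N (Rop 0 e g)" for g using R_d[OF eE NE(2) eN] .
  have Md: "Mop 0 e (d 0 ?N g) = - d 0 ?N (Mop 0 e g)" for g using M_d[OF eE NE(2) eN] .
  note IH = Suc.hyps(1)[OF n]
  have fin: ?case if "g \<in> Spt C N" "d 0 N g = f" for g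
    using homog_preimage[OF NE(1) that Suc.prems(5)] .
  consider (both) "conn C ?N" "conn (insert e C) ?N" | (absent) "\<not> conn C ?N" | (present) "\<not> conn (insert e C) ?N"
    by blast
  then show ?case
  proof cases
    \<comment> \<open>Both resolutions are exact at this slope: first \<open>p\<close> is made a
      boundary, then the corrected \<open>q\<close>.\<close>
    case both
    obtain g1 where g1: "g1 \<in> Spt (insert e C) ?N" "homog (\<delta> + 2) g1" "d 0 ?N g1 = p"
      using IH[OF CN(3,4) both(2) p hp dp] by blast
    let ?h = "q - Rop 0 e g1"
    have "homog \<delta> (Rop 0 e g1)"
    proof -
      have "Rop 0 e g1 = d 0 {e} g1" by (simp add: d_def)
      then show ?thesis using homog_d[of "{e}" "\<delta> + 2" g1] g1 eE by simp
    qed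
    moreover have "d 0 ?N ?h = 0"
      using dq Rd[of g1] g1(3) by (simp add: rlin_diff[OF d_linear] algebra_simps)
    ultimately obtain g0 where g0: "g0 \<in> Spt C ?N" "d 0 ?N g0 = ?h"
      using IH[OF CN(1,2) both(1) Spt_diff[OF q SR[OF g1(1)]] homog_diff[OF hq]] by blast
    have "d 0 N (g1 + g0) = f"
      unfolding dN rlin_add[OF d_linear] rlin_add[OF R_linear] Rv[OF g0(1)] g1(3) g0(2) fpq by simp
    then show ?thesis using fin[of "g1 + g0"] mono g1(1) g0(1) Spt_add by blast
  next
    \<comment> \<open>Deleting \<open>e\<close> disconnects, so \<open>Rop 0 e\<close> is a split:
      injective, with image the kernel of the twisted merge back. The cone is thus equivalent to the
      quotient, a twisted copy of the complex with \<open>e\<close> present, which is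
      connected.\<close>
    case absent
    obtain S where S: "\<And>W. itv C ?N W \<Longrightarrow> col W S" "(e, True) \<in> S" "(e, False) \<notin> S"
      using not_conn_side[OF Suc.prems(1) e eC Suc.prems(3) _ absent] by blast
    have cn: "conn (insert e C) ?N"
      using side_conn[OF Suc.prems(1) e eC Suc.prems(3) _ S] by blast
    define Q where "Q = itv C ?N"
    have Q: "Q W \<Longrightarrow> W \<subseteq> E \<and> col W S" for W using S(1) CN(1) by (auto simp: Q_def itv_def)
    have Qe: "e \<notin> W" "tog e W = insert e W" if "Q W" for W
      using that eC eN by (auto simp: Q_def itv_def tog_def)
    have QV: "Q (V - {e}) \<and> e \<in> V" if "itv (insert e C) ?N V" for V
      using that eC by (auto simp: Q_def itv_def)
    have tws: "d 0 ?N (tw S g) = tw S (d 0 ?N g)" if "g \<in> Spt C ?N" for g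
      using CN(1,2) S(1) that by (rule tw_d)
    \<comment> \<open>The class of \<open>f\<close> in the quotient. It is a cycle, hence a boundary
      of some \<open>r\<close>, and the section of the merge lifts \<open>r\<close> back.\<close>
    define z where "z = Mop 0 e (tw S q)"
    have z: "z \<in> Spt (insert e C) ?N" "homog \<delta> z"
      unfolding z_def using SM[OF Spt_tw[OF q]] homog_M[OF eE homog_tw[OF hq]] by auto
    have "Mop 0 e (tw S (Rop 0 e p)) = 0"
    proof (rule ext, clarify)
      fix V A
      have "Rop 0 e p (W, A') = sg W e * T 0 e p (W, A')" if "Q W" for W A'
        using Qe[OF that] by (simp add: Rop_def)
      then have *: "T 0 e (tw S (Rop 0 e p)) (tog e W, A) = 0" if "Q W" for W
        using merge_twist_split[where Q = Q, OF Q eE S(2,3) that] that by blast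
      show "Mop 0 e (tw S (Rop 0 e p)) (V, A) = 0 (V, A)"
      proof (cases "itv (insert e C) ?N V")
        case True
        then show ?thesis using *[of "V - {e}"] QV[OF True] Qe by (auto simp: Mop_def insert_absorb)
      next
        case False
        then show ?thesis using SptD[OF SM[OF Spt_tw[OF SR[OF p]]], of S 0 V A] by auto
      qed
    qed
    moreover have "d 0 ?N q = - Rop 0 e p" using dq by (simp add: eq_neg_iff_add_eq_0 add.commute)
    ultimately have "d 0 ?N z = 0"
      using Md[of "tw S q"] tws[OF q]
      by (simp add: z_def rlin_uminus[OF tw_linear] rlin_uminus[OF M_linear])
    then obtain r where r: "r \<in> Spt (insert e C) ?N" "d 0 ?N r = z"
      using IH[OF CN(3,4) cn z] by blast
    obtain q3 where q3': "(\<forall>W A. q3 (W, A) \<noteq> 0 \<longrightarrow> Q W \<and> A \<subseteq> P W \<and>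
        (\<exists>A'. r (tog e W, A') \<noteq> 0 \<and> dv (tog e W, A') = dv (W, A) - 1)) \<and>
      (\<forall>W A. Q W \<longrightarrow> A \<subseteq> P (tog e W) \<longrightarrow> T 0 e q3 (tog e W, A) = sg (tog e W) e * r (tog e W, A))"
      by (rule exE[OF merge_section[where Q = Q, OF Q eE S(2,3), of r]])
    note q3 = q3'[THEN conjunct1, rule_format] q3'[THEN conjunct2, rule_format]
    have q3S: "q3 \<in> Spt C ?N" using q3(1) Q by (auto simp: Spt_def Q_def)
    have Mq3: "Mop 0 e q3 = r"
    proof (rule ext, clarify)
      fix V A
      show "Mop 0 e q3 (V, A) = r (V, A)"
      proof (cases "itv (insert e C) ?N V \<and> A \<subseteq> P V")
        case True
        then have V: "Q (V - {e})" "e \<in> V" "tog e (V - {e}) = V" using QV by (auto simp: tog_def)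
        then show ?thesis using q3(2)[OF V(1), of A] True
          by (simp add: Mop_def flip: mult.assoc)
      next
        case False
        then show ?thesis using SptD[OF SM[OF q3S], of V A] SptD[OF r(1), of V A] by fastforce
      qed
    qed
    let ?q2 = "tw S q3"
    have q2: "?q2 \<in> Spt C ?N" using Spt_tw[OF q3S] .
    \<comment> \<open>The plus sign comes from \<open>Mop\<close> anticommuting with the
      differential. The sum vanishes in the quotient, so it is a split of some
      \<open>p2\<close>.\<close>
    let ?y = "q + d 0 ?N ?q2"
    have y: "?y \<in> Spt C ?N" using Spt_add[OF q Sd[OF q2]] .
    have M0: "Mop 0 e (tw S ?y) = 0"
      using Md[of q3] tws[OF q2] r(2) Mq3
      by (simp add: rlin_add[OF tw_linear] rlin_add[OF M_linear] tw_tw z_def[symmetric]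
          flip: tws[OF q2])
    have Ty: "T 0 e (tw S ?y) (tog e W, A) = 0" if W: "Q W" for W A
    proof -
      have "Mop 0 e (tw S ?y) (tog e W, A) = 0" using M0 by simp
      then show ?thesis using Qe[OF W] by (simp add: Mop_def)
    qed
    obtain p2 where p2a: "(\<forall>V A. p2 (V, A) \<noteq> 0 \<longrightarrow> Q (tog e V) \<and> A \<subseteq> P V \<and>
        (\<exists>A'. ?y (tog e V, A') \<noteq> 0 \<and> dv (tog e V, A') = dv (V, A) - 1)) \<and>
      (\<forall>W A. Q W \<longrightarrow> A \<subseteq> P W \<longrightarrow> T 0 e p2 (W, A) = sg W e * ?y (W, A))"
      by (rule exE[OF split_lift[where Q = Q, OF Q eE S(2,3) Ty]])
    note p2 = p2a[THEN conjunct1, rule_format] p2a[THEN conjunct2, rule_format]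
    have p2S: "p2 \<in> Spt (insert e C) ?N"
      unfolding Spt_def
    proof (intro CollectI allI impI)
      fix V A assume "p2 (V, A) \<noteq> 0"
      then have *: "Q (tog e V)" "A \<subseteq> P V" using p2(1) by blast+
      define U where "U = tog e V"
      have "V = insert e U" using Qe(2)[OF *(1)] tog_tog unfolding U_def by metis
      moreover have "itv C ?N U" "U \<subseteq> E" using * Q[OF *(1)] by (auto simp: Q_def U_def)
      ultimately have "itv (insert e C) ?N V" "V \<subseteq> E" using eE by (auto simp: itv_def)
      then show "itv (insert e C) ?N V \<and> V \<subseteq> E \<and> A \<subseteq> P V" using * by blast
    qed
    have Rp2: "Rop 0 e p2 = ?y"
    proof (rule ext, clarify)
      fix W A
      show "Rop 0 e p2 (W, A) = ?y (W, A)"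
      proof (cases "Q W \<and> A \<subseteq> P W")
        case True
        then show ?thesis using p2(2)[of W A] Qe[of W] by (simp add: Rop_def flip: mult.assoc)
      next
        case False
        then show ?thesis using SptD[OF SR[OF p2S], of 0 W A] SptD[OF y, of W A]
          unfolding Q_def by fastforce
      qed
    qed
    \<comment> \<open>What is left of \<open>f\<close> is a cycle supported on states with
      \<open>e\<close> present. So \<open>Rop\<close> kills it, and \<open>Rop\<close> is
      injective.\<close>
    let ?p3 = "p - d 0 ?N p2"
    have p3: "?p3 \<in> Spt (insert e C) ?N" using Spt_diff[OF p Sd'[OF p2S]] .
    have eq: "f - d 0 N (p2 - ?q2) = ?p3"
      unfolding dN rlin_diff[OF d_linear] rlin_diff[OF R_linear] Rv[OF q2] Rp2 fpq by simp
    have "d 0 N ?p3 = 0"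
      unfolding eq[symmetric] rlin_diff[OF d_linear] Suc.prems(6)
      using d_d[OF NE(1), of 0 "p2 - ?q2"] by (simp add: rlin_diff[OF d_linear])
    then have "d 0 ?N ?p3 + Rop 0 e ?p3 = 0" unfolding dN by (simp add: add.commute)
    from split0[OF Sd'[OF p3] SR[OF p3] this] have R3: "Rop 0 e ?p3 = 0" by blast
    have "?p3 (V, A) = 0" for V A
    proof (rule ccontr)
      assume nz: "?p3 (V, A) \<noteq> 0"
      then have V: "itv (insert e C) ?N V" "A \<subseteq> P V" using SptD[OF p3 nz] by blast+
      have V': "tog e (V - {e}) = V" using QV[OF V(1)] by (auto simp: tog_def)
      have "T 0 e ?p3 (V - {e}, A') = 0" for A'
      proof -
        have "Rop 0 e ?p3 (V - {e}, A') = 0" using R3 by simp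
        then show ?thesis by (simp add: Rop_def)
      qed
      then show False
        using split_inj[where Q = Q, OF Q eE S(2,3), of "V - {e}" ?p3 A] V QV[OF V(1)] nz V' by auto
    qed
    then have "?p3 = 0" by (auto simp: fun_eq_iff)
    then have "d 0 N (p2 - ?q2) = f" using eq by simp
    then show ?thesis using fin[of "p2 - ?q2"] mono p2S q2 Spt_diff by blast
  next
    \<comment> \<open>Keeping \<open>e\<close> disconnects, so \<open>Rop 0 e\<close> is a merge:
      surjective, with kernel the twisted image of the split \<open>Mop 0 e\<close> out of the
      states without \<open>e\<close>.\<close>
    case present
    obtain S where S: "\<And>W. itv (insert e C) ?N W \<Longrightarrow> col W S" "(e, True) \<in> S" "(e, False) \<notin> S"
      using not_conn_side[OF Suc.prems(1) e eC Suc.prems(3) _ present] by blast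
    have cn: "conn C ?N"
      using side_conn[OF Suc.prems(1) e eC Suc.prems(3) _ S] by blast
    define Q where "Q = itv (insert e C) ?N"
    have Q: "Q W \<Longrightarrow> W \<subseteq> E \<and> col W S" for W using S(1) CN(3) by (auto simp: Q_def itv_def)
    have Qe: "e \<in> W" "tog e W = W - {e}" if "Q W" for W
      using that by (auto simp: Q_def itv_def tog_def)
    have QV: "Q (insert e V) \<and> e \<notin> V" if "itv C ?N V" for V
      using that eC by (auto simp: Q_def itv_def)
    have Qtog: "itv C ?N (tog e W)" if "Q W" for W
      using that eC by (auto simp: Q_def itv_def tog_def)
    have tws: "d 0 ?N (tw S g) = tw S (d 0 ?N g)" if "g \<in> Spt (insert e C) ?N" for g
      using CN(3,4) S(1) that by (rule tw_d)
    \<comment> \<open>\<open>q\<close> is lifted through the merge; subtracting the boundary of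
      \<open>q1\<close> moves \<open>f\<close> into the kernel of \<open>Rop\<close>.\<close>
    obtain q1 where q1': "(\<forall>W A. q1 (W, A) \<noteq> 0 \<longrightarrow> Q W \<and> A \<subseteq> P W \<and>
        (\<exists>A'. q (tog e W, A') \<noteq> 0 \<and> dv (tog e W, A') = dv (W, A) - 1)) \<and>
      (\<forall>W A. Q W \<longrightarrow> A \<subseteq> P (tog e W) \<longrightarrow> T 0 e q1 (tog e W, A) = sg (tog e W) e * q (tog e W, A))"
      by (rule exE[OF merge_section[where Q = Q, OF Q eE S(2,3), of q]])
    note q1 = q1'[THEN conjunct1, rule_format] q1'[THEN conjunct2, rule_format]
    have q1S: "q1 \<in> Spt (insert e C) ?N" using q1(1) Q by (auto simp: Spt_def Q_def)
    have hq1: "homog (\<delta> + 2) q1"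
      unfolding homog_def
    proof (intro allI impI, clarify)
      fix W A assume "q1 (W, A) \<noteq> 0"
      from q1(1)[OF this] obtain A' where *: "Q W" "q (tog e W, A') \<noteq> 0" "dv (tog e W, A') = dv (W, A) - 1"
        by blast
      have "ht (tog e W) = ht W + 1" using ht_tog[of W e] Q[OF *(1)] eE Qe[OF *(1)] by simp
      moreover have "slope (tog e W, A') = \<delta>" using * hq unfolding homog_def by blast
      ultimately show "slope (W, A) = \<delta> + 2" using * by (simp add: slope_def)
    qed
    have Rq1: "Rop 0 e q1 = q"
    proof (rule ext, clarify)
      fix V A
      show "Rop 0 e q1 (V, A) = q (V, A)"
      proof (cases "itv C ?N V \<and> A \<subseteq> P V")
        case True
        then have V: "Q (insert e V)" "e \<notin> V" "tog e (insert e V) = V" using QV by (auto simp: tog_def)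
        then show ?thesis using q1(2)[OF V(1), of A] True
          by (simp add: Rop_def flip: mult.assoc)
      next
        case False
        then show ?thesis using SptD[OF SR[OF q1S], of 0 V A] SptD[OF q, of V A] by fastforce
      qed
    qed
    let ?y = "p - d 0 ?N q1"
    have y: "?y \<in> Spt (insert e C) ?N" using Spt_diff[OF p Sd'[OF q1S]] .
    have hy: "homog \<delta> ?y" using homog_diff[OF hp] homog_d[OF NE(2) hq1] by simp
    have dy: "d 0 ?N ?y = 0"
      using dp d_d[OF NE(2), of 0 q1] by (simp add: rlin_diff[OF d_linear])
    have eq: "f - d 0 N q1 = ?y" unfolding dN Rq1 fpq by simp
    have "d 0 N ?y = 0"
      unfolding eq[symmetric] rlin_diff[OF d_linear] Suc.prems(6)
      using d_d[OF NE(1), of 0 q1] by simp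
    then have Ry: "Rop 0 e ?y = 0" unfolding dN dy by simp
    have Ty: "T 0 e (tw S (tw S ?y)) (tog e W, A) = 0" if W: "Q W" for W A
    proof -
      have "Rop 0 e ?y (tog e W, A) = 0" using Ry by simp
      then show ?thesis using Qe[OF W] by (simp add: Rop_def tw_tw)
    qed
    \<comment> \<open>The double twist turns \<open>Rop 0 e ?y = 0\<close> into the hypothesis of
      \<open>split_lift\<close> for \<open>tw S ?y\<close>.\<close>
    obtain p' where p'a: "(\<forall>V A. p' (V, A) \<noteq> 0 \<longrightarrow> Q (tog e V) \<and> A \<subseteq> P V \<and>
        (\<exists>A'. tw S ?y (tog e V, A') \<noteq> 0 \<and> dv (tog e V, A') = dv (V, A) - 1)) \<and>
      (\<forall>W A. Q W \<longrightarrow> A \<subseteq> P W \<longrightarrow> T 0 e p' (W, A) = sg W e * tw S ?y (W, A))"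
      by (rule exE[OF split_lift[where Q = Q, OF Q eE S(2,3) Ty]])
    note p' = p'a[THEN conjunct1, rule_format] p'a[THEN conjunct2, rule_format]
    have p'S: "p' \<in> Spt C ?N"
      unfolding Spt_def
    proof (intro CollectI allI impI)
      fix V A assume "p' (V, A) \<noteq> 0"
      then have *: "Q (tog e V)" "A \<subseteq> P V" using p'(1) by blast+
      have "itv C ?N V" using Qtog[OF *(1)] by simp
      moreover from this have "V \<subseteq> E" using CN(1) unfolding itv_def by blast
      ultimately show "itv C ?N V \<and> V \<subseteq> E \<and> A \<subseteq> P V" using * by blast
    qed
    have hp': "homog \<delta> p'"
      unfolding homog_def
    proof (intro allI impI, clarify)
      fix V A assume nz: "p' (V, A) \<noteq> 0"
      from p'(1)[OF this] obtain A' where *: "Q (tog e V)" "tw S ?y (tog e V, A') \<noteq> 0"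
        "dv (tog e V, A') = dv (V, A) - 1" by blast
      have V: "itv C ?N V" "V \<subseteq> E" using SptD[OF p'S nz] by blast+
      then have "ht (tog e V) = ht V - 1" using ht_tog[of V e] eE QV[OF V(1)] by simp
      moreover have "slope (tog e V, A') = \<delta>" using * homog_tw[OF hy, of S] unfolding homog_def by blast
      ultimately show "slope (V, A) = \<delta>" using * by (simp add: slope_def)
    qed
    have Mp': "Mop 0 e p' = tw S ?y"
    proof (rule ext, clarify)
      fix W A
      show "Mop 0 e p' (W, A) = tw S ?y (W, A)"
      proof (cases "Q W \<and> A \<subseteq> P W")
        case True
        then show ?thesis using p'(2)[of W A] Qe[of W] by (simp add: Mop_def flip: mult.assoc)
      next
        case False
        then show ?thesis using SptD[OF SM[OF p'S], of W A] SptD[OF Spt_tw[OF y, of S], of W A]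
          unfolding Q_def by fastforce
      qed
    qed
    have "Mop 0 e (d 0 ?N p') = 0"
      using Md[of p'] Mp' tws[OF y] dy rlin_0[OF tw_linear] by simp
    have "d 0 ?N p' (V, A) = 0" for V A
    proof (rule ccontr)
      assume nz: "d 0 ?N p' (V, A) \<noteq> 0"
      then have V: "itv C ?N V" "A \<subseteq> P V" using SptD[OF Sd[OF p'S] nz] by blast+
      have V': "tog e (insert e V) = V" using QV[OF V(1)] by (auto simp: tog_def)
      have "T 0 e (d 0 ?N p') (insert e V, A') = 0" for A'
      proof -
        have "Mop 0 e (d 0 ?N p') (insert e V, A') = 0" using \<open>Mop 0 e (d 0 ?N p') = 0\<close> by simp
        then show ?thesis by (simp add: Mop_def)
      qed
      then show False
        using split_inj[where Q = Q, OF Q eE S(2,3), of "insert e V" "d 0 ?N p'" A] V QV[OF V(1)] nz V' by auto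
    qed
    then have dp': "d 0 ?N p' = 0" by (auto simp: fun_eq_iff)
    obtain p'' where p'': "p'' \<in> Spt C ?N" "d 0 ?N p'' = p'"
      using IH[OF CN(1,2) cn p'S hp' dp'] by blast
    \<comment> \<open>The preimage of \<open>p'\<close> is carried over by split and twist; its
      boundary is \<open>- ?y\<close> because \<open>Mop\<close> anticommutes with the
      differential.\<close>
    let ?w = "tw S (Mop 0 e p'')"
    have w: "?w \<in> Spt (insert e C) ?N" using Spt_tw[OF SM[OF p''(1)]] .
    have dw: "d 0 ?N ?w = - ?y"
      using tws[OF SM[OF p''(1)]] Md[of p''] p''(2) Mp'
      by (metis minus_minus rlin_uminus[OF tw_linear] tw_tw)
    have Rw: "Rop 0 e ?w = 0"
    proof (rule ext, clarify)
      fix V A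
      have "Mop 0 e p'' (W, A') = sg W e * T 0 e p'' (W, A')" if "Q W" for W A'
        using Qe[OF that] by (simp add: Mop_def)
      then have *: "T 0 e ?w (tog e W, A) = 0" if "Q W" for W
        using merge_twist_split[where Q = Q, OF Q eE S(2,3) that] that by blast
      show "Rop 0 e ?w (V, A) = 0 (V, A)"
      proof (cases "itv C ?N V")
        case True
        then have "tog e (insert e V) = V" using QV by (auto simp: tog_def)
        then show ?thesis using *[of "insert e V"] QV[OF True] by (auto simp: Rop_def)
      next
        case False
        then show ?thesis using SptD[OF SR[OF w], of 0 V A] by auto
      qed
    qed
    have "d 0 N (q1 - ?w) = f"
      unfolding dN rlin_diff[OF d_linear] rlin_diff[OF R_linear] Rw Rq1 dw fpq by simp
    then show ?thesis using fin[of "q1 - ?w"] mono q1S w Spt_diff by blast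
  qed
qed

end

section \<open>The Lee deformation\<close>

lemma fsupD: "f \<in> fsup X \<Longrightarrow> f x \<noteq> 0 \<Longrightarrow> x \<in> X"
  by (auto simp: fsup_def)

lemma fsupI: "(\<And>x. f x \<noteq> 0 \<Longrightarrow> x \<in> X) \<Longrightarrow> f \<in> fsup X"
  unfolding fsup_def by blast

lemma fsup_empty: "fsup {} = {0}"
  by (auto simp: fsup_def fun_eq_iff)

lemma fsup_add: "f \<in> fsup X \<Longrightarrow> g \<in> fsup X \<Longrightarrow> f + g \<in> fsup X"
  and fsup_diff: "f \<in> fsup X \<Longrightarrow> g \<in> fsup X \<Longrightarrow> f - g \<in> fsup X"
  and fsup_uminus: "f \<in> fsup X \<Longrightarrow> - f \<in> fsup X"
  by (auto simp: fsup_def)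

definition restr :: "('x \<Rightarrow> bool) \<Rightarrow> ('x \<Rightarrow> rat) \<Rightarrow> 'x \<Rightarrow> rat" where
  "restr Q f = (\<lambda>x. if Q x then f x else 0)"

lemma restr_linear: "rlin (restr Q)"
  by (rule rlinI) (auto simp: restr_def rscale_apply)

lemma restr_eq_0_iff: "restr Q f = 0 \<longleftrightarrow> (\<forall>x. Q x \<longrightarrow> f x = 0)"
  by (auto simp: restr_def fun_eq_iff)

context ordered_ribbon
begin

text \<open>The degree that the undeformed differential preserves and the Lee terms raise by 4. The
  slope is \<open>deg - 2 * ht\<close>.\<close>

definition deg :: "'a bgen \<Rightarrow> int" where "deg x = dv x + ht (fst x)"

definition gens :: "int \<Rightarrow> int \<Rightarrow> 'a bgen set" where
  "gens h j = {(W, A). W \<subseteq> E \<and> A \<subseteq> P W \<and> ht W = h \<and> deg (W, A) = j}"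

text \<open>The Lee differential respects the residue of the degree mod 4 and the filtration by
  lower bounds on the degree; these are the generators of the filtered pieces.\<close>

definition gc :: "int \<Rightarrow> int \<Rightarrow> int \<Rightarrow> 'a bgen set" where
  "gc h c m = {(W, A). W \<subseteq> E \<and> A \<subseteq> P W \<and> ht W = h \<and> deg (W, A) mod 4 = c mod 4 \<and> m \<le> deg (W, A)}"

definition kappa :: "int \<Rightarrow> int \<Rightarrow> nat" where
  "kappa h j = rv.dim {f\<in>fsup (gens h j). d 0 E f = 0}"

definition lker :: "int \<Rightarrow> int \<Rightarrow> int \<Rightarrow> ('a bgen \<Rightarrow> rat) set" where
  "lker h c m = {f\<in>fsup (gc h c m). d 1 E f = 0}"

lemma finite_bgens: "finite {(W, A). W \<subseteq> E \<and> A \<subseteq> P W}"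
proof -
  have "{(W, A). W \<subseteq> E \<and> A \<subseteq> P W} = Sigma (Pow E) (\<lambda>W. Pow (P W))" by auto
  then show ?thesis using finE by simp
qed

lemma finite_gens: "finite (gens h j)"
  by (rule finite_subset[OF _ finite_bgens]) (auto simp: gens_def)

lemma finite_gc: "finite (gc h c m)"
  by (rule finite_subset[OF _ finite_bgens]) (auto simp: gc_def)

lemma ht_bounds: "0 \<le> ht W" "ht W \<le> int (card E)"
  using finE by (auto simp: ht_def intro: card_mono)

lemma gens_empty: "h < 0 \<or> h > int (card E) \<Longrightarrow> gens h j = {}"
proof -
  assume h: "h < 0 \<or> h > int (card E)"
  have "(W, A) \<notin> gens h j" for W A
    using ht_bounds(1)[of W] ht_bounds(2)[of W] h by (auto simp: gens_def)
  then show ?thesis by auto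
qed

lemma d0_supp:
  assumes nz: "d 0 E f (W, A) \<noteq> 0"
  shows "W \<subseteq> E" "A \<subseteq> P W" "\<exists>e A'. f (insert e W, A') \<noteq> 0 \<and> ht (insert e W) = ht W - 1 \<and>
    deg (insert e W, A') = deg (W, A)"
proof -
  obtain e A' where e: "e \<in> E" "e \<notin> W" "f (insert e W, A') \<noteq> 0"
    "dv (insert e W, A') = dv (W, A) + 1" "W \<subseteq> E" using d_supp[OF order_refl nz] by blast
  then show "W \<subseteq> E" "A \<subseteq> P W" "\<exists>e A'. f (insert e W, A') \<noteq> 0 \<and> ht (insert e W) = ht W - 1 \<and>
    deg (insert e W, A') = deg (W, A)"
    using d_supp[OF order_refl nz] ht_insert[of W e]
    by (auto intro!: exI[of _ e] exI[of _ A'] simp: deg_def)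
qed

lemma d1_supp:
  assumes nz: "d 1 E f (W, A) \<noteq> 0"
  shows "W \<subseteq> E" "A \<subseteq> P W" "\<exists>e A'. f (insert e W, A') \<noteq> 0 \<and> ht (insert e W) = ht W - 1 \<and>
    (deg (insert e W, A') = deg (W, A) \<or> deg (insert e W, A') = deg (W, A) - 4)"
proof -
  obtain e A' where e: "e \<in> E" "e \<notin> W" "f (insert e W, A') \<noteq> 0"
    "dv (insert e W, A') = dv (W, A) + 1 \<or> dv (insert e W, A') = dv (W, A) - 3" "W \<subseteq> E"
    using d_supp[OF order_refl nz] by blast
  then show "W \<subseteq> E" "A \<subseteq> P W" "\<exists>e A'. f (insert e W, A') \<noteq> 0 \<and> ht (insert e W) = ht W - 1 \<and>
    (deg (insert e W, A') = deg (W, A) \<or> deg (insert e W, A') = deg (W, A) - 4)"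
    using d_supp[OF order_refl nz] ht_insert[of W e]
    by (auto intro!: exI[of _ e] exI[of _ A'] simp: deg_def)
qed

lemma T_diff_supp:
  assumes W: "W \<subseteq> E" and e: "e \<in> E" and nz: "T 1 e f (W, A) \<noteq> T 0 e f (W, A)"
  shows "\<exists>A'. f (tog e W, A') \<noteq> 0 \<and> dv (tog e W, A') = dv (W, A) - 3"
proof -
  let ?V = "tog e W"
  have A: "A \<subseteq> P W" using nz T_outside by metis
  have pV: "int (card (P ?V)) = int (card (P W)) + (if ca W e = cb W e then 1 else -1)"
    using card_P_tog[OF W e] .
  show ?thesis
  proof (cases "ca W e = cb W e")
    case True
    then have nV: "ca ?V e \<noteq> cb ?V e" using same_tog[OF W e] by blast
    show ?thesis using same_cases[OF W e True A]
    proof cases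
      case (1 R)
      note R = R_card[OF R_sub_tog[OF W e 1(1)]]
      have "f (?V, insert (ca ?V e) (insert (cb ?V e) R)) \<noteq> 0"
        using nz T_same(1)[OF W e True 1(1), of _ f] 1(2) by auto
      then show ?thesis using pV True 1 R(3)[OF nV]
        by (intro exI[of _ "insert (ca ?V e) (insert (cb ?V e) R)"]) (simp add: dv_def)
    next
      case (2 R)
      then show ?thesis using nz T_same(2)[OF W e True 2(1), of _ f] by simp
    qed
  next
    case False
    show ?thesis using diff_cases[OF W e A]
    proof cases
      case (1 R)
      have "f (?V, insert (ca ?V e) R) \<noteq> 0"
        using nz T_diff(1)[OF W e False 1(1), of _ f] 1(2) by auto
      then show ?thesis using pV False 1 R_card(1)[OF R_sub_tog[OF W e 1(1)]]
        by (intro exI[of _ "insert (ca ?V e) R"]) (simp add: dv_def)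
    qed (use nz T_diff(2-4)[OF W e False, of _ _ f] in auto)
  qed
qed

lemma dd_supp:
  assumes nz: "d 1 E f (W, A) \<noteq> d 0 E f (W, A)"
  shows "\<exists>e A'. f (insert e W, A') \<noteq> 0 \<and> deg (insert e W, A') = deg (W, A) - 4"
proof -
  have "(\<Sum>e\<in>E. Rop 1 e f (W, A) - Rop 0 e f (W, A)) \<noteq> 0"
    using nz by (simp add: d_def sum_fun_apply sum_subtractf)
  then obtain e where e: "e \<in> E" "Rop 1 e f (W, A) - Rop 0 e f (W, A) \<noteq> 0" by (meson sum.neutral)
  then have *: "e \<notin> W" "T 1 e f (W, A) \<noteq> T 0 e f (W, A)" by (auto simp: Rop_def)
  have W: "W \<subseteq> E" using *(2) T_outside by metis
  obtain A' where "f (insert e W, A') \<noteq> 0" "dv (insert e W, A') = dv (W, A) - 3"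
    using T_diff_supp[OF W e(1) *(2)] *(1) by (auto simp: tog_def)
  then show ?thesis using ht_insert[OF W e(1) *(1)] by (auto intro!: exI[of _ e] exI[of _ A'] simp: deg_def)
qed

lemma d0_gens: "f \<in> fsup (gens h j) \<Longrightarrow> d 0 E f \<in> fsup (gens (h + 1) j)"
proof (rule fsupI, clarify)
  fix W A assume f: "f \<in> fsup (gens h j)" and nz: "d 0 E f (W, A) \<noteq> 0"
  then obtain e A' where "(insert e W, A') \<in> gens h j" "ht (insert e W) = ht W - 1"
    "deg (insert e W, A') = deg (W, A)" using d0_supp(3)[OF nz] fsupD[OF f] by blast
  then show "(W, A) \<in> gens (h + 1) j" using d0_supp(1,2)[OF nz] by (auto simp: gens_def)
qed

lemma d1_gc: "f \<in> fsup (gc h c m) \<Longrightarrow> d 1 E f \<in> fsup (gc (h + 1) c m)"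
proof (rule fsupI, clarify)
  fix W A assume f: "f \<in> fsup (gc h c m)" and nz: "d 1 E f (W, A) \<noteq> 0"
  then obtain e A' where *: "(insert e W, A') \<in> gc h c m" "ht (insert e W) = ht W - 1"
    "deg (insert e W, A') = deg (W, A) \<or> deg (insert e W, A') = deg (W, A) - 4"
    using d1_supp(3)[OF nz] fsupD[OF f] by blast
  have "(deg (W, A) - 4) mod 4 = deg (W, A) mod 4" by simp
  then show "(W, A) \<in> gc (h + 1) c m" using d1_supp(1,2)[OF nz] * by (auto simp: gc_def)
qed

lemma dd_gc: "f \<in> fsup (gc h c m) \<Longrightarrow> d 1 E f - d 0 E f \<in> fsup (gc (h + 1) c (m + 4))"
proof (rule fsupI, clarify)
  fix W A assume f: "f \<in> fsup (gc h c m)" and nz: "(d 1 E f - d 0 E f) (W, A) \<noteq> 0"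
  then have nz': "d 1 E f (W, A) \<noteq> d 0 E f (W, A)" by simp
  have WA: "W \<subseteq> E" "A \<subseteq> P W"
    using nz' d0_supp(1,2)[of f W A] d1_supp(1,2)[of f W A] by metis+
  obtain e A' where *: "(insert e W, A') \<in> gc h c m" "deg (insert e W, A') = deg (W, A) - 4"
    using dd_supp[OF nz'] fsupD[OF f] by blast
  have "e \<notin> W \<or> e \<in> W" by blast
  have "(W, A) \<in> gc (h + 1) c m"
  proof -
    have "d 1 E f \<in> fsup (gc (h + 1) c m)" using d1_gc[OF f] .
    show ?thesis
    proof (cases "d 1 E f (W, A) = 0")
      case True
      then have "d 0 E f (W, A) \<noteq> 0" using nz' by simp
      from d0_supp(3)[OF this] obtain e A' where "(insert e W, A') \<in> gc h c m"
        "ht (insert e W) = ht W - 1" "deg (insert e W, A') = deg (W, A)" using fsupD[OF f] by blast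
      then show ?thesis using WA by (auto simp: gc_def)
    next
      case False
      then show ?thesis using fsupD[OF d1_gc[OF f]] by blast
    qed
  qed
  then show "(W, A) \<in> gc (h + 1) c (m + 4)" using * by (auto simp: gc_def)
qed

lemma gens_gc: "j mod 4 = c mod 4 \<Longrightarrow> m \<le> j \<Longrightarrow> gens h j \<subseteq> gc h c m"
  by (auto simp: gens_def gc_def)

lemma gc_mono: "m \<le> m' \<Longrightarrow> gc h c m' \<subseteq> gc h c m"
  by (auto simp: gc_def)

text \<open>Lee terms raise the degree, so in the lowest degree of the filtration only the
  undeformed differential is visible.\<close>

lemma d0_lead:
  assumes "f \<in> fsup (gc h c m)"
  shows "d 0 E (restr (\<lambda>x. deg x = m) f) = restr (\<lambda>x. deg x = m) (d 1 E f)"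
proof (rule ext, clarify)
  fix W A
  let ?l = "restr (\<lambda>x. deg x = m) f"
  show "d 0 E ?l (W, A) = restr (\<lambda>x. deg x = m) (d 1 E f) (W, A)"
  proof (cases "deg (W, A) = m")
    case False
    have "d 0 E ?l (W, A) = 0"
    proof (rule ccontr)
      assume "d 0 E ?l (W, A) \<noteq> 0"
      from d0_supp(3)[OF this] False show False by (auto simp: restr_def split: if_splits)
    qed
    then show ?thesis using False by (simp add: restr_def)
  next
    case True
    have "d 0 E (f - ?l) (W, A) = 0"
    proof (rule ccontr)
      assume "d 0 E (f - ?l) (W, A) \<noteq> 0"
      from d0_supp(3)[OF this] True show False by (auto simp: restr_def split: if_splits)
    qed
    moreover have "d 1 E f (W, A) = d 0 E f (W, A)"
    proof (rule ccontr)
      assume "d 1 E f (W, A) \<noteq> d 0 E f (W, A)"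
      from dd_supp[OF this] obtain e A' where "f (insert e W, A') \<noteq> 0"
        "deg (insert e W, A') = m - 4" using True by auto
      then show False using fsupD[OF assms, of "(insert e W, A')"] by (simp add: gc_def)
    qed
    ultimately show ?thesis using True by (simp add: restr_def rlin_diff[OF d_linear])
  qed
qed

lemma lead_gens: "f \<in> fsup (gc h c m) \<Longrightarrow> restr (\<lambda>x. deg x = m) f \<in> fsup (gens h m)"
proof (rule fsupI, clarify)
  fix W A assume f: "f \<in> fsup (gc h c m)" and "restr (\<lambda>x. deg x = m) f (W, A) \<noteq> 0"
  then have "deg (W, A) = m" "(W, A) \<in> gc h c m"
    using fsupD[OF f, of "(W, A)"] by (auto simp: restr_def split: if_splits)
  then show "(W, A) \<in> gens h m" by (simp add: gens_def gc_def)
qed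

lemma lead_0: "f \<in> fsup (gc h c m) \<Longrightarrow> restr (\<lambda>x. deg x = m) f = 0 \<Longrightarrow> f \<in> fsup (gc h c (m + 1))"
proof (rule fsupI)
  fix x assume f: "f \<in> fsup (gc h c m)" "restr (\<lambda>x. deg x = m) f = 0" "f x \<noteq> 0"
  have "x \<in> gc h c m" using fsupD[OF f(1,3)] .
  moreover have "deg x \<noteq> m" using f(2,3) unfolding restr_eq_0_iff by blast
  ultimately show "x \<in> gc h c (m + 1)" by (auto simp: gc_def)
qed

lemma lead_mod: "f \<in> fsup (gc h c m) \<Longrightarrow> m mod 4 \<noteq> c mod 4 \<Longrightarrow> restr (\<lambda>x. deg x = m) f = 0"
proof -
  assume f: "f \<in> fsup (gc h c m)" and m: "m mod 4 \<noteq> c mod 4"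
  have "f x = 0" if "deg x = m" for x
    using fsupD[OF f, of x] that m by (cases x) (auto simp: gc_def)
  then show ?thesis unfolding restr_eq_0_iff by blast
qed

lemma lead_id: "f \<in> fsup (gens h m) \<Longrightarrow> restr (\<lambda>x. deg x = m) f = f"
proof (rule ext, clarify)
  fix W A assume f: "f \<in> fsup (gens h m)"
  show "restr (\<lambda>x. deg x = m) f (W, A) = f (W, A)"
    using fsupD[OF f, of "(W, A)"] by (auto simp: restr_def gens_def)
qed

lemma lead_above: "f \<in> fsup (gc h c m') \<Longrightarrow> m < m' \<Longrightarrow> restr (\<lambda>x. deg x = m) f = 0"
proof -
  assume f: "f \<in> fsup (gc h c m')" and m: "m < m'"
  have "f x = 0" if "deg x = m" for x
    using fsupD[OF f, of x] that m by (cases x) (auto simp: gc_def)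
  then show ?thesis unfolding restr_eq_0_iff by blast
qed

text \<open>There are at most \<open>2 * card E\<close> circles, and the height is at most
  \<open>card E\<close>.\<close>

definition dmax :: int where "dmax = 3 * int (card E)"

lemma card_P_le: "W \<subseteq> E \<Longrightarrow> card (P W) \<le> 2 * card E"
proof -
  have "card (P W) \<le> card H" unfolding P_def by (rule card_image_le[OF finH])
  also have "card H = 2 * card E" by (simp add: H_def card_cartesian_product card_UNIV_bool)
  finally show ?thesis .
qed

lemma deg_bounds: "W \<subseteq> E \<Longrightarrow> A \<subseteq> P W \<Longrightarrow> deg (W, A) \<le> dmax \<and> - dmax \<le> deg (W, A)"
  using card_P_le[of W] card_mono[OF finP, of A W] ht_bounds[of W]
  by (simp add: deg_def dv_def dmax_def)

lemma gc_top: "dmax < m \<Longrightarrow> gc h c m = {}"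
proof -
  assume m: "dmax < m"
  have "(W, A) \<notin> gc h c m" for W A
    using deg_bounds[of W A] m by (auto simp: gc_def)
  then show ?thesis by auto
qed

end

section \<open>Thin complexes and the filtration of their Lee kernels\<close>

locale thin_ribbon = ordered_ribbon +
  fixes h0 :: int
  assumes E_nonempty: "E \<noteq> {}" and connected: "conn {} E"
    and h0_eq: "h0 = ht {} - int (card (P {})) + 1"
    and tree_height: "\<And>W. W \<subseteq> E \<Longrightarrow> card (P W) = 1 \<Longrightarrow> ht W = h0"
begin

text \<open>\<open>thin\<close> controls the slope but not the height of a preimage; this allows a
  preimage to be cut down to one height.\<close>

lemma d_mask_ht: "d t E (mask (\<lambda>W. k (ht W)) f) = mask (\<lambda>W. k (ht W - 1)) (d t E f)"
proof (rule ext, clarify)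
  fix W A
  have "Rop t e (mask (\<lambda>W. k (ht W)) f) (W, A) = k (ht W - 1) * Rop t e f (W, A)" if e: "e \<in> E" for e
  proof (cases "W \<subseteq> E \<and> e \<notin> W")
    case True
    then have "ht (tog e W) = ht W - 1" using ht_insert[of W e] e by (simp add: tog_def)
    then show ?thesis by (simp add: Rop_def T_mask)
  next
    case False
    then have "Rop t e g (W, A) = 0" for g using T_outside[of W A t e g] by (auto simp: Rop_def)
    then show ?thesis by simp
  qed
  then show "d t E (mask (\<lambda>W. k (ht W)) f) (W, A) = mask (\<lambda>W. k (ht W - 1)) (d t E f) (W, A)"
    by (simp add: d_def sum_fun_apply sum_distrib_left)
qed

text \<open>Degree \<open>j\<close> in height \<open>h\<close> means slope \<open>j - 2 * h\<close>.
  The preimage found by \<open>thin\<close> may spread over several heights and is cut down to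
  height \<open>h - 1\<close>.\<close>

lemma exact:
  assumes off: "j - 2 * h \<noteq> 1 - h0" "j - 2 * h \<noteq> - 1 - h0"
    and f: "f \<in> fsup (gens h j)" "d 0 E f = 0"
  shows "\<exists>g\<in>fsup (gens (h - 1) j). d 0 E g = f"
proof -
  have "f \<in> Spt {} E"
    unfolding Spt_def itv_def
  proof (intro CollectI allI impI)
    fix W A assume "f (W, A) \<noteq> 0"
    then have "(W, A) \<in> gens h j" using fsupD[OF f(1)] by blast
    then show "({} \<subseteq> W \<and> W \<subseteq> {} \<union> E) \<and> W \<subseteq> E \<and> A \<subseteq> P W" by (simp add: gens_def)
  qed
  moreover have "homog (j - 2 * h) f"
    unfolding homog_def
  proof (intro allI impI, clarify)
    fix W A assume "f (W, A) \<noteq> 0"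
    then have "(W, A) \<in> gens h j" using fsupD[OF f(1)] by blast
    then show "slope (W, A) = j - 2 * h" by (simp add: gens_def slope_def deg_def)
  qed
  ultimately obtain g where g: "g \<in> Spt {} E" "homog (j - 2 * h + 2) g" "d 0 E g = f"
    using thin[OF E_nonempty tree_height off, where C = "{}" and N = E and f = f] connected f(2) by auto
  define g' where "g' = mask (\<lambda>W. of_bool (ht W = h - 1)) g"
  have "g' \<in> fsup (gens (h - 1) j)"
  proof (rule fsupI, clarify)
    fix W A assume "g' (W, A) \<noteq> 0"
    then have *: "ht W = h - 1" "g (W, A) \<noteq> 0" by (auto simp: g'_def)
    then have "slope (W, A) = j - 2 * h + 2" using g(2) unfolding homog_def by blast
    then show "(W, A) \<in> gens (h - 1) j" using * SptD[OF g(1) *(2)]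
      by (auto simp: gens_def slope_def deg_def)
  qed
  moreover have "d 0 E g' = mask (\<lambda>W. of_bool (ht W - 1 = h - 1)) f"
    unfolding g'_def using d_mask_ht[of 0 "\<lambda>k. of_bool (k = h - 1)" g] g(3) by simp
  moreover have "mask (\<lambda>W. of_bool (ht W - 1 = h - 1)) f = f"
  proof (rule ext, clarify)
    fix W A
    show "mask (\<lambda>W. of_bool (ht W - 1 = h - 1)) f (W, A) = f (W, A)"
      using fsupD[OF f(1), of "(W, A)"] by (auto simp: gens_def)
  qed
  ultimately show ?thesis by auto
qed

lemma kappa_exact:
  assumes "j - 2 * h \<noteq> 1 - h0" "j - 2 * h \<noteq> - 1 - h0"
  shows "kappa h j + kappa (h - 1) j = card (gens (h - 1) j)"
proof -
  have "d 0 E ` fsup (gens (h - 1) j) = {f\<in>fsup (gens h j). d 0 E f = 0}"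
  proof (intro equalityI subsetI)
    fix f assume "f \<in> d 0 E ` fsup (gens (h - 1) j)"
    then show "f \<in> {f\<in>fsup (gens h j). d 0 E f = 0}"
      using d0_gens[of _ "h - 1" j] d_d[OF order_refl] by auto
  next
    fix f assume "f \<in> {f\<in>fsup (gens h j). d 0 E f = 0}"
    then show "f \<in> d 0 E ` fsup (gens (h - 1) j)" using exact[OF assms] by blast
  qed
  moreover have "rv.dim (fsup (gens (h - 1) j)) = rv.dim {f\<in>fsup (gens (h - 1) j). d 0 E f = 0}
      + rv.dim (d 0 E ` fsup (gens (h - 1) j))"
    by (rule rank_nullity[OF d_linear fsup_subspace order_refl finite_gens])
  ultimately show ?thesis by (simp add: kappa_def dim_fsup finite_gens)
qed

text \<open>In height \<open>h + 1\<close> the two diagonals are the degrees 2h - h0 + 1 and 2h - h0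
  + 3. In the residue class of the former, degrees from 2h - h0 + 2 on meet neither, so the leading
  term of a cycle is always a boundary and can be removed, degree by degree up to
  \<open>dmax\<close>.\<close>

lemma lee_lift:
  assumes c: "c mod 4 = (2 * h - h0 + 1) mod 4"
  shows "2 * h - h0 + 2 \<le> m \<Longrightarrow> z \<in> fsup (gc (h + 1) c m) \<Longrightarrow> d 1 E z = 0 \<Longrightarrow>
    \<exists>w\<in>fsup (gc h c m). d 1 E w = z"
proof (induction "nat (dmax + 1 - m)" arbitrary: m z)
  case 0
  then have "z = 0" using gc_top[of m "h + 1" c] by (simp add: fsup_empty)
  moreover have "0 \<in> fsup (gc h c m)" by (simp add: fsup_def)
  ultimately show ?case using rlin_0[OF d_linear] by blast
next
  case (Suc n)
  have n: "n = nat (dmax + 1 - (m + 1))" "2 * h - h0 + 2 \<le> m + 1" using Suc by auto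
  let ?z = "restr (\<lambda>x. deg x = m) z"
  show ?case
  proof (cases "m mod 4 = c mod 4")
    case False
    then have "z \<in> fsup (gc (h + 1) c (m + 1))" using Suc.prems lead_0 lead_mod by blast
    then obtain w where "w \<in> fsup (gc h c (m + 1))" "d 1 E w = z"
      using Suc.hyps(1)[OF n] Suc.prems(3) by blast
    then show ?thesis using fsup_mono[OF gc_mono[of m "m + 1" h c]] by auto
  next
    case True
    have "d 0 E ?z = 0" using d0_lead[OF Suc.prems(2)] Suc.prems(3) by (auto simp: restr_def fun_eq_iff)
    moreover have "m - 2 * (h + 1) \<noteq> 1 - h0" "m - 2 * (h + 1) \<noteq> - 1 - h0"
      using True c Suc.prems(1) by presburger+
    ultimately obtain w0 where w0: "w0 \<in> fsup (gens h m)" "d 0 E w0 = ?z"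
      using exact[of m "h + 1" ?z] lead_gens[OF Suc.prems(2)] by auto
    have w0': "w0 \<in> fsup (gc h c m)" using w0(1) fsup_mono[OF gens_gc[OF True order_refl]] by blast
    let ?y = "z - d 1 E w0"
    have y: "?y \<in> fsup (gc (h + 1) c m)" using fsup_diff[OF Suc.prems(2) d1_gc[OF w0']] .
    have "restr (\<lambda>x. deg x = m) w0 = w0" using lead_id[OF w0(1)] .
    then have "restr (\<lambda>x. deg x = m) ?y = 0"
      using d0_lead[OF w0'] w0(2) by (simp add: rlin_diff[OF restr_linear])
    then have "?y \<in> fsup (gc (h + 1) c (m + 1))" using lead_0[OF y] by blast
    moreover have "d 1 E ?y = 0" using Suc.prems(3) d_d[OF order_refl] by (simp add: rlin_diff[OF d_linear])
    ultimately obtain w1 where w1: "w1 \<in> fsup (gc h c (m + 1))" "d 1 E w1 = ?y"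
      using Suc.hyps(1)[OF n] by blast
    then have "w1 \<in> fsup (gc h c m)" using fsup_mono[OF gc_mono[of m "m + 1" h c]] by auto
    then have "w0 + w1 \<in> fsup (gc h c m)" using w0' fsup_add by blast
    moreover have "d 1 E (w0 + w1) = z" using w1(2) by (simp add: rlin_add[OF d_linear])
    ultimately show ?thesis by blast
  qed
qed

text \<open>Every undeformed cycle of this class is the leading term of a Lee cycle. Below the upper
  diagonal it is a boundary, and the Lee boundary of the same chain serves. From there on the error
  \<open>d 1 E x\<close> starts in degree \<open>m + 4\<close>, where \<open>lee_lift\<close>
  removes it.\<close>

lemma lead_image:
  assumes c: "c mod 4 = (2 * h - h0 + 1) mod 4" and m: "m mod 4 = c mod 4"
  shows "restr (\<lambda>x. deg x = m) ` lker h c m = {f\<in>fsup (gens h m). d 0 E f = 0}"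
proof (intro equalityI subsetI)
  fix y assume "y \<in> restr (\<lambda>x. deg x = m) ` lker h c m"
  then obtain f where f: "f \<in> fsup (gc h c m)" "d 1 E f = 0" "y = restr (\<lambda>x. deg x = m) f"
    by (auto simp: lker_def)
  then show "y \<in> {f\<in>fsup (gens h m). d 0 E f = 0}"
    using lead_gens[OF f(1)] d0_lead[OF f(1)] rlin_0[OF restr_linear] by simp
next
  fix x assume "x \<in> {f\<in>fsup (gens h m). d 0 E f = 0}"
  then have x: "x \<in> fsup (gens h m)" "d 0 E x = 0" by auto
  have x': "x \<in> fsup (gc h c m)" using x(1) fsup_mono[OF gens_gc[OF m order_refl]] by blast
  note lx = lead_id[OF x(1)]
  have l0: "restr (\<lambda>x. deg x = m) w = 0" if "w \<in> fsup (gc k c (m + 4))" for w k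
    using lead_above[OF that] by simp
  show "x \<in> restr (\<lambda>x. deg x = m) ` lker h c m"
  proof (cases "m < 2 * h - h0 + 1")
    case True
    then have "m - 2 * h \<noteq> 1 - h0" "m - 2 * h \<noteq> - 1 - h0" using m c by presburger+
    then obtain w where w: "w \<in> fsup (gens (h - 1) m)" "d 0 E w = x" using exact x by blast
    have w': "w \<in> fsup (gc (h - 1) c m)" using w(1) fsup_mono[OF gens_gc[OF m order_refl]] by blast
    have "d 1 E w \<in> lker h c m" using d1_gc[OF w'] d_d[OF order_refl] by (simp add: lker_def)
    moreover have "d 1 E w = x + (d 1 E w - d 0 E w)" using w(2) by simp
    then have "restr (\<lambda>x. deg x = m) (d 1 E w) = x"
      using l0[OF dd_gc[OF w']] lx by (metis add.right_neutral rlin_add[OF restr_linear])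
    ultimately show ?thesis by (metis image_eqI)
  next
    case False
    have "d 1 E x \<in> fsup (gc (h + 1) c (m + 4))" using dd_gc[OF x'] x(2) by simp
    then obtain w where w: "w \<in> fsup (gc h c (m + 4))" "d 1 E w = d 1 E x"
      using lee_lift[OF c, of "m + 4" "d 1 E x"] False d_d[OF order_refl] by auto
    have "w \<in> fsup (gc h c m)" using w(1) fsup_mono[OF gc_mono[of m "m + 4" h c]] by auto
    then have "x - w \<in> lker h c m" using x' w(2) by (simp add: lker_def fsup_diff rlin_diff[OF d_linear])
    moreover have "restr (\<lambda>x. deg x = m) (x - w) = x"
      using l0[OF w(1)] lx by (simp add: rlin_diff[OF restr_linear])
    ultimately show ?thesis by (metis image_eqI)
  qed
qed

lemma lker_step:
  assumes c: "c mod 4 = (2 * h - h0 + 1) mod 4"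
  shows "rv.dim (lker h c m) = rv.dim (lker h c (m + 1)) + (if m mod 4 = c mod 4 then kappa h m else 0)"
proof -
  let ?l = "restr (\<lambda>x. deg x = m)"
  have "rv.subspace (lker h c m)" unfolding lker_def by (rule kernel_subspace[OF d_linear fsup_subspace])
  moreover have "lker h c m \<subseteq> fsup (gc h c m)" by (auto simp: lker_def)
  ultimately have rn: "rv.dim (lker h c m) = rv.dim {f\<in>lker h c m. ?l f = 0} + rv.dim (?l ` lker h c m)"
    by (rule rank_nullity[OF restr_linear _ _ finite_gc])
  have "?l f = 0" if "f \<in> fsup (gc h c (m + 1))" for f
    using lead_above[OF that] by simp
  moreover have "fsup (gc h c (m + 1)) \<subseteq> fsup (gc h c m)" by (rule fsup_mono[OF gc_mono]) simp
  ultimately have "{f\<in>lker h c m. ?l f = 0} = lker h c (m + 1)"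
    using lead_0[of _ h c m] unfolding lker_def by blast
  moreover have "rv.dim (?l ` lker h c m) = (if m mod 4 = c mod 4 then kappa h m else 0)"
  proof (cases "m mod 4 = c mod 4")
    case True
    then show ?thesis using lead_image[OF c True] by (simp add: kappa_def)
  next
    case False
    have "0 \<in> lker h c m" using rlin_0[OF d_linear] by (simp add: lker_def fsup_def)
    moreover have "?l f = 0" if "f \<in> lker h c m" for f using lead_mod[of f h c m, OF _ False] that by (simp add: lker_def)
    ultimately have "?l ` lker h c m = {0}" by (auto simp: image_iff)
    then show ?thesis using False dim_zero by simp
  qed
  ultimately show ?thesis using rn by simp
qed

text \<open>Each step of the filtration contributes one \<open>kappa\<close>; the induction descends
  from \<open>dmax + 1\<close>, where no generators are left.\<close>

lemma lker_sum:
  assumes c: "c mod 4 = (2 * h - h0 + 1) mod 4"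
  shows "rv.dim (lker h c (- dmax)) = (\<Sum>m\<in>{m\<in>{- dmax..dmax}. m mod 4 = c mod 4}. kappa h m)"
proof -
  have "rv.dim (lker h c (dmax + 1 - int n)) =
    (\<Sum>m\<in>{m\<in>{dmax + 1 - int n..dmax}. m mod 4 = c mod 4}. kappa h m)" for n
  proof (induction n)
    case 0
    have "lker h c (dmax + 1) = {0}"
      using rlin_0[OF d_linear] by (auto simp: lker_def gc_top fsup_empty)
    then show ?case using dim_zero by simp
  next
    case (Suc n)
    define k where "k = dmax + 1 - int (Suc n)"
    define X where "X = {m\<in>{dmax + 1 - int n..dmax}. m mod 4 = c mod 4}"
    have k1: "k + 1 = dmax + 1 - int n" and "k \<le> dmax" by (auto simp: k_def)
    then have "{k..dmax} = insert k {dmax + 1 - int n..dmax}" by auto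
    then have iv: "{m\<in>{k..dmax}. m mod 4 = c mod 4} = (if k mod 4 = c mod 4 then insert k X else X)"
      by (auto simp: X_def)
    have "finite X" unfolding X_def by (rule finite_subset[of _ "{dmax + 1 - int n..dmax}"]) auto
    moreover have "k \<notin> X" by (auto simp: X_def k_def)
    ultimately have X: "finite X" "k \<notin> X" by blast+
    have "rv.dim (lker h c k) = (\<Sum>m\<in>X. kappa h m) + (if k mod 4 = c mod 4 then kappa h k else 0)"
      unfolding lker_step[OF c, of k] k1 Suc.IH X_def by simp
    then show ?case unfolding k_def[symmetric] iv using X by simp
  qed
  from this[of "nat (2 * dmax + 1)"] show ?thesis by (simp add: dmax_def)
qed

end

section \<open>Counting the Lee kernel by colourings\<close>

context thin_ribbon
begin

text \<open>A toggle changes the number of circles by one and the height by one, so the parity of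
  their sum is that of the empty state.\<close>

lemma parity: "W \<subseteq> E \<Longrightarrow> even (int (card (P W)) + ht W + h0 + 1)"
proof -
  assume W: "W \<subseteq> E"
  then have "finite W" using finE finite_subset by blast
  then show ?thesis using W
  proof (induction W)
    case empty
    then show ?case by (simp add: h0_eq)
  next
    case (insert e W)
    then have "W \<subseteq> E" "e \<in> E" "tog e W = insert e W" by (auto simp: tog_def)
    then show ?case using insert card_P_tog[of W e] ht_tog[of W e] by (auto split: if_splits)
  qed
qed

text \<open>A base point that picks one colouring out of each complementary pair.\<close>

definition x0 :: "'a \<times> bool" where "x0 = (SOME e. e \<in> E, False)"

lemma x0_H: "x0 \<in> H"
  using E_nonempty by (simp add: x0_def mem_H some_in_eq)

definition Y :: "int \<Rightarrow> ('a set \<times> ('a \<times> bool) set) set" where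
  "Y h = {(W, B). W \<subseteq> E \<and> ht W = h \<and> col W B \<and> x0 \<notin> B}"

text \<open>Colourings in which every edge has different colours on its sides. The deformed
  differential vanishes on them, and they count the Lee homology.\<close>

definition Good :: "int \<Rightarrow> ('a set \<times> ('a \<times> bool) set) set" where
  "Good h = {(W, B) \<in> Y h. \<forall>e\<in>E. ((e, False) \<in> B) \<noteq> ((e, True) \<in> B)}"

definition FT :: "('a bgen \<Rightarrow> rat) \<Rightarrow> 'a set \<times> ('a \<times> bool) set \<Rightarrow> rat" where
  "FT f = (\<lambda>(W, B). if W \<subseteq> E \<and> col W B \<and> x0 \<notin> B then hat 1 f W B else 0)"

definition DD :: "('a set \<times> ('a \<times> bool) set \<Rightarrow> rat) \<Rightarrow> 'a set \<times> ('a \<times> bool) set \<Rightarrow> rat" where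
  "DD g = (\<lambda>(W, B). if W \<subseteq> E \<and> col W B \<and> x0 \<notin> B
     then \<Sum>e\<in>E - W. sg W e * cc 1 W e B * g (insert e W, B) else 0)"

lemma finite_Y: "finite (Y h)"
proof (rule finite_subset)
  show "Y h \<subseteq> Pow E \<times> Pow H" by (auto simp: Y_def col_def)
  show "finite (Pow E \<times> Pow H)" using finE finH by simp
qed

lemma FT_linear: "rlin FT"
  by (rule rlinI)
    (auto simp: FT_def hat_def rscale_apply sum.distrib sum_distrib_left algebra_simps)

lemma DD_linear: "rlin DD"
  by (rule rlinI) (auto simp: DD_def rscale_apply sum.distrib sum_distrib_left algebra_simps)

text \<open>The transform turns the Lee differential into \<open>DD\<close>, which acts on each
  colouring separately. Source states that \<open>B\<close> does not colour enter with
  \<open>cc = 0\<close>.\<close>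

lemma FT_d: "FT (d 1 E f) = DD (FT f)"
proof (rule ext, clarify)
  fix W B
  show "FT (d 1 E f) (W, B) = DD (FT f) (W, B)"
  proof (cases "W \<subseteq> E \<and> col W B \<and> x0 \<notin> B")
    case True
    then have W: "W \<subseteq> E" and B: "col W B" by auto
    have "hat 1 (d 1 E f) W B = (\<Sum>e\<in>E. hat 1 (Rop 1 e f) W B)"
      unfolding hat_def d_def sum_fun_apply sum_distrib_right by (rule sum.swap)
    also have "\<dots> = (\<Sum>e\<in>E. if e \<in> W then 0 else sg W e * hat 1 (T 1 e f) W B)"
      by (intro sum.cong refl) (auto simp: hat_def Rop_def sum_distrib_left mult.assoc)
    also have "\<dots> = (\<Sum>e\<in>E - W. sg W e * hat 1 (T 1 e f) W B)"
      using finE by (simp add: sum.If_cases Diff_eq)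
    also have "\<dots> = (\<Sum>e\<in>E - W. sg W e * cc 1 W e B * FT f (insert e W, B))"
    proof (intro sum.cong refl)
      fix e assume e: "e \<in> E - W"
      then have tog: "tog e W = insert e W" by (simp add: tog_def)
      have "hat 1 (T 1 e f) W B = cc 1 W e B * hat 1 f (insert e W) B"
        using hat_T[OF W _ B, of e 1 f] e tog by simp
      moreover have "cc 1 W e B = 0 \<or> FT f (insert e W, B) = hat 1 f (insert e W) B"
        using col_tog[OF B, of e] tog W e True by (auto simp: cc_def FT_def)
      ultimately show "sg W e * hat 1 (T 1 e f) W B = sg W e * cc 1 W e B * FT f (insert e W, B)"
        by auto
    qed
    finally show ?thesis using True by (simp add: FT_def DD_def)
  qed (auto simp: FT_def DD_def)
qed

context
  fixes c :: int
  assumes c: "even (c + h0 + 1)"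
begin

text \<open>Within one residue class of degrees mod 4 the parity of the number of labels v_- is
  determined by the state; this is its sign. It relates the transform at a colouring and at its
  complement (\<open>hat_compl\<close>), so the colourings avoiding \<open>x0\<close> carry all
  information.\<close>

definition par :: "'a set \<Rightarrow> rat" where
  "par W = (if (int (card (P W)) + ht W - c) mod 4 = 0 then 1 else -1)"

lemma gc_iff:
  "(W, A) \<in> gc h c (- dmax) \<longleftrightarrow> W \<subseteq> E \<and> A \<subseteq> P W \<and> ht W = h \<and> (-1) ^ card A = par W"
proof (cases "W \<subseteq> E \<and> A \<subseteq> P W \<and> ht W = h")
  case True
  define k where "k = int (card (P W)) + ht W - c"
  have "even (int (card (P W)) + ht W + h0 + 1)" using parity True by blast
  then have "even ((int (card (P W)) + ht W + h0 + 1) - (c + h0 + 1))" using c by (rule dvd_diff)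
  then have k: "even k" by (simp add: k_def)
  have "deg (W, A) = k + c - 2 * int (card A)" by (simp add: deg_def dv_def k_def)
  then have "deg (W, A) mod 4 = c mod 4 \<longleftrightarrow> (k - 2 * int (card A)) mod 4 = 0" by presburger
  also have "\<dots> \<longleftrightarrow> (even (card A) \<longleftrightarrow> k mod 4 = 0)" using k by presburger
  also have "\<dots> \<longleftrightarrow> (-1) ^ card A = par W"
    by (cases "even (card A)") (simp_all add: par_def k_def[symmetric])
  finally show ?thesis using True deg_bounds[of W A] by (simp add: gc_def)
qed (auto simp: gc_def)

lemma chi_compl:
  assumes W: "W \<subseteq> E" and B: "col W B" and A: "A \<subseteq> P W"
  shows "chi 1 A (H - B) = (-1) ^ card A * chi 1 A B"
proof -
  have "val 1 (H - B) a = (-1) * val 1 B a" if aA: "a \<in> A" for a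
  proof -
    obtain x where x: "x \<in> H" "a = cyc W x" using subsetD[OF A aA] unfolding P_def by blast
    then show ?thesis
      using col_cyc_subset[OF W B x(1)] col_cyc_subset[OF W col_compl[OF W B] x(1)]
      by (auto simp: val_def)
  qed
  then have "chi 1 A (H - B) = (\<Prod>a\<in>A. (-1) * val 1 B a)" unfolding chi_def by (rule prod.cong[OF refl])
  then show ?thesis by (simp only: prod.distrib prod_constant chi_def)
qed

lemma hat_compl:
  assumes f: "f \<in> fsup (gc h c (- dmax))" and W: "W \<subseteq> E" and B: "col W B"
  shows "hat 1 f W (H - B) = par W * hat 1 f W B"
  unfolding hat_def sum_distrib_left
proof (intro sum.cong refl)
  fix A assume A: "A \<in> Pow (P W)"
  show "f (W, A) * chi 1 A (H - B) = par W * (f (W, A) * chi 1 A B)"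
  proof (cases "f (W, A) = 0")
    case False
    then have "(W, A) \<in> gc h c (- dmax)" using fsupD[OF f] by blast
    then have "(-1) ^ card A = par W" by (simp add: gc_iff)
    then show ?thesis using chi_compl[OF W B] A by simp
  qed simp
qed

lemma FT_supp: "f \<in> fsup (gc h c (- dmax)) \<Longrightarrow> FT f \<in> fsup (Y h)"
proof (rule fsupI, clarify)
  fix W B assume f: "f \<in> fsup (gc h c (- dmax))" and nz: "FT f (W, B) \<noteq> 0"
  then have *: "W \<subseteq> E" "col W B" "x0 \<notin> B" "hat 1 f W B \<noteq> 0" by (auto simp: FT_def split: if_splits)
  have "\<exists>A. f (W, A) \<noteq> 0"
  proof (rule ccontr)
    assume "\<not> ?thesis"
    then have "hat 1 f W B = 0" by (simp add: hat_def)
    then show False using *(4) by simp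
  qed
  then obtain A where "f (W, A) \<noteq> 0" by blast
  then have "ht W = h" using fsupD[OF f, of "(W, A)"] by (simp add: gc_def)
  then show "(W, B) \<in> Y h" using * by (simp add: Y_def)
qed

lemma FT_inj:
  assumes f: "f \<in> fsup (gc h c (- dmax))" and 0: "FT f = 0"
  shows "f = 0"
proof (rule ext, clarify, rule ccontr)
  fix W A assume nz: "f (W, A) \<noteq> 0 (W, A)"
  then have WA: "W \<subseteq> E" "A \<subseteq> P W" using fsupD[OF f, of "(W, A)"] by (auto simp: gc_def)
  have z: "hat 1 f W B = 0" if "col W B" "x0 \<notin> B" for B
  proof -
    have "FT f (W, B) = 0" using 0 by simp
    then show ?thesis using that WA by (simp add: FT_def)
  qed
  have "hat 1 f W B = 0" if B: "col W B" for B
  proof (cases "x0 \<in> B")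
    case True
    have "par W * hat 1 f W B = 0"
      using z[OF col_compl[OF WA(1) B]] True hat_compl[OF f WA(1) B] by simp
    then show ?thesis by (auto simp: par_def split: if_splits)
  qed (use z B in blast)
  then show False using hat_inj[OF WA(1) _ WA(2), of 1 f] nz by simp
qed

lemma chi_orth2:
  assumes W: "W \<subseteq> E" and C: "C \<subseteq> P W" and C': "C' \<subseteq> P W"
  shows "(\<Sum>A\<in>Pow (P W). chi 1 A (\<Union>C) * chi 1 A (\<Union>C')) = (if C = C' then 2 ^ card (P W) else 0)"
proof -
  let ?w = "\<lambda>a. val 1 (\<Union>C) a * val 1 (\<Union>C') a"
  have "(\<Sum>A\<in>Pow (P W). chi 1 A (\<Union>C) * chi 1 A (\<Union>C')) = (\<Sum>A\<in>Pow (P W). \<Prod>a\<in>A. ?w a)"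
    by (simp add: chi_def prod.distrib)
  also have "\<dots> = (\<Prod>a\<in>P W. ?w a + 1)" by (rule sum_Pow_prod) simp
  also have "\<dots> = (if \<forall>a\<in>P W. ?w a = 1 then 2 ^ card (P W) else 0)"
    by (rule prod_pm_eq) (auto simp: val_def)
  also have "(\<forall>a\<in>P W. ?w a = 1) \<longleftrightarrow> (\<forall>a\<in>P W. a \<in> C \<longleftrightarrow> a \<in> C')"
    using subset_Union_iff[OF W C] subset_Union_iff[OF W C'] by (intro ball_cong refl) (simp add: val_def)
  also have "\<dots> \<longleftrightarrow> C = C'" using C C' by blast
  finally show ?thesis .
qed

lemma col_as_Union:
  assumes W: "W \<subseteq> E" and B: "col W B"
  obtains C where "C \<subseteq> P W" "B = \<Union>C"
proof
  show "{a\<in>P W. a \<subseteq> B} \<subseteq> P W" by blast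
  show "B = \<Union>{a\<in>P W. a \<subseteq> B}"
  proof (intro equalityI subsetI)
    fix x assume x: "x \<in> B"
    then have "x \<in> H" using B by (auto simp: col_def)
    then have "cyc W x \<in> P W" "cyc W x \<subseteq> B" "x \<in> cyc W x"
      using col_cyc_subset[OF W B] x cyc_self[OF W] cyc_in_P by auto
    then show "x \<in> \<Union>{a\<in>P W. a \<subseteq> B}" by blast
  qed auto
qed

lemma Union_compl: "W \<subseteq> E \<Longrightarrow> C \<subseteq> P W \<Longrightarrow> \<Union>(P W - C) = H - \<Union>C"
proof -
  assume W: "W \<subseteq> E" and C: "C \<subseteq> P W"
  show ?thesis
  proof (intro equalityI subsetI)
    fix x assume "x \<in> \<Union>(P W - C)"
    then obtain a where a: "a \<in> P W" "a \<notin> C" "x \<in> a" by blast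
    then have "x \<notin> \<Union>C" using C P_disjoint[OF W a(1)] by blast
    then show "x \<in> H - \<Union>C" using a Union_P[OF W] by blast
  next
    fix x assume x: "x \<in> H - \<Union>C"
    then show "x \<in> \<Union>(P W - C)" using Union_P[OF W] by blast
  qed
qed

lemma FT_surj:
  assumes g: "g \<in> fsup (Y h)"
  shows "\<exists>f\<in>fsup (gc h c (- dmax)). FT f = g"
proof -
  \<comment> \<open>\<open>g\<close> is continued to the colourings containing \<open>x0\<close> by
    the symmetry that transforms of this residue class obey.\<close>
  define ex where "ex W B = (if x0 \<notin> B then g (W, B) else par W * g (W, H - B))" for W B
  define q where "q W A = (\<Sum>C\<in>Pow (P W). chi 1 A (\<Union>C) * ex W (\<Union>C)) / 2 ^ card (P W)" for W A
  define f where "f = (\<lambda>(W, A). if (W, A) \<in> gc h c (- dmax) then q W A else 0)"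
  have fs: "f \<in> fsup (gc h c (- dmax))" by (auto simp: fsup_def f_def)
  have ex_compl: "ex W (H - B) = par W * ex W B" if "B \<subseteq> H" for W B
  proof -
    have "H - (H - B) = B" using that by blast
    moreover have "par W * (par W * y) = y" for y by (simp add: par_def)
    ultimately show ?thesis using x0_H by (auto simp: ex_def)
  qed
  \<comment> \<open>The inverse transform yields no coefficient of the wrong parity: complementing
    the summation variable reverses the sign of the sum.\<close>
  have q0: "q W A = 0" if W: "W \<subseteq> E" and A: "A \<subseteq> P W" and ne: "(-1) ^ card A \<noteq> par W" for W A
  proof -
    let ?s = "\<Sum>C\<in>Pow (P W). chi 1 A (\<Union>C) * ex W (\<Union>C)"
    have "?s = (\<Sum>C\<in>Pow (P W). chi 1 A (\<Union>(P W - C)) * ex W (\<Union>(P W - C)))"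
      by (rule sum.reindex_bij_witness[of _ "\<lambda>C. P W - C" "\<lambda>C. P W - C"])
        (auto simp: double_diff)
    also have "\<dots> = (\<Sum>C\<in>Pow (P W). ((-1) ^ card A * par W) * (chi 1 A (\<Union>C) * ex W (\<Union>C)))"
    proof (intro sum.cong refl)
      fix C assume "C \<in> Pow (P W)"
      then have C: "C \<subseteq> P W" by blast
      have "\<Union>C \<subseteq> H" using C Union_P[OF W] by blast
      then show "chi 1 A (\<Union>(P W - C)) * ex W (\<Union>(P W - C)) =
          ((-1) ^ card A * par W) * (chi 1 A (\<Union>C) * ex W (\<Union>C))"
        unfolding Union_compl[OF W C] by (simp add: chi_compl[OF W col_Union[OF W C] A] ex_compl)
    qed
    also have "\<dots> = - ?s"
    proof -
      have p1: "par W = 1 \<or> par W = -1" by (simp add: par_def)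
      have k: "(-1) ^ card A * par W = -1"
      proof (cases "even (card A)")
        case True
        then have "(-1 :: rat) ^ card A = 1" by simp
        then show ?thesis using ne p1 by auto
      next
        case False
        then have "(-1 :: rat) ^ card A = -1" by simp
        then show ?thesis using ne p1 by auto
      qed
      show ?thesis unfolding k sum_distrib_left[symmetric] by simp
    qed
    finally have "?s = 0" by linarith
    then show ?thesis by (simp only: q_def div_0)
  qed
  have "FT f (W, B) = g (W, B)" for W B
  proof (cases "(W, B) \<in> Y h")
    case False
    then show ?thesis using fsupD[OF g, of "(W, B)"] fsupD[OF FT_supp[OF fs], of "(W, B)"] by force
  next
    case True
    then have W: "W \<subseteq> E" "ht W = h" and B: "col W B" "x0 \<notin> B" by (auto simp: Y_def)
    obtain C where C: "C \<subseteq> P W" "B = \<Union>C" using col_as_Union[OF W(1) B(1)] .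
    have "hat 1 f W B = (\<Sum>A\<in>Pow (P W). q W A * chi 1 A (\<Union>C))"
      unfolding hat_def C(2)
      by (intro sum.cong refl) (auto simp: f_def gc_iff W q0)
    also have "\<dots> = (\<Sum>A\<in>Pow (P W). \<Sum>C'\<in>Pow (P W). ex W (\<Union>C') / 2 ^ card (P W) *
        (chi 1 A (\<Union>C') * chi 1 A (\<Union>C)))"
      unfolding q_def sum_divide_distrib sum_distrib_right by (intro sum.cong refl) simp
    also have "\<dots> = (\<Sum>C'\<in>Pow (P W). ex W (\<Union>C') / 2 ^ card (P W) *
        (\<Sum>A\<in>Pow (P W). chi 1 A (\<Union>C') * chi 1 A (\<Union>C)))"
      unfolding sum_distrib_left by (rule sum.swap)
    also have "\<dots> = (\<Sum>C'\<in>Pow (P W). if C' = C then ex W (\<Union>C) else 0)"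
      by (intro sum.cong refl) (auto simp: chi_orth2[OF W(1) _ C(1)])
    also have "\<dots> = ex W B" using C by simp
    finally show ?thesis using W B by (simp add: FT_def ex_def)
  qed
  then show ?thesis using fs by (auto simp: fun_eq_iff)
qed

lemma FT_image: "FT ` fsup (gc h c (- dmax)) = fsup (Y h)"
proof (intro equalityI subsetI)
  fix g assume "g \<in> FT ` fsup (gc h c (- dmax))"
  then show "g \<in> fsup (Y h)" using FT_supp by blast
next
  fix g assume "g \<in> fsup (Y h)"
  then show "g \<in> FT ` fsup (gc h c (- dmax))" using FT_surj by blast
qed

lemma card_Y: "card (Y h) = card (gc h c (- dmax))"
  using dim_inj_image[OF FT_linear fsup_subspace order_refl finite_gc, of h c "- dmax"] FT_inj
    FT_image[of h] by (simp add: dim_fsup finite_Y finite_gc)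

definition hker :: "int \<Rightarrow> ('a set \<times> ('a \<times> bool) set \<Rightarrow> rat) set" where
  "hker h = {g\<in>fsup (Y h). DD g = 0}"

lemma FT_lker: "FT ` lker h c (- dmax) = hker h"
proof (intro equalityI subsetI)
  fix g assume "g \<in> FT ` lker h c (- dmax)"
  then obtain f where f: "f \<in> fsup (gc h c (- dmax))" "d 1 E f = 0" "g = FT f"
    by (auto simp: lker_def)
  then have "DD g = 0" using FT_d[of f] rlin_0[OF FT_linear] by simp
  then show "g \<in> hker h" using FT_supp f by (simp add: hker_def)
next
  fix g assume g: "g \<in> hker h"
  then obtain f where f: "f \<in> fsup (gc h c (- dmax))" "FT f = g"
    using FT_surj by (auto simp: hker_def)
  then have "FT (d 1 E f) = 0" using g FT_d by (simp add: hker_def)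
  then have "d 1 E f = 0" using FT_inj[OF d1_gc[OF f(1)]] by blast
  then show "g \<in> FT ` lker h c (- dmax)" using f by (auto simp: lker_def)
qed

lemma dim_hker: "rv.dim (hker h) = rv.dim (lker h c (- dmax))"
proof -
  have "rv.subspace (lker h c (- dmax))" unfolding lker_def by (rule kernel_subspace[OF d_linear fsup_subspace])
  moreover have "lker h c (- dmax) \<subseteq> fsup (gc h c (- dmax))" by (auto simp: lker_def)
  ultimately have "rv.dim (FT ` lker h c (- dmax)) = rv.dim (lker h c (- dmax))"
    using FT_inj by (intro dim_inj_image[OF FT_linear _ _ finite_gc]) auto
  then show ?thesis by (simp only: FT_lker)
qed

lemma DD_DD: "g \<in> fsup (Y h) \<Longrightarrow> DD (DD g) = 0"
proof -
  assume "g \<in> fsup (Y h)"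
  then obtain f where "FT f = g" using FT_surj by blast
  then have "DD (DD g) = FT (d 1 E (d 1 E f))" by (simp only: FT_d)
  then show ?thesis using d_d[OF order_refl, of 1 f] rlin_0[OF FT_linear] by simp
qed

lemma DD_supp: "g \<in> fsup (Y h) \<Longrightarrow> DD g \<in> fsup (Y (h + 1))"
proof -
  assume "g \<in> fsup (Y h)"
  then obtain f where f: "f \<in> fsup (gc h c (- dmax))" "FT f = g" using FT_surj by blast
  have "FT (d 1 E f) \<in> fsup (Y (h + 1))" by (rule FT_supp[OF d1_gc[OF f(1)]])
  then show ?thesis by (simp add: FT_d f(2))
qed

lemma DD_Good:
  assumes "(W, B) \<in> Good h" shows "DD g (W, B) = 0"
proof -
  have "cc 1 W e B = 0" if "e \<in> E - W" for e using assms that by (auto simp: Good_def cc_def)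
  then show ?thesis by (simp add: DD_def)
qed

text \<open>If \<open>B\<close> does not separate the two sides of \<open>e\<close>, the part of the deformed differential that
  deletes \<open>e\<close> is invertible on the summand of \<open>B\<close>, which is therefore acyclic.\<close>

lemma DD_exact:
  assumes y: "y \<in> hker (h + 1)" and 0: "\<And>x. x \<in> Good (h + 1) \<Longrightarrow> y x = 0"
  shows "\<exists>x\<in>fsup (Y h). DD x = y"
proof -
  define Q where "Q B e \<longleftrightarrow> e \<in> E \<and> ((e, False) \<in> B \<longleftrightarrow> (e, True) \<in> B)" for B e
  \<comment> \<open>An edge with equal colours on its sides. The choice depends on \<open>B\<close>
    only, so deleting this edge acts invertibly on the whole summand of \<open>B\<close>.\<close>
  define ch where "ch B = (SOME e. Q B e)" for B
  have ch: "Q B (ch B)" if "Q B e" for B e using that unfolding ch_def by (rule someI)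
  have yS: "y \<in> fsup (Y (h + 1))" and Dy: "DD y = 0" using y by (auto simp: hker_def)
  have yQ: "Q B (ch B)" if "y (W, B) \<noteq> 0" for W B
  proof -
    have "(W, B) \<in> Y (h + 1)" "(W, B) \<notin> Good (h + 1)" using that fsupD[OF yS] 0 by blast+
    then show ?thesis using ch by (auto simp: Good_def Q_def)
  qed
  \<comment> \<open>The inverse of the deletion of \<open>ch B\<close>: the sign \<open>sg\<close>
    is its own inverse, and \<open>cc\<close> is divided out.\<close>
  define x where "x = (\<lambda>(W, B). if W \<subseteq> E \<and> Q B (ch B) \<and> ch B \<in> W
    then sg (W - {ch B}) (ch B) / cc 1 (W - {ch B}) (ch B) B * y (W - {ch B}, B) else 0)"
  have xS: "x \<in> fsup (Y h)"
  proof (rule fsupI, clarify)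
    fix W B assume nz: "x (W, B) \<noteq> 0"
    let ?e = "ch B" and ?V = "W - {ch B}"
    have W: "W \<subseteq> E" "Q B ?e" "?e \<in> W" "y (?V, B) \<noteq> 0"
      using nz by (auto simp: x_def split: if_splits)
    then have V: "?V \<subseteq> E" "ht ?V = h + 1" "col ?V B" "x0 \<notin> B"
      using fsupD[OF yS W(4)] unfolding Y_def by simp_all
    moreover have "tog ?e ?V = W" using W by (auto simp: tog_def)
    then have "col W B" using col_tog[OF V(3), of ?e] W(2) by (auto simp: Q_def)
    moreover have "ht W = h" using ht_remove[OF W(1,3)] V(2) by simp
    ultimately show "(W, B) \<in> Y h" using W by (simp add: Y_def)
  qed
  have cc_nz: "cc 1 W e B \<noteq> 0" if "Q B e" for W e B
    using that by (auto simp: cc_def Q_def sg1_def)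
  define z where "z = DD x - y"
  have z0: "z (W, B) = 0" if nW: "ch B \<notin> W" for W B
  proof (cases "W \<subseteq> E \<and> col W B \<and> x0 \<notin> B")
    case False
    then have "y (W, B) = 0" using fsupD[OF yS] by (auto simp: Y_def)
    then show ?thesis using False by (auto simp: z_def DD_def)
  next
    case True
    show ?thesis
    proof (cases "Q B (ch B)")
      case False
      then have "x (V, B) = 0" for V by (simp add: x_def)
      then show ?thesis using yQ[of W B] False True by (auto simp: z_def DD_def)
    next
      case Q: True
      let ?e = "ch B"
      have e: "?e \<in> E - W" using Q nW by (simp add: Q_def)
      have "DD x (W, B) = (\<Sum>e\<in>E - W. sg W e * cc 1 W e B * x (insert e W, B))"
        using True by (simp add: DD_def)
      also have "\<dots> = sg W ?e * cc 1 W ?e B * x (insert ?e W, B)"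
      proof (subst sum.remove[OF _ e])
        have "x (insert e W, B) = 0" if "e \<in> E - W - {?e}" for e
          using that nW by (auto simp: x_def)
        then show "sg W ?e * cc 1 W ?e B * x (insert ?e W, B) +
            (\<Sum>e\<in>E - W - {?e}. sg W e * cc 1 W e B * x (insert e W, B)) =
            sg W ?e * cc 1 W ?e B * x (insert ?e W, B)" by simp
      qed (use finE in simp)
      also have "\<dots> = (sg W ?e * sg W ?e) * y (W, B)"
        using cc_nz[OF Q, of W] Q True e nW by (simp add: x_def Q_def field_simps)
      finally show ?thesis by (simp add: z_def)
    qed
  qed
  have Dz: "DD z = 0" using DD_DD[OF xS] Dy by (simp add: z_def rlin_diff[OF DD_linear])
  have zS: "z \<in> fsup (Y (h + 1))" unfolding z_def using fsup_diff[OF DD_supp[OF xS] yS] .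
  \<comment> \<open>\<open>z\<close> vanishes at states without \<open>ch B\<close>. At
    \<open>W - {ch B}\<close> its differential therefore has a single term, which must be
    zero.\<close>
  have "z (W, B) = 0" for W B
  proof (rule ccontr)
    assume nz: "z (W, B) \<noteq> 0"
    let ?e = "ch B" and ?V = "W - {ch B}"
    have WB: "W \<subseteq> E" "col W B" "x0 \<notin> B" using fsupD[OF zS nz] by (auto simp: Y_def)
    have eW: "?e \<in> W" using z0 nz by blast
    have Q: "Q B ?e"
    proof (rule ccontr)
      assume nQ: "\<not> ?thesis"
      then have "x (V, B) = 0" for V by (simp add: x_def)
      then have "DD x (W, B) = 0" by (simp add: DD_def)
      moreover have "y (W, B) = 0" using yQ nQ by blast
      ultimately show False using nz by (simp add: z_def)
    qed
    have V: "?V \<subseteq> E" "col ?V B" "insert ?e ?V = W" "?e \<in> E - ?V"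
      using WB eW Q col_tog[OF WB(2), of ?e] by (auto simp: Q_def tog_def insert_absorb)
    have "0 = DD z (?V, B)" using Dz by simp
    also have "\<dots> = (\<Sum>e\<in>E - ?V. sg ?V e * cc 1 ?V e B * z (insert e ?V, B))"
      using V WB by (simp add: DD_def)
    also have "\<dots> = sg ?V ?e * cc 1 ?V ?e B * z (insert ?e ?V, B)"
    proof (subst sum.remove[OF _ V(4)])
      have "z (insert e ?V, B) = 0" if "e \<in> E - ?V - {?e}" for e
        using that by (intro z0) auto
      then show "sg ?V ?e * cc 1 ?V ?e B * z (insert ?e ?V, B) +
          (\<Sum>e\<in>E - ?V - {?e}. sg ?V e * cc 1 ?V e B * z (insert e ?V, B)) =
          sg ?V ?e * cc 1 ?V ?e B * z (insert ?e ?V, B)" by simp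
    qed (use finE in simp)
    finally show False using cc_nz[OF Q, of ?V] nz V(3) by simp
  qed
  then have "z = 0" by (auto simp: fun_eq_iff)
  then have "DD x = y" by (simp add: z_def)
  then show ?thesis using xS by blast
qed

text \<open>Cycles that vanish on the good colourings are exactly the boundaries
  (\<open>DD_exact\<close>), and on the good colourings a cycle may take any values. Rank-nullity in
  height \<open>h\<close> then replaces the dimension of the boundaries.\<close>

lemma lee_count:
  "rv.dim (lker (h + 1) c (- dmax)) + rv.dim (lker h c (- dmax)) =
    card (Good (h + 1)) + card (gc h c (- dmax))"
proof -
  let ?r = "restr (\<lambda>x. x \<in> Good (h + 1))"
  have sub: "rv.subspace (hker k)" "hker k \<subseteq> fsup (Y k)" for k
    unfolding hker_def by (rule kernel_subspace[OF DD_linear fsup_subspace]) auto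
  have "rv.dim (hker (h + 1)) = rv.dim {g\<in>hker (h + 1). ?r g = 0} + rv.dim (?r ` hker (h + 1))"
    by (rule rank_nullity[OF restr_linear sub finite_Y])
  also have "{g\<in>hker (h + 1). ?r g = 0} = DD ` fsup (Y h)"
  proof (intro equalityI subsetI)
    fix g assume "g \<in> {g\<in>hker (h + 1). ?r g = 0}"
    then have "g \<in> hker (h + 1)" "\<And>x. x \<in> Good (h + 1) \<Longrightarrow> g x = 0"
      by (auto simp: restr_eq_0_iff)
    then obtain x where "x \<in> fsup (Y h)" "DD x = g" using DD_exact[of g h] by blast
    then show "g \<in> DD ` fsup (Y h)" by blast
  next
    fix g assume "g \<in> DD ` fsup (Y h)"
    then obtain x where x: "x \<in> fsup (Y h)" "g = DD x" by blast
    then have "g \<in> hker (h + 1)" using DD_supp DD_DD by (simp add: hker_def)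
    moreover have "?r g = 0" unfolding restr_eq_0_iff x(2) using DD_Good by auto
    ultimately show "g \<in> {g\<in>hker (h + 1). ?r g = 0}" by simp
  qed
  also have "?r ` hker (h + 1) = fsup (Good (h + 1))"
  proof (intro equalityI subsetI)
    fix g assume "g \<in> ?r ` hker (h + 1)"
    then show "g \<in> fsup (Good (h + 1))" by (auto simp: restr_def fsup_def)
  next
    fix g assume g: "g \<in> fsup (Good (h + 1))"
    have gY: "g \<in> fsup (Y (h + 1))" using g by (auto simp: fsup_def Good_def)
    have "DD g (W, B) = 0" for W B
      unfolding DD_def
    proof -
      have "cc 1 W e B * g (insert e W, B) = 0" if e: "e \<in> E - W" for e
      proof (rule ccontr)
        assume nz: "\<not> ?thesis"
        then have "(insert e W, B) \<in> Good (h + 1)" using fsupD[OF g] by fastforce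
        then show False using e nz by (auto simp: Good_def cc_def split: if_splits)
      qed
      then have "(\<Sum>e\<in>E - W. sg W e * cc 1 W e B * g (insert e W, B)) = 0"
        by (intro sum.neutral) (simp add: mult.assoc)
      then show "(case (W, B) of (W, B) \<Rightarrow> if W \<subseteq> E \<and> col W B \<and> x0 \<notin> B
          then \<Sum>e\<in>E - W. sg W e * cc 1 W e B * g (insert e W, B) else 0) = 0"
        by simp
    qed
    then have "g \<in> hker (h + 1)" using gY by (auto simp: hker_def fun_eq_iff)
    moreover have "?r g = g" using g by (auto simp: restr_def fsup_def fun_eq_iff)
    ultimately show "g \<in> ?r ` hker (h + 1)" by (metis image_eqI)
  qed
  also have "rv.dim (fsup (Good (h + 1))) = card (Good (h + 1))"
    by (rule dim_fsup, rule finite_subset[OF _ finite_Y[of "h + 1"]]) (auto simp: Good_def)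
  finally have 1: "rv.dim (hker (h + 1)) = rv.dim (DD ` fsup (Y h)) + card (Good (h + 1))" .
  have "card (Y h) = rv.dim (hker h) + rv.dim (DD ` fsup (Y h))"
    using rank_nullity[OF DD_linear fsup_subspace order_refl finite_Y, of h]
    by (simp add: dim_fsup finite_Y hker_def)
  then show ?thesis using 1 dim_hker card_Y by simp
qed

end

end

section \<open>Comparison of two connected ribbon graphs\<close>

lemma card_subsets_eq:
  assumes S: "finite S" "finite S'" "card S = card S'"
  shows "card {A. A \<subseteq> S \<and> Q (card A)} = card {A. A \<subseteq> S' \<and> Q (card A)}"
proof -
  obtain f where f: "bij_betw f S S'" using finite_same_card_bij[OF S] by blast
  have inj: "inj_on f S" and im: "f ` S = S'" using f by (auto simp: bij_betw_def)
  have c: "card (f ` A) = card A" if "A \<subseteq> S" for A using card_image inj_on_subset[OF inj that] by blast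
  have "bij_betw ((`) f) {A. A \<subseteq> S \<and> Q (card A)} {A. A \<subseteq> S' \<and> Q (card A)}"
  proof (rule bij_betwI')
    fix A B assume "A \<in> {A. A \<subseteq> S \<and> Q (card A)}" "B \<in> {A. A \<subseteq> S \<and> Q (card A)}"
    then show "(f ` A = f ` B) = (A = B)" using inj_on_image_eq_iff[OF inj] by blast
  next
    fix A assume "A \<in> {A. A \<subseteq> S \<and> Q (card A)}"
    then show "f ` A \<in> {A. A \<subseteq> S' \<and> Q (card A)}" using c im by auto
  next
    fix B assume B: "B \<in> {A. A \<subseteq> S' \<and> Q (card A)}"
    then obtain A where "A \<subseteq> S" "B = f ` A" using im subset_imageE by blast
    then show "\<exists>A\<in>{A. A \<subseteq> S \<and> Q (card A)}. B = f ` A" using B c by auto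
  qed
  then show ?thesis by (rule bij_betw_same_card)
qed

context ordered_ribbon
begin

lemma card_state_labels:
  "card {(W, A). W \<subseteq> E \<and> A \<subseteq> P W \<and> K W (card A)} = (\<Sum>W\<in>Pow E. card {A. A \<subseteq> P W \<and> K W (card A)})"
proof -
  have "{(W, A). W \<subseteq> E \<and> A \<subseteq> P W \<and> K W (card A)} = Sigma (Pow E) (\<lambda>W. {A. A \<subseteq> P W \<and> K W (card A)})"
    by auto
  then show ?thesis using finE by simp
qed

lemma gens_alt: "gens h j = {(W, A). W \<subseteq> E \<and> A \<subseteq> P W \<and>
    (ht W = h \<and> int (card (P W)) - 2 * int (card A) + ht W = j)}"
  by (auto simp: gens_def deg_def dv_def)

lemma gc_alt: "gc h c m = {(W, A). W \<subseteq> E \<and> A \<subseteq> P W \<and>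
    (ht W = h \<and> (int (card (P W)) - 2 * int (card A) + ht W) mod 4 = c mod 4 \<and>
      m \<le> int (card (P W)) - 2 * int (card A) + ht W)}"
  by (auto simp: gc_def deg_def dv_def)

lemma kappa_empty: "gens h j = {} \<Longrightarrow> kappa h j = 0"
proof -
  assume "gens h j = {}"
  then have "{f\<in>fsup (gens h j). d 0 E f = 0} = {0}" using rlin_0[OF d_linear] by (auto simp: fsup_empty)
  then show ?thesis by (simp only: kappa_def dim_zero)
qed

lemma lker_neg: "h < 0 \<Longrightarrow> rv.dim (lker h c m) = 0"
proof -
  assume h: "h < 0"
  have "(W, A) \<notin> gc h c m" for W A using ht_bounds(1)[of W] h by (auto simp: gc_def)
  then have "gc h c m = {}" by auto
  then have "lker h c m = {0}" using rlin_0[OF d_linear] by (auto simp: lker_def fsup_empty)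
  then show ?thesis by (simp only: dim_zero)
qed

end

lemma card_gens_eq:
  assumes "ordered_ribbon E \<sigma> pos" "ordered_ribbon E \<sigma>' pos'"
    and p: "\<And>W. W \<subseteq> E \<Longrightarrow> card (ribbon.P E \<sigma> W) = card (ribbon.P E \<sigma>' W)"
  shows "card (ordered_ribbon.gens E \<sigma> h j) = card (ordered_ribbon.gens E \<sigma>' h j)"
    and "card (ordered_ribbon.gc E \<sigma> h c m) = card (ordered_ribbon.gc E \<sigma>' h c m)"
proof -
  interpret L: ordered_ribbon E \<sigma> pos by fact
  interpret R: ordered_ribbon E \<sigma>' pos' by fact
  have eq: "card {A. A \<subseteq> L.P W \<and> Q (card (L.P W)) (card A)} = card {A. A \<subseteq> R.P W \<and> Q (card (R.P W)) (card A)}"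
    if "W \<in> Pow E" for W Q
    using card_subsets_eq[OF L.finP R.finP p, of W "Q (card (L.P W))"] that p[of W] by simp
  let ?K = "\<lambda>W k a. L.ht W = h \<and> int k - 2 * int a + L.ht W = j"
  show "card (L.gens h j) = card (R.gens h j)"
    unfolding L.gens_alt R.gens_alt L.card_state_labels[of "\<lambda>W. ?K W (card (L.P W))"]
      R.card_state_labels[of "\<lambda>W. ?K W (card (R.P W))"]
    by (intro sum.cong refl) (erule eq[of _ "?K _"])
  let ?K = "\<lambda>W k a. L.ht W = h \<and> (int k - 2 * int a + L.ht W) mod 4 = c mod 4 \<and>
      m \<le> int k - 2 * int a + L.ht W"
  show "card (L.gc h c m) = card (R.gc h c m)"
    unfolding L.gc_alt R.gc_alt L.card_state_labels[of "\<lambda>W. ?K W (card (L.P W))"]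
      R.card_state_labels[of "\<lambda>W. ?K W (card (R.P W))"]
    by (intro sum.cong refl) (erule eq[of _ "?K _"])
qed

text \<open>Equal circle numbers give equal generator counts. Exactness then fixes
  \<open>kappa\<close> except at \<open>j = 2 * h - h0 + 1\<close>, where the Lee count takes
  over.\<close>

lemma kappa_eq_connected:
  assumes "thin_ribbon E \<sigma> pos h0" "thin_ribbon E \<sigma>' pos' h0"
    and p: "\<And>W. W \<subseteq> E \<Longrightarrow> card (ribbon.P E \<sigma> W) = card (ribbon.P E \<sigma>' W)"
    and good: "\<And>h. card (thin_ribbon.Good E \<sigma> h) = card (thin_ribbon.Good E \<sigma>' h)"
  shows "ordered_ribbon.kappa E \<sigma> pos h j = ordered_ribbon.kappa E \<sigma>' pos' h j"
proof -
  interpret L: thin_ribbon E \<sigma> pos h0 by fact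
  interpret R: thin_ribbon E \<sigma>' pos' h0 by fact
  note cg = card_gens_eq[OF L.ordered_ribbon_axioms R.ordered_ribbon_axioms p]
  \<comment> \<open>\<open>j\<close> lies below both diagonals of height \<open>h + 1\<close>, so
    exactness there expresses \<open>kappa h j\<close> by \<open>kappa (h + 1) j\<close>; the
    recursion ends above the top height.\<close>
  have low: "L.kappa h j = R.kappa h j" if "j \<le> 2 * h - h0" for h j
    using that
  proof (induction "nat (int (card E) + 1 - h)" arbitrary: h)
    case 0
    then have "int (card E) < h" by simp
    then show ?case using L.gens_empty R.gens_empty L.kappa_empty R.kappa_empty by metis
  next
    case (Suc n)
    have "L.kappa (h + 1) j = R.kappa (h + 1) j" using Suc by (intro Suc.hyps(1)) auto
    moreover have "j - 2 * (h + 1) \<noteq> 1 - h0" "j - 2 * (h + 1) \<noteq> - 1 - h0" using Suc.prems by auto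
    ultimately show ?case
      using L.kappa_exact[of j "h + 1"] R.kappa_exact[of j "h + 1"] cg(1)[of h j] by simp
  qed
  \<comment> \<open>\<open>j\<close> lies above both diagonals of height \<open>h\<close>, so
    exactness in this height gives \<open>kappa h j\<close> from \<open>kappa (h - 1) j\<close>;
    negative heights carry nothing.\<close>
  have high: "L.kappa h j = R.kappa h j" if "2 * h - h0 + 2 \<le> j" for h j
    using that
  proof (induction "nat (h + 1)" arbitrary: h)
    case 0
    then have "h < 0" by simp
    then show ?case using L.gens_empty R.gens_empty L.kappa_empty R.kappa_empty by metis
  next
    case (Suc n)
    have "L.kappa (h - 1) j = R.kappa (h - 1) j" using Suc by (intro Suc.hyps(1)) auto
    moreover have "j - 2 * h \<noteq> 1 - h0" "j - 2 * h \<noteq> - 1 - h0" using Suc.prems by auto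
    ultimately show ?case
      using L.kappa_exact[of j h] R.kappa_exact[of j h] cg(1)[of "h - 1" j] by simp
  qed
  \<comment> \<open>\<open>lee_count\<close> links consecutive heights, starting from the zero space
    in height -1.\<close>
  have lee: "rv.dim (L.lker h c (- L.dmax)) = rv.dim (R.lker h c (- L.dmax))"
    if c: "even (c + h0 + 1)" for h c
  proof (cases "h < 0")
    case True
    then show ?thesis by (simp add: L.lker_neg R.lker_neg)
  next
    case False
    have "rv.dim (L.lker (int n - 1) c (- L.dmax)) = rv.dim (R.lker (int n - 1) c (- L.dmax))" for n
    proof (induction n)
      case (Suc n)
      then show ?case
        using L.lee_count[OF c, of "int n - 1"] R.lee_count[OF c, of "int n - 1"] good[of "int n"]
          cg(2)[of "int n - 1" c "- L.dmax"] by simp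
    qed (simp add: L.lker_neg R.lker_neg)
    from this[of "nat (h + 1)"] show ?thesis using False by simp
  qed
  show ?thesis
  proof (cases "j = 2 * h - h0 + 1")
    case False
    then show ?thesis using low[of j h] high[of h j] by fastforce
  next
    case True
    have c: "j mod 4 = (2 * h - h0 + 1) mod 4" "even (j + h0 + 1)" using True by auto
    let ?M = "{m\<in>{- L.dmax..L.dmax}. m mod 4 = j mod 4}"
    show ?thesis
    proof (cases "j \<in> {- L.dmax..L.dmax}")
      case True
      have fin: "finite ?M" by (rule finite_subset[of _ "{- L.dmax..L.dmax}"]) auto
      have "(\<Sum>m\<in>?M. L.kappa h m) = (\<Sum>m\<in>?M. R.kappa h m)"
        using L.lker_sum[OF c(1)] R.lker_sum[OF c(1)] lee[OF c(2), of h] by simp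
      \<comment> \<open>All other degrees of the residue class are already known, so the Lee kernel
        isolates \<open>kappa h j\<close>.\<close>
      moreover have "(\<Sum>m\<in>?M - {j}. L.kappa h m) = (\<Sum>m\<in>?M - {j}. R.kappa h m)"
      proof (intro sum.cong refl)
        fix m assume "m \<in> ?M - {j}"
        then have "m \<le> 2 * h - h0 \<or> 2 * h - h0 + 2 \<le> m" using \<open>j = 2 * h - h0 + 1\<close> by auto
        then show "L.kappa h m = R.kappa h m" using low high by blast
      qed
      ultimately show ?thesis using True sum.remove[OF fin, of j "L.kappa h"] sum.remove[OF fin, of j "R.kappa h"]
        by simp
    next
      case False
      have "L.gens h j = {}" "R.gens h j = {}"
        using False L.deg_bounds R.deg_bounds by (auto simp: L.gens_def R.gens_def)
      then show ?thesis using L.kappa_empty R.kappa_empty by metis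
    qed
  qed
qed

section \<open>Planarity\<close>

definition adj :: "('e \<times> bool \<Rightarrow> 'v) \<Rightarrow> 'e set \<Rightarrow> ('v \<times> 'v) set" where
  "adj vx W = {(vx (e, b), vx (e, \<not> b)) | e b. e \<in> W}"

lemma adj_mono: "V \<subseteq> W \<Longrightarrow> (adj vx V)\<^sup>* \<subseteq> (adj vx W)\<^sup>*"
  by (rule rtrancl_mono) (auto simp: adj_def)

lemma sym_adj: "sym (adj vx W)"
proof (rule symI)
  fix u v assume "(u, v) \<in> adj vx W"
  then obtain e b where "e \<in> W" "u = vx (e, b)" "v = vx (e, \<not> b)" by (auto simp: adj_def)
  then show "(v, u) \<in> adj vx W" unfolding adj_def by (intro CollectI exI[of _ e] exI[of _ "\<not> b"]) simp
qed

lemma adj_rtrancl_sym: "(u, v) \<in> (adj vx W)\<^sup>* \<Longrightarrow> (v, u) \<in> (adj vx W)\<^sup>*"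
  using sym_rtrancl[OF sym_adj] by (rule symD)

lemma adj_edge: "e \<in> W \<Longrightarrow> (vx (e, b), vx (e, b')) \<in> (adj vx W)\<^sup>*"
proof (cases "b = b'")
  case False
  assume "e \<in> W"
  moreover have "b' = (\<not> b)" using False by blast
  ultimately have "(vx (e, b), vx (e, b')) \<in> adj vx W" unfolding adj_def by blast
  then show ?thesis by blast
qed simp

text \<open>Vertices are the cycles of \<open>\<sigma>\<close>, under names \<open>vx\<close> that
  two embeddings can share.\<close>

locale vertex_ribbon = ribbon E \<sigma> for E :: "'e set" and \<sigma> +
  fixes vx :: "'e \<times> bool \<Rightarrow> 'v"
  assumes vx_orbit: "\<And>x y. x \<in> H \<Longrightarrow> y \<in> H \<Longrightarrow> vx x = vx y \<longleftrightarrow> y \<in> orbit \<sigma> x"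
begin

lemma sigma_H: "x \<in> H \<Longrightarrow> \<sigma> x \<in> H"
  using permutes_in_image[OF perm, of x] unfolding H_def by blast

lemma sigma_H_iff: "\<sigma> x \<in> H \<longleftrightarrow> x \<in> H"
  using permutes_in_image[OF perm, of x] unfolding H_def .

lemma vx_sigma: "x \<in> H \<Longrightarrow> vx (\<sigma> x) = vx x"
  using vx_orbit[OF _ sigma_H, of x x] orbit.base[of \<sigma> x] by simp

lemma cyc_conn:
  assumes W: "W \<subseteq> E" and x: "x \<in> H" and y: "y \<in> cyc W x"
  shows "(vx x, vx y) \<in> (adj vx W)\<^sup>*"
proof -
  have step: "phi W z \<in> H \<and> (vx z, vx (phi W z)) \<in> (adj vx W)\<^sup>*" if z: "z \<in> H" for z
  proof -
    obtain e b where eb: "\<sigma> z = (e, b)" by fastforce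
    then have "(vx (\<sigma> z), vx (phi W z)) \<in> (adj vx W)\<^sup>*"
      using adj_edge[of e W vx b "\<not> b"] by (auto simp: phi_def flip_def)
    then show ?thesis using vx_sigma[OF z] phi_in_H[OF W z] by simp
  qed
  have "cyc W x \<subseteq> {z \<in> H. (vx x, vx z) \<in> (adj vx W)\<^sup>*}"
    unfolding cyc_def
    by (rule orbit_least) (use step x in \<open>auto intro: rtrancl_trans\<close>)
  then show ?thesis using y by blast
qed

text \<open>With all edges absent each circle runs around one vertex.\<close>

lemma card_P_empty: "card (P {}) = card (vx ` H)"
proof -
  have c: "cyc {} x = orbit \<sigma> x" for x
  proof -
    have "phi {} = \<sigma>" by (auto simp: phi_def flip_def fun_eq_iff)
    then show ?thesis by (simp add: cyc_def)
  qed
  have eq: "cyc {} x = cyc {} y \<longleftrightarrow> vx x = vx y" if "x \<in> H" "y \<in> H" for x y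
    using vx_orbit[OF that] cyc_eq_iff[of "{}" y x] by (auto simp: c)
  define f where "f v = cyc {} (SOME x. x \<in> H \<and> vx x = v)" for v
  have f: "f (vx x) = cyc {} x" if "x \<in> H" for x
  proof -
    have "(SOME y. y \<in> H \<and> vx y = vx x) \<in> H \<and> vx (SOME y. y \<in> H \<and> vx y = vx x) = vx x"
      by (rule someI[of _ x]) (use that in simp)
    then show ?thesis using eq that by (auto simp: f_def)
  qed
  have "bij_betw f (vx ` H) (P {})"
    by (rule bij_betwI') (auto simp: f eq P_def)
  then show ?thesis by (metis bij_betw_same_card)
qed

end

text \<open>Planarity of all states in combinatorial form: the ends of a new edge lie on the same boundary
  circle as soon as they lie in the same component.\<close>

locale planar_ribbon = vertex_ribbon E \<sigma> vx
  for E :: "'e set" and \<sigma> and vx :: "'e \<times> bool \<Rightarrow> 'v" +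
  assumes planar: "\<And>W e. W \<subseteq> E \<Longrightarrow> e \<in> E - W \<Longrightarrow> (vx (e, False), vx (e, True)) \<in> (adj vx W)\<^sup>* \<Longrightarrow>
      ca W e = cb W e"
begin

lemma same_iff_conn:
  assumes "W \<subseteq> E" "e \<in> E - W"
  shows "ca W e = cb W e \<longleftrightarrow> (vx (e, False), vx (e, True)) \<in> (adj vx W)\<^sup>*"
  using planar[OF assms] cyc_conn[OF assms(1), of "(e, False)" "(e, True)"] assms
    cyc_eq_iff[OF assms(1), of "(e, True)" "(e, False)"]
  by (auto simp: ca_def cb_def mem_H)

lemma card_P_insert:
  assumes "W \<subseteq> E" "e \<in> E - W"
  shows "int (card (P (insert e W))) = int (card (P W)) +
    (if (vx (e, False), vx (e, True)) \<in> (adj vx W)\<^sup>* then 1 else -1)"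
  using card_P_tog[of W e] same_iff_conn[OF assms] assms by (simp add: tog_def)

text \<open>An edge added inside a component would raise the number of circles to at least two. So
  every edge of a one-circle state is a bridge, and each bridge lowers the count by one.\<close>

lemma tree_card:
  assumes H: "H \<noteq> {}" and W: "W \<subseteq> E" and 1: "card (P W) = 1"
  shows "int (card W) = int (card (P {})) - 1"
proof -
  have pos: "0 < card (P V)" for V using H by (simp add: P_def finH card_gt_0_iff)
  have bridge: "(vx (e, False), vx (e, True)) \<notin> (adj vx (W - {e}))\<^sup>*" if "e \<in> W" for e
  proof
    assume "(vx (e, False), vx (e, True)) \<in> (adj vx (W - {e}))\<^sup>*"
    then have "int (card (P W)) = int (card (P (W - {e}))) + 1"
      using card_P_insert[of "W - {e}" e] that W by (auto simp: insert_absorb)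
    then show False using pos[of "W - {e}"] 1 by simp
  qed
  have "finite V \<Longrightarrow> V \<subseteq> W \<Longrightarrow> int (card (P V)) = int (card (P {})) - int (card V)" for V
  proof (induction V rule: finite_induct)
    case (insert e V)
    have "(vx (e, False), vx (e, True)) \<notin> (adj vx V)\<^sup>*"
      using bridge[of e] adj_mono[of V "W - {e}" vx] insert by blast
    moreover have "V \<subseteq> E" "e \<in> E - V" using insert W by auto
    ultimately show ?case using card_P_insert[of V e] insert by simp
  qed simp
  from this[of W] show ?thesis using 1 finite_subset[OF W finE] by simp
qed

section \<open>Even edge sets, cuts and good colourings\<close>

lemma even_jumps:
  fixes g :: "'e \<times> bool \<Rightarrow> bool"
  shows "even (card {x \<in> H. vx x = v \<and> g (\<sigma> x) \<noteq> g x})"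
proof -
  let ?Z = "{x \<in> H. vx x = v}"
  have fin: "finite ?Z" using finH by simp
  have bij: "bij_betw \<sigma> ?Z ?Z"
  proof -
    have "inj_on \<sigma> ?Z" using permutes_inj[OF perm] inj_on_subset by blast
    moreover have "\<sigma> ` ?Z \<subseteq> ?Z" using vx_sigma sigma_H by auto
    ultimately show ?thesis using fin by (simp add: bij_betw_def endo_inj_surj)
  qed
  have "bij_betw \<sigma> {x \<in> ?Z. g (\<sigma> x)} {x \<in> ?Z. g x}"
    using bij by (auto simp: bij_betw_def inj_on_def image_iff set_eq_iff) (metis (no_types, lifting))+
  then have c: "card {x \<in> ?Z. g (\<sigma> x)} = card {x \<in> ?Z. g x}" by (rule bij_betw_same_card)
  have 1: "card {x \<in> ?Z. g (\<sigma> x)} = card {x \<in> ?Z. g (\<sigma> x) \<and> g x} + card {x \<in> ?Z. g (\<sigma> x) \<and> \<not> g x}"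
    using finH by (subst card_Un_disjoint[symmetric]) (auto intro!: arg_cong[of _ _ card])
  have 2: "card {x \<in> ?Z. g x} = card {x \<in> ?Z. g (\<sigma> x) \<and> g x} + card {x \<in> ?Z. \<not> g (\<sigma> x) \<and> g x}"
    using finH by (subst card_Un_disjoint[symmetric]) (auto intro!: arg_cong[of _ _ card])
  have "card {x \<in> H. vx x = v \<and> g (\<sigma> x) \<noteq> g x} =
      card {x \<in> ?Z. g (\<sigma> x) \<and> \<not> g x} + card {x \<in> ?Z. \<not> g (\<sigma> x) \<and> g x}"
    using finH by (subst card_Un_disjoint[symmetric]) (auto intro!: arg_cong[of _ _ card])
  then show ?thesis using c 1 2 by simp
qed

text \<open>Membership in the cycle space mod 2; counting half-edges instead of edges lets a loop
  count twice.\<close>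

definition even_at :: "'e set \<Rightarrow> bool" where
  "even_at J \<longleftrightarrow> (\<forall>v. even (card {y \<in> H. vx y = v \<and> fst y \<in> J}))"

text \<open>Once around a vertex a two-valued function changes an even number of times
  (\<open>even_jumps\<close>), and each change is charged to the half-edge being entered.\<close>

lemma even_at_jumps:
  fixes g :: "'e \<times> bool \<Rightarrow> bool"
  assumes "\<And>x. x \<in> H \<Longrightarrow> g (\<sigma> x) \<noteq> g x \<longleftrightarrow> fst (\<sigma> x) \<in> J"
  shows "even_at J"
  unfolding even_at_def
proof
  fix v
  have "bij_betw \<sigma> {x \<in> H. vx x = v \<and> g (\<sigma> x) \<noteq> g x} {y \<in> H. vx y = v \<and> fst y \<in> J}"
  proof (rule bij_betwI')
    fix y assume y: "y \<in> {y \<in> H. vx y = v \<and> fst y \<in> J}"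
    obtain x where x: "y = \<sigma> x" using permutes_surj[OF perm] by (metis surjD)
    then have "x \<in> H" using y sigma_H_iff by simp
    then show "\<exists>x\<in>{x \<in> H. vx x = v \<and> g (\<sigma> x) \<noteq> g x}. y = \<sigma> x"
      using x y assms[of x] vx_sigma[of x] by (intro bexI[of _ x]) auto
  qed (use permutes_inj[OF perm] assms vx_sigma sigma_H in \<open>auto dest: injD\<close>)
  then have "card {x \<in> H. vx x = v \<and> g (\<sigma> x) \<noteq> g x} = card {y \<in> H. vx y = v \<and> fst y \<in> J}"
    by (rule bij_betw_same_card)
  then show "even (card {y \<in> H. vx y = v \<and> fst y \<in> J})"
    using even_jumps[of v g] by simp
qed

lemma even_at_sym_diff:
  assumes "even_at J" "even_at K"
  shows "even_at ((J - K) \<union> (K - J))"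
  unfolding even_at_def
proof
  fix v
  let ?c = "\<lambda>X. card {y \<in> H. vx y = v \<and> fst y \<in> X}"
  have un: "?c (X \<union> X') = ?c X + ?c X'" if "X \<inter> X' = {}" for X X'
    using that finH by (subst card_Un_disjoint[symmetric]) (auto intro!: arg_cong[of _ _ card])
  have 1: "?c ((J - K) \<union> (J \<inter> K)) = ?c (J - K) + ?c (J \<inter> K)" by (rule un) blast
  have 2: "?c ((K - J) \<union> (J \<inter> K)) = ?c (K - J) + ?c (J \<inter> K)" by (rule un) blast
  have 3: "?c ((J - K) \<union> (K - J)) = ?c (J - K) + ?c (K - J)" by (rule un) auto
  have JK: "(J - K) \<union> (J \<inter> K) = J" "(K - J) \<union> (J \<inter> K) = K" by blast+
  have "even (?c J)" "even (?c K)" using assms unfolding even_at_def by blast+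
  then have "even (?c (J - K) + ?c (J \<inter> K))" "even (?c (K - J) + ?c (J \<inter> K))"
    using 1 2 unfolding JK by (simp_all only:)
  then show "even (?c ((J - K) \<union> (K - J)))" unfolding 3 even_add by blast
qed

text \<open>Over the component of one end of the bridge, the half-edges of \<open>J\<close> pair off
  by their edges, except for this one end. Their number would be odd.\<close>

lemma even_at_bridge:
  assumes W: "W \<subseteq> E" and e: "e \<in> E - W" and nc: "(vx (e, False), vx (e, True)) \<notin> (adj vx W)\<^sup>*"
    and J: "J \<subseteq> insert e W" "even_at J"
  shows "e \<notin> J"
proof
  assume eJ: "e \<in> J"
  let ?K = "{u. (vx (e, False), u) \<in> (adj vx W)\<^sup>*}"
  let ?Y = "{y \<in> H. vx y \<in> ?K \<and> fst y \<in> J}"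
  have fin: "finite ?Y" using finH by simp
  have "even (card ?Y)"
  proof -
    have "card ?Y = (\<Sum>v\<in>vx ` ?Y. card {y \<in> ?Y. vx y = v})"
      using sum.group[OF fin finite_imageI[OF fin] order_refl, where g = vx and h = "\<lambda>_. 1::nat"] by simp
    also have "even \<dots>"
    proof (rule dvd_sum)
      fix v assume "v \<in> vx ` ?Y"
      then have "{y \<in> ?Y. vx y = v} = {y \<in> H. vx y = v \<and> fst y \<in> J}" by auto
      then show "even (card {y \<in> ?Y. vx y = v})" using J(2) by (simp add: even_at_def)
    qed
    finally show ?thesis .
  qed
  moreover have "?Y = insert (e, False) ({a \<in> J - {e}. vx (a, False) \<in> ?K} \<times> UNIV)"
  proof (intro equalityI subsetI)
    fix y assume "y \<in> ?Y"
    then obtain a b where y: "y = (a, b)" "a \<in> J" "vx (a, b) \<in> ?K" by (cases y) auto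
    show "y \<in> insert (e, False) ({a \<in> J - {e}. vx (a, False) \<in> ?K} \<times> UNIV)"
    proof (cases "a = e")
      case True
      then show ?thesis using y nc by (cases b) auto
    next
      case False
      then have "a \<in> W" using y J(1) by blast
      then have "vx (a, False) \<in> ?K" using y(3) adj_edge[of a W vx b False] by (auto intro: rtrancl_trans)
      then show ?thesis using y False by auto
    qed
  next
    fix y assume y: "y \<in> insert (e, False) ({a \<in> J - {e}. vx (a, False) \<in> ?K} \<times> UNIV)"
    show "y \<in> ?Y"
    proof (cases "y = (e, False)")
      case True
      then show ?thesis using e eJ by (auto simp: mem_H)
    next
      case False
      then obtain a b where a: "y = (a, b)" "a \<in> J" "a \<noteq> e" "vx (a, False) \<in> ?K" using y by auto
      then have "a \<in> W" using J(1) by blast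
      then have "vx (a, b) \<in> ?K" using a(4) adj_edge[of a W vx False b] by (auto intro: rtrancl_trans)
      then show ?thesis using a \<open>a \<in> W\<close> W by (auto simp: mem_H)
    qed
  qed
  moreover have "finite {a \<in> J - {e}. vx (a, False) \<in> ?K}"
    using finite_subset[OF W finE] J(1) finite_subset[of J "insert e W"] by auto
  ultimately show False by (simp add: card_cartesian_product card_UNIV_bool)
qed

lemma phi_insert_const:
  fixes t :: "'e \<times> bool \<Rightarrow> bool"
  assumes "e \<notin> W" "\<And>x. x \<in> H \<Longrightarrow> t (phi W x) = t x" "t (e, False) = t (e, True)" "x \<in> H"
  shows "t (phi (insert e W) x) = t x"
proof -
  have "phi (insert e W) x = transpose (e, False) (e, True) (phi W x)"
    using phi_tog[of e W] assms(1) by (simp add: tog_def)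
  moreover have "t (transpose (e, False) (e, True) z) = t z" for z
    using assms(3) by (auto simp: transpose_def)
  ultimately show ?thesis using assms(2,4) by simp
qed

lemma const_cyc:
  fixes t :: "'e \<times> bool \<Rightarrow> bool"
  assumes W: "W \<subseteq> E" and t: "\<And>x. x \<in> H \<Longrightarrow> t (phi W x) = t x" and "x \<in> H" "y \<in> cyc W x"
  shows "t y = t x"
proof -
  have "col W {z \<in> H. t z}" using t phi_in_H[OF W] by (auto simp: col_def)
  then have "y \<in> {z \<in> H. t z} \<longleftrightarrow> x \<in> {z \<in> H. t z}" using col_cyc[OF W _ assms(3,4)] by blast
  then show ?thesis using cyc_subset_H[OF W assms(3)] assms(3,4) by blast
qed

text \<open>In a planar ribbon graph every cycle is a sum of face boundaries.\<close>

lemma face_colouring: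
  "finite W \<Longrightarrow> W \<subseteq> E \<Longrightarrow> J \<subseteq> W \<Longrightarrow> even_at J \<Longrightarrow>
    \<exists>t :: 'e \<times> bool \<Rightarrow> bool. (\<forall>x\<in>H. t (phi W x) = t x) \<and> (\<forall>a\<in>W. t (a, False) \<noteq> t (a, True) \<longleftrightarrow> a \<in> J)"
proof (induction W arbitrary: J rule: finite_induct)
  case empty
  then show ?case by (intro exI[of _ "\<lambda>_. False"]) simp
next
  case (insert e W)
  have W: "W \<subseteq> E" and e: "e \<in> E - W" using insert by auto
  have V: "insert e W \<subseteq> E" using insert by blast
  show ?case
  proof (cases "(vx (e, False), vx (e, True)) \<in> (adj vx W)\<^sup>*")
    case True
    then have same: "ca W e = cb W e" using planar[OF W e] by blast
    have eT: "(e, True) \<in> cyc W (e, False)" and eF: "(e, False) \<in> H"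
      using same cyc_self[OF W, of "(e, True)"] e by (simp_all add: ca_def cb_def mem_H)
    have te: "t (e, False) = t (e, True)" if t: "\<forall>x\<in>H. t (phi W x) = t x"
      for t :: "'e \<times> bool \<Rightarrow> bool"
      by (rule const_cyc[OF W _ eF eT, symmetric]) (use t in blast)
    show ?thesis
    proof (cases "e \<in> J")
      case False
      then have "J \<subseteq> W" using insert.prems by blast
      then obtain t :: "'e \<times> bool \<Rightarrow> bool" where t: "\<forall>x\<in>H. t (phi W x) = t x" "\<forall>a\<in>W. t (a, False) \<noteq> t (a, True) \<longleftrightarrow> a \<in> J"
        using insert.IH[OF W _ insert.prems(3)] by blast
      have "\<forall>x\<in>H. t (phi (insert e W) x) = t x"
        using phi_insert_const[OF insert.hyps(2)] te[OF t(1)] t(1) by blast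
      moreover have "\<forall>a\<in>insert e W. t (a, False) \<noteq> t (a, True) \<longleftrightarrow> a \<in> J"
        using t te[OF t(1)] False by auto
      ultimately show ?thesis by blast
    next
      case eJ: True
      \<comment> \<open>The new edge splits a circle in two, and the boundary \<open>S\<close> of
        one part contains \<open>e\<close>. Adding \<open>S\<close> to \<open>J\<close> removes
        \<open>e\<close>, so the induction hypothesis applies; recolouring this part afterwards
        undoes the change.\<close>
      define c1 where "c1 = ca (insert e W) e"
      have tog: "tog e W = insert e W" using e by (simp add: tog_def)
      have ne: "ca (insert e W) e \<noteq> cb (insert e W) e" using tog_split[OF W _ same] e tog by auto
      have ec: "(e, False) \<in> c1" "(e, True) \<notin> c1"
        using ne cyc_self[OF V] cyc_eq_iff[OF V, of "(e, True)" "(e, False)"]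
        by (auto simp: c1_def ca_def cb_def)
      have c1_phi: "phi (insert e W) x \<in> c1 \<longleftrightarrow> x \<in> c1" if "x \<in> H" for x
        unfolding c1_def ca_def cyc_eq_iff[OF V, symmetric] cyc_phi[OF V] ..
      define S where "S = {a \<in> insert e W. ((a, False) \<in> c1) \<noteq> ((a, True) \<in> c1)}"
      have "(\<sigma> x \<in> c1) \<noteq> (x \<in> c1) \<longleftrightarrow> fst (\<sigma> x) \<in> S" if x: "x \<in> H" for x
      proof -
        obtain a b where ab: "\<sigma> x = (a, b)" by fastforce
        show ?thesis using c1_phi[OF x] ab
          by (cases b) (auto simp: phi_def flip_def S_def split: if_splits)
      qed
      then have "even_at S" by (rule even_at_jumps)
      then have ev: "even_at ((J - S) \<union> (S - J))" by (rule even_at_sym_diff[OF insert.prems(3)])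
      have eS: "e \<in> S" using ec by (simp add: S_def)
      have "(J - S) \<union> (S - J) \<subseteq> W" using insert.prems(2) eS eJ by (auto simp: S_def)
      then obtain t :: "'e \<times> bool \<Rightarrow> bool" where t: "\<forall>x\<in>H. t (phi W x) = t x"
        "\<forall>a\<in>W. t (a, False) \<noteq> t (a, True) \<longleftrightarrow> a \<in> (J - S) \<union> (S - J)"
        using insert.IH[OF W _ ev] by blast
      define t' where "t' = (\<lambda>x. t x \<noteq> (x \<in> c1))"
      have "\<forall>x\<in>H. t (phi (insert e W) x) = t x"
        using phi_insert_const[OF insert.hyps(2)] te[OF t(1)] t(1) by blast
      then have "\<forall>x\<in>H. t' (phi (insert e W) x) = t' x" using c1_phi by (simp add: t'_def)
      moreover have "t' (a, False) \<noteq> t' (a, True) \<longleftrightarrow> a \<in> J" if a: "a \<in> insert e W" for a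
      proof (cases "a = e")
        case True
        then show ?thesis using te[OF t(1)] t(1) ec eJ by (auto simp: t'_def)
      next
        case False
        then have "t (a, False) \<noteq> t (a, True) \<longleftrightarrow> a \<in> (J - S) \<union> (S - J)" using t(2) a by blast
        moreover have "a \<in> S \<longleftrightarrow> ((a, False) \<in> c1) \<noteq> ((a, True) \<in> c1)" using a by (simp add: S_def)
        ultimately show ?thesis by (auto simp: t'_def)
      qed
      ultimately show ?thesis by blast
    qed
  next
    case nc: False
    then have eJ: "e \<notin> J" using even_at_bridge[OF W e _ insert.prems(2,3)] by blast
    then have "J \<subseteq> W" using insert.prems by blast
    then obtain t :: "'e \<times> bool \<Rightarrow> bool" where t: "\<forall>x\<in>H. t (phi W x) = t x" "\<forall>a\<in>W. t (a, False) \<noteq> t (a, True) \<longleftrightarrow> a \<in> J"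
      using insert.IH[OF W _ insert.prems(3)] by blast
    let ?K = "{u. (vx (e, False), u) \<in> (adj vx W)\<^sup>*}"
    \<comment> \<open>A bridge joins two circles, whose colours must agree. If they do not, all
      colours on one component are exchanged, which alters no difference across an edge of
      \<open>W\<close>.\<close>
    define t' where "t' = (if t (e, False) = t (e, True) then t else (\<lambda>x. t x \<noteq> (vx x \<in> ?K)))"
    have K_conn: "u \<in> ?K \<longleftrightarrow> v \<in> ?K" if "(u, v) \<in> (adj vx W)\<^sup>*" for u v
      using that adj_rtrancl_sym[OF that] by (auto intro: rtrancl_trans)
    have Kphi: "vx (phi W x) \<in> ?K \<longleftrightarrow> vx x \<in> ?K" if "x \<in> H" for x
      using K_conn[OF cyc_conn[OF W that, of "phi W x"]] by (auto simp: cyc_def intro: orbit.base)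
    have t'W: "t' (phi W x) = t' x" if "x \<in> H" for x using t(1) Kphi that by (simp add: t'_def)
    have t'e: "t' (e, False) = t' (e, True)" using nc by (auto simp: t'_def)
    have t'a: "(t' (a, False) \<noteq> t' (a, True)) = (t (a, False) \<noteq> t (a, True))" if "a \<in> W" for a
      using K_conn[OF adj_edge[OF that, of vx False True]] by (auto simp: t'_def)
    have "\<forall>x\<in>H. t' (phi (insert e W) x) = t' x"
      using phi_insert_const[OF insert.hyps(2) t'W t'e] by blast
    moreover have "\<forall>a\<in>insert e W. t' (a, False) \<noteq> t' (a, True) \<longleftrightarrow> a \<in> J"
      using t(2) t'a t'e eJ by auto
    ultimately show ?thesis by blast
  qed
qed

definition goodcol :: "'e set \<Rightarrow> ('e \<times> bool) set \<Rightarrow> bool" where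
  "goodcol W B \<longleftrightarrow> col W B \<and> (\<forall>e\<in>E. ((e, False) \<in> B) \<noteq> ((e, True) \<in> B))"

definition cut :: "'e set \<Rightarrow> bool" where
  "cut X \<longleftrightarrow> (\<exists>s :: 'v \<Rightarrow> bool. \<forall>e\<in>E. s (vx (e, False)) \<noteq> s (vx (e, True)) \<longleftrightarrow> e \<in> X)"

text \<open>Around a vertex a good colouring changes exactly at the edges of \<open>W\<close>, so
  \<open>W\<close> is even and comes from a face colouring \<open>t\<close>. The difference of the
  two is constant around vertices and is a two-colouring of the vertices that cuts exactly
  \<open>E - W\<close>. Conversely, such a vertex colouring plus \<open>t\<close> is a good
  colouring.\<close>

lemma goodcol_iff:
  assumes W: "W \<subseteq> E"
  shows "(\<exists>B. goodcol W B) \<longleftrightarrow> even_at W \<and> cut (E - W)"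
proof
  assume "\<exists>B. goodcol W B"
  then obtain B where B: "col W B" "\<And>e. e \<in> E \<Longrightarrow> ((e, False) \<in> B) \<noteq> ((e, True) \<in> B)"
    by (auto simp: goodcol_def)
  have jump: "(\<sigma> x \<in> B) \<noteq> (x \<in> B) \<longleftrightarrow> fst (\<sigma> x) \<in> W" if x: "x \<in> H" for x
  proof -
    obtain a b where ab: "\<sigma> x = (a, b)" by fastforce
    then have "a \<in> E" using sigma_H[OF x] by (simp add: mem_H)
    moreover have "phi W x \<in> B \<longleftrightarrow> x \<in> B" using B(1) x by (simp add: col_def)
    ultimately show ?thesis using ab B(2)[of a]
      by (cases b) (auto simp: phi_def flip_def split: if_splits)
  qed
  have ev: "even_at W" using even_at_jumps[of "\<lambda>x. x \<in> B" W] jump by blast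
  obtain t :: "'e \<times> bool \<Rightarrow> bool" where t: "\<forall>x\<in>H. t (phi E x) = t x" "\<forall>a\<in>E. t (a, False) \<noteq> t (a, True) \<longleftrightarrow> a \<in> W"
    using face_colouring[OF finE order_refl W ev] by blast
  define g where "g x \<longleftrightarrow> (x \<in> B) \<noteq> t x" for x
  have tj: "t x = t (a, \<not> b)" if "x \<in> H" "\<sigma> x = (a, b)" for x a b
  proof -
    have "phi E x = (a, \<not> b)" using that sigma_H[OF that(1)] by (simp add: phi_def flip_def mem_H)
    then show ?thesis using t(1) that(1) by metis
  qed
  have tj2: "t (a, b) \<noteq> t (a, \<not> b) \<longleftrightarrow> a \<in> W" if "a \<in> E" for a b
    using t(2) that by (cases b) auto
  have g\<sigma>: "g (\<sigma> x) = g x" if x: "x \<in> H" for x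
  proof -
    obtain a b where ab: "\<sigma> x = (a, b)" by fastforce
    then have "a \<in> E" using sigma_H[OF x] by (simp add: mem_H)
    then show ?thesis using jump[OF x] tj[OF x ab] tj2[of a b] ab by (auto simp: g_def)
  qed
  have g_vx: "g y = g x" if "x \<in> H" "y \<in> H" "vx x = vx y" for x y
  proof -
    have "y \<in> orbit \<sigma> x" using vx_orbit that by blast
    then have "y \<in> H \<and> g y = g x" by induct (use g\<sigma> sigma_H that(1) in auto)
    then show ?thesis by blast
  qed
  define s where "s v = g (SOME x. x \<in> H \<and> vx x = v)" for v
  have s: "s (vx x) = g x" if "x \<in> H" for x
  proof -
    have "(SOME y. y \<in> H \<and> vx y = vx x) \<in> H \<and> vx (SOME y. y \<in> H \<and> vx y = vx x) = vx x"
      by (rule someI[of _ x]) (use that in simp)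
    then show ?thesis using g_vx that unfolding s_def by metis
  qed
  have "s (vx (e, False)) \<noteq> s (vx (e, True)) \<longleftrightarrow> e \<in> E - W" if "e \<in> E" for e
    using s[of "(e, False)"] s[of "(e, True)"] that B(2)[OF that] tj2[OF that, of False]
    by (auto simp: mem_H g_def)
  then show "even_at W \<and> cut (E - W)" using ev unfolding cut_def by blast
next
  assume *: "even_at W \<and> cut (E - W)"
  then obtain s :: "'v \<Rightarrow> bool" where s: "\<And>e. e \<in> E \<Longrightarrow> s (vx (e, False)) \<noteq> s (vx (e, True)) \<longleftrightarrow> e \<in> E - W"
    unfolding cut_def by blast
  obtain t :: "'e \<times> bool \<Rightarrow> bool" where t: "\<forall>x\<in>H. t (phi E x) = t x" "\<forall>a\<in>E. t (a, False) \<noteq> t (a, True) \<longleftrightarrow> a \<in> W"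
    using face_colouring[OF finE order_refl W] * by blast
  define B where "B = {x \<in> H. s (vx x) \<noteq> t x}"
  have "phi W x \<in> B \<longleftrightarrow> x \<in> B" if x: "x \<in> H" for x
  proof -
    obtain a b where ab: "\<sigma> x = (a, b)" by fastforce
    then have a: "a \<in> E" using sigma_H[OF x] by (simp add: mem_H)
    have "phi E x = (a, \<not> b)" using ab a by (simp add: phi_def flip_def)
    then have 1: "t (a, \<not> b) = t x" using t(1) x by metis
    have 2: "vx (a, b) = vx x" using vx_sigma[OF x] ab by simp
    have 3: "t (a, b) \<noteq> t (a, \<not> b) \<longleftrightarrow> a \<in> W" using t(2) a by (cases b) auto
    have 4: "s (vx (a, b)) \<noteq> s (vx (a, \<not> b)) \<longleftrightarrow> a \<in> E - W" using s[OF a] by (cases b) auto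
    show ?thesis using 1 2 3 4 a x ab by (auto simp: B_def phi_def flip_def mem_H)
  qed
  then have "col W B" by (auto simp: col_def B_def)
  moreover have "((e, False) \<in> B) \<noteq> ((e, True) \<in> B)" if "e \<in> E" for e
    using s[OF that] t(2) that by (auto simp: B_def mem_H)
  ultimately show "\<exists>B. goodcol W B" unfolding goodcol_def by blast
qed

end

locale planar_thin_ribbon = thin_ribbon E \<sigma> pos h0 + planar_ribbon E \<sigma> vx
  for E :: "'e set" and \<sigma> and pos :: "'e \<Rightarrow> nat" and h0 and vx :: "'e \<times> bool \<Rightarrow> 'v"
begin

text \<open>Two good colourings differ by a set that contains both halves of an edge or neither.
  Such a set is a union of circles in all states alike, so connectedness makes it trivial, and the
  base point excludes \<open>H\<close>.\<close>

lemma goodcol_unique: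
  assumes W: "W \<subseteq> E" and B: "goodcol W B" "goodcol W B'" "x0 \<notin> B" "x0 \<notin> B'"
  shows "B = B'"
proof -
  let ?S = "{x \<in> H. (x \<in> B) \<noteq> (x \<in> B')}"
  have fl: "(e, b) \<in> ?S \<longleftrightarrow> (e, \<not> b) \<in> ?S" if "e \<in> E" for e b
    using B(1,2) that by (cases b) (auto simp: goodcol_def mem_H)
  have "col V ?S" if V: "V \<subseteq> E" for V
    unfolding col_def
  proof (intro conjI ballI)
    fix x assume x: "x \<in> H"
    obtain a b where ab: "\<sigma> x = (a, b)" by fastforce
    have a: "a \<in> E" using sigma_H[OF x] ab by (simp add: mem_H)
    have "phi W x \<in> ?S \<longleftrightarrow> x \<in> ?S"
      using B(1,2) x phi_in_H[OF W x] by (auto simp: goodcol_def col_def)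
    moreover have "phi V x \<in> ?S \<longleftrightarrow> phi W x \<in> ?S"
      using fl[OF a] ab by (simp add: phi_def flip_def)
    ultimately show "phi V x \<in> ?S \<longleftrightarrow> x \<in> ?S" by blast
  qed auto
  then have "\<forall>W. itv {} E W \<longrightarrow> col W ?S" by (simp add: itv_def)
  moreover have "?S \<subseteq> H \<longrightarrow> (\<forall>W. itv {} E W \<longrightarrow> col W ?S) \<longrightarrow> ?S = {} \<or> ?S = H"
    using connected unfolding conn_def by (rule spec)
  ultimately have "?S = {} \<or> ?S = H" by blast
  moreover have "x0 \<notin> ?S" using B(3,4) by blast
  ultimately have "?S = {}" using x0_H by blast
  moreover have "B \<subseteq> H" "B' \<subseteq> H" using B(1,2) by (auto simp: goodcol_def col_def)
  ultimately show ?thesis by blast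
qed

text \<open>The count on the right involves only parities and cuts in the graph, so it is common to
  all planar embeddings.\<close>

lemma card_Good: "card (Good h) = card {W. W \<subseteq> E \<and> ht W = h \<and> even_at W \<and> cut (E - W)}"
proof -
  have G: "(W, B) \<in> Good h \<longleftrightarrow> W \<subseteq> E \<and> ht W = h \<and> goodcol W B \<and> x0 \<notin> B" for W B
    by (auto simp: Good_def Y_def goodcol_def)
  have "inj_on fst (Good h)"
  proof (rule inj_onI, clarify)
    fix W B W' B' assume "(W, B) \<in> Good h" "(W', B') \<in> Good h" "fst (W, B) = fst (W', B')"
    then show "W = W' \<and> B = B'" using goodcol_unique[of W B B'] by (auto simp: G)
  qed
  moreover have "fst ` Good h = {W. W \<subseteq> E \<and> ht W = h \<and> even_at W \<and> cut (E - W)}"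
  proof (intro equalityI subsetI)
    fix W assume "W \<in> fst ` Good h"
    then obtain B where "(W, B) \<in> Good h" by auto
    then show "W \<in> {W. W \<subseteq> E \<and> ht W = h \<and> even_at W \<and> cut (E - W)}"
      using goodcol_iff[of W] by (auto simp: G)
  next
    fix W assume "W \<in> {W. W \<subseteq> E \<and> ht W = h \<and> even_at W \<and> cut (E - W)}"
    then obtain B where W: "W \<subseteq> E" "ht W = h" and B: "goodcol W B"
      using goodcol_iff[of W] by auto
    have "goodcol W (H - B)"
      using B col_compl[OF W(1)] by (auto simp: goodcol_def mem_H)
    then have "(W, B) \<in> Good h \<or> (W, H - B) \<in> Good h" using W B by (auto simp: G)
    then show "W \<in> fst ` Good h" by force
  qed
  ultimately show ?thesis by (metis card_image)
qed

end

text \<open>Whether an added edge splits or merges circles is decided by connectivity in the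
  graph.\<close>

lemma planar_card_P_eq:
  assumes "planar_ribbon E \<sigma> vx" "planar_ribbon E \<sigma>' vx" and W: "W \<subseteq> E"
  shows "card (ribbon.P E \<sigma> W) = card (ribbon.P E \<sigma>' W)"
proof -
  interpret L: planar_ribbon E \<sigma> vx by fact
  interpret R: planar_ribbon E \<sigma>' vx by fact
  have "finite W" using W L.finE finite_subset by blast
  then have "int (card (L.P W)) = int (card (R.P W))" using W
  proof (induction W rule: finite_induct)
    case empty
    then show ?case by (simp add: L.card_P_empty R.card_P_empty L.H_def R.H_def)
  next
    case (insert e W)
    then show ?case using L.card_P_insert[of W e] R.card_P_insert[of W e] by simp
  qed
  then show ?thesis by simp
qed

definition graph_connected :: "('e \<times> bool \<Rightarrow> 'v) \<Rightarrow> 'e set \<Rightarrow> bool" where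
  "graph_connected vx E \<longleftrightarrow> (\<forall>D\<subseteq>E. D \<noteq> {} \<longrightarrow> D \<noteq> E \<longrightarrow>
     vx ` (D \<times> UNIV) \<inter> vx ` ((E - D) \<times> UNIV) \<noteq> {})"

text \<open>\<open>h0\<close> is the number of edges outside a spanning tree of the vertices that
  carry edges. A set that is a union of circles in the empty and in the full state is closed under
  going around vertices and under crossing edges, hence a union of components.\<close>

lemma planar_thin:
  assumes "planar_ribbon E \<sigma> vx" "inj_on pos E" "E \<noteq> {}" "graph_connected vx E"
  shows "planar_thin_ribbon E \<sigma> pos (int (card E) - int (card (vx ` (E \<times> UNIV))) + 1) vx"
proof -
  interpret planar_ribbon E \<sigma> vx by fact
  interpret ordered_ribbon E \<sigma> pos by unfold_locales fact
  have Hn: "H \<noteq> {}" using assms(3) by (auto simp: H_def)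
  have "conn {} E"
    unfolding conn_def
  proof (intro allI impI)
    fix S assume S: "S \<subseteq> H" "\<forall>W. itv {} E W \<longrightarrow> col W S"
    then have c: "col {} S" "col E S" by (auto simp: itv_def)
    have s: "\<sigma> x \<in> S \<longleftrightarrow> x \<in> S" if "x \<in> H" for x
      using c(1) that by (auto simp: col_def phi_def flip_def)
    have fl: "(e, \<not> b) \<in> S" if "(e, b) \<in> S" for e b
    proof -
      obtain x where x: "\<sigma> x = (e, b)" using permutes_surj[OF perm] by (metis surjD)
      have "(e, b) \<in> H" using that S(1) by blast
      then have "x \<in> H" "e \<in> E" using x sigma_H_iff[of x] by (auto simp: mem_H)
      then have "x \<in> S" using s x that by metis
      then have "phi E x \<in> S" using c(2) \<open>x \<in> H\<close> by (auto simp: col_def)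
      then show ?thesis using x \<open>e \<in> E\<close> by (simp add: phi_def flip_def)
    qed
    have orb: "y \<in> S" if "x \<in> S" "y \<in> H" "vx x = vx y" for x y
    proof -
      have x: "x \<in> H" using that S(1) by blast
      then have "y \<in> orbit \<sigma> x" using vx_orbit that by blast
      then have "y \<in> H \<and> y \<in> S" by induct (use s sigma_H x that(1) in auto)
      then show ?thesis by blast
    qed
    let ?D = "fst ` S"
    have SD: "S = ?D \<times> UNIV"
    proof (intro equalityI subsetI)
      fix y assume "y \<in> ?D \<times> (UNIV :: bool set)"
      then obtain e b b' where "y = (e, b)" "(e, b') \<in> S" by auto
      then show "y \<in> S" using fl[of e b'] by (cases "b = b'") auto
    qed force
    have DE: "?D \<subseteq> E" using S(1) by (auto simp: mem_H)
    show "S = {} \<or> S = H"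
    proof (rule ccontr)
      assume *: "\<not> ?thesis"
      then have "?D \<noteq> {}" "?D \<noteq> E" using SD by (auto simp: H_def)
      then have "vx ` (?D \<times> UNIV) \<inter> vx ` ((E - ?D) \<times> UNIV) \<noteq> {}"
        using assms(4)[unfolded graph_connected_def, rule_format, OF DE] by blast
      then obtain v where v: "v \<in> vx ` (?D \<times> UNIV)" "v \<in> vx ` ((E - ?D) \<times> UNIV)" by blast
      obtain x where x: "x \<in> S" "v = vx x" using v(1) SD by auto
      obtain y where y: "v = vx y" "y \<in> (E - ?D) \<times> UNIV" using v(2) by (rule imageE)
      then have "fst y \<in> E" "fst y \<notin> fst ` S" by force+
      then have "y \<in> H" "y \<notin> S" using imageI[of y S fst] by (auto simp: mem_H)
      then show False using orb[OF x(1), of y] x(2) y(1) by simp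
    qed
  qed
  then have "thin_ribbon E \<sigma> pos (int (card E) - int (card (vx ` (E \<times> UNIV))) + 1)"
  proof (unfold_locales)
    show "int (card E) - int (card (vx ` (E \<times> UNIV))) + 1 = ht {} - int (card (P {})) + 1"
      by (simp add: ht_def card_P_empty H_def)
    fix W assume W: "W \<subseteq> E" "card (P W) = 1"
    have "int (card W) = int (card (P {})) - 1" using tree_card[OF Hn W] .
    moreover have "card (E - W) = card E - card W" "card W \<le> card E"
      using W finE by (auto simp: card_Diff_subset finite_subset card_mono)
    ultimately show "ht W = int (card E) - int (card (vx ` (E \<times> UNIV))) + 1"
      by (simp add: ht_def card_P_empty H_def)
  qed (use assms(3) in auto)
  then show ?thesis using planar_ribbon_axioms by (simp add: planar_thin_ribbon_def)
qed

lemma kappa_planar_connected: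
  assumes L: "planar_ribbon E \<sigma> vx" "inj_on pos E" and R: "planar_ribbon E \<sigma>' vx" "inj_on pos' E"
    and E: "E \<noteq> {}" "graph_connected vx E"
  shows "ordered_ribbon.kappa E \<sigma> pos h j = ordered_ribbon.kappa E \<sigma>' pos' h j"
proof -
  define h0 where "h0 = int (card E) - int (card (vx ` (E \<times> UNIV))) + 1"
  interpret L: planar_thin_ribbon E \<sigma> pos h0 vx unfolding h0_def by (rule planar_thin[OF L E])
  interpret R: planar_thin_ribbon E \<sigma>' pos' h0 vx unfolding h0_def by (rule planar_thin[OF R E])
  show ?thesis
    by (rule kappa_eq_connected[OF L.thin_ribbon_axioms R.thin_ribbon_axioms planar_card_P_eq[OF L(1) R(1)]])
      (simp_all add: L.card_Good R.card_Good)
qed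

section \<open>Independence of the order of the edges\<close>

context ordered_ribbon
begin

lemma sg_prod: "sg W e = (\<Prod>a\<in>E - W. if pos a < pos e then -1 else 1)"
proof -
  have "(\<Prod>a\<in>E - W. if pos a < pos e then -1 else 1 :: rat) = (\<Prod>a\<in>{a\<in>E - W. pos a < pos e}. -1)"
    by (rule prod.inter_filter[symmetric]) (simp add: finE)
  also have "{a\<in>E - W. pos a < pos e} = {a\<in>E. a \<notin> W \<and> pos a < pos e}" by blast
  finally show ?thesis by (simp add: sg_def)
qed

end

text \<open>The two sign conventions on the cube differ by a coboundary. The gauge
  \<open>\<eta> W\<close> is the sign of the permutation between the two orders of the absent edges,
  as a product over inversions.\<close>

lemma kappa_gauge_le:
  assumes "ordered_ribbon E \<sigma> pos" "ordered_ribbon E \<sigma> pos'"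
  shows "ordered_ribbon.kappa E \<sigma> pos h j \<le> ordered_ribbon.kappa E \<sigma> pos' h j"
proof -
  interpret L: ordered_ribbon E \<sigma> pos by fact
  interpret R: ordered_ribbon E \<sigma> pos' by fact
  define q :: "'a \<Rightarrow> 'a \<Rightarrow> rat" where
    "q a b = (if pos a < pos b \<and> pos' b < pos' a then -1 else 1)" for a b
  define \<eta> where "\<eta> W = (\<Prod>b\<in>E - W. \<Prod>a\<in>E - W. q a b)" for W
  have qq: "q a e * q e a = (if pos a < pos e then -1 else 1) * (if pos' a < pos' e then -1 else 1)"
    if "a \<in> E" "e \<in> E" "a \<noteq> e" for a e
  proof -
    have "pos a \<noteq> pos e" "pos' a \<noteq> pos' e"
      using that inj_onD[OF L.inj_pos] inj_onD[OF R.inj_pos] by blast+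
    then show ?thesis by (auto simp: q_def)
  qed
  have sq: "L.sg W e * R.sg W e = (\<Prod>a\<in>E - insert e W. q a e * q e a)"
    if e: "e \<in> E" "e \<notin> W" for W e
  proof -
    have EW: "E - W = insert e (E - insert e W)" using e by blast
    have "L.sg W e * R.sg W e = (\<Prod>a\<in>E - insert e W.
        (if pos a < pos e then -1 else 1) * (if pos' a < pos' e then -1 else 1))"
      unfolding L.sg_prod R.sg_prod EW using L.finE by (simp add: prod.distrib)
    also have "\<dots> = (\<Prod>a\<in>E - insert e W. q a e * q e a)"
      using e by (intro prod.cong refl) (auto simp: qq)
    finally show ?thesis .
  qed
  have eta: "\<eta> W * L.sg W e = R.sg W e * \<eta> (insert e W)" if e: "e \<in> E" "e \<notin> W" for W e
  proof -
    have EW: "E - W = insert e (E - insert e W)" using e by blast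
    have fin: "finite (E - insert e W)" using L.finE by simp
    have "\<eta> W = (\<Prod>a\<in>E - insert e W. q a e) * (\<Prod>b\<in>E - insert e W. q e b) * \<eta> (insert e W)"
      unfolding \<eta>_def EW using fin e by (simp add: prod.distrib q_def[of e e] mult_ac)
    also have "\<dots> = (L.sg W e * R.sg W e) * \<eta> (insert e W)"
      unfolding sq[OF e] by (simp add: prod.distrib)
    finally have "\<eta> W * L.sg W e = (L.sg W e * L.sg W e) * (R.sg W e * \<eta> (insert e W))"
      by (simp only: mult_ac)
    then show ?thesis by simp
  qed
  have chain: "R.d 0 E (mask \<eta> f) = mask \<eta> (L.d 0 E f)" for f
  proof (rule ext, clarify)
    fix W A
    have "R.Rop 0 e (mask \<eta> f) (W, A) = \<eta> W * L.Rop 0 e f (W, A)" if "e \<in> E" for e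
      using eta[OF that, of W] by (cases "e \<in> W") (auto simp: R.Rop_def L.Rop_def R.T_mask tog_def)
    then show "R.d 0 E (mask \<eta> f) (W, A) = mask \<eta> (L.d 0 E f) (W, A)"
      by (simp add: L.d_def R.d_def sum_fun_apply sum_distrib_left)
  qed
  have eta_nz: "\<eta> W \<noteq> 0" for W
    unfolding \<eta>_def using L.finE by (simp add: prod_zero_iff q_def)
  let ?KL = "{f\<in>fsup (L.gens h j). L.d 0 E f = 0}" and ?KR = "{f\<in>fsup (R.gens h j). R.d 0 E f = 0}"
  have "mask \<eta> ` ?KL \<subseteq> ?KR"
  proof
    fix g assume "g \<in> mask \<eta> ` ?KL"
    then obtain f where f: "f \<in> fsup (L.gens h j)" "L.d 0 E f = 0" "g = mask \<eta> f" by blast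
    have "g \<in> fsup (R.gens h j)"
    proof (rule fsupI, clarify)
      fix W A assume "g (W, A) \<noteq> 0"
      then have "(W, A) \<in> L.gens h j" using f fsupD[OF f(1)] by auto
      then show "(W, A) \<in> R.gens h j" by (simp add: L.gens_alt R.gens_alt)
    qed
    then show "g \<in> ?KR" using chain[of f] f(2,3) rlin_0[OF mask_linear] by simp
  qed
  then have "rv.dim (mask \<eta> ` ?KL) \<le> rv.dim ?KR"
    by (intro dim_mono_fsup[OF kernel_subspace[OF R.d_linear fsup_subspace] _ R.finite_gens]) auto
  moreover have "rv.dim (mask \<eta> ` ?KL) = rv.dim ?KL"
  proof (rule dim_inj_image[OF mask_linear kernel_subspace[OF L.d_linear fsup_subspace] _ L.finite_gens])
    fix u :: "'a bgen \<Rightarrow> rat" assume "mask \<eta> u = 0"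
    then have "\<eta> W * u (W, A) = 0" for W A by (metis mask_apply zero_fun_apply)
    then show "u = 0" using eta_nz by (auto simp: fun_eq_iff)
  qed auto
  ultimately show ?thesis by (simp add: L.kappa_def R.kappa_def)
qed

lemma kappa_gauge:
  assumes "ordered_ribbon E \<sigma> pos" "ordered_ribbon E \<sigma> pos'"
  shows "ordered_ribbon.kappa E \<sigma> pos h j = ordered_ribbon.kappa E \<sigma> pos' h j"
  using kappa_gauge_le[OF assms] kappa_gauge_le[OF assms(2,1)] by (rule order_antisym)

section \<open>Chain maps between complexes of equal dimensions\<close>

text \<open>A basis of \<open>U0\<close> is extended in \<open>U\<close> and its image is extended
  in \<open>U'\<close>; the bound on dimensions leaves enough new vectors on the right for those on
  the left.\<close>

lemma extend_injective:
  assumes U0: "rv.subspace U0" "U0 \<subseteq> U" and U: "rv.subspace U" "U \<subseteq> fsup X" "finite X"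
    and U': "rv.subspace U'" "U' \<subseteq> fsup X'" "finite X'"
    and f: "rlin f" "\<And>u. u \<in> U0 \<Longrightarrow> f u = 0 \<Longrightarrow> u = 0" "f ` U0 \<subseteq> U'"
    and dim: "rv.dim U \<le> rv.dim U'"
  shows "\<exists>g. rlin g \<and> (\<forall>u\<in>U0. g u = f u) \<and> (\<forall>u\<in>U. g u = 0 \<longrightarrow> u = 0) \<and> g ` U \<subseteq> U'"
proof -
  have "U0 \<subseteq> fsup X" using U0 U by blast
  then obtain B0 where B0: "finite B0" "rv.independent B0" "rv.span B0 = U0" "B0 \<subseteq> U0" "card B0 = rv.dim U0"
    by (rule subspace_basis[OF U(3) U0(1)])
  have inj0: "inj_on f (rv.span B0)"
  proof (rule inj_onI)
    fix u v assume "u \<in> rv.span B0" "v \<in> rv.span B0" "f u = f v"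
    then have "u - v \<in> U0" "f (u - v) = 0"
      using B0(3) rv.subspace_diff[OF U0(1)] by (auto simp: rlin_diff[OF f(1)])
    then have "u - v = 0" by (rule f(2))
    then show "u = v" by simp
  qed
  have ind0: "rv.independent (f ` B0)" by (rule rvp.linear_independent_injective_image[OF f(1) B0(2) inj0])
  have injB0: "inj_on f B0" using inj0 inj_on_subset rv.span_superset by blast
  have "B0 \<subseteq> U" using B0(4) U0(2) by blast
  then obtain B where B: "B0 \<subseteq> B" "B \<subseteq> U" "rv.independent B" "U \<subseteq> rv.span B"
    by (rule rv.maximal_independent_subset_extend[OF _ B0(2)])
  have "f ` B0 \<subseteq> U'" using B0(4) f(3) by blast
  then obtain B' where B': "f ` B0 \<subseteq> B'" "B' \<subseteq> U'" "rv.independent B'" "U' \<subseteq> rv.span B'"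
    by (rule rv.maximal_independent_subset_extend[OF _ ind0])
  have fB: "finite B" "finite B'" using fsup_indep_finite B(2,3) B'(2,3) U U' by blast+
  have "card B = rv.dim U" "card B' = rv.dim U'"
    using rv.basis_card_eq_dim[OF B(2,4,3)] rv.basis_card_eq_dim[OF B'(2,4,3)] by auto
  then have "card (B - B0) \<le> card (B' - f ` B0)"
    using dim B(1) B'(1) fB B0(1) by (simp add: card_Diff_subset card_image[OF injB0])
  then obtain \<gamma> where \<gamma>: "\<gamma> ` (B - B0) \<subseteq> B' - f ` B0" "inj_on \<gamma> (B - B0)"
    using card_le_inj[of "B - B0" "B' - f ` B0"] fB by auto
  define m where "m b = (if b \<in> B0 then f b else \<gamma> b)" for b
  have mB: "m ` B \<subseteq> B'" using B'(1) \<gamma>(1) by (auto simp: m_def)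
  have minj: "inj_on m B"
  proof (rule inj_onI)
    fix a b assume ab: "a \<in> B" "b \<in> B" "m a = m b"
    show "a = b"
    proof (cases "a \<in> B0"; cases "b \<in> B0")
      assume "a \<in> B0" "b \<in> B0"
      then show ?thesis using ab injB0 by (auto simp: m_def inj_on_def)
    next
      assume *: "a \<in> B0" "b \<notin> B0"
      then have "f a \<in> B' - f ` B0" using ab \<gamma>(1) by (auto simp: m_def)
      then show ?thesis using * by blast
    next
      assume *: "a \<notin> B0" "b \<in> B0"
      then have "f b \<in> B' - f ` B0" using ab \<gamma>(1) by (auto simp: m_def)
      then show ?thesis using * by blast
    next
      assume "a \<notin> B0" "b \<notin> B0"
      then show ?thesis using ab \<gamma>(2) by (auto simp: m_def inj_on_def)
    qed
  qed
  obtain g where g: "\<And>b. b \<in> B \<Longrightarrow> g b = m b" "rlin g"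
    using rvp.linear_independent_extend[OF B(3), of m] by auto
  have "g u = f u" if "u \<in> U0" for u
  proof (rule rvp.linear_eq_on[OF g(2) f(1)])
    show "u \<in> rv.span B0" using that B0(3) by simp
    show "\<And>b. b \<in> B0 \<Longrightarrow> g b = f b" using g(1) B(1) by (auto simp: m_def)
  qed
  moreover have gi: "g ` B = m ` B" using g(1) by (auto simp: image_def)
  have "rv.independent (g ` B)" unfolding gi using rv.independent_mono[OF B'(3) mB] .
  moreover have "inj_on g B" using minj g(1) by (simp add: inj_on_def)
  ultimately have "inj_on g (rv.span B)"
    using rvp.linear_inj_on_span_independent_image[OF g(2)] by blast
  then have "u = 0" if "u \<in> U" "g u = 0" for u
    using that B(4) rlin_0[OF g(2)] rv.span_zero[of B] unfolding inj_on_def by (metis subsetD)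
  moreover have "g ` U \<subseteq> U'"
  proof -
    have "g ` U \<subseteq> g ` rv.span B" using B(4) by blast
    also have "\<dots> = rv.span (m ` B)" using rvp.linear_span_image[OF g(2), of B] gi by simp
    also have "\<dots> \<subseteq> U'" using mB B'(2) U'(1) by (intro rv.span_minimal) auto
    finally show ?thesis .
  qed
  ultimately show ?thesis using g(2) \<open>\<And>u. u \<in> U0 \<Longrightarrow> g u = f u\<close> by blast
qed

lemma kernel_iso_image:
  assumes T: "rlin T" and U: "rv.subspace U" "U \<subseteq> fsup X" "finite X" and U': "rv.subspace U'" "U' \<subseteq> fsup X'" "finite X'"
    and inj: "\<And>u. u \<in> U \<Longrightarrow> T u = 0 \<Longrightarrow> u = 0" and im: "T ` U \<subseteq> U'" and dim: "rv.dim U = rv.dim U'"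
  shows "T ` U = U'"
proof -
  have "T ` U \<subseteq> fsup X'" using im U'(2) by blast
  then obtain B where B: "finite B" "rv.independent B" "rv.span B = T ` U" "B \<subseteq> T ` U" "card B = rv.dim (T ` U)"
    by (rule subspace_basis[OF U'(3) image_subspace[OF T U(1)]])
  have "B \<subseteq> U'" using B(4) im by blast
  then obtain B' where B': "B \<subseteq> B'" "B' \<subseteq> U'" "rv.independent B'" "U' \<subseteq> rv.span B'"
    by (rule rv.maximal_independent_subset_extend[OF _ B(2)])
  have "finite B'" using fsup_indep_finite[OF U'(3) B'(3)] B'(2) U'(2) by blast
  moreover have "card B' = card B"
    using rv.basis_card_eq_dim[OF B'(2,4,3)] dim B(5) dim_inj_image[OF T U inj] by simp
  ultimately have "B = B'" using B'(1) by (simp add: card_subset_eq)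
  then show ?thesis using B'(4) B(3) im by blast
qed

text \<open>An injective chain map is built degree by degree: the map on one degree determines it on the
  image of the differential, from where it extends first to the cycles and then to everything.\<close>

lemma injective_chain_map:
  fixes D :: "('x \<Rightarrow> rat) \<Rightarrow> 'x \<Rightarrow> rat" and D' :: "('y \<Rightarrow> rat) \<Rightarrow> 'y \<Rightarrow> rat"
  assumes D: "rlin D" "\<And>n f. f \<in> fsup (X n) \<Longrightarrow> D f \<in> fsup (X (Suc n))" "\<And>f. D (D f) = 0"
    and D': "rlin D'" "\<And>n f. f \<in> fsup (X' n) \<Longrightarrow> D' f \<in> fsup (X' (Suc n))" "\<And>f. D' (D' f) = 0"
    and fin: "\<And>n. finite (X n)" "\<And>n. finite (X' n)"
    and card: "\<And>n. card (X n) = card (X' n)"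
    and ker: "\<And>n. rv.dim {f\<in>fsup (X n). D f = 0} = rv.dim {f\<in>fsup (X' n). D' f = 0}"
  shows "\<exists>\<Theta> :: nat \<Rightarrow> ('x \<Rightarrow> rat) \<Rightarrow> 'y \<Rightarrow> rat. \<forall>n. rlin (\<Theta> n) \<and> (\<forall>f\<in>fsup (X n). \<Theta> n f \<in> fsup (X' n) \<and>
    D' (\<Theta> n f) = \<Theta> (Suc n) (D f) \<and> (\<Theta> n f = 0 \<longrightarrow> f = 0))"
proof -
  let ?V = "\<lambda>n. fsup (X n)" and ?V' = "\<lambda>n. fsup (X' n)"
  let ?K = "\<lambda>n. {f\<in>?V n. D f = 0}" and ?K' = "\<lambda>n. {f\<in>?V' n. D' f = 0}"
  define Pr where "Pr n \<Theta> \<longleftrightarrow> rlin \<Theta> \<and> (\<forall>f\<in>?V n. \<Theta> f = 0 \<longrightarrow> f = 0) \<and> \<Theta> ` ?V n \<subseteq> ?V' n \<and> \<Theta> ` ?K n \<subseteq> ?K' n"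
    for n and \<Theta> :: "('x \<Rightarrow> rat) \<Rightarrow> 'y \<Rightarrow> rat"
  define Qr where "Qr n \<Theta> \<Theta>' \<longleftrightarrow> (\<forall>f\<in>?V n. D' (\<Theta> f) = \<Theta>' (D f))"
    for n and \<Theta> \<Theta>' :: "('x \<Rightarrow> rat) \<Rightarrow> 'y \<Rightarrow> rat"
  have sK: "rv.subspace (?K n)" and sK': "rv.subspace (?K' n)" for n
    using kernel_subspace[OF D(1) fsup_subspace] kernel_subspace[OF D'(1) fsup_subspace] by blast+
  have step: "\<exists>\<Theta>. Pr n \<Theta> \<and> (\<forall>u\<in>U0. \<Theta> u = \<phi> u)"
    if U0: "rv.subspace U0" "U0 \<subseteq> ?K n" and \<phi>: "rlin \<phi>" "\<And>u. u \<in> U0 \<Longrightarrow> \<phi> u = 0 \<Longrightarrow> u = 0" "\<phi> ` U0 \<subseteq> ?K' n"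
    for n U0 and \<phi> :: "('x \<Rightarrow> rat) \<Rightarrow> 'y \<Rightarrow> rat"
  proof -
    have KV: "?K n \<subseteq> ?V n" "?K' n \<subseteq> ?V' n" by auto
    have "\<exists>\<psi>. rlin \<psi> \<and> (\<forall>u\<in>U0. \<psi> u = \<phi> u) \<and> (\<forall>u\<in>?K n. \<psi> u = 0 \<longrightarrow> u = 0) \<and> \<psi> ` ?K n \<subseteq> ?K' n"
    proof (rule extend_injective[OF U0 sK KV(1) fin(1) sK' KV(2) fin(2) \<phi>(1)])
      show "rv.dim (?K n) \<le> rv.dim (?K' n)" by (simp only: ker order_refl)
    qed (fact \<phi>)+
    then obtain \<psi> where \<psi>: "rlin \<psi>" "\<forall>u\<in>U0. \<psi> u = \<phi> u" "\<forall>u\<in>?K n. \<psi> u = 0 \<longrightarrow> u = 0" "\<psi> ` ?K n \<subseteq> ?K' n"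
      by (elim exE conjE)
    have "\<exists>\<Theta>. rlin \<Theta> \<and> (\<forall>u\<in>?K n. \<Theta> u = \<psi> u) \<and> (\<forall>u\<in>?V n. \<Theta> u = 0 \<longrightarrow> u = 0) \<and> \<Theta> ` ?V n \<subseteq> ?V' n"
    proof (rule extend_injective[OF sK KV(1) fsup_subspace order_refl fin(1) fsup_subspace order_refl fin(2) \<psi>(1)])
      show "\<psi> ` ?K n \<subseteq> ?V' n" using \<psi>(4) by blast
      show "rv.dim (?V n) \<le> rv.dim (?V' n)" by (simp add: dim_fsup fin card)
      show "\<And>u. u \<in> ?K n \<Longrightarrow> \<psi> u = 0 \<Longrightarrow> u = 0" using \<psi>(3) by blast
    qed
    then obtain \<Theta> where \<Theta>: "rlin \<Theta>" "\<forall>u\<in>?K n. \<Theta> u = \<psi> u" "\<forall>u\<in>?V n. \<Theta> u = 0 \<longrightarrow> u = 0" "\<Theta> ` ?V n \<subseteq> ?V' n"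
      by (elim exE conjE)
    have "Pr n \<Theta>" unfolding Pr_def using \<Theta> \<psi>(4) by (auto simp: image_subset_iff)
    moreover have "\<forall>u\<in>U0. \<Theta> u = \<phi> u" using \<Theta>(2) \<psi>(2) U0(2) by auto
    ultimately show ?thesis by blast
  qed
  have "\<exists>\<Theta>. Pr 0 \<Theta>"
  proof -
    have z: "rlin (\<lambda>f :: 'x \<Rightarrow> rat. 0 :: 'y \<Rightarrow> rat)" by (rule rlinI) auto
    have "0 \<in> ?K 0" "0 \<in> ?K' 0" using rv.subspace_0[OF sK] rv.subspace_0[OF sK'] by blast+
    then show ?thesis using step[OF rv.subspace_single_0 _ z, of 0] by auto
  qed
  moreover have "\<exists>\<Theta>'. Pr (Suc n) \<Theta>' \<and> Qr n \<Theta> \<Theta>'" if P: "Pr n \<Theta>" for n \<Theta>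
  proof -
    have lin: "rlin \<Theta>" and inj: "\<And>f. f \<in> ?V n \<Longrightarrow> \<Theta> f = 0 \<Longrightarrow> f = 0" and im: "\<Theta> ` ?V n \<subseteq> ?V' n" "\<Theta> ` ?K n \<subseteq> ?K' n"
      using P by (auto simp: Pr_def)
    have kim: "\<Theta> ` ?K n = ?K' n"
      by (rule kernel_iso_image[OF lin sK _ fin(1) sK' _ fin(2) _ im(2) ker]) (use inj in auto)
    \<comment> \<open>A linear choice of preimages under \<open>D\<close>. Since
      \<open>\<Theta>\<close> maps cycles to cycles, \<open>D'\<close> after \<open>\<Theta>\<close>
      does not depend on the choice.\<close>
    obtain \<rho> where \<rho>: "\<rho> ` UNIV \<subseteq> ?V n" "rlin \<rho>" "\<And>v. v \<in> D ` ?V n \<Longrightarrow> D (\<rho> v) = v"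
      using rvp.linear_exists_right_inverse_on[OF D(1) fsup_subspace[of "X n"]] by auto
    define \<phi> where "\<phi> = (\<lambda>v. D' (\<Theta> (\<rho> v)))"
    have \<phi>l: "rlin \<phi>" unfolding \<phi>_def by (rule rlin_compose[OF D'(1) rlin_compose[OF lin \<rho>(2)]])
    have \<phi>D: "\<phi> (D f) = D' (\<Theta> f)" if f: "f \<in> ?V n" for f
    proof -
      have "\<rho> (D f) - f \<in> ?K n"
        using \<rho>(1) \<rho>(3)[of "D f"] f fsup_diff by (auto simp: rlin_diff[OF D(1)])
      then have "D' (\<Theta> (\<rho> (D f) - f)) = 0" using im(2) by blast
      then show ?thesis by (simp add: \<phi>_def rlin_diff[OF lin] rlin_diff[OF D'(1)])
    qed
    have "\<exists>\<Theta>'. Pr (Suc n) \<Theta>' \<and> (\<forall>u\<in>D ` ?V n. \<Theta>' u = \<phi> u)"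
    proof (rule step[OF image_subspace[OF D(1) fsup_subspace] _ \<phi>l])
      show "D ` ?V n \<subseteq> ?K (Suc n)" using D(2,3) by auto
      show "\<phi> ` (D ` ?V n) \<subseteq> ?K' (Suc n)" using \<phi>D im(1) D'(2,3) by (auto simp: image_subset_iff)
      fix u assume "u \<in> D ` ?V n" "\<phi> u = 0"
      then obtain f where f: "f \<in> ?V n" "u = D f" "D' (\<Theta> f) = 0" using \<phi>D by auto
      \<comment> \<open>Injectivity on boundaries requires \<open>\<Theta>\<close> to reach every
        cycle of the target; this is where equal kernel dimensions enter.\<close>
      then have "\<Theta> f \<in> \<Theta> ` ?K n" using im(1) kim by blast
      then obtain k where k: "k \<in> ?K n" "\<Theta> f = \<Theta> k" by blast
      then have "f - k = 0" using f(1) inj[of "f - k"] fsup_diff by (auto simp: rlin_diff[OF lin])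
      then show "u = 0" using k f by simp
    qed
    then show ?thesis using \<phi>D unfolding Qr_def by fastforce
  qed
  ultimately have "\<exists>\<Theta>. \<forall>n. Pr n (\<Theta> n) \<and> Qr n (\<Theta> n) (\<Theta> (Suc n))" by (rule dependent_nat_choice)
  then obtain \<Theta> where \<Theta>: "\<forall>n. Pr n (\<Theta> n) \<and> Qr n (\<Theta> n) (\<Theta> (Suc n))" ..
  have "rlin (\<Theta> n)" for n using \<Theta> by (simp add: Pr_def)
  moreover have "\<Theta> n f \<in> ?V' n \<and> D' (\<Theta> n f) = \<Theta> (Suc n) (D f) \<and> (\<Theta> n f = 0 \<longrightarrow> f = 0)"
    if f: "f \<in> ?V n" for n f
  proof -
    have "Pr n (\<Theta> n)" "Qr n (\<Theta> n) (\<Theta> (Suc n))" using \<Theta> by auto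
    then show ?thesis using f unfolding Pr_def Qr_def by blast
  qed
  ultimately show ?thesis by blast
qed

section \<open>Disjoint unions\<close>

definition restrict_perm :: "'e set \<Rightarrow> ('e \<times> bool \<Rightarrow> 'e \<times> bool) \<Rightarrow> 'e \<times> bool \<Rightarrow> 'e \<times> bool" where
  "restrict_perm D \<sigma> x = (if fst x \<in> D then \<sigma> x else x)"

text \<open>\<open>D\<close> is a union of components: the rotation does not leave it, so a circle
  that meets it lies over it.\<close>

locale subribbon = ribbon E \<sigma> for E :: "'e set" and \<sigma> +
  fixes D :: "'e set"
  assumes D: "D \<subseteq> E" and pres: "\<And>x. fst x \<in> D \<Longrightarrow> fst (\<sigma> x) \<in> D"
begin

lemma restrict_permutes: "restrict_perm D \<sigma> permutes (D \<times> UNIV)"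
proof (rule bij_imp_permutes)
  have fin: "finite (D \<times> (UNIV :: bool set))" using finite_subset[OF D finE] by simp
  have "inj_on (restrict_perm D \<sigma>) (D \<times> UNIV)"
    using permutes_inj[OF perm] by (auto simp: inj_on_def restrict_perm_def)
  moreover have "restrict_perm D \<sigma> ` (D \<times> UNIV) \<subseteq> D \<times> UNIV"
  proof
    fix y assume "y \<in> restrict_perm D \<sigma> ` (D \<times> UNIV)"
    then obtain x where "fst x \<in> D" "y = restrict_perm D \<sigma> x" by auto
    then show "y \<in> D \<times> UNIV" using pres[of x] by (simp add: restrict_perm_def mem_Times_iff)
  qed
  ultimately show "bij_betw (restrict_perm D \<sigma>) (D \<times> UNIV) (D \<times> UNIV)"
    using fin by (simp add: bij_betw_def endo_inj_surj)
qed (auto simp: restrict_perm_def)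

sublocale S: ribbon D "restrict_perm D \<sigma>"
  by unfold_locales (use finite_subset[OF D finE] restrict_permutes in auto)

lemma cyc_restrict:
  assumes W: "W \<subseteq> E" and x: "fst x \<in> D"
  shows "cyc W x = S.cyc (W \<inter> D) x"
  unfolding cyc_def S.cyc_def
proof (rule orbit_cong0)
  show "x \<in> D \<times> UNIV" using x by (simp add: mem_Times_iff)
  show "phi W \<in> D \<times> UNIV \<rightarrow> D \<times> UNIV" using pres by (auto simp: phi_def mem_Times_iff)
  fix y :: "'e \<times> bool" assume "y \<in> D \<times> UNIV"
  then have "fst y \<in> D" by (simp add: mem_Times_iff)
  then show "phi W y = S.phi (W \<inter> D) y"
    using pres[of y] by (simp add: phi_def S.phi_def restrict_perm_def flip_def)
qed

lemma ca_restrict: "W \<subseteq> E \<Longrightarrow> e \<in> D \<Longrightarrow> ca W e = S.ca (W \<inter> D) e"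
  and cb_restrict: "W \<subseteq> E \<Longrightarrow> e \<in> D \<Longrightarrow> cb W e = S.cb (W \<inter> D) e"
  by (simp_all add: ca_def S.ca_def cb_def S.cb_def cyc_restrict)

lemma P_restrict: "W \<subseteq> E \<Longrightarrow> S.P (W \<inter> D) = cyc W ` (D \<times> UNIV)"
  unfolding S.P_def S.H_def by (intro image_cong refl) (simp add: cyc_restrict mem_Times_iff)

lemma P_restrict_subset: "W \<subseteq> E \<Longrightarrow> S.P (W \<inter> D) \<subseteq> P W"
  using D by (auto simp: P_restrict P_def H_def)

text \<open>Toggling an edge of \<open>D\<close> touches only circles over \<open>D\<close>; the
  state and the labels outside act as parameters.\<close>

lemma T_slice:
  assumes W: "W1 \<subseteq> E - D" "W2 \<subseteq> D" and A1: "A1 \<subseteq> P (W1 \<union> W2)" "\<And>c. c \<in> A1 \<Longrightarrow> c \<inter> D \<times> UNIV = {}"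
    and A2: "A2 \<subseteq> S.P W2" and e: "e \<in> D"
  shows "T t e f (W1 \<union> W2, A1 \<union> A2) =
    S.T t e (\<lambda>(V, B). if V \<subseteq> D \<and> B \<subseteq> S.P V then f (W1 \<union> V, A1 \<union> B) else 0) (W2, A2)"
proof -
  let ?W = "W1 \<union> W2" and ?V2 = "tog e W2"
  have WE: "?W \<subseteq> E" "?W \<inter> D = W2" using W D by auto
  have tV: "tog e ?W = W1 \<union> ?V2" using W e by (auto simp: tog_def)
  have V2: "?V2 \<subseteq> D" using tog_subset[OF W(2) e] .
  have VE: "W1 \<union> ?V2 \<subseteq> E" "(W1 \<union> ?V2) \<inter> D = ?V2" using W V2 D by auto
  have A: "A1 \<union> A2 \<subseteq> P ?W" using A1(1) A2 P_restrict_subset[OF WE(1)] WE(2) by auto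
  have n: "S.ca V e \<notin> A1" "S.cb V e \<notin> A1" if V: "V \<subseteq> D" for V
  proof -
    have "(e, False) \<in> S.ca V e" "(e, True) \<in> S.cb V e"
      using S.cyc_self[OF V] by (auto simp: S.ca_def S.cb_def)
    then show "S.ca V e \<notin> A1" "S.cb V e \<notin> A1" using A1(2) e by blast+
  qed
  define R0 where "R0 = A2 - {S.ca W2 e, S.cb W2 e}"
  have R: "A1 \<union> A2 - {S.ca W2 e, S.cb W2 e} = A1 \<union> R0" using n[OF W(2)] unfolding R0_def by blast
  have "R0 \<subseteq> S.rest W2 e" using A2 by (auto simp: S.rest_def R0_def)
  then have "R0 \<subseteq> S.rest ?V2 e" using S.rest_tog[OF W(2) e] by simp
  then have RP: "R0 \<subseteq> S.P ?V2" "insert (S.ca ?V2 e) R0 \<subseteq> S.P ?V2" "insert (S.cb ?V2 e) R0 \<subseteq> S.P ?V2"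
    "insert (S.ca ?V2 e) (insert (S.cb ?V2 e) R0) \<subseteq> S.P ?V2"
    using S.P_rest[OF e, of ?V2] by auto
  have mem: "S.ca W2 e \<in> A1 \<union> A2 \<longleftrightarrow> S.ca W2 e \<in> A2" "S.cb W2 e \<in> A1 \<union> A2 \<longleftrightarrow> S.cb W2 e \<in> A2"
    using n[OF W(2)] by blast+
  show ?thesis
    unfolding T_def S.T_def Let_def prod.case tV ca_restrict[OF WE(1) e] cb_restrict[OF WE(1) e]
      ca_restrict[OF VE(1) e] cb_restrict[OF VE(1) e] WE(2) VE(2) R R0_def[symmetric] mem
    using WE(1) A W(2) A2 V2 RP by simp
qed

end

lemma rlin_pt_sum: "rlin (\<lambda>f. \<Sum>y\<in>X. rscale (f y) (\<theta> y))"
  by (rule rlinI) (auto simp: sum_fun_apply rscale_apply algebra_simps sum.distrib sum_distrib_left)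

lemma pt_sum_eq:
  assumes X: "finite X" "Y \<subseteq> X" and f: "f \<in> fsup Y" and S: "rlin S" "\<And>y. y \<in> Y \<Longrightarrow> \<theta> y = S (pt y)"
  shows "(\<Sum>y\<in>X. rscale (f y) (\<theta> y)) = S f"
proof -
  have Y: "finite Y" using X finite_subset by blast
  have z: "rscale 0 g = 0" for g :: "'b \<Rightarrow> rat" by (simp add: rscale_def zero_fun_def)
  have "(\<Sum>y\<in>X. rscale (f y) (\<theta> y)) = (\<Sum>y\<in>Y. rscale (f y) (\<theta> y))"
    using f by (intro sum.mono_neutral_right[OF X]) (auto simp: fsup_def z)
  also have "\<dots> = (\<Sum>y\<in>Y. S (rscale (f y) (pt y)))"
    by (intro sum.cong refl) (simp add: S(2) rlin_scale[OF S(1)])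
  also have "\<dots> = S (\<Sum>y\<in>Y. rscale (f y) (pt y))" by (simp add: rlin_sum[OF S(1)])
  also have "\<dots> = S f" using fsup_expand[OF Y f] by simp
  finally show ?thesis .
qed

lemma pt_fsup: "y \<in> X \<Longrightarrow> pt y \<in> fsup X"
  by (auto simp: fsup_def pt_def)

text \<open>Two ribbon graphs that differ only on the union \<open>D\<close> of components. Placing
  \<open>D\<close> last in the order makes the signs of the other edges independent of the state on
  \<open>D\<close>, and multiplies the signs on \<open>D\<close> by one that depends only on the
  state outside (\<open>sg_C\<close>, \<open>sg_D\<close>).\<close>

locale modified_ribbon = L: ordered_ribbon E \<sigma> pos + R: ordered_ribbon E \<sigma>' pos
  for E :: "'e set" and \<sigma> \<sigma>' and pos :: "'e \<Rightarrow> nat" +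
  fixes D :: "'e set"
  assumes DE: "D \<subseteq> E"
    and presL: "\<And>x. fst x \<in> D \<Longrightarrow> fst (\<sigma> x) \<in> D" "\<And>x. fst x \<in> E - D \<Longrightarrow> fst (\<sigma> x) \<in> E - D"
    and presR: "\<And>x. fst x \<in> D \<Longrightarrow> fst (\<sigma>' x) \<in> D" "\<And>x. fst x \<in> E - D \<Longrightarrow> fst (\<sigma>' x) \<in> E - D"
    and agree: "\<And>x. fst x \<in> E - D \<Longrightarrow> \<sigma>' x = \<sigma> x"
    and pos_lt: "\<And>a b. a \<in> E - D \<Longrightarrow> b \<in> D \<Longrightarrow> pos a < pos b"
    and cardP: "\<And>W. W \<subseteq> D \<Longrightarrow> card (ribbon.P D (restrict_perm D \<sigma>) W) = card (ribbon.P D (restrict_perm D \<sigma>') W)"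
    and kappa_D: "\<And>h j. ordered_ribbon.kappa D (restrict_perm D \<sigma>) pos h j =
      ordered_ribbon.kappa D (restrict_perm D \<sigma>') pos h j"
begin

abbreviation D' where "D' \<equiv> E - D"

sublocale SL: ordered_ribbon D "restrict_perm D \<sigma>" pos
proof -
  interpret X: subribbon E \<sigma> D by unfold_locales (use DE presL in auto)
  show "ordered_ribbon D (restrict_perm D \<sigma>) pos"
    by unfold_locales (use L.inj_pos DE inj_on_subset in blast)
qed

sublocale SR: ordered_ribbon D "restrict_perm D \<sigma>'" pos
proof -
  interpret X: subribbon E \<sigma>' D by unfold_locales (use DE presR in auto)
  show "ordered_ribbon D (restrict_perm D \<sigma>') pos"
    by unfold_locales (use L.inj_pos DE inj_on_subset in blast)
qed

sublocale C: ordered_ribbon "E - D" "restrict_perm (E - D) \<sigma>" pos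
proof -
  interpret X: subribbon E \<sigma> "E - D" by unfold_locales (use presL in auto)
  show "ordered_ribbon (E - D) (restrict_perm (E - D) \<sigma>) pos"
    by unfold_locales (use L.inj_pos inj_on_subset in blast)
qed

sublocale LD: subribbon E \<sigma> D by unfold_locales (use DE presL in auto)
sublocale LC: subribbon E \<sigma> "E - D" by unfold_locales (use presL in auto)
sublocale RD: subribbon E \<sigma>' D by unfold_locales (use DE presR in auto)
sublocale RC: subribbon E \<sigma>' "E - D" by unfold_locales (use presR in auto)

lemma same_C: "restrict_perm (E - D) \<sigma>' = restrict_perm (E - D) \<sigma>"
  by (auto simp: restrict_perm_def fun_eq_iff agree)

lemma RC_P: "RC.S.P = C.P" and RC_T: "RC.S.T = C.T"
  by (simp_all add: same_C)

lemma cap: "W1 \<subseteq> D' \<Longrightarrow> W2 \<subseteq> D \<Longrightarrow> (W1 \<union> W2) \<inter> D = W2 \<and> (W1 \<union> W2) \<inter> D' = W1 \<and> W1 \<union> W2 \<subseteq> E"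
  using DE by blast

lemma HE: "L.H = D' \<times> UNIV \<union> D \<times> UNIV"
  using DE by (auto simp: L.H_def)

lemma L_P:
  assumes "W1 \<subseteq> D'" "W2 \<subseteq> D" shows "L.P (W1 \<union> W2) = C.P W1 \<union> SL.P W2"
proof -
  have E: "W1 \<union> W2 \<subseteq> E" "(W1 \<union> W2) \<inter> D = W2" "(W1 \<union> W2) \<inter> D' = W1" using cap[OF assms] by auto
  show ?thesis using LD.P_restrict[OF E(1)] LC.P_restrict[OF E(1)]
    unfolding E(2,3) by (simp add: L.P_def HE image_Un)
qed

lemma R_P:
  assumes "W1 \<subseteq> D'" "W2 \<subseteq> D" shows "R.P (W1 \<union> W2) = C.P W1 \<union> SR.P W2"
proof -
  have E: "W1 \<union> W2 \<subseteq> E" "(W1 \<union> W2) \<inter> D = W2" "(W1 \<union> W2) \<inter> D' = W1" using cap[OF assms] by auto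
  show ?thesis using RD.P_restrict[OF E(1)] RC.P_restrict[OF E(1)]
    unfolding E(2,3) by (simp add: R.P_def L.H_def[symmetric] HE image_Un same_C)
qed

lemma C_block: "W1 \<subseteq> D' \<Longrightarrow> c \<in> C.P W1 \<Longrightarrow> c \<subseteq> D' \<times> UNIV \<and> c \<noteq> {}"
  using C.P_subset_H[of W1 c] C.P_nonempty[of c W1] unfolding C.H_def by blast

lemma SL_block: "W2 \<subseteq> D \<Longrightarrow> c \<in> SL.P W2 \<Longrightarrow> c \<subseteq> D \<times> UNIV \<and> c \<noteq> {}"
  using SL.P_subset_H[of W2 c] SL.P_nonempty[of c W2] unfolding SL.H_def by blast

lemma SR_block: "W2 \<subseteq> D \<Longrightarrow> c \<in> SR.P W2 \<Longrightarrow> c \<subseteq> D \<times> UNIV \<and> c \<noteq> {}"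
  using SR.P_subset_H[of W2 c] SR.P_nonempty[of c W2] unfolding SR.H_def by blast

text \<open>Recovers the \<open>D\<close> part of a set of circles; circles are nonempty, so one
  outside is never mistaken for one inside.\<close>

definition inner :: "('e \<times> bool) set set \<Rightarrow> ('e \<times> bool) set set" where
  "inner A = {c \<in> A. c \<subseteq> D \<times> UNIV}"

lemma inner_un:
  assumes "\<And>c. c \<in> A1 \<Longrightarrow> c \<subseteq> D' \<times> UNIV \<and> c \<noteq> {}" "\<And>c. c \<in> A2 \<Longrightarrow> c \<subseteq> D \<times> UNIV \<and> c \<noteq> {}"
  shows "inner (A1 \<union> A2) = A2" "(A1 \<union> A2) - A2 = A1" "A1 \<inter> A2 = {}"
proof -
  have "\<not> c \<subseteq> D \<times> UNIV" if "c \<in> A1" for c using assms(1)[OF that] by fastforce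
  then show "inner (A1 \<union> A2) = A2" "(A1 \<union> A2) - A2 = A1" "A1 \<inter> A2 = {}"
    using assms(2) by (auto simp: inner_def)
qed

lemma ht_un:
  assumes "W1 \<subseteq> D'" "W2 \<subseteq> D"
  shows "L.ht (W1 \<union> W2) = C.ht W1 + SL.ht W2"
proof -
  have "E - (W1 \<union> W2) = (D' - W1) \<union> (D - W2)" "(D' - W1) \<inter> (D - W2) = {}" using assms DE by auto
  then show ?thesis using L.finE C.finE SL.finE
    by (simp add: L.ht_def C.ht_def SL.ht_def card_Un_disjoint)
qed

lemma deg_un_L:
  assumes "W1 \<subseteq> D'" "W2 \<subseteq> D" "A1 \<subseteq> C.P W1" "A2 \<subseteq> SL.P W2"
  shows "L.deg (W1 \<union> W2, A1 \<union> A2) = C.deg (W1, A1) + SL.deg (W2, A2)"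
proof -
  have "C.P W1 \<inter> SL.P W2 = {}" "A1 \<inter> A2 = {}"
    using inner_un(3)[of "C.P W1" "SL.P W2"] C_block[OF assms(1)] SL_block[OF assms(2)] assms(3,4) by blast+
  moreover have "finite A1" "finite A2" using assms(3,4) finite_subset C.finP SL.finP by blast+
  ultimately show ?thesis
    by (simp add: L.deg_def C.deg_def SL.deg_def L.dv_def C.dv_def SL.dv_def L_P[OF assms(1,2)]
        ht_un[OF assms(1,2)] card_Un_disjoint)
qed

lemma deg_un_R:
  assumes "W1 \<subseteq> D'" "W2 \<subseteq> D" "A1 \<subseteq> C.P W1" "A2 \<subseteq> SR.P W2"
  shows "R.deg (W1 \<union> W2, A1 \<union> A2) = C.deg (W1, A1) + SR.deg (W2, A2)"
proof -
  have "C.P W1 \<inter> SR.P W2 = {}" "A1 \<inter> A2 = {}"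
    using inner_un(3)[of "C.P W1" "SR.P W2"] C_block[OF assms(1)] SR_block[OF assms(2)] assms(3,4) by blast+
  moreover have "finite A1" "finite A2" using assms(3,4) finite_subset C.finP SR.finP by blast+
  ultimately show ?thesis
    by (simp add: R.deg_def C.deg_def SR.deg_def R.dv_def C.dv_def SR.dv_def R_P[OF assms(1,2)]
        ht_un[OF assms(1,2)] card_Un_disjoint)
qed

definition XL where "XL = {(W, A). W \<subseteq> D \<and> A \<subseteq> SL.P W}"
definition XR where "XR = {(W, A). W \<subseteq> D \<and> A \<subseteq> SR.P W}"
definition XC where "XC = {(W, A). W \<subseteq> D' \<and> A \<subseteq> C.P W}"

definition sl :: "('e bgen \<Rightarrow> rat) \<Rightarrow> 'e bgen \<Rightarrow> 'e bgen \<Rightarrow> rat" where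
  "sl f = (\<lambda>(W1, A1) (W2, A2). if W2 \<subseteq> D \<and> A2 \<subseteq> SL.P W2 then f (W1 \<union> W2, A1 \<union> A2) else 0)"

definition slR :: "('e bgen \<Rightarrow> rat) \<Rightarrow> 'e bgen \<Rightarrow> 'e bgen \<Rightarrow> rat" where
  "slR f = (\<lambda>(W1, A1) (W2, A2). if W2 \<subseteq> D \<and> A2 \<subseteq> SR.P W2 then f (W1 \<union> W2, A1 \<union> A2) else 0)"

definition slC :: "('e bgen \<Rightarrow> rat) \<Rightarrow> 'e bgen \<Rightarrow> 'e bgen \<Rightarrow> rat" where
  "slC f = (\<lambda>(W2, A2) (W1, A1). if W1 \<subseteq> D' \<and> A1 \<subseteq> C.P W1 then f (W1 \<union> W2, A1 \<union> A2) else 0)"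

lemma T_L_D:
  assumes "(W1, A1) \<in> XC" "(W2, A2) \<in> XL" "e \<in> D"
  shows "L.T t e f (W1 \<union> W2, A1 \<union> A2) = SL.T t e (sl f (W1, A1)) (W2, A2)"
proof -
  have *: "W1 \<subseteq> D'" "A1 \<subseteq> C.P W1" "W2 \<subseteq> D" "A2 \<subseteq> SL.P W2" using assms by (auto simp: XC_def XL_def)
  have "c \<inter> D \<times> UNIV = {}" if "c \<in> A1" for c using C_block[OF *(1)] *(2) that by blast
  then show ?thesis
    using LD.T_slice[OF *(1,3) _ _ *(4) assms(3), of A1 t f] *(2) L_P[OF *(1,3)]
    by (auto simp: sl_def)
qed

lemma T_R_D:
  assumes "(W1, A1) \<in> XC" "(W2, A2) \<in> XR" "e \<in> D"
  shows "R.T t e f (W1 \<union> W2, A1 \<union> A2) = SR.T t e (slR f (W1, A1)) (W2, A2)"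
proof -
  have *: "W1 \<subseteq> D'" "A1 \<subseteq> C.P W1" "W2 \<subseteq> D" "A2 \<subseteq> SR.P W2" using assms by (auto simp: XC_def XR_def)
  have "c \<inter> D \<times> UNIV = {}" if "c \<in> A1" for c using C_block[OF *(1)] *(2) that by blast
  then show ?thesis
    using RD.T_slice[OF *(1,3) _ _ *(4) assms(3), of A1 t f] *(2) R_P[OF *(1,3)]
    by (auto simp: slR_def)
qed

lemma T_L_C:
  assumes "(W1, A1) \<in> XC" "(W2, A2) \<in> XL" "e \<in> D'"
  shows "L.T t e f (W1 \<union> W2, A1 \<union> A2) = C.T t e (slC f (W2, A2)) (W1, A1)"
proof -
  have *: "W1 \<subseteq> D'" "A1 \<subseteq> C.P W1" "W2 \<subseteq> D" "A2 \<subseteq> SL.P W2" using assms by (auto simp: XC_def XL_def)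
  have W2: "W2 \<subseteq> E - D'" using *(3) DE by blast
  have "c \<inter> D' \<times> UNIV = {}" if "c \<in> A2" for c using SL_block[OF *(3)] *(4) that by blast
  then have "L.T t e f (W2 \<union> W1, A2 \<union> A1) = C.T t e
      (\<lambda>(V, B). if V \<subseteq> D' \<and> B \<subseteq> C.P V then f (W2 \<union> V, A2 \<union> B) else 0) (W1, A1)"
    using LC.T_slice[OF W2 *(1) _ _ *(2) assms(3), of A2 t f] *(4) L_P[OF *(1,3)]
    by (auto simp: Un_commute)
  moreover have "(\<lambda>(V, B). if V \<subseteq> D' \<and> B \<subseteq> C.P V then f (W2 \<union> V, A2 \<union> B) else 0) = slC f (W2, A2)"
    by (simp add: slC_def fun_eq_iff Un_commute)
  ultimately show ?thesis by (simp only: Un_commute[of W1] Un_commute[of A1])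
qed

lemma T_R_C:
  assumes "(W1, A1) \<in> XC" "(W2, A2) \<in> XR" "e \<in> D'"
  shows "R.T t e f (W1 \<union> W2, A1 \<union> A2) = C.T t e (slC f (W2, A2)) (W1, A1)"
proof -
  have *: "W1 \<subseteq> D'" "A1 \<subseteq> C.P W1" "W2 \<subseteq> D" "A2 \<subseteq> SR.P W2" using assms by (auto simp: XC_def XR_def)
  have W2: "W2 \<subseteq> E - D'" using *(3) DE by blast
  have "c \<inter> D' \<times> UNIV = {}" if "c \<in> A2" for c using SR_block[OF *(3)] *(4) that by blast
  then have "R.T t e f (W2 \<union> W1, A2 \<union> A1) = C.T t e
      (\<lambda>(V, B). if V \<subseteq> D' \<and> B \<subseteq> C.P V then f (W2 \<union> V, A2 \<union> B) else 0) (W1, A1)"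
    using RC.T_slice[OF W2 *(1) _ _ _ assms(3), of A2 A1 t f] *(2,4) R_P[OF *(1,3)]
    unfolding RC_P RC_T by (auto simp: Un_commute)
  moreover have "(\<lambda>(V, B). if V \<subseteq> D' \<and> B \<subseteq> C.P V then f (W2 \<union> V, A2 \<union> B) else 0) = slC f (W2, A2)"
    by (simp add: slC_def fun_eq_iff Un_commute)
  ultimately show ?thesis by (simp only: Un_commute[of W1] Un_commute[of A1])
qed

lemma sg_C:
  assumes "W1 \<subseteq> D'" "W2 \<subseteq> D" "e \<in> D'"
  shows "L.sg (W1 \<union> W2) e = C.sg W1 e"
proof -
  have "{a \<in> E. a \<notin> W1 \<union> W2 \<and> pos a < pos e} = {a \<in> D'. a \<notin> W1 \<and> pos a < pos e}"
    using assms pos_lt[OF assms(3)] by (auto dest: less_asym)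
  then show ?thesis by (simp add: L.sg_def C.sg_def)
qed

lemma sg_D:
  assumes "W1 \<subseteq> D'" "W2 \<subseteq> D" "e \<in> D"
  shows "L.sg (W1 \<union> W2) e = (-1) ^ card (D' - W1) * SL.sg W2 e"
proof -
  have "{a \<in> E. a \<notin> W1 \<union> W2 \<and> pos a < pos e} = (D' - W1) \<union> {a \<in> D. a \<notin> W2 \<and> pos a < pos e}"
    using assms DE pos_lt[OF _ assms(3)] by auto
  moreover have "(D' - W1) \<inter> {a \<in> D. a \<notin> W2 \<and> pos a < pos e} = {}" by blast
  ultimately have "card {a \<in> E. a \<notin> W1 \<union> W2 \<and> pos a < pos e} =
      card (D' - W1) + card {a \<in> D. a \<notin> W2 \<and> pos a < pos e}"
    using C.finE SL.finE by (simp add: card_Un_disjoint)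
  then show ?thesis by (simp add: L.sg_def SL.sg_def power_add)
qed

lemma (in ordered_ribbon) d_apply: "d t N f (W, A) = (\<Sum>e\<in>N - W. sg W e * T t e f (W, A))" if "finite N"
proof -
  have "d t N f (W, A) = (\<Sum>e\<in>N. if e \<in> W then 0 else sg W e * T t e f (W, A))"
    unfolding d_def sum_fun_apply by (intro sum.cong refl) (simp add: Rop_def)
  then show ?thesis using that by (simp add: sum.If_cases Diff_eq)
qed

lemma d_L:
  assumes "(W1, A1) \<in> XC" "(W2, A2) \<in> XL"
  shows "L.d 0 E f (W1 \<union> W2, A1 \<union> A2) = (\<Sum>e\<in>D' - W1. C.sg W1 e * L.T 0 e f (W1 \<union> W2, A1 \<union> A2))
    + (-1) ^ card (D' - W1) * SL.d 0 D (sl f (W1, A1)) (W2, A2)"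
proof -
  have *: "W1 \<subseteq> D'" "W2 \<subseteq> D" using assms by (auto simp: XC_def XL_def)
  have "E - (W1 \<union> W2) = (D' - W1) \<union> (D - W2)" "(D' - W1) \<inter> (D - W2) = {}" using * DE by auto
  then have "L.d 0 E f (W1 \<union> W2, A1 \<union> A2) =
      (\<Sum>e\<in>D' - W1. L.sg (W1 \<union> W2) e * L.T 0 e f (W1 \<union> W2, A1 \<union> A2)) +
      (\<Sum>e\<in>D - W2. L.sg (W1 \<union> W2) e * L.T 0 e f (W1 \<union> W2, A1 \<union> A2))"
    using L.finE C.finE SL.finE by (simp add: L.d_apply sum.union_disjoint)
  also have "(\<Sum>e\<in>D' - W1. L.sg (W1 \<union> W2) e * L.T 0 e f (W1 \<union> W2, A1 \<union> A2)) =
      (\<Sum>e\<in>D' - W1. C.sg W1 e * L.T 0 e f (W1 \<union> W2, A1 \<union> A2))"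
    by (intro sum.cong refl) (simp add: sg_C[OF *])
  also have "(\<Sum>e\<in>D - W2. L.sg (W1 \<union> W2) e * L.T 0 e f (W1 \<union> W2, A1 \<union> A2)) =
      (-1) ^ card (D' - W1) * SL.d 0 D (sl f (W1, A1)) (W2, A2)"
    unfolding SL.d_apply[OF SL.finE] sum_distrib_left
    by (intro sum.cong refl) (simp add: sg_D[OF *] T_L_D[OF assms])
  finally show ?thesis .
qed

lemma d_R:
  assumes "(W1, A1) \<in> XC" "(W2, A2) \<in> XR"
  shows "R.d 0 E f (W1 \<union> W2, A1 \<union> A2) = (\<Sum>e\<in>D' - W1. C.sg W1 e * R.T 0 e f (W1 \<union> W2, A1 \<union> A2))
    + (-1) ^ card (D' - W1) * SR.d 0 D (slR f (W1, A1)) (W2, A2)"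
proof -
  have *: "W1 \<subseteq> D'" "W2 \<subseteq> D" using assms by (auto simp: XC_def XR_def)
  have "E - (W1 \<union> W2) = (D' - W1) \<union> (D - W2)" "(D' - W1) \<inter> (D - W2) = {}" using * DE by auto
  then have "R.d 0 E f (W1 \<union> W2, A1 \<union> A2) =
      (\<Sum>e\<in>D' - W1. L.sg (W1 \<union> W2) e * R.T 0 e f (W1 \<union> W2, A1 \<union> A2)) +
      (\<Sum>e\<in>D - W2. L.sg (W1 \<union> W2) e * R.T 0 e f (W1 \<union> W2, A1 \<union> A2))"
    using L.finE C.finE SL.finE by (simp add: R.d_apply sum.union_disjoint)
  also have "(\<Sum>e\<in>D' - W1. L.sg (W1 \<union> W2) e * R.T 0 e f (W1 \<union> W2, A1 \<union> A2)) =
      (\<Sum>e\<in>D' - W1. C.sg W1 e * R.T 0 e f (W1 \<union> W2, A1 \<union> A2))"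
    by (intro sum.cong refl) (simp add: sg_C[OF *])
  also have "(\<Sum>e\<in>D - W2. L.sg (W1 \<union> W2) e * R.T 0 e f (W1 \<union> W2, A1 \<union> A2)) =
      (-1) ^ card (D' - W1) * SR.d 0 D (slR f (W1, A1)) (W2, A2)"
    unfolding SR.d_apply[OF SR.finE] sum_distrib_left
    by (intro sum.cong refl) (simp add: sg_D[OF *] T_R_D[OF assms])
  finally show ?thesis .
qed

lemma XL_gens: "SL.gens h j \<subseteq> XL" by (auto simp: SL.gens_def XL_def)
lemma XR_gens: "SR.gens h j \<subseteq> XR" by (auto simp: SR.gens_def XR_def)
lemma finXL: "finite XL" using SL.finite_bgens by (simp add: XL_def)

text \<open>Heights are natural numbers here because the construction of the chain map starts in
  height 0.\<close>

lemma component_maps: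
  "\<exists>\<Theta> :: nat \<Rightarrow> ('e bgen \<Rightarrow> rat) \<Rightarrow> 'e bgen \<Rightarrow> rat. \<forall>n. rlin (\<Theta> n) \<and>
    (\<forall>f\<in>fsup (SL.gens (int n) j). \<Theta> n f \<in> fsup (SR.gens (int n) j) \<and>
      SR.d 0 D (\<Theta> n f) = \<Theta> (Suc n) (SL.d 0 D f) \<and> (\<Theta> n f = 0 \<longrightarrow> f = 0))"
proof (rule injective_chain_map[OF SL.d_linear _ _ SR.d_linear])
  fix n
  show "f \<in> fsup (SL.gens (int n) j) \<Longrightarrow> SL.d 0 D f \<in> fsup (SL.gens (int (Suc n)) j)" for f
    using SL.d0_gens[of f "int n" j] by (simp add: add.commute)
  show "f \<in> fsup (SR.gens (int n) j) \<Longrightarrow> SR.d 0 D f \<in> fsup (SR.gens (int (Suc n)) j)" for f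
    using SR.d0_gens[of f "int n" j] by (simp add: add.commute)
  show "SL.d 0 D (SL.d 0 D f) = 0" "SR.d 0 D (SR.d 0 D f) = 0" for f
    using SL.d_d[OF order_refl] SR.d_d[OF order_refl] by blast+
  show "finite (SL.gens (int n) j)" "finite (SR.gens (int n) j)" by (rule SL.finite_gens SR.finite_gens)+
  show "card (SL.gens (int n) j) = card (SR.gens (int n) j)"
    by (rule card_gens_eq[OF SL.ordered_ribbon_axioms SR.ordered_ribbon_axioms cardP])
  show "rv.dim {f \<in> fsup (SL.gens (int n) j). SL.d 0 D f = 0} = rv.dim {f \<in> fsup (SR.gens (int n) j). SR.d 0 D f = 0}"
    using kappa_D[of "int n" j] by (simp only: SL.kappa_def SR.kappa_def)
qed

text \<open>The maps for single heights and degrees are assembled into one, given by its columns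
  \<open>\<theta> y\<close>. The explicit matrix allows the map to be moved past the operators of
  the edges outside \<open>D\<close>.\<close>

lemma chain_map:
  "\<exists>\<theta> :: 'e bgen \<Rightarrow> 'e bgen \<Rightarrow> rat. let Th = (\<lambda>f. \<Sum>y\<in>XL. rscale (f y) (\<theta> y)) in
    (\<forall>h j. \<forall>f\<in>fsup (SL.gens h j). Th f \<in> fsup (SR.gens h j) \<and> (Th f = 0 \<longrightarrow> f = 0)) \<and>
    (\<forall>f\<in>fsup XL. Th f \<in> fsup XR \<and> SR.d 0 D (Th f) = Th (SL.d 0 D f))"
proof -
  obtain \<Theta> :: "int \<Rightarrow> nat \<Rightarrow> ('e bgen \<Rightarrow> rat) \<Rightarrow> 'e bgen \<Rightarrow> rat" where
    \<Theta>: "\<forall>j n. rlin (\<Theta> j n) \<and> (\<forall>f\<in>fsup (SL.gens (int n) j). \<Theta> j n f \<in> fsup (SR.gens (int n) j) \<and>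
      SR.d 0 D (\<Theta> j n f) = \<Theta> j (Suc n) (SL.d 0 D f) \<and> (\<Theta> j n f = 0 \<longrightarrow> f = 0))"
    by (rule exE[OF choice[OF allI[OF component_maps]]])
  define \<theta> where "\<theta> y = \<Theta> (SL.deg y) (nat (SL.ht (fst y))) (pt y)" for y
  define Th where "Th = (\<lambda>f. \<Sum>y\<in>XL. rscale (f y) (\<theta> y))"
  have lin: "rlin Th" unfolding Th_def by (rule rlin_pt_sum)
  have Th: "Th f = \<Theta> j (nat h) f" if "f \<in> fsup (SL.gens h j)" for f h j
    unfolding Th_def
  proof (rule pt_sum_eq[OF finXL XL_gens that])
    show "rlin (\<Theta> j (nat h))" using \<Theta> by blast
    show "\<theta> y = \<Theta> j (nat h) (pt y)" if "y \<in> SL.gens h j" for y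
      using that by (auto simp: \<theta>_def SL.gens_def)
  qed
  have nat: "int (nat h) = h" if "SL.gens h j \<noteq> {}" for h j
    using SL.gens_empty[of h j] that by force
  have 1: "Th f \<in> fsup (SR.gens h j) \<and> (Th f = 0 \<longrightarrow> f = 0)" if f: "f \<in> fsup (SL.gens h j)" for f h j
  proof (cases "SL.gens h j = {}")
    case True
    then have "f = 0" using f by (simp add: fsup_empty)
    then show ?thesis using rlin_0[OF lin] by (simp add: fsup_def)
  next
    case False
    then have "f \<in> fsup (SL.gens (int (nat h)) j)" using f nat by simp
    then have "\<Theta> j (nat h) f \<in> fsup (SR.gens (int (nat h)) j) \<and> (\<Theta> j (nat h) f = 0 \<longrightarrow> f = 0)"
      using \<Theta> by blast
    then show ?thesis using Th[OF f] nat[OF False] by simp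
  qed
  have gr: "y \<in> SL.gens (SL.ht (fst y)) (SL.deg y)" if "y \<in> XL" for y
    using that by (auto simp: XL_def SL.gens_def)
  have dpt: "SR.d 0 D (Th (pt y)) = Th (SL.d 0 D (pt y))" if y: "y \<in> XL" for y
  proof -
    let ?h = "SL.ht (fst y)" and ?j = "SL.deg y"
    have p: "pt y \<in> fsup (SL.gens ?h ?j)" using pt_fsup[OF gr[OF y]] .
    have h: "int (nat ?h) = ?h" using gr[OF y] nat by blast
    then have "pt y \<in> fsup (SL.gens (int (nat ?h)) ?j)" using p by simp
    then have "SR.d 0 D (\<Theta> ?j (nat ?h) (pt y)) = \<Theta> ?j (Suc (nat ?h)) (SL.d 0 D (pt y))" using \<Theta> by blast
    moreover have "Suc (nat ?h) = nat (?h + 1)" using h by arith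
    ultimately show ?thesis using Th[OF p] Th[OF SL.d0_gens[OF p]] by simp
  qed
  have 2: "Th f \<in> fsup XR \<and> SR.d 0 D (Th f) = Th (SL.d 0 D f)" if f: "f \<in> fsup XL" for f
  proof
    have ex: "f = (\<Sum>y\<in>XL. rscale (f y) (pt y))" by (rule fsup_expand[OF finXL f])
    have "\<theta> y \<in> fsup XR" if y: "y \<in> XL" for y
    proof -
      have "Th (pt y) \<in> fsup XR" using 1[OF pt_fsup[OF gr[OF y]]] fsup_mono[OF XR_gens] by blast
      moreover have "Th (pt y) = \<theta> y" using Th[OF pt_fsup[OF gr[OF y]]] by (simp add: \<theta>_def)
      ultimately show ?thesis by simp
    qed
    then show "Th f \<in> fsup XR" unfolding Th_def
      by (intro rv.subspace_sum[OF fsup_subspace] rv.subspace_scale[OF fsup_subspace])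
    have "SR.d 0 D (Th f) = (\<Sum>y\<in>XL. rscale (f y) (SR.d 0 D (Th (pt y))))"
      by (subst ex) (simp add: rlin_sum[OF lin] rlin_scale[OF lin] rlin_sum[OF SR.d_linear] rlin_scale[OF SR.d_linear])
    also have "\<dots> = (\<Sum>y\<in>XL. rscale (f y) (Th (SL.d 0 D (pt y))))" by (simp add: dpt)
    also have "\<dots> = Th (SL.d 0 D (\<Sum>y\<in>XL. rscale (f y) (pt y)))"
      by (simp add: rlin_sum[OF lin] rlin_scale[OF lin] rlin_sum[OF SL.d_linear] rlin_scale[OF SL.d_linear])
    also have "\<dots> = Th (SL.d 0 D f)" using ex by simp
    finally show "SR.d 0 D (Th f) = Th (SL.d 0 D f)" .
  qed
  show ?thesis using 1 2 unfolding Let_def Th_def by blast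
qed

lemma kappa_le: "L.kappa h j \<le> R.kappa h j"
proof -
  obtain \<theta> where \<theta>: "let Th = (\<lambda>f. \<Sum>y\<in>XL. rscale (f y) (\<theta> y)) in
    (\<forall>h j. \<forall>f\<in>fsup (SL.gens h j). Th f \<in> fsup (SR.gens h j) \<and> (Th f = 0 \<longrightarrow> f = 0)) \<and>
    (\<forall>f\<in>fsup XL. Th f \<in> fsup XR \<and> SR.d 0 D (Th f) = Th (SL.d 0 D f))"
    by (rule exE[OF chain_map])
  define Th where "Th = (\<lambda>f. \<Sum>y\<in>XL. rscale (f y) (\<theta> y))"
  have Th1: "Th f \<in> fsup (SR.gens h j)" and Th2: "Th f = 0 \<Longrightarrow> f = 0" if "f \<in> fsup (SL.gens h j)" for f h j
    using \<theta> that unfolding Let_def Th_def[symmetric] by blast+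
  have Th3: "Th f \<in> fsup XR" "SR.d 0 D (Th f) = Th (SL.d 0 D f)" if "f \<in> fsup XL" for f
    using \<theta> that unfolding Let_def Th_def[symmetric] by blast+
  have lin: "rlin Th" unfolding Th_def by (rule rlin_pt_sum)
  have Tha: "Th f x = (\<Sum>y\<in>XL. f y * \<theta> y x)" for f x
    by (simp add: Th_def sum_fun_apply rscale_apply)
  \<comment> \<open>The chain map over \<open>D\<close> tensored with the identity: it acts on each
    slice with fixed state and labels outside \<open>D\<close>.\<close>
  define B where "B f = (\<lambda>(W, A). if W \<subseteq> E \<and> A \<subseteq> R.P W
    then Th (sl f (W - D, A - inner A)) (W \<inter> D, inner A) else 0)" for f
  have sl_add: "sl (f + g) z = sl f z + sl g z" "sl (rscale c f) z = rscale c (sl f z)" for f g z c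
    by (cases z; auto simp: sl_def fun_eq_iff rscale_apply)+
  have B_lin: "rlin B"
    by (rule rlinI) (auto simp: B_def sl_add rlin_add[OF lin] rlin_scale[OF lin] rscale_apply)
  have slX: "sl f z \<in> fsup XL" for f z
    by (cases z) (auto simp: fsup_def sl_def XL_def)
  have B_at: "B f (W1 \<union> W2, A1 \<union> A2) = Th (sl f (W1, A1)) (W2, A2)"
    if "(W1, A1) \<in> XC" "(W2, A2) \<in> XR" for f W1 A1 W2 A2
  proof -
    have *: "W1 \<subseteq> D'" "A1 \<subseteq> C.P W1" "W2 \<subseteq> D" "A2 \<subseteq> SR.P W2" using that by (auto simp: XC_def XR_def)
    have in2: "inner (A1 \<union> A2) = A2" "(A1 \<union> A2) - A2 = A1"
      using inner_un[of A1 A2] C_block[OF *(1)] SR_block[OF *(3)] *(2,4) by blast+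
    have "W1 \<union> W2 \<subseteq> E" "(W1 \<union> W2) - D = W1" "(W1 \<union> W2) \<inter> D = W2" using *(1,3) DE by auto
    moreover have "A1 \<union> A2 \<subseteq> R.P (W1 \<union> W2)" using R_P[OF *(1,3)] *(2,4) by auto
    ultimately show ?thesis unfolding B_def in2 by (simp add: in2)
  qed
  have dec: "\<exists>W1 A1 W2 A2. (W1, A1) \<in> XC \<and> (W2, A2) \<in> XR \<and> W = W1 \<union> W2 \<and> A = A1 \<union> A2"
    if "W \<subseteq> E" "A \<subseteq> R.P W" for W A
  proof -
    have W: "W = (W - D) \<union> (W \<inter> D)" "W - D \<subseteq> D'" "W \<inter> D \<subseteq> D" using that by auto
    have P: "R.P W = C.P (W - D) \<union> SR.P (W \<inter> D)" using R_P[OF W(2,3)] W(1) by simp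
    show ?thesis using that(2) W unfolding P
      by (intro exI[of _ "W - D"] exI[of _ "A \<inter> C.P (W - D)"] exI[of _ "W \<inter> D"] exI[of _ "A \<inter> SR.P (W \<inter> D)"])
        (auto simp: XC_def XR_def)
  qed
  have sl_gens: "sl f (W1, A1) \<in> fsup (SL.gens (h - C.ht W1) (j - C.deg (W1, A1)))"
    if f: "f \<in> fsup (L.gens h j)" and x: "(W1, A1) \<in> XC" for f W1 A1 h j
  proof (rule fsupI, clarify)
    fix W2 A2 assume "sl f (W1, A1) (W2, A2) \<noteq> 0"
    then have y: "W2 \<subseteq> D" "A2 \<subseteq> SL.P W2" "(W1 \<union> W2, A1 \<union> A2) \<in> L.gens h j"
      using fsupD[OF f] by (auto simp: sl_def split: if_splits)
    have x': "W1 \<subseteq> D'" "A1 \<subseteq> C.P W1" using x by (auto simp: XC_def)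
    show "(W2, A2) \<in> SL.gens (h - C.ht W1) (j - C.deg (W1, A1))"
      using y deg_un_L[OF x'(1) y(1) x'(2) y(2)] ht_un[OF x'(1) y(1)]
      by (auto simp: L.gens_def SL.gens_def)
  qed
  have B_gens: "B f \<in> fsup (R.gens h j)" if f: "f \<in> fsup (L.gens h j)" for f
  proof (rule fsupI, clarify)
    fix W A assume nz: "B f (W, A) \<noteq> 0"
    then have WA: "W \<subseteq> E" "A \<subseteq> R.P W" by (auto simp: B_def split: if_splits)
    then obtain W1 A1 W2 A2 where z: "(W1, A1) \<in> XC" "(W2, A2) \<in> XR" "W = W1 \<union> W2" "A = A1 \<union> A2"
      using dec by blast
    have "Th (sl f (W1, A1)) (W2, A2) \<noteq> 0" using nz B_at[OF z(1,2)] z by simp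
    then have g: "(W2, A2) \<in> SR.gens (h - C.ht W1) (j - C.deg (W1, A1))"
      using fsupD[OF Th1[OF sl_gens[OF f z(1)]]] by blast
    have x': "W1 \<subseteq> D'" "A1 \<subseteq> C.P W1" "W2 \<subseteq> D" "A2 \<subseteq> SR.P W2" using z by (auto simp: XC_def XR_def)
    show "(W, A) \<in> R.gens h j"
      using g WA deg_un_R[OF x'(1,3,2,4)] ht_un[OF x'(1,3)] z by (auto simp: R.gens_def SR.gens_def)
  qed
  have B_inj: "f = 0" if f: "f \<in> fsup (L.gens h j)" and 0: "B f = 0" for f
  proof (rule ext, clarify, rule ccontr)
    fix W A assume nz: "f (W, A) \<noteq> 0 (W, A)"
    then have WA: "W \<subseteq> E" "A \<subseteq> L.P W" using fsupD[OF f, of "(W, A)"] by (auto simp: L.gens_def)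
    have W: "W = (W - D) \<union> (W \<inter> D)" "W - D \<subseteq> D'" "W \<inter> D \<subseteq> D" using WA by auto
    have P: "L.P W = C.P (W - D) \<union> SL.P (W \<inter> D)" using L_P[OF W(2,3)] W(1) by simp
    let ?A1 = "A \<inter> C.P (W - D)" and ?A2 = "A \<inter> SL.P (W \<inter> D)"
    have x: "(W - D, ?A1) \<in> XC" using W by (auto simp: XC_def)
    have "Th (sl f (W - D, ?A1)) (W2, A2) = 0" for W2 A2
    proof (cases "(W2, A2) \<in> XR")
      case True
      have "B f ((W - D) \<union> W2, ?A1 \<union> A2) = 0" using 0 by simp
      then show ?thesis using B_at[OF x True] by simp
    next
      case False
      then show ?thesis using fsupD[OF Th3(1)[OF slX]] by blast
    qed
    then have "Th (sl f (W - D, ?A1)) = 0" by (auto simp: fun_eq_iff)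
    then have "sl f (W - D, ?A1) = 0" using Th2[OF sl_gens[OF f x]] by blast
    then have "sl f (W - D, ?A1) (W \<inter> D, ?A2) = 0" by simp
    moreover have "?A1 \<union> ?A2 = A" using WA(2) P by auto
    ultimately show False using nz W by (simp add: sl_def)
  qed
  \<comment> \<open>Seen from outside \<open>D\<close>, the map forms linear combinations of slices
    with the coefficients of \<open>\<theta>\<close>, which the linear outer operators
    respect.\<close>
  have slC_B: "slC (B f) (W2, A2) = (\<Sum>y\<in>XL. rscale (\<theta> y (W2, A2)) (slC f y))"
    if y: "(W2, A2) \<in> XR" for f W2 A2
  proof (rule ext, clarify)
    fix W1 A1
    show "slC (B f) (W2, A2) (W1, A1) = (\<Sum>y\<in>XL. rscale (\<theta> y (W2, A2)) (slC f y)) (W1, A1)"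
    proof (cases "(W1, A1) \<in> XC")
      case True
      then have v: "W1 \<subseteq> D'" "A1 \<subseteq> C.P W1" by (auto simp: XC_def)
      have "slC (B f) (W2, A2) (W1, A1) = Th (sl f (W1, A1)) (W2, A2)"
        using v B_at[OF True y] by (simp add: slC_def)
      also have "\<dots> = (\<Sum>z\<in>XL. \<theta> z (W2, A2) * slC f z (W1, A1))"
        unfolding Tha using v by (intro sum.cong refl) (auto simp: sl_def slC_def XL_def)
      finally show ?thesis by (simp add: sum_fun_apply rscale_apply)
    next
      case False
      have "slC g y (W1, A1) = 0" for g y
        using False by (cases y) (auto simp: slC_def XC_def)
      then show ?thesis by (simp add: sum_fun_apply rscale_apply)
    qed
  qed
  have chain: "R.d 0 E (B f) = B (L.d 0 E f)" if f: "f \<in> fsup (L.gens h j)" for f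
  proof (rule ext, clarify)
    fix W A
    show "R.d 0 E (B f) (W, A) = B (L.d 0 E f) (W, A)"
    proof (cases "W \<subseteq> E \<and> A \<subseteq> R.P W")
      case False
      then have "R.T 0 e (B f) (W, A) = 0" for e unfolding R.T_def prod.case by (rule if_not_P)
      then have "R.d 0 E (B f) (W, A) = 0" by (simp add: R.d_apply[OF R.finE])
      moreover have "B (L.d 0 E f) (W, A) = 0" unfolding B_def prod.case using False by (rule if_not_P)
      ultimately show ?thesis by simp
    next
      case True
      have WA: "W \<subseteq> E" "A \<subseteq> R.P W" using True by simp_all
      obtain W1 A1 W2 A2 where z: "(W1, A1) \<in> XC" "(W2, A2) \<in> XR" "W = W1 \<union> W2" "A = A1 \<union> A2"
        using dec[OF WA] by (elim exE conjE)
      let ?k = "(-1) ^ card (D' - W1) :: rat"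
      have s: "slR (B f) (W1, A1) = Th (sl f (W1, A1))"
      proof (rule ext, clarify)
        fix V2 C2
        show "slR (B f) (W1, A1) (V2, C2) = Th (sl f (W1, A1)) (V2, C2)"
        proof (cases "(V2, C2) \<in> XR")
          case True
          then show ?thesis using B_at[OF z(1) True] by (simp add: slR_def XR_def)
        next
          case False
          then have "Th (sl f (W1, A1)) (V2, C2) = 0" using fsupD[OF Th3(1)[OF slX]] by blast
          then show ?thesis using False by (auto simp: slR_def XR_def)
        qed
      qed
      have T1: "R.T 0 e (B f) (W, A) = (\<Sum>y\<in>XL. \<theta> y (W2, A2) * C.T 0 e (slC f y) (W1, A1))"
        if "e \<in> D'" for e
        unfolding z(3,4) T_R_C[OF z(1,2) that] slC_B[OF z(2)] rlin_sum[OF C.T_linear]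
          rlin_scale[OF C.T_linear]
        by (simp add: sum_fun_apply rscale_apply)
      have "R.d 0 E (B f) (W, A) = (\<Sum>e\<in>D' - W1. C.sg W1 e * (\<Sum>y\<in>XL. \<theta> y (W2, A2) * C.T 0 e (slC f y) (W1, A1)))
          + ?k * Th (SL.d 0 D (sl f (W1, A1))) (W2, A2)"
        unfolding Th3(2)[OF slX, symmetric] s[symmetric]
        using d_R[OF z(1,2), of "B f"] T1 unfolding z(3,4) by simp
      also have "\<dots> = (\<Sum>y\<in>XL. ((\<Sum>e\<in>D' - W1. C.sg W1 e * C.T 0 e (slC f y) (W1, A1)) +
          ?k * SL.d 0 D (sl f (W1, A1)) y) * \<theta> y (W2, A2))"
      proof -
        have "(\<Sum>e\<in>D' - W1. C.sg W1 e * (\<Sum>y\<in>XL. \<theta> y (W2, A2) * C.T 0 e (slC f y) (W1, A1))) =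
          (\<Sum>y\<in>XL. (\<Sum>e\<in>D' - W1. C.sg W1 e * C.T 0 e (slC f y) (W1, A1)) * \<theta> y (W2, A2))"
          unfolding sum_distrib_left sum_distrib_right
          by (subst sum.swap) (intro sum.cong refl, simp add: mult_ac)
        then show ?thesis unfolding Tha
          by (simp only: distrib_right sum.distrib sum_distrib_left[where r = ?k] mult.assoc)
      qed
      also have "\<dots> = (\<Sum>y\<in>XL. sl (L.d 0 E f) (W1, A1) y * \<theta> y (W2, A2))"
      proof (intro sum.cong refl)
        fix y assume "y \<in> XL"
        then obtain V2 C2 where y: "y = (V2, C2)" "(V2, C2) \<in> XL" by (cases y) auto
        have "sl (L.d 0 E f) (W1, A1) y = L.d 0 E f (W1 \<union> V2, A1 \<union> C2)"
          using y by (simp add: sl_def XL_def)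
        also have "\<dots> = (\<Sum>e\<in>D' - W1. C.sg W1 e * C.T 0 e (slC f y) (W1, A1)) +
            ?k * SL.d 0 D (sl f (W1, A1)) y"
          unfolding d_L[OF z(1) y(2)] y(1) by (simp add: T_L_C[OF z(1) y(2)])
        finally show "((\<Sum>e\<in>D' - W1. C.sg W1 e * C.T 0 e (slC f y) (W1, A1)) +
            ?k * SL.d 0 D (sl f (W1, A1)) y) * \<theta> y (W2, A2) = sl (L.d 0 E f) (W1, A1) y * \<theta> y (W2, A2)"
          by simp
      qed
      also have "\<dots> = B (L.d 0 E f) (W, A)" using B_at[OF z(1,2)] by (simp add: z(3,4) Tha)
      finally show ?thesis .
    qed
  qed
  let ?KL = "{f\<in>fsup (L.gens h j). L.d 0 E f = 0}" and ?KR = "{f\<in>fsup (R.gens h j). R.d 0 E f = 0}"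
  have "B ` ?KL \<subseteq> ?KR" using B_gens chain rlin_0[OF B_lin] by auto
  then have "rv.dim (B ` ?KL) \<le> rv.dim ?KR"
    by (intro dim_mono_fsup[OF kernel_subspace[OF R.d_linear fsup_subspace] _ R.finite_gens]) auto
  moreover have "rv.dim (B ` ?KL) = rv.dim ?KL"
    by (rule dim_inj_image[OF B_lin kernel_subspace[OF L.d_linear fsup_subspace] _ L.finite_gens])
      (use B_inj in auto)
  ultimately show ?thesis by (simp add: L.kappa_def R.kappa_def)
qed

end

section \<open>Restriction to components and replacement of one part at a time\<close>

lemma (in planar_ribbon) orbit_cong_part:
  assumes "x \<in> D \<times> UNIV" "\<And>x. x \<in> D \<times> UNIV \<Longrightarrow> f x \<in> D \<times> UNIV" "\<And>x. x \<in> D \<times> UNIV \<Longrightarrow> g x = f x"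
  shows "orbit g x = orbit f x"
  by (rule orbit_cong0[of x "D \<times> UNIV"]) (use assms in auto)

lemma (in planar_ribbon) separated_pres:
  assumes D: "D \<subseteq> E" "vx ` (D \<times> UNIV) \<inter> vx ` ((E - D) \<times> UNIV) = {}" and x: "fst x \<in> D"
  shows "fst (\<sigma> x) \<in> D"
proof (rule ccontr)
  assume n: "fst (\<sigma> x) \<notin> D"
  have xH: "x \<in> H" using x D by (auto simp: H_def mem_Times_iff)
  then have "\<sigma> x \<in> H" by (rule sigma_H)
  then have "\<sigma> x \<in> (E - D) \<times> UNIV" using n by (auto simp: H_def mem_Times_iff)
  then have "vx (\<sigma> x) \<in> vx ` ((E - D) \<times> UNIV)" by (rule imageI)
  moreover have "vx x \<in> vx ` (D \<times> UNIV)" using x by (intro imageI) (simp add: mem_Times_iff)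
  ultimately show False using D(2) vx_sigma[OF xH] by auto
qed

lemma (in planar_ribbon) planar_restrict:
  assumes D: "D \<subseteq> E" "vx ` (D \<times> UNIV) \<inter> vx ` ((E - D) \<times> UNIV) = {}"
  shows "planar_ribbon D (restrict_perm D \<sigma>) vx"
proof -
  interpret X: subribbon E \<sigma> D by unfold_locales (use D(1) separated_pres[OF D] in auto)
  show ?thesis
  proof
    fix x y assume xy: "x \<in> X.S.H" "y \<in> X.S.H"
    then have "x \<in> H" "y \<in> H" "x \<in> D \<times> UNIV" using D(1) by (auto simp: H_def X.S.H_def)
    moreover have "orbit (restrict_perm D \<sigma>) x = orbit \<sigma> x"
      by (rule orbit_cong_part[OF calculation(3)])
        (use separated_pres[OF D] in \<open>auto simp: restrict_perm_def mem_Times_iff\<close>)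
    ultimately show "vx x = vx y \<longleftrightarrow> y \<in> orbit (restrict_perm D \<sigma>) x" using vx_orbit by simp
  next
    fix W e assume We: "W \<subseteq> D" "e \<in> D - W" "(vx (e, False), vx (e, True)) \<in> (adj vx W)\<^sup>*"
    then have "W \<subseteq> E" "e \<in> E - W" "e \<in> D" "W \<inter> D = W" using D by auto
    then show "X.S.ca W e = X.S.cb W e"
      using planar[OF \<open>W \<subseteq> E\<close> \<open>e \<in> E - W\<close> We(3)] X.ca_restrict[of W e] X.cb_restrict[of W e] by simp
  qed
qed

text \<open>By \<open>kappa_gauge\<close> the numbering may be changed to one with \<open>D\<close>
  last; \<open>kappa_le\<close> in both directions then gives equality.\<close>

lemma kappa_modified:
  assumes L: "ordered_ribbon E \<sigma> pos" and R: "ordered_ribbon E \<sigma>' pos'" and D: "D \<subseteq> E"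
    and presL: "\<And>x. fst x \<in> D \<Longrightarrow> fst (\<sigma> x) \<in> D" "\<And>x. fst x \<in> E - D \<Longrightarrow> fst (\<sigma> x) \<in> E - D"
    and presR: "\<And>x. fst x \<in> D \<Longrightarrow> fst (\<sigma>' x) \<in> D"
    and agree: "\<And>x. fst x \<in> E - D \<Longrightarrow> \<sigma>' x = \<sigma> x"
    and planar: "planar_ribbon D (restrict_perm D \<sigma>) vx" "planar_ribbon D (restrict_perm D \<sigma>') vx"
    and IH: "\<And>pos h j. inj_on pos D \<Longrightarrow> ordered_ribbon.kappa D (restrict_perm D \<sigma>) pos h j =
      ordered_ribbon.kappa D (restrict_perm D \<sigma>') pos h j"
  shows "ordered_ribbon.kappa E \<sigma> pos h j = ordered_ribbon.kappa E \<sigma>' pos' h j"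
proof -
  interpret L: ordered_ribbon E \<sigma> pos by fact
  interpret R: ordered_ribbon E \<sigma>' pos' by fact
  \<comment> \<open>Shifting the positions on \<open>D\<close> beyond the sum of all positions
    places \<open>D\<close> last and keeps the numbering injective.\<close>
  define p where "p a = (if a \<in> D then pos a + Suc (sum pos E) else pos a)" for a
  have le: "pos a \<le> sum pos E" if "a \<in> E" for a by (rule member_le_sum[OF that _ L.finE]) simp
  have inj: "inj_on p E"
  proof (rule inj_onI)
    fix a b assume ab: "a \<in> E" "b \<in> E" and p: "p a = p b"
    have "pos a = pos b" using p le[OF ab(1)] le[OF ab(2)]
      by (cases "a \<in> D"; cases "b \<in> D"; simp only: p_def if_True if_False)
    then show "a = b" by (rule inj_onD[OF L.inj_pos _ ab])
  qed
  have lt: "p a < p b" if "a \<in> E - D" "b \<in> D" for a b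
    using that le[of a] by (simp add: p_def)
  have Lp: "ordered_ribbon E \<sigma> p" and Rp: "ordered_ribbon E \<sigma>' p" by unfold_locales (rule inj)+
  have injD: "inj_on p D" using inj D by (rule inj_on_subset)
  have presR2: "fst (\<sigma>' x) \<in> E - D" if "fst x \<in> E - D" for x using agree[OF that] presL(2)[OF that] by simp
  have "modified_ribbon E \<sigma> \<sigma>' p D"
    by (rule modified_ribbon.intro[OF Lp Rp modified_ribbon_axioms.intro[OF D presL presR presR2 agree lt
        planar_card_P_eq[OF planar] IH[OF injD]]])
  moreover have "modified_ribbon E \<sigma>' \<sigma> p D"
    by (rule modified_ribbon.intro[OF Rp Lp modified_ribbon_axioms.intro[OF D presR presR2 presL
        agree[symmetric] lt planar_card_P_eq[OF planar(2,1)] IH[OF injD, symmetric]]])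
  ultimately have "ordered_ribbon.kappa E \<sigma> p h j = ordered_ribbon.kappa E \<sigma>' p h j"
    by (intro order_antisym modified_ribbon.kappa_le)
  then show ?thesis using kappa_gauge[OF L Lp, of h j] kappa_gauge[OF Rp R, of h j] by simp
qed

lemma kappa_empty_edges:
  fixes \<sigma> \<sigma>' :: "'e \<times> bool \<Rightarrow> 'e \<times> bool"
  assumes "ordered_ribbon {} \<sigma> pos" "ordered_ribbon {} \<sigma>' pos'"
  shows "ordered_ribbon.kappa {} \<sigma> pos h j = ordered_ribbon.kappa {} \<sigma>' pos' h j"
proof -
  interpret L: ordered_ribbon "{}" \<sigma> pos by fact
  interpret R: ordered_ribbon "{}" \<sigma>' pos' by fact
  have P: "L.P W = {}" "R.P W = {}" for W by (simp_all add: L.P_def R.P_def L.H_def R.H_def)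
  have "L.gens h j = R.gens h j"
    by (simp add: L.gens_def R.gens_def P L.deg_def R.deg_def L.dv_def R.dv_def L.ht_def R.ht_def)
  then show ?thesis by (simp add: L.kappa_def R.kappa_def L.d_def R.d_def)
qed

text \<open>Induction on the edge set. If \<open>D\<close> splits off, the hybrid
  \<open>\<tau>\<close> carries the second embedding on \<open>D\<close> and the first elsewhere;
  each of the two replacements changes only a proper part, where the induction hypothesis
  applies.\<close>

theorem kappa_planar:
  assumes "planar_ribbon E \<sigma> vx" "inj_on pos E" "planar_ribbon E \<sigma>' vx" "inj_on pos' E"
  shows "ordered_ribbon.kappa E \<sigma> pos h j = ordered_ribbon.kappa E \<sigma>' pos' h j"
proof -
  have "finite E" using assms(1) by (simp add: planar_ribbon_def vertex_ribbon_def ribbon_def)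
  then show ?thesis using assms
  proof (induction E arbitrary: \<sigma> pos \<sigma>' pos' h j rule: finite_psubset_induct)
    case (psubset E)
    note L = psubset.prems(1) and R = psubset.prems(3)
    interpret L: planar_ribbon E \<sigma> vx by (rule L)
    interpret R: planar_ribbon E \<sigma>' vx by (rule R)
    have LO: "ordered_ribbon E \<sigma> pos" by unfold_locales (rule psubset.prems(2))
    have RO: "ordered_ribbon E \<sigma>' pos'" by unfold_locales (rule psubset.prems(4))
    show ?case
    proof (cases "E = {}")
      case True
      show ?thesis using kappa_empty_edges[of \<sigma> pos \<sigma>' pos' h j] LO RO unfolding True by blast
    next
      case nE: False
      show ?thesis
      proof (cases "graph_connected vx E")
        case True
        show ?thesis by (rule kappa_planar_connected[OF psubset.prems nE True])
      next
        case False
        then obtain D where D: "D \<subseteq> E" "D \<noteq> {}" "D \<noteq> E"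
          and sep: "vx ` (D \<times> UNIV) \<inter> vx ` ((E - D) \<times> UNIV) = {}"
          unfolding graph_connected_def by blast
        let ?C = "E - D"
        have C: "?C \<subseteq> E" "E - ?C = D" using D by auto
        have sep': "vx ` (?C \<times> UNIV) \<inter> vx ` ((E - ?C) \<times> UNIV) = {}" using sep unfolding C(2) by blast
        have sub: "D \<subset> E" "?C \<subset> E" using D by auto
        define \<tau> where "\<tau> x = (if fst x \<in> D then \<sigma>' x else \<sigma> x)" for x
        note LD = L.separated_pres[OF D(1) sep] and LC = L.separated_pres[OF C(1) sep']
        note RD = R.separated_pres[OF D(1) sep] and RC = R.separated_pres[OF C(1) sep']
        have tD: "fst (\<tau> x) \<in> D" if "fst x \<in> D" for x using RD[OF that] that by (simp add: \<tau>_def)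
        have tC: "fst (\<tau> x) \<in> ?C" if "fst x \<in> ?C" for x using LC[OF that] that by (simp add: \<tau>_def)
        have "\<tau> permutes (E \<times> UNIV)"
        proof (rule bij_imp_permutes)
          have "inj_on \<tau> (E \<times> UNIV)"
          proof (rule inj_onI)
            fix x y assume xy: "x \<in> E \<times> (UNIV :: bool set)" "y \<in> E \<times> (UNIV :: bool set)" "\<tau> x = \<tau> y"
            have "fst x \<in> D \<longleftrightarrow> fst y \<in> D"
              using tD[of x] tD[of y] tC[of x] tC[of y] xy by (auto simp: mem_Times_iff)
            then show "x = y"
              using xy(3) injD[OF permutes_inj[OF L.perm], of x y] injD[OF permutes_inj[OF R.perm], of x y]
              by (auto simp: \<tau>_def split: if_splits)
          qed
          moreover have "\<tau> x \<in> E \<times> UNIV" if "x \<in> E \<times> UNIV" for x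
            using that tD[of x] tC[of x] D(1) by (cases "fst x \<in> D") (auto simp: mem_Times_iff)
          then have "\<tau> ` (E \<times> UNIV) \<subseteq> E \<times> UNIV" by blast
          ultimately show "bij_betw \<tau> (E \<times> UNIV) (E \<times> UNIV)"
            using L.finE by (simp add: bij_betw_def endo_inj_surj)
          fix x :: "'a \<times> bool" assume x: "x \<notin> E \<times> UNIV"
          then show "\<tau> x = x"
            using permutes_not_in[OF L.perm x] D(1) by (auto simp: \<tau>_def mem_Times_iff)
        qed
        then have T: "ordered_ribbon E \<tau> pos"
          by unfold_locales (use L.finE psubset.prems(2) in auto)
        have rD: "restrict_perm D \<tau> = restrict_perm D \<sigma>'" by (auto simp: restrict_perm_def \<tau>_def fun_eq_iff)
        have rC: "restrict_perm ?C \<tau> = restrict_perm ?C \<sigma>" by (auto simp: restrict_perm_def \<tau>_def fun_eq_iff)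
        note pD = L.planar_restrict[OF D(1) sep] R.planar_restrict[OF D(1) sep]
        note pC = L.planar_restrict[OF C(1) sep'] R.planar_restrict[OF C(1) sep']
        have 1: "ordered_ribbon.kappa E \<sigma> pos h j = ordered_ribbon.kappa E \<tau> pos h j"
        proof (rule kappa_modified[OF LO T D(1) LD LC tD _ pD(1)])
          show "fst x \<in> ?C \<Longrightarrow> \<tau> x = \<sigma> x" for x by (simp add: \<tau>_def)
          show "planar_ribbon D (restrict_perm D \<tau>) vx" unfolding rD by (rule pD(2))
          show "inj_on p D \<Longrightarrow> ordered_ribbon.kappa D (restrict_perm D \<sigma>) p h j =
            ordered_ribbon.kappa D (restrict_perm D \<tau>) p h j" for p :: "'a \<Rightarrow> nat" and h j
            unfolding rD by (rule psubset.IH[OF sub(1) pD(1) _ pD(2)])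
        qed
        have 2: "ordered_ribbon.kappa E \<tau> pos h j = ordered_ribbon.kappa E \<sigma>' pos' h j"
        proof (rule kappa_modified[OF T RO C(1) tC _ RC _ _ pC(2)])
          show "fst x \<in> E - ?C \<Longrightarrow> fst (\<tau> x) \<in> E - ?C" for x using tD[of x] unfolding C(2) .
          show "fst x \<in> E - ?C \<Longrightarrow> \<sigma>' x = \<tau> x" for x unfolding C(2) by (simp add: \<tau>_def)
          show "planar_ribbon ?C (restrict_perm ?C \<tau>) vx" unfolding rC by (rule pC(1))
          show "inj_on p ?C \<Longrightarrow> ordered_ribbon.kappa ?C (restrict_perm ?C \<tau>) p h j =
            ordered_ribbon.kappa ?C (restrict_perm ?C \<sigma>') p h j" for p :: "'a \<Rightarrow> nat" and h j
            unfolding rC by (rule psubset.IH[OF sub(2) pC(1) _ pC(2)])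
        qed
        show ?thesis using 1 2 by simp
      qed
    qed
  qed
qed

section \<open>Ranks of quotients\<close>

lemma common_denominator:
  fixes q :: "'s \<Rightarrow> rat"
  assumes "finite S"
  shows "\<exists>N::int. 0 < N \<and> (\<forall>s\<in>S. \<exists>n::int. of_int N * q s = of_int n)"
  using assms
proof induction
  case empty
  show ?case by (intro exI[of _ 1]) simp
next
  case (insert s S)
  then obtain N :: int where N: "0 < N" "\<forall>s\<in>S. \<exists>n::int. of_int N * q s = of_int n" by blast
  obtain a b :: int where ab: "q s = of_int a / of_int b" "b > 0"
    using quotient_of_div[of "q s" "fst (quotient_of (q s))" "snd (quotient_of (q s))"]
      quotient_of_denom_pos[of "q s" "fst (quotient_of (q s))" "snd (quotient_of (q s))"] by force
  have 1: "of_int (N * b) * q s = of_int (N * a)" using ab by simp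
  have 2: "\<exists>n::int. of_int (N * b) * q t = of_int n" if t: "t \<in> S" for t
  proof -
    obtain n :: int where "of_int N * q t = of_int n" using N(2) t by blast
    then have "of_int (N * b) * q t = of_int (n * b)" by (simp add: mult.commute mult.left_commute)
    then show ?thesis by blast
  qed
  have "N * b > 0" using N(1) ab(2) by simp
  then show ?case using 1 2 by (intro exI[of _ "N * b"]) blast
qed

text \<open>The vectors \<open>v s\<close> and a basis of \<open>U\<close> form one family over a
  disjoint sum, so that independence becomes injectivity of a single linear map.\<close>

lemma card_independent_modulo:
  fixes v :: "'s \<Rightarrow> 'x \<Rightarrow> rat"
  assumes X: "finite X" and K: "rv.subspace K" "K \<subseteq> fsup X" and U: "rv.subspace U" "U \<subseteq> K"
    and S: "finite S" "\<And>s. s \<in> S \<Longrightarrow> v s \<in> K"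
    and ind: "\<And>q s. (\<Sum>s\<in>S. rscale (q s) (v s)) \<in> U \<Longrightarrow> s \<in> S \<Longrightarrow> q s = 0"
  shows "card S + rv.dim U \<le> rv.dim K"
proof -
  obtain b where b: "finite b" "rv.independent b" "rv.span b = U" "b \<subseteq> U" "card b = rv.dim U"
    by (rule subspace_basis[OF X U(1) order_trans[OF U(2) K(2)]])
  define w :: "'s + ('x \<Rightarrow> rat) \<Rightarrow> 'x \<Rightarrow> rat" where "w = case_sum v id"
  define M where "M f = (\<Sum>i\<in>S <+> b. rscale (f i) (w i))" for f
  have fin: "finite (S <+> b)" using S(1) b(1) by simp
  have lin: "rlin M" unfolding M_def by (rule rlin_pt_sum)
  have M: "M f = (\<Sum>s\<in>S. rscale (f (Inl s)) (v s)) + (\<Sum>u\<in>b. rscale (f (Inr u)) u)" for f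
    unfolding M_def by (simp add: sum.Plus[OF S(1) b(1)] w_def)
  have inj: "f = 0" if f: "f \<in> fsup (S <+> b)" and 0: "M f = 0" for f
  proof -
    have bU: "(\<Sum>u\<in>b. rscale (f (Inr u)) u) \<in> U"
      using b(4) by (intro rv.subspace_sum[OF U(1)] rv.subspace_scale[OF U(1)]) blast
    have "(\<Sum>s\<in>S. rscale (f (Inl s)) (v s)) = - (\<Sum>u\<in>b. rscale (f (Inr u)) u)"
      using 0 unfolding M by (simp add: eq_neg_iff_add_eq_0)
    then have "(\<Sum>s\<in>S. rscale (f (Inl s)) (v s)) \<in> U" using rv.subspace_neg[OF U(1) bU] by simp
    from ind[OF this] have l: "f (Inl s) = 0" if "s \<in> S" for s using that by blast
    have "rscale 0 g = 0" for g :: "'x \<Rightarrow> rat" by (simp add: rscale_def zero_fun_def)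
    then have "(\<Sum>u\<in>b. rscale (f (Inr u)) u) = 0" using 0 unfolding M by (simp add: l)
    then have r: "f (Inr u) = 0" if "u \<in> b" for u
      using rv.independentD[OF b(2,1) order_refl _ that, of "\<lambda>u. f (Inr u)"] by simp
    show ?thesis
    proof (rule ext)
      fix i show "f i = 0 i" using f l r by (cases i) (auto simp: fsup_def)
    qed
  qed
  have "w i \<in> K" if "i \<in> S <+> b" for i using that S(2) b(4) U(2) by (auto simp: w_def)
  then have "M f \<in> K" for f
    unfolding M_def by (intro rv.subspace_sum[OF K(1)] rv.subspace_scale[OF K(1)])
  then have "rv.dim (M ` fsup (S <+> b)) \<le> rv.dim K" by (intro dim_mono_fsup[OF K X]) blast
  then show ?thesis
    using dim_inj_image[OF lin fsup_subspace order_refl fin inj] dim_fsup[OF fin] b(5)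
    by (simp add: card_Plus[OF S(1) b(1)])
qed

lemma complement_basis:
  assumes X: "finite X" and K: "rv.subspace K" "K \<subseteq> fsup X" and U: "rv.subspace U" "U \<subseteq> K"
  obtains R where "finite R" "R \<subseteq> K" "card R + rv.dim U = rv.dim K"
    "\<And>q r. (\<Sum>r\<in>R. rscale (q r) r) \<in> U \<Longrightarrow> r \<in> R \<Longrightarrow> q r = 0"
proof -
  obtain b where b: "finite b" "rv.independent b" "rv.span b = U" "b \<subseteq> U" "card b = rv.dim U"
    by (rule subspace_basis[OF X U(1) order_trans[OF U(2) K(2)]])
  obtain c where c: "b \<subseteq> c" "c \<subseteq> K" "rv.independent c" "K \<subseteq> rv.span c"
    using rv.maximal_independent_subset_extend[OF order_trans[OF b(4) U(2)] b(2)] by blast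
  have fc: "finite c" using fsup_indep_finite[OF X c(3)] c(2) K(2) by blast
  have "rv.span c = K" using c(2,4) K(1) by (metis order_antisym rv.span_minimal)
  then have dK: "rv.dim K = card c" using rv.dim_span_eq_card_independent[OF c(3)] by simp
  show ?thesis
  proof (rule that[of "c - b"])
    show "finite (c - b)" using fc by blast
    show "c - b \<subseteq> K" using c(2) by blast
    show "card (c - b) + rv.dim U = rv.dim K"
      using card_Diff_subset[OF b(1) c(1)] card_mono[OF fc c(1)] b(5) dK by simp
    fix q r assume s: "(\<Sum>r\<in>c - b. rscale (q r) r) \<in> U" and r: "r \<in> c - b"
    have "(\<Sum>r\<in>c - b. rscale (q r) r) \<in> rv.span (c - b)"
      by (intro rv.span_sum rv.span_scale rv.span_base)
    then have "(\<Sum>r\<in>c - b. rscale (q r) r) = 0"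
      using indep_disjoint_span[OF c(3) c(1)] s b(3) by blast
    then show "q r = 0" using rv.independentD[OF c(3) _ _ _ r, of q] fc by blast
  qed
qed

text \<open>A relation among cosets is a relation among representatives up to an element of
  \<open>B\<close>.\<close>

lemma (in comm_group) int_independent_quotient:
  assumes B: "subgroup B G" and S: "finite S" "S \<subseteq> carrier (G Mod B)"
    and r: "\<And>s. s \<in> S \<Longrightarrow> r s \<in> carrier G \<and> s = B #> r s"
  shows "int_independent (G Mod B) S \<longleftrightarrow>
    (\<forall>c :: _ \<Rightarrow> int. finprod G (\<lambda>s. r s [^] c s) S \<in> B \<longrightarrow> (\<forall>s\<in>S. c s = 0))"
proof -
  interpret N: normal B G using B normal_iff_subgroup by blast
  interpret Q: comm_group "G Mod B" by (rule abelian_FactGroup[OF B])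
  interpret h: group_hom G "G Mod B" "\<lambda>a. B #> a"
    by unfold_locales (rule N.r_coset_hom_Mod)
  have fp: "finprod (G Mod B) (\<lambda>s. s [^]\<^bsub>G Mod B\<^esub> c s) T = B #> finprod G (\<lambda>s. r s [^] c s) T \<and>
      finprod G (\<lambda>s. r s [^] c s) T \<in> carrier G" if "T \<subseteq> S" for c :: "_ \<Rightarrow> int" and T
    using finite_subset[OF that S(1)] that
  proof (induction T)
    case empty
    show ?case using h.hom_one by simp
  next
    case (insert s T)
    have rs: "r t [^] c t \<in> carrier G" if "t \<in> insert s T" for t using r[of t] that insert.prems by auto
    have qs: "t [^]\<^bsub>G Mod B\<^esub> c t \<in> carrier (G Mod B)" if "t \<in> insert s T" for t
      using that insert.prems S(2) by blast
    have "s [^]\<^bsub>G Mod B\<^esub> c s = B #> (r s [^] c s)"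
      using r[of s] insert.prems h.hom_int_pow[of "r s" "c s"] by auto
    then show ?case using insert.IH insert.prems insert.hyps rs qs
      by (simp add: Q.finprod_insert finprod_insert Pi_iff)
  qed
  have "B #> a = \<one>\<^bsub>G Mod B\<^esub> \<longleftrightarrow> a \<in> B" if "a \<in> carrier G" for a
    using coset_join1[OF _ that B] coset_join2[OF that B] by (auto simp: FactGroup_def)
  then show ?thesis unfolding int_independent_def using fp[OF order_refl] S by auto
qed

lemma finprod_subgroup_free_Abelian:
  assumes Z: "subgroup Z (free_Abelian_group X)" and r: "\<And>s. s \<in> S \<Longrightarrow> r s \<in> Z"
  shows "finprod (subgroup_generated (free_Abelian_group X) Z)
      (\<lambda>s. r s [^]\<^bsub>subgroup_generated (free_Abelian_group X) Z\<^esub> (c s :: int)) S = (\<Sum>s\<in>S. frag_cmul (c s) (r s))"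
proof -
  let ?A = "free_Abelian_group X" and ?G = "subgroup_generated (free_Abelian_group X) Z"
  interpret A: comm_group ?A by (rule abelian_free_Abelian_group)
  interpret G: comm_group ?G by (rule A.abelian_subgroup_generated[OF abelian_free_Abelian_group])
  have cG: "carrier ?G = Z" by (rule subgroup.carrier_subgroup_generated_subgroup[OF Z])
  have ZA: "a \<in> Z \<Longrightarrow> Poly_Mapping.keys a \<subseteq> X" for a
    using subgroup.subset[OF Z] by (metis carrier_free_Abelian_group_iff subsetD)
  have pw: "r s [^]\<^bsub>?G\<^esub> c s = frag_cmul (c s) (r s)" if "s \<in> S" for s
    using A.int_pow_subgroup_generated[of "r s" Z "c s"] r[OF that] ZA[OF r[OF that]] by (simp add: cG)
  have in_G: "frag_cmul (c s) (r s) \<in> carrier ?G" if "s \<in> S" for s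
    using G.int_pow_closed[of "r s" "c s"] r[OF that] pw[OF that] by (simp add: cG)
  have "finprod ?G (\<lambda>s. frag_cmul (c s) (r s)) T = (\<Sum>s\<in>T. frag_cmul (c s) (r s))" if "T \<subseteq> S" for T
    using that
  proof (induction T rule: infinite_finite_induct)
    case (insert s T)
    then have "(\<lambda>s. frag_cmul (c s) (r s)) \<in> T \<rightarrow> carrier ?G" "frag_cmul (c s) (r s) \<in> carrier ?G"
      using in_G by auto
    then show ?case using insert by (simp add: G.finprod_insert)
  qed (simp_all only: G.finprod_empty G.finprod_infinite sum.empty sum.infinite, simp_all)
  moreover have "finprod ?G (\<lambda>s. r s [^]\<^bsub>?G\<^esub> c s) S = finprod ?G (\<lambda>s. frag_cmul (c s) (r s)) S"
    by (rule G.finprod_cong') (use pw in_G in auto)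
  ultimately show ?thesis by simp
qed

text \<open>This replaces tensoring with the rationals: \<open>\<iota>\<close> maps \<open>Z\<close>
  onto \<open>K\<close> up to denominators, and an element of \<open>Z\<close> over \<open>U\<close>
  has a multiple in \<open>B\<close>. Rational relations become integral ones after
  \<open>common_denominator\<close>.\<close>

lemma group_rank_quotient:
  fixes \<iota> :: "('a \<Rightarrow>\<^sub>0 int) \<Rightarrow> 'x \<Rightarrow> rat"
  assumes Z: "subgroup Z (free_Abelian_group X)" and B: "subgroup B (subgroup_generated (free_Abelian_group X) Z)"
    and add: "\<And>a b. \<iota> (a + b) = \<iota> a + \<iota> b" and scale: "\<And>n a. \<iota> (frag_cmul n a) = rscale (of_int n) (\<iota> a)"
    and Y: "finite Y" and K: "rv.subspace K" "K \<subseteq> fsup Y" and U: "rv.subspace U" "U \<subseteq> K"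
    and ZK: "\<And>z. z \<in> Z \<Longrightarrow> \<iota> z \<in> K" "\<And>k. k \<in> K \<Longrightarrow> \<exists>N>0. \<exists>z\<in>Z. \<iota> z = rscale (of_int N) k"
    and BU: "\<And>z. z \<in> B \<Longrightarrow> \<iota> z \<in> U" "\<And>z. z \<in> Z \<Longrightarrow> \<iota> z \<in> U \<Longrightarrow> \<exists>N>0. frag_cmul N z \<in> B"
  shows "group_rank (subgroup_generated (free_Abelian_group X) Z Mod B) = rv.dim K - rv.dim U"
proof -
  let ?A = "free_Abelian_group X" and ?G = "subgroup_generated (free_Abelian_group X) Z"
  interpret A: comm_group ?A by (rule abelian_free_Abelian_group)
  interpret G: comm_group ?G by (rule A.abelian_subgroup_generated[OF abelian_free_Abelian_group])
  have cG: "carrier ?G = Z" by (rule subgroup.carrier_subgroup_generated_subgroup[OF Z])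
  have \<iota>0: "\<iota> 0 = 0" using add[of 0 0] by simp
  have \<iota>s: "\<iota> (\<Sum>s\<in>S. frag_cmul (c s) (r s)) = (\<Sum>s\<in>S. rscale (of_int (c s)) (\<iota> (r s)))" for S :: "'s set" and c r
    by (induction S rule: infinite_finite_induct) (simp_all add: add scale \<iota>0)
  have Zs: "(\<Sum>s\<in>S. frag_cmul (c s) (r s)) \<in> Z" if "finite S" "\<And>s. s \<in> S \<Longrightarrow> r s \<in> Z" for S :: "'s set" and c r
  proof -
    have "(\<Sum>s\<in>S. frag_cmul (c s) (r s)) = finprod ?G (\<lambda>s. r s [^]\<^bsub>?G\<^esub> c s) S"
      by (rule finprod_subgroup_free_Abelian[OF Z that(2), symmetric])
    also have "\<dots> \<in> carrier ?G" by (rule G.finprod_closed, rule Pi_I, rule G.int_pow_closed) (use that(2) cG in blast)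
    finally show ?thesis using cG by simp
  qed
  have ri: "int_independent (?G Mod B) S \<longleftrightarrow>
      (\<forall>c :: _ \<Rightarrow> int. (\<Sum>s\<in>S. frag_cmul (c s) (r s)) \<in> B \<longrightarrow> (\<forall>s\<in>S. c s = 0))"
    if "finite S" "S \<subseteq> carrier (?G Mod B)" "\<And>s. s \<in> S \<Longrightarrow> r s \<in> Z \<and> s = B #>\<^bsub>?G\<^esub> r s" for S r
  proof -
    have "r s \<in> carrier ?G \<and> s = B #>\<^bsub>?G\<^esub> r s" if "s \<in> S" for s using that \<open>\<And>s. s \<in> S \<Longrightarrow> r s \<in> Z \<and> _\<close> cG by blast
    from G.int_independent_quotient[OF B that(1,2) this] show ?thesis
      using finprod_subgroup_free_Abelian[OF Z, of S r] that(3) by simp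
  qed
  have upper: "card S + rv.dim U \<le> rv.dim K" if S: "int_independent (?G Mod B) S" for S
  proof -
    have fS: "finite S" "S \<subseteq> carrier (?G Mod B)" using S by (auto simp: int_independent_def)
    have "\<forall>s\<in>S. \<exists>a. a \<in> Z \<and> s = B #>\<^bsub>?G\<^esub> a"
      using fS(2) cG by (auto simp: FactGroup_def RCOSETS_def)
    from bchoice[OF this] obtain r where r: "\<forall>s\<in>S. r s \<in> Z \<and> s = B #>\<^bsub>?G\<^esub> r s" ..
    then have r': "r s \<in> Z" if "s \<in> S" for s using that by blast
    have in0: "\<forall>s\<in>S. c s = 0" if "(\<Sum>s\<in>S. frag_cmul (c s) (r s)) \<in> B" for c :: "_ \<Rightarrow> int"
      using ri[OF fS, of r] r S that by blast
    show ?thesis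
    proof (rule card_independent_modulo[OF Y K U fS(1), of "\<lambda>s. \<iota> (r s)"])
      show "\<iota> (r s) \<in> K" if "s \<in> S" for s using ZK(1)[OF r'[OF that]] .
      fix q s assume q: "(\<Sum>s\<in>S. rscale (q s) (\<iota> (r s))) \<in> U" and s: "s \<in> S"
      obtain N :: int where N: "0 < N" "\<forall>s\<in>S. \<exists>n::int. of_int N * q s = of_int n"
        using common_denominator[OF fS(1), of q] by blast
      from bchoice[OF N(2)] obtain c :: "_ \<Rightarrow> int" where c: "\<forall>s\<in>S. of_int N * q s = of_int (c s)" ..
      have "\<iota> (\<Sum>s\<in>S. frag_cmul (c s) (r s)) = (\<Sum>s\<in>S. rscale (of_int N * q s) (\<iota> (r s)))"
        unfolding \<iota>s using c by (intro sum.cong refl) simp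
      also have "\<dots> = rscale (of_int N) (\<Sum>s\<in>S. rscale (q s) (\<iota> (r s)))"
        by (simp add: rv.scale_sum_right)
      finally have "\<iota> (\<Sum>s\<in>S. frag_cmul (c s) (r s)) \<in> U" using rv.subspace_scale[OF U(1) q] by simp
      from BU(2)[OF Zs[OF fS(1) r'] this]
      obtain M where M: "M > 0" "frag_cmul M (\<Sum>s\<in>S. frag_cmul (c s) (r s)) \<in> B" by blast
      have "frag_cmul M (\<Sum>s\<in>S. frag_cmul (c s) (r s)) = (\<Sum>s\<in>S. frag_cmul (M * c s) (r s))"
        by (simp add: frag_cmul_sum)
      then have "M * c s = 0" using in0[of "\<lambda>s. M * c s"] M(2) s by (simp only:)
      then show "q s = 0" using c s M(1) N(1) by auto
    qed
  qed
  obtain R where R: "finite R" "R \<subseteq> K" "card R + rv.dim U = rv.dim K"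
    "\<And>q r. (\<Sum>r\<in>R. rscale (q r) r) \<in> U \<Longrightarrow> r \<in> R \<Longrightarrow> q r = 0"
    by (rule complement_basis[OF Y K U]) blast
  have "\<forall>k\<in>R. \<exists>z. z \<in> Z \<and> (\<exists>N>0. \<iota> z = rscale (of_int N) k)" using ZK(2) R(2) by blast
  from bchoice[OF this] obtain z where z: "\<forall>k\<in>R. z k \<in> Z \<and> (\<exists>N>0. \<iota> (z k) = rscale (of_int N) k)" ..
  then have "\<forall>k\<in>R. \<exists>N::int. N > 0 \<and> \<iota> (z k) = rscale (of_int N) k" by blast
  from bchoice[OF this] obtain N :: "_ \<Rightarrow> int" where N: "\<forall>k\<in>R. N k > 0 \<and> \<iota> (z k) = rscale (of_int (N k)) k" ..
  have in0: "\<forall>k\<in>R. c k = 0" if "(\<Sum>k\<in>R. frag_cmul (c k) (z k)) \<in> B" for c :: "_ \<Rightarrow> int"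
  proof
    fix k assume k: "k \<in> R"
    have "(\<Sum>k\<in>R. rscale (of_int (c k) * of_int (N k)) k) = \<iota> (\<Sum>k\<in>R. frag_cmul (c k) (z k))"
      unfolding \<iota>s using N by (intro sum.cong refl) simp
    then have "(\<Sum>k\<in>R. rscale (of_int (c k) * of_int (N k)) k) \<in> U" using BU(1)[OF that] by simp
    from R(4)[OF this k] show "c k = 0" using N k by auto
  qed
  define \<pi> where "\<pi> k = B #>\<^bsub>?G\<^esub> z k" for k
  have inj: "inj_on \<pi> R"
  proof (rule inj_onI, rule ccontr)
    fix k l assume kl: "k \<in> R" "l \<in> R" "\<pi> k = \<pi> l" "k \<noteq> l"
    have zk: "z k \<in> carrier ?G" "z l \<in> carrier ?G" using z kl cG by auto
    have "z k \<in> B #>\<^bsub>?G\<^esub> z l" using G.rcos_self[OF zk(1) B] kl(3) by (simp add: \<pi>_def)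
    then obtain b where b: "b \<in> B" "z k = b + z l" by (auto simp: r_coset_def)
    \<comment> \<open>Equal cosets would give a relation with coefficients 1 and -1 at
      \<open>k\<close> and \<open>l\<close>.\<close>
    define c where "c i = (if i = k then 1 else if i = l then -1 else 0 :: int)" for i
    have "(\<Sum>i\<in>R. frag_cmul (c i) (z i)) = (\<Sum>i\<in>{k, l}. frag_cmul (c i) (z i))"
      by (rule sum.mono_neutral_right) (use R(1) kl in \<open>auto simp: c_def\<close>)
    also have "\<dots> = z k - z l" using kl(4) by (simp add: c_def)
    finally have "\<forall>i\<in>R. c i = 0" using in0[of c] b by simp
    then show False using kl(1) by (auto simp: c_def)
  qed
  have ii: "int_independent (?G Mod B) (\<pi> ` R)"
  proof -
    define r where "r = z \<circ> inv_into R \<pi>"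
    have r: "r (\<pi> k) = z k" if "k \<in> R" for k using inj that by (simp add: r_def)
    have c1: "\<pi> ` R \<subseteq> carrier (?G Mod B)" using z cG by (auto simp: FactGroup_def RCOSETS_def \<pi>_def)
    have c2: "r s \<in> Z \<and> s = B #>\<^bsub>?G\<^esub> r s" if "s \<in> \<pi> ` R" for s using that r z by (auto simp: \<pi>_def)
    have "\<forall>s\<in>\<pi> ` R. c s = 0" if "(\<Sum>s\<in>\<pi> ` R. frag_cmul (c s) (r s)) \<in> B" for c :: "_ \<Rightarrow> int"
    proof -
      have "(\<Sum>s\<in>\<pi> ` R. frag_cmul (c s) (r s)) = (\<Sum>k\<in>R. frag_cmul (c (\<pi> k)) (z k))"
        by (simp add: sum.reindex[OF inj] r)
      then show ?thesis using in0[of "\<lambda>k. c (\<pi> k)"] that by auto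
    qed
    then show ?thesis using ri[OF finite_imageI[OF R(1)] c1 c2] by blast
  qed
  show ?thesis unfolding group_rank_def
  proof (rule cSup_eq_maximum)
    show "rv.dim K - rv.dim U \<in> {card S |S. int_independent (?G Mod B) S}"
      using ii card_image[OF inj] R(3) by (intro CollectI exI[of _ "\<pi> ` R"]) simp
    show "x \<le> rv.dim K - rv.dim U" if "x \<in> {card S |S. int_independent (?G Mod B) S}" for x
      using that upper by fastforce
  qed
qed

section \<open>Boundary components of a fatgraph\<close>

text \<open>Orbits of a first-return map are the traces of the full orbits. The induction is on the
  number of steps of \<open>f\<close>, taking off one return at a time.\<close>

lemma orbit_return:
  assumes step: "\<And>d. d \<in> A \<Longrightarrow> \<exists>n>0. b d = (f ^^ n) d \<and> b d \<in> A \<and> (\<forall>k. 0 < k \<longrightarrow> k < n \<longrightarrow> (f ^^ k) d \<notin> A)"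
    and x: "x \<in> A"
  shows "orbit b x = orbit f x \<inter> A"
proof
  have s: "b d \<in> orbit f d \<and> b d \<in> A" if "d \<in> A" for d
    using step[OF that] by (auto simp: orbit_altdef)
  have "y \<in> orbit f x \<and> y \<in> A" if "y \<in> orbit b x" for y
    using that
  proof induction
    case base
    show ?case using s[OF x] .
  next
    case (step y)
    then show ?case using s[of y] orbit_trans[of "b y" f y x] by blast
  qed
  then show "orbit b x \<subseteq> orbit f x \<inter> A" by blast
  have "(f ^^ n) x \<in> A \<longrightarrow> 0 < n \<longrightarrow> x \<in> A \<longrightarrow> (f ^^ n) x \<in> orbit b x" for n x
  proof (induction n arbitrary: x rule: less_induct)
    case (less n)
    show ?case
    proof (intro impI)
      assume a: "(f ^^ n) x \<in> A" "0 < n" "x \<in> A"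
      obtain m where m: "m > 0" "b x = (f ^^ m) x" "b x \<in> A" "\<forall>k. 0 < k \<longrightarrow> k < m \<longrightarrow> (f ^^ k) x \<notin> A"
        using step[OF a(3)] by blast
      have "m \<le> n" using m(4) a(1,2) by (meson not_le)
      show "(f ^^ n) x \<in> orbit b x"
      proof (cases "m = n")
        case True
        then show ?thesis using m(2) orbit.base[of b x] by simp
      next
        case False
        have "(f ^^ (n - m + m)) x = (f ^^ (n - m)) (b x)" unfolding m(2) by (simp add: funpow_add)
        then have e: "(f ^^ n) x = (f ^^ (n - m)) (b x)" using \<open>m \<le> n\<close> by simp
        have "(f ^^ (n - m)) (b x) \<in> orbit b (b x)"
          using less.IH[of "n - m" "b x"] False \<open>m \<le> n\<close> m(1,3) a(1) unfolding e by simp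
        then show ?thesis unfolding e using orbit_trans[OF _ orbit.base] by metis
      qed
    qed
  qed
  then show "orbit f x \<inter> A \<subseteq> orbit b x" using x by (auto simp: orbit_altdef)
qed

lemma funpow_avoid:
  assumes "\<And>k. k < n \<Longrightarrow> (f ^^ k) x \<notin> A" "\<And>y. y \<notin> A \<Longrightarrow> g y = f y"
  shows "(g ^^ n) x = (f ^^ n) x"
  using assms(1) by (induction n) (simp_all add: assms(2))

definition opp :: "'e \<times> bool \<Rightarrow> 'e \<times> bool" where "opp d = (fst d, \<not> snd d)"

lemma opp_opp [simp]: "opp (opp d) = d" and fst_opp [simp]: "fst (opp d) = fst d"
  by (simp_all add: opp_def)

lemma flip_opp: "flip W d = (if fst d \<in> W then opp d else d)"
  by (simp add: flip_def opp_def)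

locale fat =
  fixes F :: "('v, 'e) fatgraph"
  assumes fat: "is_fatgraph F"
begin

sublocale ribbon "edges F" "rot F"
  using fat by unfold_locales (auto simp: is_fatgraph_def half_edges_def)

lemma att_verts: "x \<in> H \<Longrightarrow> att F x \<in> verts F"
  using fat by (auto simp: is_fatgraph_def half_edges_def H_def)

lemma orbit_att: "x \<in> H \<Longrightarrow> orbit (rot F) x = {y \<in> H. att F y = att F x}"
proof -
  assume x: "x \<in> H"
  then have h: "x \<in> half_edges_at F (edges F) (att F x)" by (simp add: half_edges_at_def half_edges_def H_def)
  then have "cyclic_on (rot F) (half_edges_at F (edges F) (att F x))"
    using fat att_verts[OF x] unfolding is_fatgraph_def by blast
  then have "orbit (rot F) x = half_edges_at F (edges F) (att F x)"
    using h by (simp add: orbit_cyclic_eq3)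
  then show ?thesis by (auto simp: half_edges_at_def half_edges_def H_def)
qed

sublocale vertex_ribbon "edges F" "rot F" "att F"
  by unfold_locales (auto simp: orbit_att)

lemma mem_half_edges: "d \<in> half_edges W \<longleftrightarrow> fst d \<in> W"
  by (cases d) (simp add: half_edges_def)

text \<open>\<open>rot F \<circ> flip W\<close> is conjugate to
  \<open>phi W = flip W \<circ> rot F\<close>, and \<open>boundary_step\<close> is the first-return
  map of the former to the half-edges of \<open>W\<close>.\<close>

lemma rot_image_cyc: "orbit (rot F \<circ> flip W) (rot F x) = rot F ` cyc W x"
proof -
  have "((rot F \<circ> flip W) ^^ n) (rot F x) = rot F ((phi W ^^ n) x)" for n
    by (induction n) (simp_all add: phi_def)
  then show ?thesis unfolding cyc_def orbit_altdef by auto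
qed

lemma rot_cyc_inter:
  assumes "W \<subseteq> edges F" "x \<in> H"
  shows "rot F ` cyc W x \<inter> half_edges W = opp ` (cyc W x \<inter> half_edges W)"
proof
  show "rot F ` cyc W x \<inter> half_edges W \<subseteq> opp ` (cyc W x \<inter> half_edges W)"
  proof
    fix y assume "y \<in> rot F ` cyc W x \<inter> half_edges W"
    then obtain c where c: "c \<in> cyc W x" "y = rot F c" "fst y \<in> W" by (auto simp: mem_half_edges)
    have "phi W c = opp y" using c(2,3) by (simp add: phi_def flip_opp)
    moreover have "phi W c \<in> cyc W x" using c(1) unfolding cyc_def by (rule orbit.step)
    ultimately show "y \<in> opp ` (cyc W x \<inter> half_edges W)"
      using c(3) by (intro image_eqI[of _ _ "opp y"]) (simp_all add: mem_half_edges)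
  qed
  show "opp ` (cyc W x \<inter> half_edges W) \<subseteq> rot F ` cyc W x \<inter> half_edges W"
  proof
    fix y assume "y \<in> opp ` (cyc W x \<inter> half_edges W)"
    then obtain z where z: "z \<in> cyc W x" "fst z \<in> W" "y = opp z" by (auto simp: mem_half_edges)
    obtain c where c: "c \<in> cyc W x" "z = phi W c"
      using z(1) cyc_self[OF assms(1), of x] unfolding cyc_def by (cases rule: orbit.cases) auto
    have "rot F c = y" using c(2) z(2,3) by (auto simp: phi_def flip_opp split: if_splits)
    then have "y \<in> rot F ` cyc W x" using c(1) by blast
    then show "y \<in> rot F ` cyc W x \<inter> half_edges W" using z by (simp add: mem_half_edges)
  qed
qed

lemma rot_in_least:
  assumes "\<exists>n>0. (rot F ^^ n) d \<in> half_edges W"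
  shows "\<exists>n. rot_in F W d = (rot F ^^ n) (rot F d) \<and> rot_in F W d \<in> half_edges W \<and>
    (\<forall>k<n. (rot F ^^ k) (rot F d) \<notin> half_edges W)"
proof -
  let ?P = "\<lambda>n. 0 < n \<and> (rot F ^^ n) d \<in> half_edges W"
  define n where "n = (LEAST n. ?P n)"
  have n: "?P n" unfolding n_def by (rule LeastI_ex) (use assms in blast)
  have l: "\<not> ?P k" if "k < n" for k using not_less_Least[of k ?P] that unfolding n_def by blast
  obtain m where m: "n = Suc m" using n by (cases n) auto
  have r: "rot_in F W d = (rot F ^^ m) (rot F d)"
    unfolding rot_in_def n_def[symmetric] m by (simp add: funpow_swap1)
  have "(rot F ^^ k) (rot F d) \<notin> half_edges W" if "k < m" for k
    using l[of "Suc k"] that m by (simp add: funpow_swap1)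
  moreover have "rot_in F W d \<in> half_edges W" using n unfolding rot_in_def n_def[symmetric] by simp
  ultimately show ?thesis using r by blast
qed

lemma orbit_boundary_step:
  assumes W: "W \<subseteq> edges F" and x: "x \<in> half_edges W"
  shows "orbit (boundary_step F W) x = orbit (rot F \<circ> flip W) x \<inter> half_edges W"
proof (rule orbit_return[OF _ x])
  fix d assume d: "d \<in> half_edges W"
  have "permutation (rot F)" using perm finH by (auto simp: permutation_permutes H_def)
  then have "opp d \<in> orbit (rot F) (opp d)" by (rule permutation_self_in_orbit)
  then have "\<exists>n>0. (rot F ^^ n) (opp d) \<in> half_edges W"
    using d by (auto simp: orbit_altdef mem_half_edges)
  from rot_in_least[OF this] obtain n where
    n: "rot_in F W (opp d) = (rot F ^^ n) (rot F (opp d))" "rot_in F W (opp d) \<in> half_edges W"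
      "\<forall>k<n. (rot F ^^ k) (rot F (opp d)) \<notin> half_edges W" by blast
  have f: "((rot F \<circ> flip W) ^^ Suc k) d = (rot F ^^ k) (rot F (opp d))" if "k \<le> n" for k
  proof -
    have "((rot F \<circ> flip W) ^^ k) (rot F (opp d)) = (rot F ^^ k) (rot F (opp d))"
      by (rule funpow_avoid[of _ _ _ "half_edges W"]) (use n(3) that in \<open>auto simp: flip_opp mem_half_edges\<close>)
    then show ?thesis using d by (simp add: funpow_Suc_right flip_opp mem_half_edges del: funpow.simps)
  qed
  have "boundary_step F W d = ((rot F \<circ> flip W) ^^ Suc n) d"
    unfolding f[OF order_refl] n(1)[symmetric] by (simp add: boundary_step_def opp_def)
  moreover have "boundary_step F W d \<in> half_edges W" using n(2) by (simp add: boundary_step_def opp_def)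
  moreover have "((rot F \<circ> flip W) ^^ k) d \<notin> half_edges W" if k: "0 < k" "k < Suc n" for k
  proof -
    obtain m where m: "k = Suc m" using k(1) by (cases k) auto
    have "m \<le> n" "m < n" using k(2) m by auto
    then show ?thesis unfolding m f[OF \<open>m \<le> n\<close>] using n(3) by blast
  qed
  ultimately show "\<exists>n>0. boundary_step F W d = ((rot F \<circ> flip W) ^^ n) d \<and> boundary_step F W d \<in> half_edges W \<and>
    (\<forall>k. 0 < k \<longrightarrow> k < n \<longrightarrow> ((rot F \<circ> flip W) ^^ k) d \<notin> half_edges W)"
    by (intro exI[of _ "Suc n"]) blast
qed

lemma cyc_free:
  assumes W: "W \<subseteq> edges F" and d: "d \<in> H" and c: "cyc W d \<inter> half_edges W = {}"
  shows "cyc W d = orbit (rot F) d"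
  unfolding cyc_def
proof (rule orbit_cong0[of d "cyc W d"])
  show "d \<in> cyc W d" by (rule cyc_self[OF W])
  have p: "phi W y = rot F y \<and> phi W y \<in> cyc W d" if "y \<in> cyc W d" for y
  proof -
    have "phi W y \<in> cyc W d" using that unfolding cyc_def by (rule orbit.step)
    then have "fst (phi W y) \<notin> W" using c by (auto simp: mem_half_edges)
    then show ?thesis using \<open>phi W y \<in> cyc W d\<close> by (simp add: phi_def flip_opp split: if_splits)
  qed
  show "phi W \<in> cyc W d \<rightarrow> cyc W d" by (rule Pi_I) (use p in blast)
  show "y \<in> cyc W d \<Longrightarrow> phi W y = rot F y" for y using p by blast
qed

lemma no_half_edges_iff:
  assumes W: "W \<subseteq> edges F" and d: "d \<in> H"
  shows "half_edges_at F W (att F d) = {} \<longleftrightarrow> cyc W d \<inter> half_edges W = {}"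
proof
  assume e: "half_edges_at F W (att F d) = {}"
  have ne: "fst y \<notin> W" if "att F y = att F d" for y
    using e that by (cases y) (auto simp: half_edges_at_def mem_half_edges)
  have st: "phi W y = rot F y \<and> rot F y \<in> H \<and> att F (rot F y) = att F d" if "y \<in> H" "att F y = att F d" for y
    using ne[of "rot F y"] vx_sigma[OF that(1)] sigma_H[OF that(1)] that(2) by (simp add: phi_def flip_opp)
  have "cyc W d \<subseteq> {y \<in> H. att F y = att F d}"
    unfolding cyc_def by (rule orbit_least) (use st d in auto)
  then show "cyc W d \<inter> half_edges W = {}" using ne by (auto simp: mem_half_edges)
next
  assume "cyc W d \<inter> half_edges W = {}"
  then have "{y \<in> H. att F y = att F d} \<inter> half_edges W = {}" using cyc_free[OF W d] orbit_att[OF d] by simp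
  then have "fst y \<notin> W" if "att F y = att F d" for y
    using that W by (auto simp: mem_half_edges mem_H)
  then show "half_edges_at F W (att F d) = {}" by (auto simp: half_edges_at_def mem_half_edges)
qed

text \<open>A circle also contains ends of absent edges, and it names an edge by the half opposite
  to the one in \<open>boundary_step\<close>; dropping the former and applying \<open>opp\<close>
  corrects both. A circle without half-edges of \<open>W\<close> surrounds a vertex isolated in the
  state.\<close>

lemma boundary_at_cyc:
  assumes W: "W \<subseteq> edges F" and d: "d \<in> H"
  shows "boundary_at F W d = (if cyc W d \<inter> half_edges W = {} then Inr (att F d)
    else Inl (opp ` (cyc W d \<inter> half_edges W)))"
proof (cases "cyc W d \<inter> half_edges W = {}")
  case True
  then show ?thesis using no_half_edges_iff[OF W d] by (simp add: boundary_at_def)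
next
  case False
  then obtain x where x: "x \<in> half_edges W" "att F x = att F d"
    using no_half_edges_iff[OF W d] by (auto simp: half_edges_at_def)
  then have "x \<in> orbit (rot F) d" using W orbit_att[OF d] by (auto simp: mem_half_edges mem_H)
  then have "\<exists>n>0. (rot F ^^ n) d \<in> half_edges W" using x(1) by (auto simp: orbit_altdef)
  from rot_in_least[OF this] obtain n where
    n: "rot_in F W d = (rot F ^^ n) (rot F d)" "rot_in F W d \<in> half_edges W"
      "\<forall>k<n. (rot F ^^ k) (rot F d) \<notin> half_edges W" by blast
  have "((rot F \<circ> flip W) ^^ n) (rot F d) = (rot F ^^ n) (rot F d)"
    by (rule funpow_avoid[of _ _ _ "half_edges W"]) (use n(3) in \<open>auto simp: flip_opp mem_half_edges\<close>)
  moreover have "((rot F \<circ> flip W) ^^ n) (rot F d) = rot F ((phi W ^^ n) d)"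
    by (induction n) (simp_all add: phi_def)
  ultimately have r: "rot_in F W d = rot F ((phi W ^^ n) d)" using n(1) by simp
  have "(phi W ^^ n) d \<in> cyc W d"
    using cyc_self[OF W, of d] by (cases n) (auto simp: cyc_def orbit_altdef simp del: funpow.simps)
  then have "orbit (boundary_step F W) (rot_in F W d) = rot F ` cyc W d \<inter> half_edges W"
    using orbit_boundary_step[OF W n(2)] cyc_eq[OF W] unfolding r rot_image_cyc by simp
  then show ?thesis using False no_half_edges_iff[OF W d] rot_cyc_inter[OF W d] by (simp add: boundary_at_def)
qed

lemma boundary_at_eq_iff:
  assumes W: "W \<subseteq> edges F" and d: "d1 \<in> H" "d2 \<in> H"
  shows "boundary_at F W d1 = boundary_at F W d2 \<longleftrightarrow> cyc W d1 = cyc W d2"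
proof
  assume c: "cyc W d1 = cyc W d2"
  show "boundary_at F W d1 = boundary_at F W d2"
  proof (cases "cyc W d1 \<inter> half_edges W = {}")
    case True
    have "d2 \<in> orbit (rot F) d1" using cyc_free[OF W d(1) True] cyc_self[OF W, of d2] c by simp
    then have "att F d1 = att F d2" using orbit_att[OF d(1)] by simp
    then show ?thesis using c by (simp add: boundary_at_cyc[OF W] d)
  qed (use c in \<open>simp add: boundary_at_cyc[OF W] d\<close>)
next
  assume b: "boundary_at F W d1 = boundary_at F W d2"
  have oi: "A = B" if "opp ` A = opp ` B" for A B :: "('e \<times> bool) set"
  proof -
    have "opp ` opp ` A = opp ` opp ` B" using that by simp
    then show ?thesis by (simp add: image_image)
  qed
  show "cyc W d1 = cyc W d2"
  proof (cases "cyc W d1 \<inter> half_edges W = {}")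
    case True
    then have "att F d1 = att F d2" using b by (simp add: boundary_at_cyc[OF W] d split: if_splits)
    then have "d2 \<in> orbit (rot F) d1" using orbit_att[OF d(1)] d(2) by simp
    then have "d2 \<in> cyc W d1" using cyc_free[OF W d(1) True] by simp
    then show ?thesis using cyc_eq[OF W] by blast
  next
    case False
    then have "opp ` (cyc W d1 \<inter> half_edges W) = opp ` (cyc W d2 \<inter> half_edges W)"
      using b by (simp add: boundary_at_cyc[OF W] d split: if_splits)
    then have eq: "cyc W d1 \<inter> half_edges W = cyc W d2 \<inter> half_edges W" by (rule oi)
    then obtain z where "z \<in> cyc W d1" "z \<in> cyc W d2" using False by blast
    then show ?thesis using cyc_eq[OF W] by metis
  qed
qed

text \<open>These vertices form a boundary component in every state but have no half-edges, so the
  circles miss them; their labels are passive.\<close>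

definition Iso where "Iso = {v \<in> verts F. half_edges_at F (edges F) v = {}}"

lemma boundaries_eq:
  assumes W: "W \<subseteq> edges F"
  shows "boundaries F W = boundary_at F W ` H \<union> Inr ` Iso"
proof
  show "boundaries F W \<subseteq> boundary_at F W ` H \<union> Inr ` Iso"
  proof
    fix c assume "c \<in> boundaries F W"
    then consider x where "x \<in> half_edges W" "c = Inl (orbit (boundary_step F W) x)"
      | v where "v \<in> verts F" "half_edges_at F W v = {}" "c = Inr v"
      by (auto simp: boundaries_def)
    then show "c \<in> boundary_at F W ` H \<union> Inr ` Iso"
    proof cases
      case 1
      have xH: "x \<in> H" using 1(1) W by (auto simp: mem_half_edges mem_H)
      obtain d where d: "x = rot F d" "d \<in> H" using xH sigma_H_iff by (metis permutes_surj[OF perm] surjD)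
      have c: "c = Inl (opp ` (cyc W d \<inter> half_edges W))"
        using 1 orbit_boundary_step[OF W 1(1)] rot_cyc_inter[OF W d(2)] unfolding d(1) rot_image_cyc by simp
      have "x \<in> rot F ` cyc W d" using d cyc_self[OF W, of d] by blast
      then have "opp ` (cyc W d \<inter> half_edges W) \<noteq> {}" using rot_cyc_inter[OF W d(2)] 1(1) by blast
      then have "boundary_at F W d = c" using c by (auto simp: boundary_at_cyc[OF W d(2)])
      then show ?thesis using d(2) by blast
    next
      case 2
      show ?thesis
      proof (cases "v \<in> Iso")
        case False
        then obtain d where d: "d \<in> H" "att F d = v"
          using 2(1) by (auto simp: Iso_def half_edges_at_def mem_half_edges mem_H)
        then have "boundary_at F W d = c" using 2 by (simp add: boundary_at_def)
        then show ?thesis using d(1) by blast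
      qed (use 2 in blast)
    qed
  qed
  show "boundary_at F W ` H \<union> Inr ` Iso \<subseteq> boundaries F W"
  proof (rule Un_least)
    show "Inr ` Iso \<subseteq> boundaries F W"
      using W by (fastforce simp: Iso_def boundaries_def half_edges_at_def mem_half_edges)
    show "boundary_at F W ` H \<subseteq> boundaries F W"
    proof
      fix c assume "c \<in> boundary_at F W ` H"
      then obtain d where d: "d \<in> H" "c = boundary_at F W d" by blast
      show "c \<in> boundaries F W"
      proof (cases "half_edges_at F W (att F d) = {}")
        case True
        then show ?thesis using d att_verts[OF d(1)] by (auto simp: boundary_at_def boundaries_def)
      next
        case False
        have "\<exists>n>0. (rot F ^^ n) d \<in> half_edges W"
        proof -
          obtain x where x: "x \<in> half_edges W" "att F x = att F d" using False by (auto simp: half_edges_at_def)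
          then have "x \<in> orbit (rot F) d" using W orbit_att[OF d(1)] by (auto simp: mem_half_edges mem_H)
          then show ?thesis using x(1) by (auto simp: orbit_altdef)
        qed
        from rot_in_least[OF this] have "rot_in F W d \<in> half_edges W" by blast
        then show ?thesis using False d by (auto simp: boundary_at_def boundaries_def)
      qed
    qed
  qed
qed

lemma boundary_not_Iso: "d \<in> H \<Longrightarrow> boundary_at F W d \<notin> Inr ` Iso"
  by (cases d) (auto simp: boundary_at_def Iso_def half_edges_at_def mem_half_edges mem_H)

lemma card_boundaries:
  assumes W: "W \<subseteq> edges F"
  shows "card (boundaries F W) = card (P W) + card Iso"
proof -
  have fI: "finite Iso" using fat by (simp add: Iso_def is_fatgraph_def)
  have "card (boundary_at F W ` H) = card (P W)"
  proof -
    obtain g where g: "\<And>d. d \<in> H \<Longrightarrow> g (cyc W d) = boundary_at F W d"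
    proof
      fix d assume d: "d \<in> H"
      have "(SOME x. x \<in> H \<and> cyc W x = cyc W d) \<in> H \<and> cyc W (SOME x. x \<in> H \<and> cyc W x = cyc W d) = cyc W d"
        by (rule someI[of _ d]) (use d in simp)
      then show "boundary_at F W (SOME x. x \<in> H \<and> cyc W x = cyc W d) = boundary_at F W d"
        using boundary_at_eq_iff[OF W _ d] by simp
    qed
    have "inj_on g (P W)" unfolding P_def by (rule inj_onI) (use g boundary_at_eq_iff[OF W] in auto)
    moreover have "g ` P W = boundary_at F W ` H" unfolding P_def image_image by (rule image_cong) (use g in auto)
    ultimately show ?thesis by (metis card_image)
  qed
  moreover have "boundary_at F W ` H \<inter> Inr ` Iso = {}" using boundary_not_Iso by blast
  ultimately show ?thesis unfolding boundaries_eq[OF W]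
    by (subst card_Un_disjoint) (use finH fI in \<open>simp_all add: card_image\<close>)
qed

lemma boundary_at_unchanged:
  assumes W: "W \<subseteq> edges F" and e: "e \<in> W" and d: "d \<in> H" "cyc W d \<in> rest W e"
  shows "cyc (W - {e}) d = cyc W d" "boundary_at F (W - {e}) d = boundary_at F W d"
proof -
  have n: "cyc W d \<noteq> ca W e" "cyc W d \<noteq> cb W e" using d(2) by (auto simp: rest_def)
  have t: "tog e W = W - {e}" using e by (simp add: tog_def)
  show c: "cyc (W - {e}) d = cyc W d" using cyc_tog_other[OF W n] by (simp add: t)
  have "(e, b) \<notin> cyc W d" for b
    using n cyc_eq[OF W, of "(e, b)" d] by (cases b) (auto simp: ca_def cb_def)
  then have "cyc W d \<inter> half_edges (W - {e}) = cyc W d \<inter> half_edges W"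
    by (auto simp: half_edges_def)
  then show "boundary_at F (W - {e}) d = boundary_at F W d"
    using W c by (subst (1 2) boundary_at_cyc) (use W d in auto)
qed

text \<open>A component common to both states contains no half of \<open>e\<close>, whence its
  circle belongs to \<open>rest\<close>.\<close>

lemma boundaries_inter:
  assumes W: "W \<subseteq> edges F" and e: "e \<in> W"
  shows "boundaries F W \<inter> boundaries F (W - {e}) = Inr ` Iso \<union> boundary_at F W ` {d \<in> H. cyc W d \<in> rest W e}"
proof
  have W': "W - {e} \<subseteq> edges F" using W by blast
  show "Inr ` Iso \<union> boundary_at F W ` {d \<in> H. cyc W d \<in> rest W e} \<subseteq> boundaries F W \<inter> boundaries F (W - {e})"
  proof
    fix c assume "c \<in> Inr ` Iso \<union> boundary_at F W ` {d \<in> H. cyc W d \<in> rest W e}"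
    then show "c \<in> boundaries F W \<inter> boundaries F (W - {e})"
    proof
      assume "c \<in> boundary_at F W ` {d \<in> H. cyc W d \<in> rest W e}"
      then obtain d where d: "d \<in> H" "cyc W d \<in> rest W e" "c = boundary_at F W d" by blast
      then have "c = boundary_at F (W - {e}) d" using boundary_at_unchanged(2)[OF W e d(1,2)] by simp
      then show ?thesis unfolding boundaries_eq[OF W] boundaries_eq[OF W'] using d by blast
    qed (simp add: boundaries_eq[OF W] boundaries_eq[OF W'])
  qed
  show "boundaries F W \<inter> boundaries F (W - {e}) \<subseteq> Inr ` Iso \<union> boundary_at F W ` {d \<in> H. cyc W d \<in> rest W e}"
  proof
    fix c assume c: "c \<in> boundaries F W \<inter> boundaries F (W - {e})"
    show "c \<in> Inr ` Iso \<union> boundary_at F W ` {d \<in> H. cyc W d \<in> rest W e}"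
    proof (cases "c \<in> Inr ` Iso")
      case False
      then obtain d d' where d: "d \<in> H" "c = boundary_at F W d" "d' \<in> H" "c = boundary_at F (W - {e}) d'"
        using c unfolding boundaries_eq[OF W] boundaries_eq[OF W'] by blast
      have "(e, b) \<notin> cyc W d" for b
      proof
        assume m: "(e, b) \<in> cyc W d"
        then have "opp (e, b) \<in> opp ` (cyc W d \<inter> half_edges W)" using e by (auto simp: mem_half_edges)
        moreover have "c = Inl (opp ` (cyc W d \<inter> half_edges W))"
          using m e d(2) by (auto simp: boundary_at_cyc[OF W d(1)] mem_half_edges)
        ultimately have "opp (e, b) \<in> opp ` (cyc (W - {e}) d' \<inter> half_edges (W - {e}))"
          using d(4) by (auto simp: boundary_at_cyc[OF W' d(3)] split: if_splits)
        then show False by (auto simp: mem_half_edges opp_def)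
      qed
      then have "cyc W d \<in> rest W e"
        using cyc_in_P[OF d(1), of W] cyc_self[OF W, of "(e, False)"] cyc_self[OF W, of "(e, True)"]
        by (auto simp: rest_def ca_def cb_def)
      then show ?thesis using d by blast
    qed simp
  qed
qed

end

section \<open>Genus\<close>

context fat
begin

lemma adj_eq: "adjacency F W = adj (att F) W"
  by (simp add: adjacency_def adj_def)

text \<open>The numerator in \<open>genus\<close>. It grows with the edge set, and this monotonicity
  carries planarity from \<open>F\<close> to all states.\<close>

definition \<gamma> :: "'e set \<Rightarrow> int" where
  "\<gamma> W = 2 * int (num_components F W) - int (card (verts F)) + int (card W) - int (card (boundaries F W))"

lemma genus_gamma: "genus F W = \<gamma> W div 2"
  by (simp add: genus_def \<gamma>_def)

lemma finV: "finite (verts F)"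
  using fat by (simp add: is_fatgraph_def)

definition Conn where "Conn W = (adj (att F) W)\<^sup>* \<inter> verts F \<times> verts F"

lemma equiv_Conn: "equiv (verts F) (Conn W)"
proof (rule equivI)
  show "refl_on (verts F) (Conn W)" by (auto simp: refl_on_def Conn_def)
  show "sym (Conn W)" by (auto simp: sym_def Conn_def intro: adj_rtrancl_sym)
  show "trans (Conn W)" by (auto simp: trans_def Conn_def)
qed (auto simp: Conn_def)

lemma num_components_Conn: "num_components F W = card (verts F // Conn W)"
  by (simp add: num_components_def Conn_def adj_eq)

lemma num_components_connected:
  assumes "(att F (e, False), att F (e, True)) \<in> (adj (att F) W)\<^sup>*"
  shows "num_components F (insert e W) = num_components F W"
proof -
  have "adj (att F) (insert e W) \<subseteq> (adj (att F) W)\<^sup>*"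
  proof
    fix p assume "p \<in> adj (att F) (insert e W)"
    then obtain e' b where p: "p = (att F (e', b), att F (e', \<not> b))" "e' = e \<or> e' \<in> W"
      by (auto simp: adj_def)
    from p(2) show "p \<in> (adj (att F) W)\<^sup>*"
    proof
      assume "e' = e"
      then show ?thesis using assms adj_rtrancl_sym[OF assms] unfolding p(1) by (cases b) auto
    next
      assume "e' \<in> W"
      then show ?thesis using adj_edge[of e' W "att F" b "\<not> b"] unfolding p(1) by blast
    qed
  qed
  moreover have "adj (att F) W \<subseteq> adj (att F) (insert e W)" by (auto simp: adj_def)
  ultimately have "(adj (att F) (insert e W))\<^sup>* = (adj (att F) W)\<^sup>*" by (intro rtrancl_subset)
  then show ?thesis by (simp add: num_components_Conn Conn_def)
qed

text \<open>Only the class of one end of \<open>e\<close> can be absorbed: with that class left out,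
  passing to the coarser classes is injective.\<close>

lemma num_components_insert:
  assumes e: "e \<in> edges F"
  shows "num_components F W \<le> num_components F (insert e W) + 1"
proof -
  let ?a = "att F (e, False)" and ?b = "att F (e, True)" and ?S = "(adj (att F) W)\<^sup>*"
  have V: "?a \<in> verts F" "?b \<in> verts F" using e by (auto intro!: att_verts simp: mem_H)
  have sym: "(y, x) \<in> ?S" if "(x, y) \<in> ?S" for x y using adj_rtrancl_sym that .
  define K where "K = {x. (?a, x) \<in> ?S \<or> (?b, x) \<in> ?S}"
  have step: "(x, y) \<in> ?S \<or> x \<in> K \<and> y \<in> K" if "(x, y) \<in> (adj (att F) (insert e W))\<^sup>*" for x y
    using that
  proof induction
    case base
    then show ?case by simp
  next
    case (step y z)
    obtain e' b where p: "y = att F (e', b)" "z = att F (e', \<not> b)" "e' = e \<or> e' \<in> W"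
      using step(2) by (auto simp: adj_def)
    from p(3) show ?case
    proof
      assume "e' = e"
      then have yz: "y \<in> K" "z \<in> K" "y = ?a \<or> y = ?b" unfolding K_def p(1,2) by (cases b; auto)+
      from step.IH show ?case
      proof
        assume "(x, y) \<in> ?S"
        then have "x \<in> K" using sym yz(3) unfolding K_def by blast
        then show ?case using yz by blast
      qed (use yz in blast)
    next
      assume "e' \<in> W"
      then have "(y, z) \<in> ?S" unfolding p(1,2) by (rule adj_edge)
      then show ?case using step.IH unfolding K_def by (auto intro: rtrancl_trans)
    qed
  qed
  let ?R = "Conn W" and ?R' = "Conn (insert e W)"
  note eq = equiv_Conn[of W] and eq' = equiv_Conn[of "insert e W"]
  have sub: "?R \<subseteq> ?R'" using adj_mono[of W "insert e W" "att F"] by (auto simp: Conn_def)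
  have im: "?R' `` (?R `` {x}) = ?R' `` {x}" if "x \<in> verts F" for x
  proof
    show "?R' `` (?R `` {x}) \<subseteq> ?R' `` {x}" using sub eq' by (auto simp: equiv_def trans_def)
    show "?R' `` {x} \<subseteq> ?R' `` (?R `` {x})" using equiv_class_self[OF eq that] by blast
  qed
  let ?Q = "verts F // ?R - {?R `` {?a}}"
  have "inj_on (\<lambda>C. ?R' `` C) ?Q"
  proof (rule inj_onI)
    fix C D assume C: "C \<in> ?Q" and D: "D \<in> ?Q" and CD: "?R' `` C = ?R' `` D"
    obtain x y where x: "x \<in> verts F" "C = ?R `` {x}" and y: "y \<in> verts F" "D = ?R `` {y}"
      using C D by (auto elim!: quotientE)
    have "?R' `` {x} = ?R' `` {y}" using CD im[OF x(1)] im[OF y(1)] unfolding x(2) y(2) by simp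
    then have "(x, y) \<in> ?R'" using eq_equiv_class[OF _ eq' y(1)] by blast
    then have "(x, y) \<in> ?S \<or> x \<in> K \<and> y \<in> K" using step by (auto simp: Conn_def)
    moreover have "(?a, z) \<notin> ?S" if "z \<in> verts F" "?R `` {z} \<noteq> ?R `` {?a}" for z
      using equiv_class_eq[OF eq, of ?a z] that V by (auto simp: Conn_def)
    then have "(?a, x) \<notin> ?S" "(?a, y) \<notin> ?S" using C D x y by blast+
    ultimately have "(x, y) \<in> ?S" using sym[of ?b x] rtrancl_trans[of x ?b _ y] unfolding K_def by blast
    then have "(x, y) \<in> ?R" using x y by (simp add: Conn_def)
    then show "C = D" unfolding x(2) y(2) by (rule equiv_class_eq[OF eq])
  qed
  moreover have "(\<lambda>C. ?R' `` C) ` ?Q \<subseteq> verts F // ?R'"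
    using im by (auto elim!: quotientE intro!: quotientI)
  moreover have fin: "finite (verts F // ?R)" "finite (verts F // ?R')"
    using finV by (auto intro!: finite_quotient simp: Conn_def)
  ultimately have "card ?Q \<le> card (verts F // ?R')" by (intro card_inj_on_le)
  then show ?thesis unfolding num_components_Conn using fin(1) V
    by (simp add: card_Diff_singleton_if split: if_splits)
qed

lemma gamma_empty: "\<gamma> {} = 0"
proof -
  have "verts F // Conn {} = (\<lambda>x. {x}) ` verts F"
    by (auto simp: Conn_def adj_def quotient_def)
  then have k: "num_components F {} = card (verts F)" by (simp add: num_components_Conn card_image)
  have "verts F = att F ` H \<union> Iso"
    using att_verts by (auto simp: Iso_def half_edges_at_def mem_half_edges mem_H image_iff)
  moreover have "att F ` H \<inter> Iso = {}" by (auto simp: Iso_def half_edges_at_def mem_half_edges mem_H)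
  moreover have "finite Iso" using finV by (simp add: Iso_def)
  ultimately have "card (verts F) = card (att F ` H) + card Iso" using finH by (simp add: card_Un_disjoint)
  then show ?thesis using card_boundaries[of "{}"] card_P_empty k by (simp add: \<gamma>_def)
qed

text \<open>An edge between two components merges two circles. Inside a component it either splits a
  circle or merges two, and the latter raises the numerator by 2.\<close>

lemma gamma_insert:
  assumes W: "W \<subseteq> edges F" and e: "e \<in> edges F - W"
  shows "\<gamma> (insert e W) \<ge> \<gamma> W"
    and "(att F (e, False), att F (e, True)) \<in> (adj (att F) W)\<^sup>* \<Longrightarrow> ca W e \<noteq> cb W e \<Longrightarrow>
      \<gamma> (insert e W) = \<gamma> W + 2"
proof -
  have eE: "e \<in> edges F" and W': "insert e W \<subseteq> edges F" using W e by auto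
  have fW: "finite W" using finite_subset[OF W finE] .
  have cW: "int (card (insert e W)) = int (card W) + 1" using fW e by simp
  have p: "int (card (P (insert e W))) = int (card (P W)) + (if ca W e = cb W e then 1 else -1)"
    using card_P_tog[OF W eE] e by (simp add: tog_def)
  have \<gamma>': "\<gamma> (insert e W) - \<gamma> W = 2 * int (num_components F (insert e W)) - 2 * int (num_components F W) + 1
      - (if ca W e = cb W e then 1 else -1)"
    unfolding \<gamma>_def card_boundaries[OF W] card_boundaries[OF W'] using cW p by simp
  show "(att F (e, False), att F (e, True)) \<in> (adj (att F) W)\<^sup>* \<Longrightarrow> ca W e \<noteq> cb W e \<Longrightarrow>
      \<gamma> (insert e W) = \<gamma> W + 2"
    using num_components_connected[of e W] \<gamma>' by simp
  show "\<gamma> (insert e W) \<ge> \<gamma> W"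
  proof (cases "(att F (e, False), att F (e, True)) \<in> (adj (att F) W)\<^sup>*")
    case True
    then show ?thesis using num_components_connected[of e W] \<gamma>' by (simp split: if_splits)
  next
    case False
    have "ca W e \<noteq> cb W e"
    proof
      assume "ca W e = cb W e"
      then have m: "(e, True) \<in> cyc W (e, False)" using cyc_self[OF W, of "(e, True)"] by (simp add: ca_def cb_def)
      show False using cyc_conn[OF W _ m] False eE by (simp add: mem_H)
    qed
    then show ?thesis using num_components_insert[OF eE, of W] \<gamma>' by simp
  qed
qed

lemma gamma_mono:
  assumes "W' \<subseteq> edges F" "W \<subseteq> W'"
  shows "\<gamma> W \<le> \<gamma> W'"
proof -
  have "\<gamma> W \<le> \<gamma> (W \<union> D)" if "finite D" "D \<subseteq> W' - W" for D
    using that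
  proof (induction D rule: finite_induct)
    case (insert e D)
    then have "W \<union> D \<subseteq> edges F" "e \<in> edges F - (W \<union> D)" using assms by auto
    from gamma_insert(1)[OF this] insert show ?case by simp
  qed simp
  moreover have "finite (W' - W)" "W \<union> (W' - W) = W'" using assms finite_subset[OF _ finE] by auto
  ultimately show ?thesis by (metis order_refl)
qed

text \<open>\<open>genus\<close> rounds down, so genus 0 gives only the bound 1; a violation of
  planarity raises \<open>\<gamma>\<close> by 2 and is still excluded
  (\<open>same_circle\<close>).\<close>

lemma gamma_bounds:
  assumes "genus F (edges F) = 0" "W \<subseteq> edges F"
  shows "0 \<le> \<gamma> W" "\<gamma> W \<le> 1"
proof -
  have "\<gamma> (edges F) \<le> 1" using assms(1) unfolding genus_gamma by linarith
  then show "\<gamma> W \<le> 1" using gamma_mono[OF order_refl assms(2)] by simp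
  show "0 \<le> \<gamma> W" using gamma_mono[OF assms(2), of "{}"] gamma_empty by simp
qed

lemma genus_zero: "genus F (edges F) = 0 \<Longrightarrow> W \<subseteq> edges F \<Longrightarrow> genus F W = 0"
  using gamma_bounds[of W] unfolding genus_gamma by linarith

lemma same_circle:
  assumes g: "genus F (edges F) = 0" and W: "W \<subseteq> edges F" "e \<in> edges F - W"
    and c: "(att F (e, False), att F (e, True)) \<in> (adj (att F) W)\<^sup>*"
  shows "ca W e = cb W e"
proof (rule ccontr)
  assume "ca W e \<noteq> cb W e"
  then have "\<gamma> (insert e W) = \<gamma> W + 2" using gamma_insert(2)[OF W c] by simp
  moreover have "insert e W \<subseteq> edges F" using W by auto
  ultimately show False using gamma_bounds(1)[OF g W(1)] gamma_bounds(2)[OF g, of "insert e W"] by simp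
qed

end

section \<open>The chromatic complex in terms of circles\<close>

text \<open>Fatgraphs with equal underlying graphs may attach the two named halves of an edge the
  other way round; \<open>t\<close> marks the edges to be renamed. Afterwards both embeddings share
  the map from half-edges to vertices.\<close>

definition swap_ends :: "('e \<Rightarrow> bool) \<Rightarrow> 'e \<times> bool \<Rightarrow> 'e \<times> bool" where
  "swap_ends t d = (fst d, snd d \<noteq> t (fst d))"

lemma swap_swap [simp]: "swap_ends t (swap_ends t d) = d" and fst_swap [simp]: "fst (swap_ends t d) = fst d"
  by (auto simp: swap_ends_def prod_eq_iff)

lemma swap_flip: "swap_ends t (flip W d) = flip W (swap_ends t d)"
  by (auto simp: swap_ends_def flip_def)

lemma swap_image_eq: "swap_ends t ` A = swap_ends t ` B \<longleftrightarrow> A = B"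
proof
  assume "swap_ends t ` A = swap_ends t ` B"
  then have "swap_ends t ` swap_ends t ` A = swap_ends t ` swap_ends t ` B" by simp
  then show "A = B" by (simp add: image_image)
qed simp

lemma takeWhile_shorter: "x \<in> set xs \<Longrightarrow> \<not> Q x \<Longrightarrow> length (takeWhile Q xs) < length xs"
  by (induction xs) auto

lemma mem_swap_image: "y \<in> swap_ends t ` A \<longleftrightarrow> swap_ends t y \<in> A"
proof
  assume "swap_ends t y \<in> A"
  then show "y \<in> swap_ends t ` A" by (intro image_eqI[of _ _ "swap_ends t y"]) simp_all
qed auto

definition index_in :: "'e list \<Rightarrow> 'e \<Rightarrow> nat" where
  "index_in es a = length (takeWhile (\<lambda>x. x \<noteq> a) es)"

lemma inj_index_in: "inj_on (index_in es) (set es)"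
proof (rule inj_onI)
  fix a b assume ab: "a \<in> set es" "b \<in> set es" "index_in es a = index_in es b"
  have n: "es ! index_in es x = x" if "x \<in> set es" for x
  proof -
    have "index_in es x < length es"
      using that takeWhile_shorter[of x es "\<lambda>y. y \<noteq> x"] by (auto simp: index_in_def)
    then show ?thesis using nth_length_takeWhile[of "\<lambda>y. y \<noteq> x" es] by (simp add: index_in_def)
  qed
  have "a = es ! index_in es a" by (rule n[OF ab(1), symmetric])
  also have "\<dots> = b" unfolding ab(3) by (rule n[OF ab(2)])
  finally show "a = b" .
qed

lemma index_in_less_iff:
  assumes "e \<in> set es" "distinct es"
  shows "{a \<in> set es. index_in es a < index_in es e} = set (takeWhile (\<lambda>x. x \<noteq> e) es)"
proof -
  obtain xs ys where es: "es = xs @ e # ys" "e \<notin> set xs"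
    using split_list_first[OF assms(1)] by blast
  have t: "takeWhile (\<lambda>x. x \<noteq> e) es = xs"
    unfolding es(1) using es(2) by (subst takeWhile_append2) auto
  have e: "index_in es e = length xs" by (simp add: index_in_def t)
  have 1: "index_in es a < length xs" if "a \<in> set xs" for a
    using that takeWhile_shorter[of a xs "\<lambda>y. y \<noteq> a"] unfolding es(1) index_in_def
    by (subst takeWhile_append1[of a]) auto
  have 2: "index_in es a \<ge> length xs" if "a \<notin> set xs" for a
    unfolding es(1) index_in_def using that by (subst takeWhile_append2) auto
  show ?thesis unfolding t e
  proof (intro equalityI subsetI)
    fix a assume "a \<in> {a \<in> set es. index_in es a < length xs}"
    then show "a \<in> set xs" using 2[of a] by (metis (mono_tags, lifting) mem_Collect_eq not_le)
  qed (use 1 es(1) in auto)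
qed

locale chrom = fat F for F :: "('v, 'e) fatgraph" +
  fixes t :: "'e \<Rightarrow> bool" and vx :: "'e \<times> bool \<Rightarrow> 'v" and es :: "'e list"
  assumes g0: "genus F (edges F) = 0"
    and vx_att: "\<And>d. fst d \<in> edges F \<Longrightarrow> vx d = att F (swap_ends t d)"
    and es: "distinct es" "set es = edges F"
begin

abbreviation sw where "sw \<equiv> swap_ends t"

definition \<tau> :: "'e \<times> bool \<Rightarrow> 'e \<times> bool" where "\<tau> = sw \<circ> rot F \<circ> sw"

lemma \<tau>_permutes: "\<tau> permutes (edges F \<times> UNIV)"
proof -
  have "bij \<tau>" unfolding \<tau>_def using permutes_bij[OF perm] bij_betw_byWitness[of UNIV sw sw UNIV]
    by (intro bij_comp) auto
  moreover have "\<tau> x = x" if "x \<notin> edges F \<times> UNIV" for x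
  proof -
    have "sw x \<notin> edges F \<times> UNIV" using that by (auto simp: mem_Times_iff)
    then show ?thesis using permutes_not_in[OF perm] by (simp add: \<tau>_def)
  qed
  ultimately show ?thesis by (auto simp: permutes_def bij_iff)
qed

sublocale X: ordered_ribbon "edges F" \<tau> "index_in es"
  by unfold_locales (use finE \<tau>_permutes inj_index_in[of es] es in auto)

lemma sw_H: "sw d \<in> H \<longleftrightarrow> d \<in> H"
  by (simp add: mem_H)

lemma orbit_swap_ends: "orbit (sw \<circ> f \<circ> sw) x = sw ` orbit f (sw x)"
proof -
  have "((sw \<circ> f \<circ> sw) ^^ n) x = sw ((f ^^ n) (sw x))" for n by (induction n) simp_all
  then show ?thesis unfolding orbit_altdef by auto
qed

lemma Xcyc: "X.cyc W x = sw ` cyc W (sw x)"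
proof -
  have "X.phi W = sw \<circ> phi W \<circ> sw"
    unfolding X.phi_def phi_def by (simp add: \<tau>_def fun_eq_iff swap_flip)
  then show ?thesis by (simp add: X.cyc_def cyc_def orbit_swap_ends)
qed

lemma Xcyc_eq_iff: "X.cyc W x = X.cyc W y \<longleftrightarrow> cyc W (sw x) = cyc W (sw y)"
  by (simp add: Xcyc swap_image_eq)

lemma adj_vx: "W \<subseteq> edges F \<Longrightarrow> adj vx W = adj (att F) W"
proof -
  assume W: "W \<subseteq> edges F"
  have v: "vx (e, b) = att F (e, b \<noteq> t e)" if "e \<in> W" for e b
    using vx_att[of "(e, b)"] that W by (auto simp: swap_ends_def)
  show ?thesis
  proof (intro equalityI subsetI)
    fix p assume "p \<in> adj vx W"
    then obtain e b where "e \<in> W" "p = (vx (e, b), vx (e, \<not> b))" by (auto simp: adj_def)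
    then have "e \<in> W" "p = (att F (e, b \<noteq> t e), att F (e, \<not> (b \<noteq> t e)))" using v by auto
    then show "p \<in> adj (att F) W" unfolding adj_def by blast
  next
    fix p assume "p \<in> adj (att F) W"
    then obtain e b where e: "e \<in> W" "p = (att F (e, b), att F (e, \<not> b))" by (auto simp: adj_def)
    have "p = (vx (e, b \<noteq> t e), vx (e, \<not> (b \<noteq> t e)))" using v[OF e(1)] e(2) by (cases "t e") auto
    then show "p \<in> adj vx W" unfolding adj_def using e(1) by blast
  qed
qed

lemma vx_orbit_swap:
  assumes xy: "x \<in> H" "y \<in> H"
  shows "vx x = vx y \<longleftrightarrow> y \<in> orbit \<tau> x"
proof -
  have "vx x = vx y \<longleftrightarrow> att F (sw y) = att F (sw x)"
    unfolding vx_att[OF xy(1)[unfolded mem_H]] vx_att[OF xy(2)[unfolded mem_H]] by (rule eq_commute)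
  also have "\<dots> \<longleftrightarrow> sw y \<in> orbit (rot F) (sw x)"
    using xy orbit_att[of "sw x"] by (simp add: sw_H)
  also have "\<dots> \<longleftrightarrow> y \<in> orbit \<tau> x"
    unfolding \<tau>_def orbit_swap_ends mem_swap_image ..
  finally show ?thesis .
qed

lemma same_circle_swap:
  assumes W: "W \<subseteq> edges F" "e \<in> edges F - W" and c: "(vx (e, False), vx (e, True)) \<in> (adj vx W)\<^sup>*"
  shows "X.ca W e = X.cb W e"
proof -
  have v: "vx (e, b) = att F (e, b \<noteq> t e)" for b
    using vx_att[of "(e, b)"] W(2) by (simp add: swap_ends_def)
  have c': "(att F (e, t e), att F (e, \<not> t e)) \<in> (adj (att F) W)\<^sup>*"
    using c unfolding adj_vx[OF W(1)] v by simp
  have "(att F (e, False), att F (e, True)) \<in> (adj (att F) W)\<^sup>*"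
    using c' adj_rtrancl_sym[OF c'] by (cases "t e") simp_all
  from same_circle[OF g0 W this] show "X.ca W e = X.cb W e"
    by (cases "t e") (simp_all add: X.ca_def X.cb_def ca_def cb_def Xcyc swap_image_eq swap_ends_def)
qed

lemma vertex_ribbon_swap: "vertex_ribbon (edges F) \<tau> vx"
  by (rule vertex_ribbon.intro[OF X.ribbon_axioms vertex_ribbon_axioms.intro[OF vx_orbit_swap]])

sublocale X: planar_ribbon "edges F" \<tau> vx
  by (rule planar_ribbon.intro[OF vertex_ribbon_swap planar_ribbon_axioms.intro[OF same_circle_swap]])

text \<open>The bijection from circles to the boundary components other than those of
  \<open>Iso\<close>; the choice of the half-edge is immaterial by \<open>bc_cyc\<close>.\<close>

definition bc :: "'e set \<Rightarrow> ('e \<times> bool) set \<Rightarrow> ('e \<times> bool) set + 'v" where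
  "bc W c = boundary_at F W (sw (SOME d. d \<in> c))"

lemma bc_cyc: "W \<subseteq> edges F \<Longrightarrow> d \<in> H \<Longrightarrow> bc W (X.cyc W d) = boundary_at F W (sw d)"
proof -
  assume W: "W \<subseteq> edges F" and d: "d \<in> H"
  have s: "(SOME x. x \<in> X.cyc W d) \<in> X.cyc W d" by (rule someI[of _ d]) (rule X.cyc_self[OF W])
  then have "(SOME x. x \<in> X.cyc W d) \<in> H" using X.cyc_subset_H[OF W d] by (rule subsetD[rotated])
  then show ?thesis
    using boundary_at_eq_iff[OF W] X.cyc_eq[OF W s] d by (simp add: bc_def Xcyc_eq_iff sw_H)
qed

lemma XP_cases: "c \<in> X.P W \<Longrightarrow> (\<And>d. d \<in> H \<Longrightarrow> c = X.cyc W d \<Longrightarrow> thesis) \<Longrightarrow> thesis"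
  by (auto simp: X.P_def)

lemma bc_inj: "W \<subseteq> edges F \<Longrightarrow> inj_on (bc W) (X.P W)"
proof (rule inj_onI)
  fix c c' assume W: "W \<subseteq> edges F" and c: "c \<in> X.P W" "c' \<in> X.P W" "bc W c = bc W c'"
  obtain d d' where d: "d \<in> H" "c = X.cyc W d" "d' \<in> H" "c' = X.cyc W d'"
    using c(1,2) by (auto elim!: XP_cases)
  have "boundary_at F W (sw d) = boundary_at F W (sw d')"
    using c(3) unfolding d(2,4) bc_cyc[OF W d(1)] bc_cyc[OF W d(3)] .
  then show "c = c'" unfolding d(2,4) Xcyc_eq_iff
    using boundary_at_eq_iff[OF W, of "sw d" "sw d'"] d(1,3) by (simp only: sw_H)
qed

lemma bc_image: "W \<subseteq> edges F \<Longrightarrow> bc W ` X.P W = boundary_at F W ` H"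
proof -
  assume W: "W \<subseteq> edges F"
  have "sw ` H = H"
  proof (intro equalityI subsetI)
    fix x assume "x \<in> H"
    then show "x \<in> sw ` H" by (intro image_eqI[of _ _ "sw x"]) (simp_all add: sw_H)
  qed (use sw_H in blast)
  moreover have "bc W ` X.P W = (\<lambda>d. boundary_at F W (sw d)) ` H"
    unfolding X.P_def image_image by (rule image_cong) (simp_all add: bc_cyc[OF W])
  ultimately show ?thesis by (metis image_image)
qed

lemma boundaries_bc: "W \<subseteq> edges F \<Longrightarrow> boundaries F W = bc W ` X.P W \<union> Inr ` Iso"
  by (simp add: boundaries_eq bc_image)

lemma bc_not_Iso: "W \<subseteq> edges F \<Longrightarrow> c \<in> X.P W \<Longrightarrow> bc W c \<notin> Inr ` Iso"
proof -
  assume W: "W \<subseteq> edges F" and c: "c \<in> X.P W"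
  obtain d where d: "d \<in> H" "c = X.cyc W d" by (rule XP_cases[OF c])
  show ?thesis unfolding d(2) bc_cyc[OF W d(1)] using d(1) by (intro boundary_not_Iso) (simp only: sw_H)
qed

lemma side_cyc: "W \<subseteq> edges F \<Longrightarrow> e \<in> edges F \<Longrightarrow> boundary_at F W (e, b) = bc W (X.cyc W (e, b \<noteq> t e))"
  using bc_cyc[of W "(e, b \<noteq> t e)"] by (cases "t e") (simp_all add: mem_H swap_ends_def)

lemma Xrest_iff: "d \<in> H \<Longrightarrow> X.cyc W d \<in> X.rest W e \<longleftrightarrow> cyc W (sw d) \<in> rest W e"
proof -
  assume d: "d \<in> H"
  have 1: "X.cyc W d \<in> X.P W" "cyc W (sw d) \<in> P W"
    using X.cyc_in_P[OF d] cyc_in_P[of "sw d" W] d by (simp_all only: sw_H)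
  have "X.cyc W d \<in> X.rest W e \<longleftrightarrow>
      cyc W (sw d) \<noteq> cyc W (sw (e, False)) \<and> cyc W (sw d) \<noteq> cyc W (sw (e, True))"
    unfolding X.rest_def X.ca_def X.cb_def Diff_iff insert_iff empty_iff Xcyc_eq_iff using 1(1) by (simp only: simp_thms de_Morgan_disj)
  also have "\<dots> \<longleftrightarrow> cyc W (sw d) \<noteq> cyc W (e, False) \<and> cyc W (sw d) \<noteq> cyc W (e, True)"
  proof -
    have sE: "swap_ends t (e, b) = (e, b \<noteq> t e)" for b by (simp add: swap_ends_def)
    show ?thesis unfolding sE by (cases "t e") (simp_all only: simp_thms conj_commute)
  qed
  also have "\<dots> \<longleftrightarrow> cyc W (sw d) \<in> rest W e"
    unfolding rest_def ca_def cb_def Diff_iff insert_iff empty_iff using 1(2) by (simp only: simp_thms de_Morgan_disj)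
  finally show ?thesis .
qed

lemma bc_unchanged:
  assumes W: "W \<subseteq> edges F" "e \<in> W" and c: "c \<in> X.rest W e"
  shows "bc (W - {e}) c = bc W c"
proof -
  have "c \<in> X.P W" using c by (simp add: X.rest_def)
  then obtain d where d: "d \<in> H" "c = X.cyc W d" by (rule XP_cases)
  have r: "cyc W (sw d) \<in> rest W e" using c d Xrest_iff by simp
  note u = boundary_at_unchanged[OF W _ r, unfolded sw_H, OF d(1)]
  have "X.cyc (W - {e}) d = c" using u(1) d(2) by (simp add: Xcyc)
  moreover have "W - {e} \<subseteq> edges F" using W(1) by blast
  ultimately show ?thesis using bc_cyc[of "W - {e}" d] bc_cyc[OF W(1) d(1)] u(2) d by simp
qed

lemma boundaries_inter_bc:
  assumes W: "W \<subseteq> edges F" "e \<in> W"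
  shows "boundaries F W \<inter> boundaries F (W - {e}) = Inr ` Iso \<union> bc W ` X.rest W e"
proof -
  have "boundary_at F W ` {d \<in> H. cyc W d \<in> rest W e} = bc W ` X.rest W e"
  proof (intro equalityI subsetI)
    fix c assume "c \<in> boundary_at F W ` {d \<in> H. cyc W d \<in> rest W e}"
    then obtain d where d: "d \<in> H" "cyc W d \<in> rest W e" "c = boundary_at F W d" by blast
    then have "c = bc W (X.cyc W (sw d))" "X.cyc W (sw d) \<in> X.rest W e"
      using bc_cyc[OF W(1), of "sw d"] Xrest_iff[of "sw d" W e] by (simp_all add: sw_H)
    then show "c \<in> bc W ` X.rest W e" by blast
  next
    fix c assume "c \<in> bc W ` X.rest W e"
    then obtain c' where c: "c' \<in> X.rest W e" "c = bc W c'" by blast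
    then have "c' \<in> X.P W" by (simp add: X.rest_def)
    then obtain d where d: "d \<in> H" "c' = X.cyc W d" by (rule XP_cases)
    then show "c \<in> boundary_at F W ` {d \<in> H. cyc W d \<in> rest W e}"
      using c bc_cyc[OF W(1) d(1)] Xrest_iff[OF d(1)] sw_H by blast
  qed
  then show ?thesis by (simp add: boundaries_inter[OF W])
qed

text \<open>\<open>edge_sign\<close> looks at the source state and \<open>sg\<close> at the target;
  they differ only in \<open>e\<close>, which does not precede itself.\<close>

lemma sign_eq:
  assumes e: "e \<in> edges F - W'"
  shows "of_int (edge_sign es (insert e W') e) = X.sg W' e"
proof -
  have eE: "e \<in> set es" using e es by simp
  have "length (filter (\<lambda>x. x \<notin> insert e W') (takeWhile (\<lambda>x. x \<noteq> e) es)) =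
      card (set (filter (\<lambda>x. x \<notin> insert e W') (takeWhile (\<lambda>x. x \<noteq> e) es)))"
    by (rule distinct_card[OF distinct_filter[OF distinct_takeWhile[OF es(1)]], symmetric])
  also have "set (filter (\<lambda>x. x \<notin> insert e W') (takeWhile (\<lambda>x. x \<noteq> e) es)) =
      {a \<in> edges F. a \<notin> W' \<and> index_in es a < index_in es e}"
    using index_in_less_iff[OF eE es(1)] es(2) by (auto simp: set_eq_iff)
  finally show ?thesis by (simp add: edge_sign_def X.sg_def)
qed

end

lemma UNIV_vbasis: "(UNIV :: vbasis set) = {VPlus, VMinus}" and UNIV_rbasis: "(UNIV :: rbasis set) = {XMinus2, X0}"
  by (auto intro: vbasis.exhaust rbasis.exhaust)

lemma finite_rlists: "finite {r :: rbasis list. length r = n}"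
proof -
  have "finite (UNIV :: rbasis set)" by (simp add: UNIV_rbasis)
  from finite_lists_length_eq[OF this, of n] show ?thesis by simp
qed

lemma height_map_supp:
  assumes "Poly_Mapping.lookup (height_map r) r' \<noteq> 0"
  shows "length r' = Suc (length r)" "sum_list (map rdeg r') = sum_list (map rdeg r)"
proof -
  have "length r' = Suc (length r) \<and> sum_list (map rdeg r') = sum_list (map rdeg r)"
  proof (cases r rule: rev_cases)
    case Nil
    then show ?thesis using assms by (auto simp: height_map_def lookup_single when_def split: if_splits)
  next
    case (snoc s x)
    then show ?thesis using assms
      by (cases x) (auto simp: height_map_def lookup_single lookup_add when_def split: if_splits)
  qed
  then show "length r' = Suc (length r)" "sum_list (map rdeg r') = sum_list (map rdeg r)" by auto
qed

text \<open>The \<open>R\<close>-factor of the differential is injective: the coefficient at \<open>r \<otimes> x\<^sub>0\<close> recovers the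
  coefficient at \<open>r\<close>.\<close>

lemma height_map_snoc: "Poly_Mapping.lookup (height_map r0) (r @ [X0]) = (if r0 = r then 1 else 0)"
proof (cases r0 rule: rev_cases)
  case Nil
  then show ?thesis by (auto simp: height_map_def lookup_single when_def)
next
  case (snoc s x)
  then show ?thesis
    by (cases x) (auto simp: height_map_def lookup_single lookup_add when_def)
qed

section \<open>Generators as circle labels with passive labels, and their differential\<close>

type_synonym 'v lab = "('v \<Rightarrow> vbasis) \<times> ('v \<Rightarrow> vbasis) \<times> rbasis list"

context chrom
begin

text \<open>Separates a generator into its circle part and the labels of vertices, isolated vertices
  and R-factors. The genus list is empty because all states have genus 0.\<close>

definition gof :: "'e bgen \<times> 'v lab \<Rightarrow> ('v, 'e) gen" where
  "gof = (\<lambda>((W, A), (vl, il, r)). Gen W vl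
    (\<lambda>c\<in>boundaries F W. if c \<in> Inr ` Iso then il (projr c) else if c \<in> bc W ` A then VMinus else VPlus) [] r)"

definition Y :: "('e bgen \<times> 'v lab) set" where
  "Y = {((W, A), (vl, il, r)). W \<subseteq> edges F \<and> A \<subseteq> X.P W \<and> vl \<in> verts F \<rightarrow>\<^sub>E UNIV \<and> il \<in> Iso \<rightarrow>\<^sub>E UNIV \<and>
    length r = height F W}"

lemma height_ht: "W \<subseteq> edges F \<Longrightarrow> int (height F W) = X.ht W"
  using card_Diff_subset[OF finite_subset[OF _ finE], of W] by (simp add: height_def X.ht_def)

lemma finIso: "finite Iso"
  using finV by (simp add: Iso_def)

lemma finY: "finite Y"
proof -
  let ?L = "(verts F \<rightarrow>\<^sub>E UNIV) \<times> (Iso \<rightarrow>\<^sub>E UNIV) \<times> (\<Union>n\<le>card (edges F). {r. length r = n}) :: 'v lab set"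
  have "finite ?L"
    using finV finIso finite_rlists
    by (intro finite_cartesian_product finite_PiE finite_UN_I) (simp_all add: UNIV_vbasis)
  from finite_cartesian_product[OF X.finite_bgens this]
  have "finite ({(W, A). W \<subseteq> edges F \<and> A \<subseteq> X.P W} \<times> ?L)" .
  then show ?thesis
    by (rule rev_finite_subset) (auto simp: Y_def height_def)
qed

lemma gof_simps [simp]:
  "state (gof ((W, A), (vl, il, r))) = W" "vlab (gof ((W, A), (vl, il, r))) = vl"
  "glab (gof ((W, A), (vl, il, r))) = []" "rlab (gof ((W, A), (vl, il, r))) = r"
  by (simp_all add: gof_def)

lemma blab_bc:
  assumes W: "W \<subseteq> edges F" "A \<subseteq> X.P W" and c: "c \<in> X.P W"
  shows "blab (gof ((W, A), (vl, il, r))) (bc W c) = (if c \<in> A then VMinus else VPlus)"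
proof -
  have "bc W c \<in> boundaries F W" using c boundaries_bc[OF W(1)] by blast
  moreover have "bc W c \<in> bc W ` A \<longleftrightarrow> c \<in> A" by (rule inj_on_image_mem_iff[OF bc_inj[OF W(1)] c W(2)])
  ultimately show ?thesis using bc_not_Iso[OF W(1) c] by (simp add: gof_def)
qed

lemma blab_Iso:
  assumes "W \<subseteq> edges F" "v \<in> Iso"
  shows "blab (gof ((W, A), (vl, il, r))) (Inr v) = il v"
proof -
  have "Inr v \<in> boundaries F W" "(Inr v :: ('e \<times> bool) set + 'v) \<in> Inr ` Iso" using assms boundaries_bc[OF assms(1)] by blast+
  then show ?thesis by (simp add: gof_def)
qed

lemma gof_state_gens: "((W, A), (vl, il, r)) \<in> Y \<Longrightarrow> gof ((W, A), (vl, il, r)) \<in> state_gens F W"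
  using genus_zero[OF g0, of W] by (auto simp: state_gens_def Y_def) (auto simp: gof_def)

lemma gof_inj: "inj_on gof Y"
proof (rule inj_onI)
  fix x y assume xy: "x \<in> Y" "y \<in> Y" "gof x = gof y"
  obtain W A vl il r where x: "x = ((W, A), (vl, il, r))" by (metis prod.collapse)
  obtain W' A' vl' il' r' where y: "y = ((W', A'), (vl', il', r'))" by (metis prod.collapse)
  have z: "((W, A), (vl, il, r)) \<in> Y" "((W', A'), (vl', il', r')) \<in> Y"
    and eq: "gof ((W, A), (vl, il, r)) = gof ((W', A'), (vl', il', r'))"
    using xy unfolding x y by auto
  have 1: "W' = W" "vl' = vl" "r' = r"
    using arg_cong[OF eq, of state] arg_cong[OF eq, of vlab] arg_cong[OF eq, of rlab] by simp_all
  have Y: "W \<subseteq> edges F" "A \<subseteq> X.P W" "A' \<subseteq> X.P W" "il \<in> Iso \<rightarrow>\<^sub>E UNIV" "il' \<in> Iso \<rightarrow>\<^sub>E UNIV"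
    using z 1(1) by (auto simp: Y_def)
  have "il v = il' v" if "v \<in> Iso" for v
    using blab_Iso[OF Y(1) that, of A vl il r] blab_Iso[OF Y(1) that, of A' vl il' r] eq unfolding 1 by metis
  then have 2: "il = il'" using Y(4,5) by (rule PiE_ext[rotated 2])
  have "c \<in> A \<longleftrightarrow> c \<in> A'" if "c \<in> X.P W" for c
    using blab_bc[OF Y(1,2) that, of vl il r] blab_bc[OF Y(1,3) that, of vl il' r] eq unfolding 1
    by (metis vbasis.distinct(1))
  then have "A = A'" using Y(2,3) by blast
  then show "x = y" unfolding x y using 1 2 by simp
qed

lemma gof_surj:
  assumes W: "W \<subseteq> edges F" and x: "x \<in> state_gens F W"
  shows "x \<in> gof ` Y"
proof -
  have x': "state x = W" "vlab x \<in> verts F \<rightarrow>\<^sub>E UNIV" "blab x \<in> boundaries F W \<rightarrow>\<^sub>E UNIV" "glab x = []"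
    "length (rlab x) = height F W"
    using x genus_zero[OF g0 W] by (auto simp: state_gens_def)
  define A where "A = {c \<in> X.P W. blab x (bc W c) = VMinus}"
  define il where "il = (\<lambda>v\<in>Iso. blab x (Inr v))"
  let ?z = "((W, A), (vlab x, il, rlab x))"
  have z: "?z \<in> Y" using W x' by (auto simp: Y_def A_def il_def)
  have AP: "A \<subseteq> X.P W" by (auto simp: A_def)
  have "blab (gof ?z) = blab x"
  proof (rule PiE_ext)
    show "blab (gof ?z) \<in> boundaries F W \<rightarrow>\<^sub>E UNIV" using gof_state_gens[OF z] by (simp add: state_gens_def)
    show "blab x \<in> boundaries F W \<rightarrow>\<^sub>E UNIV" by (rule x'(3))
    fix c assume "c \<in> boundaries F W"
    then consider d where "d \<in> X.P W" "c = bc W d" | v where "v \<in> Iso" "c = Inr v"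
      unfolding boundaries_bc[OF W] by blast
    then show "blab (gof ?z) c = blab x c"
    proof cases
      case 1
      show ?thesis using blab_bc[OF W AP 1(1)] 1 by (cases "blab x (bc W d)") (simp_all add: A_def)
    next
      case 2
      show ?thesis using blab_Iso[OF W 2(1)] 2 by (simp add: il_def)
    qed
  qed
  then have g: "gof ?z = x" using x' by (intro gen.expand) simp
  show ?thesis by (rule image_eqI[where f = gof and x = ?z]) (simp_all only: g z)
qed

text \<open>The common boundary components are those of \<open>Iso\<close> and the circles of
  \<open>rest\<close>, so agreement of labels there separates into \<open>il' = il\<close> and
  agreement away from \<open>e\<close>; the labels at \<open>e\<close> are a finite check.
  \<open>t\<close> may exchange the sides of \<open>e\<close>, which the symmetry of merge and split
  absorbs.\<close>

lemma boundary_coeff_eq: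
  assumes z: "((W, A), (vl, il, r)) \<in> Y" "((W', A'), (vl', il', r')) \<in> Y"
    and e: "e \<in> edges F - W'" and We: "W = insert e W'"
  shows "of_int (boundary_coeff F e (gof ((W, A), (vl, il, r))) (gof ((W', A'), (vl', il', r')))) =
    of_bool (il' = il) * X.T 0 e (pt (W, A)) (W', A')" (is "of_int (boundary_coeff F e ?x ?y) = _")
proof -
  have Y: "W \<subseteq> edges F" "A \<subseteq> X.P W" "W' \<subseteq> edges F" "A' \<subseteq> X.P W'" "il \<in> Iso \<rightarrow>\<^sub>E UNIV" "il' \<in> Iso \<rightarrow>\<^sub>E UNIV"
    using z by (auto simp: Y_def)
  have eE: "e \<in> edges F" "e \<in> W" "W - {e} = W'" "tog e W' = W" using e We by (auto simp: tog_def)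
  define a b a' b' where ab: "a = X.ca W e" "b = X.cb W e" "a' = X.ca W' e" "b' = X.cb W' e"
  define R where "R = A' - {a', b'}"
  have rest: "X.rest W e = X.rest W' e" using X.rest_tog[OF Y(3) eE(1)] eE(4) by simp
  have abP: "a \<in> X.P W" "b \<in> X.P W" "a' \<in> X.P W'" "b' \<in> X.P W'"
    using X.ca_in_P[OF eE(1)] X.cb_in_P[OF eE(1)] by (simp_all add: ab)
  have ss: "a = b \<longleftrightarrow> a' \<noteq> b'" using X.same_tog[OF Y(3) eE(1)] eE(4) by (simp add: ab)
  have A1: "A - {a, b} = A \<inter> X.rest W e" and A2: "R = A' \<inter> X.rest W e"
    using Y(2,4) unfolding R_def rest by (auto simp: X.rest_def ab) (use rest in \<open>auto simp: X.rest_def\<close>)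
  have nR: "a \<notin> R" "b \<notin> R" unfolding A2 by (simp_all add: ab)
  define lx where "lx c = (if c \<in> A then VMinus else VPlus)" for c
  define ly where "ly c = (if c \<in> A' then VMinus else VPlus)" for c
  have bx: "blab ?x (bc W c) = lx c" if "c \<in> X.P W" for c unfolding lx_def by (rule blab_bc[OF Y(1,2) that])
  have by': "blab ?y (bc W' c) = ly c" if "c \<in> X.P W'" for c unfolding ly_def by (rule blab_bc[OF Y(3,4) that])
  have rc: "blab ?x (bc W c) = blab ?y (bc W c) \<longleftrightarrow> (c \<in> A \<longleftrightarrow> c \<in> A')" if c: "c \<in> X.rest W e" for c
  proof -
    have "c \<in> X.P W" "c \<in> X.P W'" using c c[unfolded rest] by (simp_all add: X.rest_def)
    moreover have "bc W c = bc W' c" using bc_unchanged[OF Y(1) eE(2) c] eE(3) by simp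
    ultimately show ?thesis using bx[of c] by'[of c] by (simp add: lx_def ly_def)
  qed
  have vc: "(\<forall>v\<in>Iso. blab ?x (Inr v) = blab ?y (Inr v)) \<longleftrightarrow> il' = il"
  proof
    assume "\<forall>v\<in>Iso. blab ?x (Inr v) = blab ?y (Inr v)"
    then have "il' v = il v" if "v \<in> Iso" for v
      using that blab_Iso[OF Y(1) that, of A vl il r] blab_Iso[OF Y(3) that, of A' vl' il' r'] by simp
    then show "il' = il" using Y(5,6) by (intro PiE_ext)
  qed (use blab_Iso Y(1,3) in simp)
  have Q: "(\<forall>c\<in>X.rest W e. c \<in> A \<longleftrightarrow> c \<in> A') \<longleftrightarrow> A - {a, b} = R" unfolding A1 A2 by blast
  have cond: "(\<forall>c\<in>boundaries F W \<inter> boundaries F W'. blab ?x c = blab ?y c) \<longleftrightarrow> il' = il \<and> A - {a, b} = R"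
    using boundaries_inter_bc[OF Y(1) eE(2)] vc Q rc unfolding eE(3) by (simp add: ball_Un)
  define p q p' q' where pq: "p = (if t e then b else a)" "q = (if t e then a else b)"
    "p' = (if t e then b' else a')" "q' = (if t e then a' else b')"
  have sd: "boundary_at F W (e, False) = bc W p" "boundary_at F W (e, True) = bc W q"
    "boundary_at F W' (e, False) = bc W' p'" "boundary_at F W' (e, True) = bc W' q'"
    using side_cyc[OF Y(1) eE(1)] side_cyc[OF Y(3) eE(1)]
    by (simp_all add: pq ab X.ca_def X.cb_def)
  have pP: "p \<in> X.P W" "q \<in> X.P W" "p' \<in> X.P W'" "q' \<in> X.P W'" using abP by (simp_all add: pq)
  have ne: "bc W p \<noteq> bc W q \<longleftrightarrow> a \<noteq> b"
    using inj_on_eq_iff[OF bc_inj[OF Y(1)] pP(1,2)] by (auto simp: pq)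
  have B: "boundary_coeff F e ?x ?y = (if il' = il \<and> A - {a, b} = R then
      (if a \<noteq> b then Poly_Mapping.lookup (merge_map (lx p, lx q)) (ly p')
       else Poly_Mapping.lookup (split_map (lx p)) (ly p', ly q')) else 0)"
    unfolding boundary_coeff_def Let_def gof_simps eE(3) cond sd ne bx[OF pP(1)] bx[OF pP(2)] by'[OF pP(3)] by'[OF pP(4)] ..
  have Tv: "X.T 0 e (pt (W, A)) (W', A') =
      (if a' = b' then (if a' \<in> A' then of_bool (insert a R = A) + of_bool (insert b R = A) else of_bool (R = A))
       else if a' \<in> A' then (if b' \<in> A' then of_bool (insert a R = A) else of_bool (R = A))
       else if b' \<in> A' then of_bool (R = A) else 0)"
    using Y(3,4) unfolding X.T_def Let_def prod.case eE(4) ab[symmetric] R_def[symmetric] by (simp add: pt_def)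
  have e1: "insert a R = A \<longleftrightarrow> A - {a, b} = R \<and> a \<in> A \<and> (b \<in> A \<longleftrightarrow> b = a)"
    and e2: "insert b R = A \<longleftrightarrow> A - {a, b} = R \<and> b \<in> A \<and> (a \<in> A \<longleftrightarrow> a = b)"
    and e3: "R = A \<longleftrightarrow> A - {a, b} = R \<and> a \<notin> A \<and> b \<notin> A"
    using nR by blast+
  define QQ where "QQ \<longleftrightarrow> A - {a, b} = R"
  show ?thesis unfolding B Tv e1 e2 e3 QQ_def[symmetric] using ss
    by (cases QQ; cases "a = b"; cases "a \<in> A"; cases "b \<in> A"; cases "a' \<in> A'"; cases "b' \<in> A'"; cases "t e")
      (simp_all add: lx_def ly_def pq lookup_add lookup_single when_def)
qed

definition hc :: "rbasis list \<Rightarrow> rbasis list \<Rightarrow> rat" where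
  "hc r r' = of_int (Poly_Mapping.lookup (height_map r) r')"

lemma edge_coeff_eq:
  assumes z: "((W, A), (vl, il, r)) \<in> Y" "((W', A'), (vl', il', r')) \<in> Y"
    and e: "e \<in> edges F - W'" and We: "W = insert e W'"
  shows "of_int (edge_coeff F e (gof ((W, A), (vl, il, r))) (gof ((W', A'), (vl', il', r')))) =
    of_bool (vl' = vl \<and> il' = il) * hc r r' * X.T 0 e (pt (W, A)) (W', A')"
proof -
  have W: "W \<subseteq> edges F" "W - {e} \<subseteq> edges F" using z by (auto simp: Y_def)
  have "genus_coeff F e (gof ((W, A), (vl, il, r))) (gof ((W', A'), (vl', il', r'))) = 1"
    by (simp add: genus_coeff_def genus_zero[OF g0] W)
  then show ?thesis
    using boundary_coeff_eq[OF assms] by (simp add: edge_coeff_def hc_def)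
qed

text \<open>The circle differential in each row of labels, combined with the matrix of
  \<open>height_map\<close> on the R-labels. \<open>iota_Dg\<close> identifies it with the chromatic
  differential.\<close>

definition dl :: "('e bgen \<times> 'v lab \<Rightarrow> rat) \<Rightarrow> 'e bgen \<times> 'v lab \<Rightarrow> rat" where
  "dl f = (\<lambda>(x, (vl, il, r')). \<Sum>r\<in>{r. Suc (length r) = length r'}.
    hc r r' * X.d 0 (edges F) (row (vl, il, r) f) x)"

lemma dl_linear: "rlin dl"
  by (rule rlinI) (auto simp: dl_def row_add row_scale rlin_add[OF X.d_linear] rlin_scale[OF X.d_linear]
    rscale_apply distrib_left sum.distrib sum_distrib_left mult_ac)

lemma finite_shorter: "finite {r :: rbasis list. Suc (length r) = n}"
  by (rule finite_subset[OF _ finite_rlists[of "n - 1"]]) auto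

definition \<iota> :: "(('v, 'e) gen \<Rightarrow>\<^sub>0 int) \<Rightarrow> 'e bgen \<times> 'v lab \<Rightarrow> rat" where
  "\<iota> c z = (if z \<in> Y then of_int (Poly_Mapping.lookup c (gof z)) else 0)"

definition Dg :: "('v, 'e) gen \<Rightarrow> (('v, 'e) gen \<Rightarrow>\<^sub>0 int)" where
  "Dg x = (\<Sum>e\<in>state x. edge_map F es e x)"

lemma finite_state_gens: "W \<subseteq> edges F \<Longrightarrow> finite (state_gens F W)"
  by (rule finite_subset[OF _ finite_imageI[OF finY]]) (use gof_surj in blast)

lemma lookup_Dg:
  assumes "state x = W" "W \<subseteq> edges F"
  shows "Poly_Mapping.lookup (Dg x) y =
    (\<Sum>e\<in>W. edge_sign es W e * (if y \<in> state_gens F (W - {e}) then edge_coeff F e x y else 0))"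
proof -
  have "Poly_Mapping.lookup (edge_map F es e x) y =
      edge_sign es W e * (if y \<in> state_gens F (W - {e}) then edge_coeff F e x y else 0)" for e
  proof -
    have "finite (state_gens F (W - {e}))" using finite_state_gens[of "W - {e}"] assms(2) by blast
    then show ?thesis
      by (simp add: edge_map_def assms(1) lookup_sum lookup_single when_def sum.delta if_distrib
          cong: if_cong)
  qed
  then show ?thesis by (simp add: Dg_def assms(1) lookup_sum)
qed

lemma iota_Dg:
  assumes z: "z \<in> Y"
  shows "\<iota> (Dg (gof z)) = dl (pt z)"
proof (rule ext)
  fix z' :: "'e bgen \<times> 'v lab"
  obtain W A vl il r where zz: "z = ((W, A), (vl, il, r))" by (metis prod.collapse)
  obtain W' A' vl' il' r' where zz': "z' = ((W', A'), (vl', il', r'))" by (metis prod.collapse)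
  have Yz: "W \<subseteq> edges F" "A \<subseteq> X.P W" "vl \<in> verts F \<rightarrow>\<^sub>E UNIV" "il \<in> Iso \<rightarrow>\<^sub>E UNIV" "length r = height F W"
    using z by (auto simp: zz Y_def)
  let ?o = "of_bool (vl' = vl \<and> il' = il) :: rat"
  have rw: "row (vl', il', r0) (pt z) = rscale (of_bool (vl' = vl \<and> il' = il \<and> r0 = r)) (pt (W, A))" for r0
    by (auto simp: row_def pt_def zz rscale_apply fun_eq_iff)
  have "dl (pt z) z' = (\<Sum>r0\<in>{r0. Suc (length r0) = length r'}.
      if r0 = r then ?o * hc r r' * X.d 0 (edges F) (pt (W, A)) (W', A') else 0)"
    unfolding dl_def zz' prod.case rw rlin_scale[OF X.d_linear]
    by (intro sum.cong refl) (simp add: rscale_apply)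
  also have "\<dots> = ?o * hc r r' * X.d 0 (edges F) (pt (W, A)) (W', A')"
  proof (cases "Suc (length r) = length r'")
    case False
    then have "hc r r' = 0" using height_map_supp(1)[of r r'] by (auto simp: hc_def)
    then show ?thesis using finite_shorter by (simp add: sum.delta)
  qed (use finite_shorter in \<open>simp add: sum.delta\<close>)
  also have "\<dots> = (\<Sum>e\<in>{e \<in> edges F - W'. insert e W' = W}. ?o * hc r r' * (X.sg W' e * X.T 0 e (pt (W, A)) (W', A')))"
  proof -
    have "X.d 0 (edges F) (pt (W, A)) (W', A') = (\<Sum>e\<in>edges F - W'. X.sg W' e * X.T 0 e (pt (W, A)) (W', A'))"
      by (rule X.d_apply[OF finE])
    also have "\<dots> = (\<Sum>e\<in>{e \<in> edges F - W'. insert e W' = W}. X.sg W' e * X.T 0 e (pt (W, A)) (W', A'))"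
      by (rule sum.mono_neutral_right) (use finE in \<open>auto simp: X.T_def Let_def pt_def tog_def\<close>)
    finally show ?thesis by (simp add: sum_distrib_left)
  qed
  finally have rhs: "dl (pt z) z' =
      (\<Sum>e\<in>{e \<in> edges F - W'. insert e W' = W}. ?o * hc r r' * (X.sg W' e * X.T 0 e (pt (W, A)) (W', A')))" .
  show "\<iota> (Dg (gof z)) z' = dl (pt z) z'"
  proof (cases "z' \<in> Y")
    case True
    then have z'Y: "((W', A'), (vl', il', r')) \<in> Y" "W' \<subseteq> edges F" by (auto simp: zz' Y_def)
    have st: "gof z' \<in> state_gens F V \<longleftrightarrow> V = W'" for V
      using gof_state_gens[OF z'Y(1)] by (auto simp: zz' state_gens_def)
    have "\<iota> (Dg (gof z)) z' = of_int (\<Sum>e\<in>W. edge_sign es W e * (if W - {e} = W' then edge_coeff F e (gof z) (gof z') else 0))"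
      using True lookup_Dg[of "gof z" W "gof z'"] Yz(1) by (simp add: \<iota>_def st zz)
    also have "(\<Sum>e\<in>W. edge_sign es W e * (if W - {e} = W' then edge_coeff F e (gof z) (gof z') else 0)) =
        (\<Sum>e\<in>{e \<in> edges F - W'. insert e W' = W}. edge_sign es W e * edge_coeff F e (gof z) (gof z'))"
      by (rule sum.mono_neutral_cong_right) (use Yz(1) finite_subset[OF Yz(1) finE] in auto)
    also have "of_int \<dots> = (\<Sum>e\<in>{e \<in> edges F - W'. insert e W' = W}. ?o * hc r r' * (X.sg W' e * X.T 0 e (pt (W, A)) (W', A')))"
      unfolding of_int_sum
    proof (intro sum.cong refl)
      fix e assume e: "e \<in> {e \<in> edges F - W'. insert e W' = W}"
      then have e': "e \<in> edges F - W'" "W = insert e W'" by auto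
      have "of_int (edge_coeff F e (gof z) (gof z')) = ?o * hc r r' * X.T 0 e (pt (W, A)) (W', A')"
        unfolding zz zz' by (rule edge_coeff_eq[OF z[unfolded zz] z'Y(1) e'])
      moreover have "of_int (edge_sign es W e) = X.sg W' e" unfolding e'(2) by (rule sign_eq[OF e'(1)])
      ultimately show "of_int (edge_sign es W e * edge_coeff F e (gof z) (gof z')) =
          ?o * hc r r' * (X.sg W' e * X.T 0 e (pt (W, A)) (W', A'))" by simp
    qed
    finally show ?thesis using rhs by simp
  next
    \<comment> \<open>No nonzero coefficient leads outside \<open>Y\<close>, since each factor
      enforces one of the conditions that define \<open>Y\<close>.\<close>
    case False
    have "?o * hc r r' * (X.sg W' e * X.T 0 e (pt (W, A)) (W', A')) = 0"
      if e: "e \<in> edges F - W'" "insert e W' = W" for e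
    proof (rule ccontr)
      assume nz: "?o * hc r r' * (X.sg W' e * X.T 0 e (pt (W, A)) (W', A')) \<noteq> 0"
      then have 1: "vl' = vl" "il' = il" "hc r r' \<noteq> 0" "X.T 0 e (pt (W, A)) (W', A') \<noteq> 0"
        by (auto split: if_splits)
      then have "W' \<subseteq> edges F" "A' \<subseteq> X.P W'" by (auto simp: X.T_def split: if_splits)
      moreover have "length r' = Suc (height F W)" using height_map_supp(1)[of r r'] 1(3) Yz(5) by (simp add: hc_def)
      moreover have "height F W' = Suc (height F W)"
      proof -
        have "card W = Suc (card W')" using e finite_subset[OF \<open>W' \<subseteq> edges F\<close> finE] by auto
        then show ?thesis using card_mono[OF finE Yz(1)] by (simp add: height_def)
      qed
      ultimately show False using False Yz 1 by (simp add: zz' Y_def)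
    qed
    then have "dl (pt z) z' = 0" unfolding rhs by (intro sum.neutral) blast
    then show ?thesis using False by (simp add: \<iota>_def)
  qed
qed

end

definition labels :: "'v set \<Rightarrow> 'v set \<Rightarrow> int \<Rightarrow> 'v lab set" where
  "labels V I h = {(vl, il, r). vl \<in> V \<rightarrow>\<^sub>E UNIV \<and> il \<in> I \<rightarrow>\<^sub>E UNIV \<and> int (length r) = h}"

definition label_deg :: "'v set \<Rightarrow> 'v set \<Rightarrow> 'v lab \<Rightarrow> int" where
  "label_deg V I = (\<lambda>(vl, il, r). (\<Sum>v\<in>V. vdeg (vl v)) + (\<Sum>v\<in>I. vdeg (il v)) + sum_list (map rdeg r))"

lemma finite_labels: "finite V \<Longrightarrow> finite I \<Longrightarrow> finite (labels V I h)"
proof -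
  assume f: "finite V" "finite I"
  have "finite ((V \<rightarrow>\<^sub>E UNIV) \<times> (I \<rightarrow>\<^sub>E UNIV) \<times> {r. length r = nat h} :: 'a lab set)"
    using f finite_rlists by (intro finite_cartesian_product finite_PiE) (simp_all add: UNIV_vbasis)
  then show ?thesis by (rule rev_finite_subset) (auto simp: labels_def)
qed

lemma subgroup_free_Abelian_groupI:
  assumes "\<And>a. a \<in> S \<Longrightarrow> Poly_Mapping.keys a \<subseteq> X" "0 \<in> S" "\<And>a b. a \<in> S \<Longrightarrow> b \<in> S \<Longrightarrow> a - b \<in> S"
  shows "subgroup S (free_Abelian_group X)"
proof (rule group.subgroupI[OF group_free_Abelian_group])
  have m: "- a \<in> S" if "a \<in> S" for a using assms(3)[OF assms(2) that] by simp
  show "S \<subseteq> carrier (free_Abelian_group X)" using assms(1) by auto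
  show "S \<noteq> {}" using assms(2) by blast
  show "inv\<^bsub>free_Abelian_group X\<^esub> a \<in> S" if "a \<in> S" for a using m[OF that] assms(1)[OF that] by simp
  show "a \<otimes>\<^bsub>free_Abelian_group X\<^esub> b \<in> S" if "a \<in> S" "b \<in> S" for a b
    using assms(3)[OF that(1) m[OF that(2)]] by simp
qed

section \<open>Kernel dimensions of the chromatic complex and ranks of its cohomology\<close>

context chrom
begin

abbreviation lbs where "lbs \<equiv> labels (verts F) Iso"
abbreviation ldeg where "ldeg \<equiv> label_deg (verts F) Iso"

definition Yg :: "int \<Rightarrow> int \<Rightarrow> ('e bgen \<times> 'v lab) set" where
  "Yg h j = {z \<in> Y. X.ht (fst (fst z)) = h \<and> X.deg (fst z) + ldeg (snd z) = j}"

lemma Yg_Y: "Yg h j \<subseteq> Y" by (auto simp: Yg_def)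

lemma finYg: "finite (Yg h j)" by (rule finite_subset[OF Yg_Y finY])

lemma gen_deg_gof:
  assumes z: "((W, A), l) \<in> Y"
  shows "gen_deg F (gof ((W, A), l)) = X.deg (W, A) + ldeg l"
proof -
  obtain vl il r where l: "l = (vl, il, r)" by (metis prod.collapse)
  have Y: "W \<subseteq> edges F" "A \<subseteq> X.P W" using z by (auto simp: Y_def l)
  have fA: "finite A" using finite_subset[OF Y(2)] by blast
  let ?x = "gof ((W, A), (vl, il, r))"
  have d: "bc W ` X.P W \<inter> Inr ` Iso = {}" using bc_not_Iso[OF Y(1)] by blast
  have "(\<Sum>c\<in>boundaries F W. vdeg (blab ?x c)) =
      (\<Sum>c\<in>bc W ` X.P W. vdeg (blab ?x c)) + (\<Sum>c\<in>Inr ` Iso. vdeg (blab ?x c))"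
    unfolding boundaries_bc[OF Y(1)] by (rule sum.union_disjoint) (use d finIso in auto)
  also have "(\<Sum>c\<in>bc W ` X.P W. vdeg (blab ?x c)) = (\<Sum>c\<in>X.P W. if c \<in> A then -1 else 1)"
    unfolding sum.reindex[OF bc_inj[OF Y(1)]] comp_def by (intro sum.cong refl) (simp add: blab_bc[OF Y])
  also have "\<dots> = int (card (X.P W)) - 2 * int (card A)"
  proof -
    have "(\<Sum>c\<in>X.P W. if c \<in> A then -1 else 1 :: int) = (\<Sum>c\<in>X.P W. 1 - (if c \<in> A then 2 else 0))"
      by (intro sum.cong refl) simp
    also have "\<dots> = int (card (X.P W)) - (\<Sum>c\<in>X.P W. if c \<in> A then 2 else 0)" by (simp add: sum_subtractf)
    also have "(\<Sum>c\<in>X.P W. if c \<in> A then 2 else 0 :: int) = (\<Sum>c\<in>A. 2)"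
      by (rule sum.mono_neutral_cong_right) (use Y(2) in auto)
    finally show ?thesis by simp
  qed
  also have "(\<Sum>c\<in>Inr ` Iso. vdeg (blab ?x c)) = (\<Sum>v\<in>Iso. vdeg (il v))"
    by (simp add: sum.reindex blab_Iso[OF Y(1)])
  finally show ?thesis using height_ht[OF Y(1)]
    by (simp add: gen_deg_def l label_deg_def X.deg_def X.dv_def)
qed

lemma gens_eq: "{x. \<exists>W\<subseteq>edges F. int (height F W) = h \<and> x \<in> state_gens F W \<and> gen_deg F x = j} = gof ` Yg h j"
proof (intro equalityI subsetI)
  fix x assume "x \<in> {x. \<exists>W\<subseteq>edges F. int (height F W) = h \<and> x \<in> state_gens F W \<and> gen_deg F x = j}"
  then obtain W where W: "W \<subseteq> edges F" "int (height F W) = h" "x \<in> state_gens F W" "gen_deg F x = j" by blast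
  obtain z where z: "z \<in> Y" "x = gof z" using gof_surj[OF W(1,3)] by blast
  obtain W' A l where zz: "z = ((W', A), l)" by (metis prod.collapse)
  obtain vl il r where l: "l = (vl, il, r)" by (metis prod.collapse)
  have "W' = W" using W(3) z(2) by (simp add: zz l state_gens_def)
  then have "z \<in> Yg h j"
    using z W(1,2,4) height_ht[OF W(1)] gen_deg_gof[of W A l] by (simp add: Yg_def zz)
  then show "x \<in> gof ` Yg h j" using z(2) by blast
next
  fix x assume "x \<in> gof ` Yg h j"
  then obtain z where z: "z \<in> Yg h j" "x = gof z" by blast
  obtain W A vl il r where zz: "z = ((W, A), (vl, il, r))" by (metis prod.collapse)
  have zY: "((W, A), (vl, il, r)) \<in> Y" "W \<subseteq> edges F" using z(1) by (auto simp: Yg_def zz Y_def)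
  have "int (height F W) = h" using z(1) height_ht[OF zY(2)] by (simp add: Yg_def zz)
  moreover have "x \<in> state_gens F W" using gof_state_gens[OF zY(1)] by (simp add: z(2) zz)
  moreover have "gen_deg F x = j" using gen_deg_gof[OF zY(1)] z(1) by (simp add: Yg_def z(2) zz)
  ultimately show "x \<in> {x. \<exists>W\<subseteq>edges F. int (height F W) = h \<and> x \<in> state_gens F W \<and> gen_deg F x = j}"
    using zY(2) by blast
qed

text \<open>With the passive labels fixed, what remains is a generator of the circle complex in the
  complementary degree; this makes \<open>Yg\<close> a union of rows.\<close>

lemma Yg_iff: "(x, l) \<in> Yg h j \<longleftrightarrow> l \<in> lbs h \<and> x \<in> X.gens h (j - ldeg l)"
proof -
  obtain W A where x: "x = (W, A)" by (cases x)
  obtain vl il r where l: "l = (vl, il, r)" by (metis prod.collapse)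
  show ?thesis
  proof (cases "W \<subseteq> edges F")
    case True
    have "length r = height F W \<longleftrightarrow> int (length r) = X.ht W" unfolding height_ht[OF True, symmetric] by simp
    then show ?thesis by (auto simp: Yg_def Y_def X.gens_def labels_def x l)
  qed (auto simp: Yg_def Y_def X.gens_def x l)
qed

lemma fsup_Yg: "f \<in> fsup (Yg h j) \<longleftrightarrow>
    (\<forall>l\<in>lbs h. row l f \<in> fsup (X.gens h (j - ldeg l))) \<and> (\<forall>l. l \<notin> lbs h \<longrightarrow> row l f = 0)"
proof
  assume f: "f \<in> fsup (Yg h j)"
  then show "(\<forall>l\<in>lbs h. row l f \<in> fsup (X.gens h (j - ldeg l))) \<and> (\<forall>l. l \<notin> lbs h \<longrightarrow> row l f = 0)"
    by (auto simp: fsup_def row_def Yg_iff fun_eq_iff)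
next
  assume a: "(\<forall>l\<in>lbs h. row l f \<in> fsup (X.gens h (j - ldeg l))) \<and> (\<forall>l. l \<notin> lbs h \<longrightarrow> row l f = 0)"
  show "f \<in> fsup (Yg h j)"
  proof (rule fsupI)
    fix z assume nz: "f z \<noteq> 0"
    obtain x l where z: "z = (x, l)" by (cases z)
    have 1: "row l f x \<noteq> 0" using nz by (simp add: row_def z)
    then have l: "l \<in> lbs h" using a by (metis zero_fun_def)
    then show "z \<in> Yg h j" using a 1 unfolding z Yg_iff by (blast dest: fsupD)
  qed
qed

abbreviation dX where "dX \<equiv> X.d 0 (edges F)"

lemma dl_snoc: "dl f (x, (vl, il, r @ [X0])) = dX (row (vl, il, r) f) x"
proof -
  have "dl f (x, (vl, il, r @ [X0])) =
      (\<Sum>r0\<in>{r0. Suc (length r0) = Suc (length r)}. if r0 = r then dX (row (vl, il, r) f) x else 0)"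
    unfolding dl_def prod.case by (intro sum.cong) (simp_all add: hc_def height_map_snoc)
  then show ?thesis using finite_shorter[of "Suc (length r)"] by (simp add: sum.delta)
qed

text \<open>By \<open>dl_snoc\<close> the target label extended by x_0 shows the circle differential
  of one source row alone, so different R-labels cannot cancel.\<close>

lemma dl_zero_iff: "dl f = 0 \<longleftrightarrow> (\<forall>l. dX (row l f) = 0)"
proof
  assume 0: "dl f = 0"
  show "\<forall>l. dX (row l f) = 0"
  proof (intro allI ext)
    fix l :: "'v lab" and x
    obtain vl il r where l: "l = (vl, il, r)" by (metis prod.collapse)
    show "dX (row l f) x = 0 x" using dl_snoc[of f x vl il r] 0 by (simp add: l)
  qed
next
  assume "\<forall>l. dX (row l f) = 0"
  then show "dl f = 0" by (auto simp: dl_def fun_eq_iff)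
qed

lemma row_dl: "row (vl, il, r') (dl f) =
    (\<Sum>r\<in>{r. Suc (length r) = length r'}. rscale (hc r r') (dX (row (vl, il, r) f)))"
  by (auto simp: row_def dl_def fun_eq_iff sum_fun_apply rscale_apply)

lemma dl_dl: "dl (dl f) = 0"
  unfolding dl_zero_iff
proof
  fix l :: "'v lab"
  obtain vl il r where l: "l = (vl, il, r)" by (metis prod.collapse)
  have z: "rscale c 0 = 0" for c :: rat by (simp add: rscale_def zero_fun_def)
  show "dX (row l (dl f)) = 0"
    unfolding l row_dl rlin_sum[OF X.d_linear] rlin_scale[OF X.d_linear] X.d_d[OF order_refl] z by simp
qed

lemma dl_Yg: "f \<in> fsup (Yg h j) \<Longrightarrow> dl f \<in> fsup (Yg (h + 1) j)"
proof (rule fsupI)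
  fix z assume f: "f \<in> fsup (Yg h j)" and nz: "dl f z \<noteq> 0"
  obtain x vl il r' where z: "z = (x, (vl, il, r'))" by (metis prod.collapse)
  obtain r where r: "Suc (length r) = length r'" "hc r r' * dX (row (vl, il, r) f) x \<noteq> 0"
    using nz unfolding dl_def z prod.case by (rule sum.not_neutral_contains_not_neutral) blast
  have h: "hc r r' \<noteq> 0" and d: "dX (row (vl, il, r) f) x \<noteq> 0" using r(2) by auto
  have l: "(vl, il, r) \<in> lbs h"
  proof (rule ccontr)
    assume "(vl, il, r) \<notin> lbs h"
    then have "row (vl, il, r) f = 0" using f fsup_Yg by blast
    then show False using d rlin_0[OF X.d_linear] by (simp add: zero_fun_def)
  qed
  then have "row (vl, il, r) f \<in> fsup (X.gens h (j - ldeg (vl, il, r)))" using f fsup_Yg by blast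
  from fsupD[OF X.d0_gens[OF this] d] have "x \<in> X.gens (h + 1) (j - ldeg (vl, il, r))" .
  moreover have "ldeg (vl, il, r') = ldeg (vl, il, r)"
    using height_map_supp(2)[of r r'] h by (simp add: hc_def label_deg_def)
  moreover have "(vl, il, r') \<in> lbs (h + 1)" using l r(1) by (auto simp: labels_def)
  ultimately show "z \<in> Yg (h + 1) j" unfolding z Yg_iff by simp
qed

lemma dim_kernel_Yg: "rv.dim {f \<in> fsup (Yg h j). dl f = 0} = (\<Sum>l\<in>lbs h. X.kappa h (j - ldeg l))"
proof -
  let ?U = "\<lambda>l. {f \<in> fsup (X.gens h (j - ldeg l)). dX f = 0}"
  have eq: "{f \<in> fsup (Yg h j). dl f = 0} = {f. (\<forall>l\<in>lbs h. row l f \<in> ?U l) \<and> (\<forall>l. l \<notin> lbs h \<longrightarrow> row l f = 0)}"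
  proof (intro equalityI subsetI)
    fix f assume "f \<in> {f \<in> fsup (Yg h j). dl f = 0}"
    then show "f \<in> {f. (\<forall>l\<in>lbs h. row l f \<in> ?U l) \<and> (\<forall>l. l \<notin> lbs h \<longrightarrow> row l f = 0)}"
      unfolding fsup_Yg dl_zero_iff by blast
  next
    fix f assume a: "f \<in> {f. (\<forall>l\<in>lbs h. row l f \<in> ?U l) \<and> (\<forall>l. l \<notin> lbs h \<longrightarrow> row l f = 0)}"
    have "dX (row l f) = 0" for l
    proof (cases "l \<in> lbs h")
      case False
      then have "row l f = 0" using a by blast
      then show ?thesis by (simp add: rlin_0[OF X.d_linear])
    qed (use a in blast)
    then show "f \<in> {f \<in> fsup (Yg h j). dl f = 0}" using a unfolding mem_Collect_eq fsup_Yg dl_zero_iff by blast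
  qed
  have dm: "rv.dim {f. (\<forall>l\<in>lbs h. row l f \<in> ?U l) \<and> (\<forall>l. l \<notin> lbs h \<longrightarrow> row l f = 0)} = (\<Sum>l\<in>lbs h. rv.dim (?U l))"
  proof (rule dim_rows[OF finite_labels[OF finV finIso] _ _ X.finite_bgens])
    show "rv.subspace (?U l)" for l by (rule kernel_subspace[OF X.d_linear fsup_subspace])
    show "?U l \<subseteq> fsup {(W, A). W \<subseteq> edges F \<and> A \<subseteq> X.P W}" for l
      using fsup_mono[of "X.gens h (j - ldeg l)" "{(W, A). W \<subseteq> edges F \<and> A \<subseteq> X.P W}"]
      by (auto simp: X.gens_def)
  qed
  show ?thesis unfolding eq dm X.kappa_def ..
qed

lemma dim_Yg: "rv.dim (fsup (Yg h j)) = (\<Sum>l\<in>lbs h. card (X.gens h (j - ldeg l)))"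
proof -
  let ?U = "\<lambda>l. fsup (X.gens h (j - ldeg l))"
  have eq: "fsup (Yg h j) = {f. (\<forall>l\<in>lbs h. row l f \<in> ?U l) \<and> (\<forall>l. l \<notin> lbs h \<longrightarrow> row l f = 0)}"
    using fsup_Yg by blast
  have dm: "rv.dim {f. (\<forall>l\<in>lbs h. row l f \<in> ?U l) \<and> (\<forall>l. l \<notin> lbs h \<longrightarrow> row l f = 0)} = (\<Sum>l\<in>lbs h. rv.dim (?U l))"
  proof (rule dim_rows[OF finite_labels[OF finV finIso] fsup_subspace _ X.finite_bgens])
    show "?U l \<subseteq> fsup {(W, A). W \<subseteq> edges F \<and> A \<subseteq> X.P W}" for l
      by (rule fsup_mono) (auto simp: X.gens_def)
  qed
  show ?thesis unfolding eq dm dim_fsup[OF X.finite_gens] ..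
qed

lemma iota_add: "\<iota> (a + b) = \<iota> a + \<iota> b" and iota_diff: "\<iota> (a - b) = \<iota> a - \<iota> b"
  and iota_scale: "\<iota> (frag_cmul n a) = rscale (of_int n) (\<iota> a)" and iota_0: "\<iota> 0 = 0"
  by (auto simp: \<iota>_def fun_eq_iff lookup_add lookup_minus rscale_apply)

lemma iota_sum: "\<iota> (\<Sum>i\<in>I. frag_cmul (n i) (a i)) = (\<Sum>i\<in>I. rscale (of_int (n i)) (\<iota> (a i)))"
  by (induction I rule: infinite_finite_induct) (simp_all add: iota_add iota_scale iota_0)

lemma iota_Yg:
  assumes c: "Poly_Mapping.keys c \<subseteq> gof ` Yg h j"
  shows "\<iota> c \<in> fsup (Yg h j)"
proof (rule fsupI)
  fix z assume nz: "\<iota> c z \<noteq> 0"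
  then have z: "z \<in> Y" "gof z \<in> Poly_Mapping.keys c" by (auto simp: \<iota>_def in_keys_iff split: if_splits)
  then obtain z1 where "z1 \<in> Yg h j" "gof z = gof z1" using c by blast
  then show "z \<in> Yg h j" using inj_onD[OF gof_inj, of z z1] z(1) Yg_Y by blast
qed

lemma iota_eq_0:
  assumes c: "Poly_Mapping.keys c \<subseteq> gof ` Y" and 0: "\<iota> c = 0"
  shows "c = 0"
proof (rule poly_mapping_eqI)
  fix x
  show "Poly_Mapping.lookup c x = Poly_Mapping.lookup 0 x"
  proof (cases "x \<in> gof ` Y")
    case True
    then obtain z where z: "z \<in> Y" "x = gof z" by blast
    have "\<iota> c z = 0" using 0 by simp
    then show ?thesis using z by (simp add: \<iota>_def)
  next
    case False
    then have "x \<notin> Poly_Mapping.keys c" using c by blast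
    then show ?thesis by (simp add: in_keys_iff)
  qed
qed

lemma iota_of: "z \<in> Y \<Longrightarrow> \<iota> (frag_of (gof z)) = pt z"
  using inj_onD[OF gof_inj] by (auto simp: \<iota>_def pt_def fun_eq_iff)

lemma iota_extend:
  assumes "Poly_Mapping.keys c \<subseteq> gof ` Y"
  shows "\<iota> (frag_extend Dg c) = dl (\<iota> c)"
  using assms
proof (rule frag_induction)
  show "\<iota> (frag_extend Dg 0) = dl (\<iota> 0)" by (simp add: iota_0 rlin_0[OF dl_linear])
  show "\<iota> (frag_extend Dg (frag_of x)) = dl (\<iota> (frag_of x))" if "x \<in> gof ` Y" for x
    using that iota_Dg iota_of by auto
  show "\<iota> (frag_extend Dg (a - b)) = dl (\<iota> (a - b))"
    if "\<iota> (frag_extend Dg a) = dl (\<iota> a)" "\<iota> (frag_extend Dg b) = dl (\<iota> b)" for a b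
    using that by (simp add: frag_extend_diff iota_diff rlin_diff[OF dl_linear])
qed

lemma keys_Dg: "z \<in> Y \<Longrightarrow> Poly_Mapping.keys (Dg (gof z)) \<subseteq> gof ` Y"
proof
  fix y assume z: "z \<in> Y" and y: "y \<in> Poly_Mapping.keys (Dg (gof z))"
  obtain W A vl il r where zz: "z = ((W, A), (vl, il, r))" by (metis prod.collapse)
  have W: "state (gof z) = W" "W \<subseteq> edges F" using z by (auto simp: zz Y_def)
  have "Poly_Mapping.lookup (Dg (gof z)) y \<noteq> 0" using y by (simp add: in_keys_iff)
  then obtain e where "y \<in> state_gens F (W - {e})"
    unfolding lookup_Dg[OF W] by (rule sum.not_neutral_contains_not_neutral) (auto split: if_splits)
  then show "y \<in> gof ` Y" using gof_surj[of "W - {e}" y] W(2) by blast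
qed

lemma keys_extend_Y:
  assumes "Poly_Mapping.keys c \<subseteq> gof ` Y"
  shows "Poly_Mapping.keys (frag_extend Dg c) \<subseteq> gof ` Y"
  using assms
proof (rule frag_induction)
  show "Poly_Mapping.keys (frag_extend Dg (a - b)) \<subseteq> gof ` Y"
    if "Poly_Mapping.keys (frag_extend Dg a) \<subseteq> gof ` Y" "Poly_Mapping.keys (frag_extend Dg b) \<subseteq> gof ` Y" for a b
    using that keys_diff[of "frag_extend Dg a" "frag_extend Dg b"] by (auto simp: frag_extend_diff)
  show "Poly_Mapping.keys (frag_extend Dg (frag_of x)) \<subseteq> gof ` Y" if x: "x \<in> gof ` Y" for x
  proof -
    obtain z where z: "z \<in> Y" "x = gof z" using x by blast
    show ?thesis unfolding z(2) frag_extend_of by (rule keys_Dg[OF z(1)])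
  qed
qed simp

lemma keys_extend:
  assumes c: "Poly_Mapping.keys c \<subseteq> gof ` Yg h j"
  shows "Poly_Mapping.keys (frag_extend Dg c) \<subseteq> gof ` Yg (h + 1) j"
proof
  fix y assume y: "y \<in> Poly_Mapping.keys (frag_extend Dg c)"
  have cY: "Poly_Mapping.keys c \<subseteq> gof ` Y" using c Yg_Y by blast
  then obtain z where z: "z \<in> Y" "y = gof z" using keys_extend_Y y by blast
  have "dl (\<iota> c) z \<noteq> 0" using y z unfolding iota_extend[OF cY, symmetric] by (simp add: \<iota>_def in_keys_iff)
  then show "y \<in> gof ` Yg (h + 1) j" using fsupD[OF dl_Yg[OF iota_Yg[OF c]]] z(2) by blast
qed

lemma iota_lift:
  assumes f: "f \<in> fsup (Yg h j)"
  shows "\<exists>N>0. \<exists>c. Poly_Mapping.keys c \<subseteq> gof ` Yg h j \<and> \<iota> c = rscale (of_int N) f"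
proof -
  obtain N :: int where N: "0 < N" "\<forall>z\<in>Yg h j. \<exists>n::int. of_int N * f z = of_int n"
    using common_denominator[OF finYg[of h j], of f] by blast
  from bchoice[OF N(2)] obtain n :: "_ \<Rightarrow> int" where n: "\<forall>z\<in>Yg h j. of_int N * f z = of_int (n z)" ..
  define c where "c = (\<Sum>z\<in>Yg h j. frag_cmul (n z) (frag_of (gof z)))"
  have "Poly_Mapping.keys c \<subseteq> gof ` Yg h j"
    unfolding c_def by (rule order_trans[OF keys_sum]) auto
  moreover have "\<iota> c = (\<Sum>z\<in>Yg h j. rscale (rscale (of_int N) f z) (pt z))"
    unfolding c_def iota_sum
  proof (intro sum.cong refl)
    fix z assume z: "z \<in> Yg h j"
    show "rscale (of_int (n z)) (\<iota> (frag_of (gof z))) = rscale (rscale (of_int N) f z) (pt z)"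
      unfolding iota_of[OF subsetD[OF Yg_Y z]] rscale_apply[of "of_int N"] bspec[OF n z] ..
  qed
  then have "\<iota> c = rscale (of_int N) f"
    using fsup_expand[OF finYg rv.subspace_scale[OF fsup_subspace f]] by simp
  ultimately show ?thesis using N(1) by blast
qed

text \<open>The rank of the cycles minus that of the boundaries, the latter being the dimension of
  the chains one height lower minus that of their kernel. Adding \<open>card (edges F)\<close> to
  \<open>i\<close> undoes the shift of the complex. Only \<open>kappa\<close>, generator counts and
  label sums remain.\<close>

lemma group_rank_cohomology:
  "group_rank (cohomology (chromatic_complex F es) i j) =
    (\<Sum>l\<in>lbs (i + int (card (edges F))). X.kappa (i + int (card (edges F))) (j - ldeg l)) -
    ((\<Sum>l\<in>lbs (i + int (card (edges F)) - 1). card (X.gens (i + int (card (edges F)) - 1) (j - ldeg l))) -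
     (\<Sum>l\<in>lbs (i + int (card (edges F)) - 1). X.kappa (i + int (card (edges F)) - 1) (j - ldeg l)))"
proof -
  define h where "h = i + int (card (edges F))"
  let ?A = "free_Abelian_group (gof ` Yg h j)"
  let ?\<delta> = "frag_extend Dg"
  define Z where "Z = {c. Poly_Mapping.keys c \<subseteq> gof ` Yg h j \<and> ?\<delta> c = 0}"
  define B where "B = ?\<delta> ` {c. Poly_Mapping.keys c \<subseteq> gof ` Yg (h - 1) j}"
  have D: "(\<lambda>x. \<Sum>e\<in>state x. edge_map F es e x) = Dg" by (simp add: Dg_def fun_eq_iff)
  have coh: "cohomology (chromatic_complex F es) i j = subgroup_generated ?A Z Mod B"
  proof -
    have "kernel ?A (free_Abelian_group (gof ` Yg (h + 1) j)) ?\<delta> = Z" by (auto simp: kernel_def Z_def)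
    moreover have "carrier (free_Abelian_group (gof ` Yg (h - 1) j)) = {c. Poly_Mapping.keys c \<subseteq> gof ` Yg (h - 1) j}"
      by auto
    ultimately show ?thesis
      unfolding cohomology_def chromatic_complex_def shift_complex_def unshifted_chromatic_complex_def
      by (simp add: gens_eq D B_def h_def algebra_simps)
  qed
  let ?K = "{f \<in> fsup (Yg h j). dl f = 0}" and ?U = "dl ` fsup (Yg (h - 1) j)"
  have YgY: "Poly_Mapping.keys c \<subseteq> gof ` Y" if "Poly_Mapping.keys c \<subseteq> gof ` Yg h' j" for c h'
    using that Yg_Y by blast
  have zero: "?\<delta> c = 0 \<longleftrightarrow> dl (\<iota> c) = 0" if "Poly_Mapping.keys c \<subseteq> gof ` Yg h' j" for c h'
    using iota_extend[OF YgY[OF that]] iota_eq_0[OF keys_extend_Y[OF YgY[OF that]]] iota_0 by metis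
  have UK: "?U \<subseteq> ?K" using dl_Yg[of _ "h - 1" j] dl_dl by auto
  have BZ: "B \<subseteq> Z"
  proof
    fix b assume "b \<in> B"
    then obtain c where c: "Poly_Mapping.keys c \<subseteq> gof ` Yg (h - 1) j" "b = ?\<delta> c" by (auto simp: B_def)
    have k: "Poly_Mapping.keys b \<subseteq> gof ` Yg h j" using keys_extend[OF c(1)] c(2) by simp
    have "dl (\<iota> b) = 0" unfolding c(2) iota_extend[OF YgY[OF c(1)]] by (rule dl_dl)
    then have "?\<delta> b = 0" using zero[OF k] by blast
    then show "b \<in> Z" using k by (simp add: Z_def)
  qed
  have kd: "Poly_Mapping.keys (a - b) \<subseteq> S" if "Poly_Mapping.keys a \<subseteq> S" "Poly_Mapping.keys b \<subseteq> S"
    for a b :: "('v, 'e) gen \<Rightarrow>\<^sub>0 int" and S using that keys_diff[of a b] by blast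
  have sZ: "subgroup Z ?A"
  proof (rule subgroup_free_Abelian_groupI)
    show "Poly_Mapping.keys a \<subseteq> gof ` Yg h j" if "a \<in> Z" for a using that by (simp add: Z_def)
    show "0 \<in> Z" by (simp add: Z_def)
    show "a - b \<in> Z" if "a \<in> Z" "b \<in> Z" for a b
      using that kd[of a "gof ` Yg h j" b] by (simp add: Z_def frag_extend_diff)
  qed
  have sB: "subgroup B ?A"
  proof (rule subgroup_free_Abelian_groupI)
    show "Poly_Mapping.keys a \<subseteq> gof ` Yg h j" if "a \<in> B" for a using that BZ by (auto simp: Z_def)
    show "0 \<in> B" unfolding B_def by (intro image_eqI[of _ _ 0]) auto
    fix a b assume "a \<in> B" "b \<in> B"
    then obtain c c' where c: "Poly_Mapping.keys c \<subseteq> gof ` Yg (h - 1) j" "a = ?\<delta> c"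
      "Poly_Mapping.keys c' \<subseteq> gof ` Yg (h - 1) j" "b = ?\<delta> c'" by (auto simp: B_def)
    then show "a - b \<in> B" unfolding B_def
      by (intro image_eqI[of _ _ "c - c'"]) (simp_all add: frag_extend_diff kd)
  qed
  have sB': "subgroup B (subgroup_generated ?A Z)"
    using group.subgroup_subgroup_generated_iff[OF group_free_Abelian_group] sB BZ
      subgroup.carrier_subgroup_generated_subgroup[OF sZ] by blast
  have "group_rank (cohomology (chromatic_complex F es) i j) = rv.dim ?K - rv.dim ?U"
    unfolding coh
  proof (rule group_rank_quotient[OF sZ sB' iota_add iota_scale finYg])
    show "rv.subspace ?K" by (rule kernel_subspace[OF dl_linear fsup_subspace])
    show "?K \<subseteq> fsup (Yg h j)" by blast
    show "rv.subspace ?U" by (rule image_subspace[OF dl_linear fsup_subspace])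
    show "?U \<subseteq> ?K" by (rule UK)
    show "\<iota> z \<in> ?K" if "z \<in> Z" for z
    proof -
      have k: "Poly_Mapping.keys z \<subseteq> gof ` Yg h j" "?\<delta> z = 0" using that by (simp_all add: Z_def)
      then show ?thesis using iota_Yg[OF k(1)] zero[OF k(1)] by blast
    qed
    show "\<exists>N>0. \<exists>z\<in>Z. \<iota> z = rscale (of_int N) k" if k: "k \<in> ?K" for k
    proof -
      obtain N c where c: "N > 0" "Poly_Mapping.keys c \<subseteq> gof ` Yg h j" "\<iota> c = rscale (of_int N) k"
        using iota_lift k by blast
      have "dl (\<iota> c) = 0" using k unfolding c(3) rlin_scale[OF dl_linear] by (simp add: rscale_def zero_fun_def)
      then have "c \<in> Z" using zero[OF c(2)] c(2) by (simp add: Z_def)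
      then show ?thesis using c(1,3) by blast
    qed
    show "\<iota> z \<in> ?U" if zB: "z \<in> B" for z
    proof -
      obtain c where c: "Poly_Mapping.keys c \<subseteq> gof ` Yg (h - 1) j" "z = ?\<delta> c" using zB by (auto simp: B_def)
      show ?thesis unfolding c(2) iota_extend[OF YgY[OF c(1)]] by (rule imageI[OF iota_Yg[OF c(1)]])
    qed
    \<comment> \<open>The boundary of an integral lift of a multiple of \<open>f\<close> and the
      same multiple of \<open>z\<close> have equal coordinates, and coordinates determine a
      chain.\<close>
    show "\<exists>N>0. frag_cmul N z \<in> B" if z: "z \<in> Z" "\<iota> z \<in> ?U" for z
    proof -
      obtain f where f: "f \<in> fsup (Yg (h - 1) j)" "\<iota> z = dl f" using z(2) by blast
      obtain N c where c: "N > 0" "Poly_Mapping.keys c \<subseteq> gof ` Yg (h - 1) j" "\<iota> c = rscale (of_int N) f"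
        using iota_lift[OF f(1)] by blast
      have "\<iota> (?\<delta> c - frag_cmul N z) = 0"
        unfolding iota_diff iota_scale iota_extend[OF YgY[OF c(2)]] c(3) rlin_scale[OF dl_linear] f(2) by simp
      moreover have "Poly_Mapping.keys (?\<delta> c - frag_cmul N z) \<subseteq> gof ` Y"
      proof (rule kd[OF keys_extend_Y[OF YgY[OF c(2)]]])
        have "Poly_Mapping.keys z \<subseteq> gof ` Yg h j" using z(1) by (simp add: Z_def)
        then show "Poly_Mapping.keys (frag_cmul N z) \<subseteq> gof ` Y" by (rule order_trans[OF keys_cmul YgY])
      qed
      ultimately have "?\<delta> c - frag_cmul N z = 0" by (intro iota_eq_0)
      then have "frag_cmul N z = ?\<delta> c" by simp
      then show ?thesis using c(1,2) by (auto simp: B_def)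
    qed
  qed
  moreover have "rv.dim (fsup (Yg (h - 1) j)) = rv.dim {f \<in> fsup (Yg (h - 1) j). dl f = 0} + rv.dim ?U"
    by (rule rank_nullity[OF dl_linear fsup_subspace order_refl finYg])
  ultimately show ?thesis unfolding h_def[symmetric] dim_kernel_Yg[symmetric] dim_Yg[symmetric] by simp
qed

end

theorem theorem6p1:
  fixes F F' :: "('v, 'e) fatgraph" and G :: "('v, 'e) graph" and es es' :: "'e list"
  assumes "is_fatgraph F" and "is_fatgraph F'"
    and "underlying_graph F = G" and "underlying_graph F' = G"
    and "genus F (edges F) = 0" and "genus F' (edges F') = 0"
    and "distinct es" and "set es = edges F"
    and "distinct es'" and "set es' = edges F'"
  shows "poincare (cohomology (chromatic_complex F es)) =
         poincare (cohomology (chromatic_complex F' es'))"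
proof -
  have u: "underlying_graph F' = underlying_graph F" using assms(3,4) by simp
  have V: "verts F' = verts F" using arg_cong[OF u, of gverts] by (simp add: underlying_graph_def)
  have E: "edges F' = edges F" using arg_cong[OF u, of gedges] by (simp add: underlying_graph_def)
  have ends: "{att F' (e, False), att F' (e, True)} = {att F (e, False), att F (e, True)}" if "e \<in> edges F" for e
    using fun_cong[OF arg_cong[OF u, of gends], of e] that E by (simp add: underlying_graph_def)
  \<comment> \<open>Marks the edges attached the other way round in \<open>F'\<close>; a loop is
    never marked.\<close>
  define t where "t e \<longleftrightarrow> att F' (e, False) \<noteq> att F (e, False)" for e
  interpret A: chrom F "\<lambda>_. False" "att F" es
    by unfold_locales (use assms in \<open>simp_all add: swap_ends_def\<close>)
  have sw: "att F d = att F' (swap_ends t d)" if "fst d \<in> edges F'" for d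
  proof -
    obtain e b where d: "d = (e, b)" by (cases d)
    have "e \<in> edges F" using that E by (simp add: d)
    from ends[OF this] show ?thesis
      by (cases b; cases "t e") (auto simp: swap_ends_def t_def d doubleton_eq_iff)
  qed
  interpret B: chrom F' t "att F" es'
    by unfold_locales (use assms sw in simp_all)
  have I: "B.Iso = A.Iso"
  proof -
    have iso: "half_edges_at K (edges K) v = {} \<longleftrightarrow> (\<forall>e\<in>edges K. v \<notin> {att K (e, False), att K (e, True)})"
      for K :: "('v, 'e) fatgraph" and v
      by (auto simp: half_edges_at_def half_edges_def) (metis (full_types))
    have "(\<forall>e\<in>edges F. v \<notin> {att F' (e, False), att F' (e, True)}) \<longleftrightarrow>
        (\<forall>e\<in>edges F. v \<notin> {att F (e, False), att F (e, True)})" for v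
      by (intro ball_cong refl) (simp only: ends)
    then show ?thesis unfolding A.Iso_def B.Iso_def iso unfolding V E by simp
  qed
  \<comment> \<open>After the renaming both circle complexes use the vertex map
    \<open>att F\<close>, so \<open>kappa_planar\<close> compares them, with unrelated numberings of
    the edges.\<close>
  have k: "A.X.kappa h j = B.X.kappa h j" for h j
    unfolding E
    by (rule kappa_planar[OF A.X.planar_ribbon_axioms A.X.inj_pos
        B.X.planar_ribbon_axioms[unfolded E] B.X.inj_pos[unfolded E]])
  have c: "card (A.X.gens h j) = card (B.X.gens h j)" for h j
    unfolding E
    by (rule card_gens_eq(1)[OF A.X.ordered_ribbon_axioms B.X.ordered_ribbon_axioms[unfolded E]
        planar_card_P_eq[OF A.X.planar_ribbon_axioms B.X.planar_ribbon_axioms[unfolded E]]])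
  have "group_rank (cohomology (chromatic_complex F es) i j) =
      group_rank (cohomology (chromatic_complex F' es') i j)" for i j
    unfolding A.group_rank_cohomology B.group_rank_cohomology k c V I by (simp add: E)
  then show ?thesis by (simp add: poincare_def qdim_def)
qed

end
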